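(* Let $n\ge 2$ and let $\theta$ be a real antisymmetric $n\times n$ matrix. Every pseudodifferential operator $P\in \Psi^{-n}(\mathbb{T}^n_\theta)$ is strongly measurable (as an operator in $\mathscr{L}^{1,\infty}(\mathscr{H}_\theta)$), and $$ \int\!\!\!\!\!\!-\, P=\frac1n \operatorname{Res}(P). $$ That is, $\varphi(P)=\frac1n\operatorname{Res}(P)$ for every normalized positive trace $\varphi$ on $\mathscr{L}^{1,\infty}(\mathscr{H}_\theta)$.
   Context: Noncommutative torus. Let $\theta_1,\dots,\theta_n$ be the columns of $\theta$, $\mathbb{T}^n=\mathbb{R}^n/2\pi\mathbb{Z}^n$, and let $L^2(\mathbb{T}^n)$ have inner product $(2\pi)^{-n}\int \xi\bar\eta\,dx$. Let $U_j$ be the unitaries $(U_j\xi)(x)=e^{ix_j}\xi(x+\pi\theta_j)$ on $L^2(\mathbb{T}^n)$, $U^k=U_1^{k_1}\cdots U_n^{k_n}$ for $k\in\mathbb{Z}^n$, and let $A_\theta$ be the $C^*$-algebra they generate. $\tau(T)=\langle T1|1\rangle$ is a tracial state on $A_\theta$ with $\tau(1)=1$, $\tau(U^k)=0$ for $k\ne0$. $\mathscr{H}_\theta$ is the Hilbert space completion of $A_\theta$ for $\langle u|v\rangle=\tau(uv^* )$; $(U^k)_{k\in\mathbb{Z}^n}$ is an orthonormal basis. $\alpha_s(U^k)=e^{is\cdot k}U^k$ ($s\in\mathbb{R}^n$) defines an action of $\mathbb{R}^n$ on $A_\theta$; $\mathscr{A}_\theta$ is its algebra of smooth vectors, i.e.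 $\{\sum u_kU^k:\ (u_k) \text{ rapidly decaying}\}$. $\delta_j$ are the derivations of $\mathscr{A}_\theta$ with $\delta_j(U^k)=k_jU^k$; $\delta^\alpha=\delta_1^{\alpha_1}\cdots\delta_n^{\alpha_n}$. $\mathscr{A}_\theta$ is a Fréchet $*$-algebra for the semi-norms $u\mapsto\|\delta^\alpha u\|$ ($\|\cdot\|$ the norm of $A_\theta$). Pseudodifferential operators. $S_q(\mathbb{R}^n;\mathscr{A}_\theta)$ is the space of $\rho\in C^\infty(\mathbb{R}^n\setminus0;\mathscr{A}_\theta)$ with $\rho(t\xi)=t^q\rho(\xi)$ for $t>0$. $S^q(\mathbb{R}^n;\mathscr{A}_\theta)$ is the space of $\rho\in C^\infty(\mathbb{R}^n;\mathscr{A}_\theta)$ with $\rho\sim\sum_{j\ge0}\rho_{q-j}$, $\rho_{q-j}\in S_{q-j}(\mathbb{R}^n;\mathscr{A}_\theta)$, meaning that for all $N\geq 0$ and multi-orders $\alpha,\beta$ there is $C_{N\alpha\beta}$ with $\|\delta^\alpha\partial_\xi^\beta(\rho-\sum_{j<N}\rho_{q-j})(\xi)\|\le C_{N\alpha\beta}|\xi|^{\Re q-N-|\beta|}$ for $|\xi|\ge1$. $\Psi^q(\mathbb{T}^n_\theta)$ is the set of operators $P_\rho:\mathscr{A}_\theta\to\mathscr{A}_\theta$, $P_\rho(\sum u_kU^k)=\sum_k u_k\rho(k)U^k$, with $\rho\in S^q(\mathbb{R}^n;\mathscr{A}_\theta)$. The homogeneous symbols $\rho_{q-j}$ are uniquely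 determined by $P=P_\rho$. Operators in $\Psi^{-n}(\mathbb{T}^n_\theta)$ extend to operators in $\mathscr{L}^{1,\infty}(\mathscr{H}_\theta)$ and are identified with these extensions. Noncommutative residue. For $P\in\Psi^m(\mathbb{T}^n_\theta)$, $m\in\mathbb{Z}$, $\operatorname{Res}(P)=\int_{\mathbb{S}^{n-1}}\tau[\rho_{-n}(\xi)]\,d^{n-1}\xi$, where $\rho_{-n}$ is the symbol of degree $-n$ of $P$ ($0$ if the order is $<-n$). Noncommutative integral. For a separable Hilbert space $\mathscr{H}$, $\mathscr{L}^{1,\infty}(\mathscr{H})$ is the ideal of compact operators $T$ whose singular values satisfy $\mu_k(T)=O(k^{-1})$, $\mu_k(T)$ being the $(k+1)$-th eigenvalue of $|T|$. A trace on $\mathscr{L}^{1,\infty}$ is a linear form vanishing on all commutators $[A,T]$, $A\in\mathscr{L}(\mathscr{H})$, $T\in\mathscr{L}^{1,\infty}$. It is positive if it is non-negative on positive operators, and normalized if it takes the value $1$ on any positive operator with $\mu_k=(k+1)^{-1}$ for all $k\geq 0$. $T\in\mathscr{L}^{1,\infty}$ is strongly measurable if there is $L\in\mathbb{C}$ with $\varphi(T)=L$ for every normalized positive trace $\varphi$; then $\int\!\!\!\!\!-\,T:=L$. *)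

theory Defs
  imports "HOL-Analysis.Analysis" "HOL-Library.Landau_Symbols"
begin

section \<open>Complex Hilbert spaces and their bounded operators\<close>

text \<open>Inner products are linear in the first and antilinear in the second variable. The norm is the
  one of the underlying real inner product space, whose inner product is the real part of \<open>cinner\<close>.\<close>

class complex_vector = real_vector +
  fixes scaleC :: "complex \<Rightarrow> 'a \<Rightarrow> 'a" (infixr "*\<^sub>C" 75)
  assumes scaleC_add_right: "c *\<^sub>C (x + y) = c *\<^sub>C x + c *\<^sub>C y"
    and scaleC_add_left: "(c + d) *\<^sub>C x = c *\<^sub>C x + d *\<^sub>C x"
    and scaleC_scaleC: "c *\<^sub>C (d *\<^sub>C x) = (c * d) *\<^sub>C x"
    and scaleR_eq_scaleC: "r *\<^sub>R x = complex_of_real r *\<^sub>C x"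

class complex_inner = complex_vector + real_inner +
  fixes cinner :: "'a \<Rightarrow> 'a \<Rightarrow> complex"
  assumes cinner_commute: "cinner x y = cnj (cinner y x)"
    and cinner_add_left: "cinner (x + y) z = cinner x z + cinner y z"
    and cinner_scaleC_left: "cinner (c *\<^sub>C x) y = c * cinner x y"
    and inner_eq_Re_cinner: "inner x y = Re (cinner x y)"

class complex_hilbert = complex_inner + complete_space

lemma scaleC_one: "1 *\<^sub>C (x :: 'a::complex_vector) = x"
  using scaleR_eq_scaleC[of 1 x] by simp

interpretation complex_vs: vector_space "scaleC :: complex \<Rightarrow> 'a \<Rightarrow> 'a::complex_vector"
  by unfold_locales (simp_all add: scaleC_add_right scaleC_add_left scaleC_scaleC scaleC_one)

lemma norm_scaleC: "norm (c *\<^sub>C (x :: 'a::complex_inner)) = cmod c * norm x"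
proof -
  have im: "Im (cinner x x) = 0"
    using arg_cong[OF cinner_commute[of x x], of Im] by simp
  have "cinner (c *\<^sub>C x) (c *\<^sub>C x) = c * cnj (c * cinner x x)"
    using cinner_scaleC_left cinner_commute by metis
  then have "inner (c *\<^sub>C x) (c *\<^sub>C x) = (cmod c)\<^sup>2 * inner x x"
    by (simp add: inner_eq_Re_cinner im cmod_power2 algebra_simps)
      (simp add: power2_eq_square algebra_simps)
  then show ?thesis
    by (simp add: norm_eq_sqrt_inner real_sqrt_mult)
qed

lemma bounded_linear_scaleC: "bounded_linear (\<lambda>x :: 'a::complex_inner. c *\<^sub>C x)"
  by (rule bounded_linear_intro[where K = "cmod c"])
    (simp_all add: scaleC_add_right scaleR_eq_scaleC scaleC_scaleC mult.commute norm_scaleC)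

instantiation blinfun :: (real_normed_vector, complex_inner) complex_vector
begin

lift_definition scaleC_blinfun :: "complex \<Rightarrow> ('a \<Rightarrow>\<^sub>L 'b) \<Rightarrow> 'a \<Rightarrow>\<^sub>L 'b"
  is "\<lambda>c T x. c *\<^sub>C T x"
  by (rule bounded_linear_compose[OF bounded_linear_scaleC])

instance
  by standard (transfer, simp add: scaleC_add_right scaleC_add_left scaleC_scaleC scaleR_eq_scaleC)+

end

text \<open>The type \<open>'a \<Rightarrow>\<^sub>L 'b\<close> contains all bounded real-linear maps.\<close>

definition clinear_op :: "('a::complex_inner \<Rightarrow>\<^sub>L 'b::complex_inner) \<Rightarrow> bool" where
  "clinear_op T \<longleftrightarrow> (\<forall>c x. T (c *\<^sub>C x) = c *\<^sub>C T x)"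

definition adjoint_op :: "('a::complex_inner \<Rightarrow>\<^sub>L 'a) \<Rightarrow> 'a \<Rightarrow>\<^sub>L 'a" where
  "adjoint_op T = (THE S :: 'a \<Rightarrow>\<^sub>L 'a. \<forall>x y. cinner (T x) y = cinner x (S y))"

definition positive_op :: "('a::complex_inner \<Rightarrow>\<^sub>L 'a) \<Rightarrow> bool" where
  "positive_op T \<longleftrightarrow> clinear_op T \<and> (\<forall>x. cinner (T x) x \<in> \<real> \<and> 0 \<le> Re (cinner (T x) x))"

definition abs_op :: "('a::complex_inner \<Rightarrow>\<^sub>L 'a) \<Rightarrow> 'a \<Rightarrow>\<^sub>L 'a" where
  "abs_op T = (THE S. positive_op S \<and> S o\<^sub>L S = adjoint_op T o\<^sub>L T)"

definition compact_op :: "('a::complex_inner \<Rightarrow>\<^sub>L 'a) \<Rightarrow> bool" where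
  "compact_op T \<longleftrightarrow> clinear_op T \<and> compact (closure (blinfun_apply T ` cball 0 1))"

definition inverse_op :: "('a::real_normed_vector \<Rightarrow>\<^sub>L 'a) \<Rightarrow> 'a \<Rightarrow>\<^sub>L 'a" where
  "inverse_op T = (THE S. S o\<^sub>L T = id_blinfun \<and> T o\<^sub>L S = id_blinfun)"

definition powi_op :: "('a::real_normed_vector \<Rightarrow>\<^sub>L 'a) \<Rightarrow> int \<Rightarrow> 'a \<Rightarrow>\<^sub>L 'a" where
  "powi_op T m =
     (if 0 \<le> m then (((o\<^sub>L) T) ^^ nat m) id_blinfun
      else (((o\<^sub>L) (inverse_op T)) ^^ nat (- m)) id_blinfun)"


section \<open>The ideal of weak trace class operators, traces, and the noncommutative integral\<close>

text \<open>\<open>\<mu>\<close> lists the eigenvalues of the positive compact operator \<open>A\<close> in decreasing order and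
  repeated according to multiplicity; it is padded with zeros if there are only finitely many
  positive ones (no zero occurs otherwise, as \<open>\<mu>\<close> is decreasing).\<close>

definition eigenvalue_seq :: "('a::complex_inner \<Rightarrow>\<^sub>L 'a) \<Rightarrow> (nat \<Rightarrow> real) \<Rightarrow> bool" where
  "eigenvalue_seq A \<mu> \<longleftrightarrow> decseq \<mu> \<and> (\<forall>k. 0 \<le> \<mu> k) \<and>
     (\<forall>l>0. finite {k. \<mu> k = l} \<and> card {k. \<mu> k = l} = complex_vs.dim {x. A x = l *\<^sub>R x})"

definition singular_value :: "('a::complex_inner \<Rightarrow>\<^sub>L 'a) \<Rightarrow> nat \<Rightarrow> real" where
  "singular_value T = (THE \<mu>. eigenvalue_seq (abs_op T) \<mu>)"

definition weak_trace_class :: "('a::complex_hilbert \<Rightarrow>\<^sub>L 'a) set" where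
  "weak_trace_class = {T. compact_op T \<and> singular_value T \<in> O(\<lambda>k. 1 / real k)}"

text \<open>Only the values of \<open>\<phi>\<close> on \<^const>\<open>weak_trace_class\<close> are relevant.\<close>

definition is_trace :: "(('a::complex_hilbert \<Rightarrow>\<^sub>L 'a) \<Rightarrow> complex) \<Rightarrow> bool" where
  "is_trace \<phi> \<longleftrightarrow>
     (\<forall>S\<in>weak_trace_class. \<forall>T\<in>weak_trace_class. \<phi> (S + T) = \<phi> S + \<phi> T) \<and>
     (\<forall>c. \<forall>T\<in>weak_trace_class. \<phi> (c *\<^sub>C T) = c * \<phi> T) \<and>
     (\<forall>A. \<forall>T\<in>weak_trace_class. clinear_op A \<longrightarrow> \<phi> ((A o\<^sub>L T) - (T o\<^sub>L A)) = 0)"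

definition positive_trace :: "(('a::complex_hilbert \<Rightarrow>\<^sub>L 'a) \<Rightarrow> complex) \<Rightarrow> bool" where
  "positive_trace \<phi> \<longleftrightarrow> is_trace \<phi> \<and>
     (\<forall>T\<in>weak_trace_class. positive_op T \<longrightarrow> \<phi> T \<in> \<real> \<and> 0 \<le> Re (\<phi> T))"

definition normalized_trace :: "(('a::complex_hilbert \<Rightarrow>\<^sub>L 'a) \<Rightarrow> complex) \<Rightarrow> bool" where
  "normalized_trace \<phi> \<longleftrightarrow> is_trace \<phi> \<and>
     (\<forall>T\<in>weak_trace_class. positive_op T \<and> (\<forall>k. singular_value T k = 1 / real (k + 1)) \<longrightarrow> \<phi> T = 1)"

text \<open>\<open>has_nc_integral T L\<close> means that \<open>T\<close> is strongly measurable with noncommutative integral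
  \<open>L\<close> (in the style of \<^const>\<open>has_integral\<close>).\<close>

definition has_nc_integral :: "('a::complex_hilbert \<Rightarrow>\<^sub>L 'a) \<Rightarrow> complex \<Rightarrow> bool" where
  "has_nc_integral T L \<longleftrightarrow> T \<in> weak_trace_class \<and>
     (\<forall>\<phi>. positive_trace \<phi> \<and> normalized_trace \<phi> \<longrightarrow> \<phi> T = L)"

definition strongly_measurable_op :: "('a::complex_hilbert \<Rightarrow>\<^sub>L 'a) \<Rightarrow> bool" where
  "strongly_measurable_op T \<longleftrightarrow> (\<exists>L. has_nc_integral T L)"


section \<open>The Hilbert space of square-integrable functions on the torus\<close>

text \<open>Functions on the torus are functions on \<open>real ^ 'n\<close> that are \<open>2\<pi>\<close>-periodic in each
  variable; integration is over the period cube, with total mass one.\<close>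

definition torus_measure :: "(real ^ 'n) measure" where
  "torus_measure = uniform_measure lborel (cbox 0 (\<chi> i. 2 * pi))"

definition torus_sqint :: "(real ^ 'n \<Rightarrow> complex) \<Rightarrow> bool" where
  "torus_sqint f \<longleftrightarrow> f \<in> borel_measurable borel \<and> (\<forall>x j. f (x + axis j (2 * pi)) = f x) \<and>
     integrable torus_measure (\<lambda>x. (cmod (f x))\<^sup>2)"

definition torus_eq :: "(real ^ 'n \<Rightarrow> complex) \<Rightarrow> (real ^ 'n \<Rightarrow> complex) \<Rightarrow> bool" where
  "torus_eq f g \<longleftrightarrow> torus_sqint f \<and> torus_sqint g \<and> (AE x in torus_measure. f x = g x)"

lemma sets_torus_measure [measurable_cong, simp]: "sets torus_measure = sets borel"
  by (simp add: torus_measure_def)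

lemma finite_measure_torus: "finite_measure (torus_measure :: (real ^ 'n) measure)"
proof
  have "0 < measure lborel (cbox (0 :: real ^ 'n) (\<chi> i. 2 * pi))"
    by (auto simp: content_pos_lt_eq Basis_vec_def inner_axis)
  then have "emeasure lborel (cbox (0 :: real ^ 'n) (\<chi> i. 2 * pi)) \<noteq> 0"
    by (auto simp: measure_def)
  then show "emeasure torus_measure (space (torus_measure :: (real ^ 'n) measure)) \<noteq> \<infinity>"
    by (simp add: torus_measure_def emeasure_uniform_measure emeasure_lborel_cbox_eq
        divide_ennreal_def ennreal_mult_eq_top_iff ennreal_inverse_eq_top_iff)
qed

lemma torus_sqint_add:
  assumes "torus_sqint f" "torus_sqint g"
  shows "torus_sqint (\<lambda>x. f x + g x)"
proof -
  have [measurable]: "f \<in> borel_measurable borel" "g \<in> borel_measurable borel"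
    using assms by (auto simp: torus_sqint_def)
  have bd: "(cmod (f x + g x))\<^sup>2 \<le> 2 * (cmod (f x))\<^sup>2 + 2 * (cmod (g x))\<^sup>2" for x
  proof -
    have "(cmod (f x + g x))\<^sup>2 \<le> (cmod (f x) + cmod (g x))\<^sup>2"
      by (intro power_mono norm_triangle_ineq) simp
    also have "\<dots> \<le> 2 * (cmod (f x))\<^sup>2 + 2 * (cmod (g x))\<^sup>2"
      using sum_squares_bound[of "cmod (f x)" "cmod (g x)"] by (simp add: power2_sum)
    finally show ?thesis .
  qed
  have "integrable torus_measure (\<lambda>x. 2 * (cmod (f x))\<^sup>2 + 2 * (cmod (g x))\<^sup>2)"
    using assms by (auto simp: torus_sqint_def)
  then have "integrable torus_measure (\<lambda>x. (cmod (f x + g x))\<^sup>2)"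
    by (rule Bochner_Integration.integrable_bound) (use bd in auto)
  then show ?thesis
    using assms by (auto simp: torus_sqint_def)
qed

lemma torus_sqint_mult: "torus_sqint f \<Longrightarrow> torus_sqint (\<lambda>x. c * f x)"
  by (auto simp: torus_sqint_def norm_mult power_mult_distrib)

lemma torus_sqint_diff:
  assumes "torus_sqint f" "torus_sqint g"
  shows "torus_sqint (\<lambda>x. f x - g x)"
  using torus_sqint_add[OF assms(1) torus_sqint_mult[OF assms(2), of "-1"]] by simp

lemma torus_sqint_const: "torus_sqint (\<lambda>x. c)"
  by (simp add: torus_sqint_def finite_measure.integrable_const[OF finite_measure_torus])

lemma torus_integrable_prod:
  assumes "torus_sqint f" "torus_sqint g"
  shows "integrable torus_measure (\<lambda>x. f x * cnj (g x))"
proof -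
  have [measurable]: "f \<in> borel_measurable borel" "g \<in> borel_measurable borel"
    using assms by (auto simp: torus_sqint_def)
  have [measurable]: "(\<lambda>x. cnj (g x)) \<in> borel_measurable borel"
    by (rule borel_measurable_continuous_on[OF continuous_on_cnj[OF continuous_on_id]]) measurable
  have bd: "cmod (f x * cnj (g x)) \<le> (cmod (f x))\<^sup>2 + (cmod (g x))\<^sup>2" for x
  proof -
    have "2 * (cmod (f x) * cmod (g x)) \<le> (cmod (f x))\<^sup>2 + (cmod (g x))\<^sup>2"
      using sum_squares_bound[of "cmod (f x)" "cmod (g x)"] by (simp add: mult.assoc)
    then show ?thesis
      using mult_nonneg_nonneg[OF norm_ge_zero[of "f x"] norm_ge_zero[of "g x"]]
      unfolding norm_mult complex_mod_cnj by linarith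
  qed
  have "integrable torus_measure (\<lambda>x. (cmod (f x))\<^sup>2 + (cmod (g x))\<^sup>2)"
    using assms by (auto simp: torus_sqint_def)
  then show ?thesis
    by (rule Bochner_Integration.integrable_bound) (use bd in auto)
qed

quotient_type (overloaded) 'n torus_L2 = "real ^ 'n::finite \<Rightarrow> complex" / partial: torus_eq
proof (rule part_equivpI)
  show "\<exists>f :: real ^ 'n \<Rightarrow> complex. torus_eq f f"
    by (rule exI[of _ "\<lambda>x. 0"]) (simp add: torus_eq_def torus_sqint_const)
  show "symp (torus_eq :: (real ^ 'n \<Rightarrow> complex) \<Rightarrow> _)"
    by (auto simp: symp_def torus_eq_def eq_commute)
  show "transp (torus_eq :: (real ^ 'n \<Rightarrow> complex) \<Rightarrow> _)"
    by (auto simp: transp_def torus_eq_def elim: AE_mp)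
qed

instantiation torus_L2 :: (finite) complex_vector
begin

lift_definition zero_torus_L2 :: "'a torus_L2" is "\<lambda>x. 0"
  by (simp add: torus_eq_def torus_sqint_const)

lift_definition plus_torus_L2 :: "'a torus_L2 \<Rightarrow> 'a torus_L2 \<Rightarrow> 'a torus_L2"
  is "\<lambda>f g x. f x + g x"
  by (auto simp: torus_eq_def torus_sqint_add)

lift_definition minus_torus_L2 :: "'a torus_L2 \<Rightarrow> 'a torus_L2 \<Rightarrow> 'a torus_L2"
  is "\<lambda>f g x. f x - g x"
  by (auto simp: torus_eq_def torus_sqint_diff)

lift_definition uminus_torus_L2 :: "'a torus_L2 \<Rightarrow> 'a torus_L2" is "\<lambda>f x. - f x"
  using torus_sqint_mult[where c = "-1"] by (auto simp: torus_eq_def)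

lift_definition scaleC_torus_L2 :: "complex \<Rightarrow> 'a torus_L2 \<Rightarrow> 'a torus_L2" is "\<lambda>c f x. c * f x"
  by (auto simp: torus_eq_def torus_sqint_mult)

definition scaleR_torus_L2 :: "real \<Rightarrow> 'a torus_L2 \<Rightarrow> 'a torus_L2" where
  "scaleR_torus_L2 r x = complex_of_real r *\<^sub>C x"

instance
proof
  fix x y z :: "'a torus_L2" and c d :: complex and r s :: real
  show "x + y + z = x + (y + z)"
    by transfer (simp add: torus_eq_def torus_sqint_add add.assoc)
  show "x + y = y + x"
    by transfer (simp add: torus_eq_def torus_sqint_add add.commute)
  show "0 + x = x"
    by transfer (simp add: torus_eq_def)
  show "- x + x = 0"
    by transfer (simp add: torus_eq_def torus_sqint_const)
  show "x - y = x + - y"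
    by transfer (simp add: torus_eq_def torus_sqint_diff)
  show scA: "c *\<^sub>C (x + y) = c *\<^sub>C x + c *\<^sub>C y" for c and x y :: "'a torus_L2"
    by transfer (simp add: torus_eq_def torus_sqint_add torus_sqint_mult distrib_left)
  show scB: "(c + d) *\<^sub>C x = c *\<^sub>C x + d *\<^sub>C x" for c d and x :: "'a torus_L2"
    by transfer (simp add: torus_eq_def torus_sqint_add torus_sqint_mult distrib_right)
  show scC: "c *\<^sub>C (d *\<^sub>C x) = (c * d) *\<^sub>C x" for c d and x :: "'a torus_L2"
    by transfer (use torus_sqint_mult in \<open>auto simp: torus_eq_def mult.assoc\<close>)
  show "r *\<^sub>R x = complex_of_real r *\<^sub>C x"
    by (simp add: scaleR_torus_L2_def)
  show "r *\<^sub>R (x + y) = r *\<^sub>R x + r *\<^sub>R y" "(r + s) *\<^sub>R x = r *\<^sub>R x + s *\<^sub>R x"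
    "r *\<^sub>R s *\<^sub>R x = (r * s) *\<^sub>R x"
    by (simp_all add: scaleR_torus_L2_def scA scB scC)
  show "1 *\<^sub>R x = x"
    unfolding scaleR_torus_L2_def by transfer (simp add: torus_eq_def)
qed

end

instantiation torus_L2 :: (finite) complex_inner
begin

lift_definition cinner_torus_L2 :: "'a torus_L2 \<Rightarrow> 'a torus_L2 \<Rightarrow> complex"
  is "\<lambda>f g. LINT x|torus_measure. f x * cnj (g x)"
proof -
  fix f f' g g' :: "real ^ 'a \<Rightarrow> complex"
  assume "torus_eq f f'" "torus_eq g g'"
  then show "(LINT x|torus_measure. f x * cnj (g x)) = (LINT x|torus_measure. f' x * cnj (g' x))"
    by (intro integral_cong_AE)
      (auto simp: torus_eq_def
        dest: borel_measurable_integrable[OF torus_integrable_prod, of f g]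
              borel_measurable_integrable[OF torus_integrable_prod, of f' g'])
qed

definition inner_torus_L2 :: "'a torus_L2 \<Rightarrow> 'a torus_L2 \<Rightarrow> real" where
  "inner_torus_L2 x y = Re (cinner x y)"

definition norm_torus_L2 :: "'a torus_L2 \<Rightarrow> real" where
  "norm_torus_L2 x = sqrt (inner x x)"

definition dist_torus_L2 :: "'a torus_L2 \<Rightarrow> 'a torus_L2 \<Rightarrow> real" where
  "dist_torus_L2 x y = norm (x - y)"

definition sgn_torus_L2 :: "'a torus_L2 \<Rightarrow> 'a torus_L2" where
  "sgn_torus_L2 x = x /\<^sub>R norm x"

definition uniformity_torus_L2 :: "('a torus_L2 \<times> 'a torus_L2) filter" where
  "uniformity_torus_L2 = (INF e\<in>{0<..}. principal {(x, y). dist x y < e})"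

definition open_torus_L2 :: "'a torus_L2 set \<Rightarrow> bool" where
  "open_torus_L2 U \<longleftrightarrow> (\<forall>x\<in>U. \<forall>\<^sub>F (x', y) in uniformity. x' = x \<longrightarrow> y \<in> U)"

instance
proof
  fix x y z :: "'a torus_L2" and c :: complex and r :: real
  show "dist x y = norm (x - y)" "sgn x = x /\<^sub>R norm x" "norm x = sqrt (inner x x)"
    by (simp_all add: dist_torus_L2_def sgn_torus_L2_def norm_torus_L2_def)
  show "uniformity = (INF e\<in>{0<..}. principal {(x, y). dist (x :: 'a torus_L2) y < e})"
    by (rule uniformity_torus_L2_def)
  show "open U \<longleftrightarrow> (\<forall>x\<in>U. \<forall>\<^sub>F (x', y) in uniformity. x' = x \<longrightarrow> y \<in> U)"
    for U :: "'a torus_L2 set"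
    by (rule open_torus_L2_def)
  show comm: "cinner x y = cnj (cinner y x)" for x y :: "'a torus_L2"
    by transfer (subst Bochner_Integration.integral_cnj[symmetric], simp add: mult.commute)
  show cadd: "cinner (x + y) z = cinner x z + cinner y z" for x y z :: "'a torus_L2"
    by transfer (simp add: torus_eq_def distrib_right torus_integrable_prod)
  show csc: "cinner (c *\<^sub>C x) y = c * cinner x y" for c and x y :: "'a torus_L2"
    by transfer (simp add: mult.assoc)
  show "inner x y = Re (cinner x y)"
    by (rule inner_torus_L2_def)
  show "inner x y = inner y x"
    unfolding inner_torus_L2_def by (subst comm) simp
  show "inner (x + y) z = inner x z + inner y z" "inner (r *\<^sub>R x) y = r * inner x y"
    by (simp_all add: inner_torus_L2_def cadd scaleR_eq_scaleC csc)
  have sq: "Re (LINT t|torus_measure. f t * cnj (f t)) = (LINT t|torus_measure. (cmod (f t))\<^sup>2)"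
    for f :: "real ^ 'a \<Rightarrow> complex"
    by (simp add: complex_norm_square[symmetric] flip: of_real_power)
  show "0 \<le> inner x x"
    unfolding inner_torus_L2_def by transfer (simp add: sq)
  show "inner x x = 0 \<longleftrightarrow> x = 0"
    unfolding inner_torus_L2_def
  proof transfer
    fix f :: "real ^ 'a \<Rightarrow> complex"
    assume "torus_eq f f"
    then have f: "torus_sqint f" by (simp add: torus_eq_def)
    then have "integrable torus_measure (\<lambda>x. (cmod (f x))\<^sup>2)"
      by (simp add: torus_sqint_def)
    then have "(LINT t|torus_measure. (cmod (f t))\<^sup>2) = 0 \<longleftrightarrow> (AE t in torus_measure. f t = 0)"
      by (subst integral_nonneg_eq_0_iff_AE) auto
    then show "Re (LINT t|torus_measure. f t * cnj (f t)) = 0 \<longleftrightarrow> torus_eq f (\<lambda>x. 0)"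
      using f by (simp add: sq torus_eq_def torus_sqint_const)
  qed
qed

end

lift_definition torus_one :: "'n::finite torus_L2" is "\<lambda>x. 1"
  by (simp add: torus_eq_def torus_sqint_const)


section \<open>The noncommutative torus\<close>

text \<open>The \<open>n\<close> coordinates are indexed by a finite linearly ordered type \<open>'n\<close>; the order is the
  one in which the product \<open>U\<^sub>1\<^bsup>k\<^sub>1\<^esup> \<cdots> U\<^sub>n\<^bsup>k\<^sub>n\<^esup>\<close> is formed.\<close>

type_synonym 'n rvec = "(real, 'n) vec"
type_synonym 'n ivec = "(int, 'n) vec"
type_synonym 'n rmat = "((real, 'n) vec, 'n) vec"
type_synonym 'n torus_op = "'n torus_L2 \<Rightarrow>\<^sub>L 'n torus_L2"

definition coords :: "'n::{finite, linorder} list" where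
  "coords = sorted_list_of_set UNIV"

text \<open>The class of \<open>x \<mapsto> exp (i x\<^sub>j) \<xi> (x + \<pi> \<theta>\<^sub>j)\<close> does not depend on the chosen
  representative of \<open>\<xi>\<close>.\<close>

definition nct_U :: "'n::finite rmat \<Rightarrow> 'n \<Rightarrow> 'n torus_op" where
  "nct_U \<theta> j = Blinfun (\<lambda>\<xi>. abs_torus_L2
     (\<lambda>x. cis (x $ j) * rep_torus_L2 \<xi> (x + pi *\<^sub>R column j \<theta>)))"

definition nct_monomial :: "'n::{finite, linorder} rmat \<Rightarrow> 'n ivec \<Rightarrow> 'n torus_op" where
  "nct_monomial \<theta> k = foldr (\<lambda>j T. powi_op (nct_U \<theta> j) (k $ j) o\<^sub>L T) coords id_blinfun"

definition star_subalgebra :: "('a::complex_inner \<Rightarrow>\<^sub>L 'a) set \<Rightarrow> bool" where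
  "star_subalgebra B \<longleftrightarrow> 0 \<in> B \<and> (\<forall>S\<in>B. \<forall>T\<in>B. S + T \<in> B \<and> S o\<^sub>L T \<in> B) \<and>
     (\<forall>c. \<forall>T\<in>B. c *\<^sub>C T \<in> B) \<and> (\<forall>T\<in>B. adjoint_op T \<in> B)"

definition nct_algebra :: "'n::finite rmat \<Rightarrow> 'n torus_op set" where
  "nct_algebra \<theta> = \<Inter> {B. star_subalgebra B \<and> closed B \<and> range (nct_U \<theta>) \<subseteq> B}"

definition nct_trace :: "'n::finite torus_op \<Rightarrow> complex" where
  "nct_trace T = cinner (T torus_one) torus_one"

text \<open>\<open>\<iota>\<close> exhibits the Hilbert space \<open>'h\<close> as the completion of the algebra for the inner product
  \<open>\<langle>u|v\<rangle> = \<tau>(u v*)\<close>.\<close>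

definition nct_completion ::
  "'n::finite rmat \<Rightarrow> ('n torus_op \<Rightarrow> 'h::complex_hilbert) \<Rightarrow> bool" where
  "nct_completion \<theta> \<iota> \<longleftrightarrow>
     (\<forall>u\<in>nct_algebra \<theta>. \<forall>v\<in>nct_algebra \<theta>. \<iota> (u + v) = \<iota> u + \<iota> v) \<and>
     (\<forall>c. \<forall>u\<in>nct_algebra \<theta>. \<iota> (c *\<^sub>C u) = c *\<^sub>C \<iota> u) \<and>
     (\<forall>u\<in>nct_algebra \<theta>. \<forall>v\<in>nct_algebra \<theta>.
        cinner (\<iota> u) (\<iota> v) = nct_trace (u o\<^sub>L adjoint_op v)) \<and>
     closure (\<iota> ` nct_algebra \<theta>) = UNIV"

definition real_of_lattice :: "'n::finite ivec \<Rightarrow> 'n rvec" where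
  "real_of_lattice k = (\<chi> j. real_of_int (k $ j))"

definition rapidly_decaying :: "('n::finite ivec \<Rightarrow> complex) \<Rightarrow> bool" where
  "rapidly_decaying c \<longleftrightarrow>
     (\<forall>N. \<exists>C. \<forall>k. (1 + norm (real_of_lattice k)) ^ N * cmod (c k) \<le> C)"

definition nct_smooth :: "'n::{finite, linorder} rmat \<Rightarrow> 'n torus_op set" where
  "nct_smooth \<theta> =
     {u. \<exists>c. rapidly_decaying c \<and> ((\<lambda>k. c k *\<^sub>C nct_monomial \<theta> k) has_sum u) UNIV}"

text \<open>The coefficient of \<open>u\<close> on the element \<open>U\<^sup>k\<close> of the orthonormal basis, i.e. \<open>\<langle>u|U\<^sup>k\<rangle>\<close>.\<close>

definition nct_coeff ::
  "'n::{finite, linorder} rmat \<Rightarrow> 'n torus_op \<Rightarrow> 'n ivec \<Rightarrow> complex" where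
  "nct_coeff \<theta> u k = nct_trace (u o\<^sub>L adjoint_op (nct_monomial \<theta> k))"

text \<open>The derivation \<open>\<delta>\<^sub>j\<close>, i.e. \<open>U\<^sup>k \<mapsto> k\<^sub>j U\<^sup>k\<close> extended to rapidly convergent series.\<close>

definition nct_delta ::
  "'n::{finite, linorder} rmat \<Rightarrow> 'n \<Rightarrow> 'n torus_op \<Rightarrow> 'n torus_op" where
  "nct_delta \<theta> j u =
     (\<Sum>\<^sub>\<infinity>k. (of_int (k $ j) * nct_coeff \<theta> u k) *\<^sub>C nct_monomial \<theta> k)"

definition nct_deltas ::
  "'n::{finite, linorder} rmat \<Rightarrow> ('n \<Rightarrow> nat) \<Rightarrow> 'n torus_op \<Rightarrow> 'n torus_op" where
  "nct_deltas \<theta> \<alpha> = foldr (\<lambda>j. nct_delta \<theta> j ^^ \<alpha> j) coords"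


section \<open>Symbols and pseudodifferential operators\<close>

text \<open>Convergence in the Frechet space of smooth elements, given by the seminorms
  \<open>u \<mapsto> \<parallel>\<delta>\<^sup>\<alpha> u\<parallel>\<close>, and smoothness of maps with values in that space.\<close>

definition nct_tendsto ::
  "'n::{finite, linorder} rmat \<Rightarrow> ('a \<Rightarrow> 'n torus_op) \<Rightarrow> 'n torus_op \<Rightarrow> 'a filter \<Rightarrow> bool" where
  "nct_tendsto \<theta> f l F \<longleftrightarrow> (\<forall>\<alpha>. ((\<lambda>x. norm (nct_deltas \<theta> \<alpha> (f x - l))) \<longlongrightarrow> 0) F)"

definition nct_has_pderiv ::
  "'n::{finite, linorder} rmat \<Rightarrow> 'n \<Rightarrow> ('n rvec \<Rightarrow> 'n torus_op) \<Rightarrow> 'n torus_op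
     \<Rightarrow> 'n rvec \<Rightarrow> bool" where
  "nct_has_pderiv \<theta> j \<rho> l \<xi> \<longleftrightarrow> l \<in> nct_smooth \<theta> \<and>
     nct_tendsto \<theta> (\<lambda>h. (\<rho> (\<xi> + axis j h) - \<rho> \<xi>) /\<^sub>R h) l (at 0)"

definition nct_pderiv ::
  "'n::{finite, linorder} rmat \<Rightarrow> 'n \<Rightarrow> ('n rvec \<Rightarrow> 'n torus_op)
     \<Rightarrow> 'n rvec \<Rightarrow> 'n torus_op" where
  "nct_pderiv \<theta> j \<rho> \<xi> = (THE l. nct_has_pderiv \<theta> j \<rho> l \<xi>)"

definition nct_pderivs ::
  "'n::{finite, linorder} rmat \<Rightarrow> ('n \<Rightarrow> nat) \<Rightarrow> ('n rvec \<Rightarrow> 'n torus_op)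
     \<Rightarrow> 'n rvec \<Rightarrow> 'n torus_op" where
  "nct_pderivs \<theta> \<beta> = foldr (\<lambda>j. nct_pderiv \<theta> j ^^ \<beta> j) coords"

text \<open>For open \<open>\<Omega>\<close>: all iterated partial derivatives (\<open>js\<close> lists the directions) exist and are
  continuous on \<open>\<Omega>\<close>.\<close>

definition nct_smooth_on ::
  "'n::{finite, linorder} rmat \<Rightarrow> 'n rvec set \<Rightarrow> ('n rvec \<Rightarrow> 'n torus_op) \<Rightarrow> bool" where
  "nct_smooth_on \<theta> \<Omega> \<rho> \<longleftrightarrow> (\<forall>\<xi>\<in>\<Omega>. \<rho> \<xi> \<in> nct_smooth \<theta>) \<and>
     (\<forall>js. \<forall>\<xi>\<in>\<Omega>.
        nct_tendsto \<theta> (foldr (nct_pderiv \<theta>) js \<rho>) (foldr (nct_pderiv \<theta>) js \<rho> \<xi>) (at \<xi>) \<and>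
        (\<forall>j. \<exists>l. nct_has_pderiv \<theta> j (foldr (nct_pderiv \<theta>) js \<rho>) l \<xi>))"

definition nct_homogeneous_symbols ::
  "'n::{finite, linorder} rmat \<Rightarrow> complex \<Rightarrow> ('n rvec \<Rightarrow> 'n torus_op) set" where
  "nct_homogeneous_symbols \<theta> q = {\<rho>. nct_smooth_on \<theta> (- {0}) \<rho> \<and>
     (\<forall>t>0. \<forall>\<xi>. \<xi> \<noteq> 0 \<longrightarrow> \<rho> (t *\<^sub>R \<xi>) = (complex_of_real t powr q) *\<^sub>C \<rho> \<xi>)}"

text \<open>\<open>\<rho>\<close> is a symbol of order \<open>q\<close> with homogeneous components \<open>\<sigma> j\<close> of degree \<open>q - j\<close>.\<close>

definition nct_symbol_expansion ::
  "'n::{finite, linorder} rmat \<Rightarrow> complex \<Rightarrow> ('n rvec \<Rightarrow> 'n torus_op)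
     \<Rightarrow> (nat \<Rightarrow> 'n rvec \<Rightarrow> 'n torus_op) \<Rightarrow> bool" where
  "nct_symbol_expansion \<theta> q \<rho> \<sigma> \<longleftrightarrow> nct_smooth_on \<theta> UNIV \<rho> \<and>
     (\<forall>j. \<sigma> j \<in> nct_homogeneous_symbols \<theta> (q - of_nat j)) \<and>
     (\<forall>N \<alpha> \<beta>. \<exists>C. \<forall>\<xi>. 1 \<le> norm \<xi> \<longrightarrow>
        norm (nct_deltas \<theta> \<alpha> (nct_pderivs \<theta> \<beta> (\<lambda>\<eta>. \<rho> \<eta> - (\<Sum>j<N. \<sigma> j \<eta>)) \<xi>))
          \<le> C * norm \<xi> powr (Re q - real N - real (\<Sum>i\<in>UNIV. \<beta> i)))"

definition nct_symbols ::
  "'n::{finite, linorder} rmat \<Rightarrow> complex \<Rightarrow> ('n rvec \<Rightarrow> 'n torus_op) set" where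
  "nct_symbols \<theta> q = {\<rho>. \<exists>\<sigma>. nct_symbol_expansion \<theta> q \<rho> \<sigma>}"

definition nct_quantize ::
  "'n::{finite, linorder} rmat \<Rightarrow> ('n rvec \<Rightarrow> 'n torus_op) \<Rightarrow> 'n torus_op \<Rightarrow> 'n torus_op" where
  "nct_quantize \<theta> \<rho> u =
     (\<Sum>\<^sub>\<infinity>k. nct_coeff \<theta> u k *\<^sub>C (\<rho> (real_of_lattice k) o\<^sub>L nct_monomial \<theta> k))"

text \<open>Operators on the algebra of smooth elements are represented by functions whose values
  outside of \<^const>\<open>nct_smooth\<close> are irrelevant.\<close>

definition nct_pdo ::
  "'n::{finite, linorder} rmat \<Rightarrow> complex \<Rightarrow> ('n torus_op \<Rightarrow> 'n torus_op) set" where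
  "nct_pdo \<theta> q = {P. \<exists>\<rho>\<in>nct_symbols \<theta> q. \<forall>u\<in>nct_smooth \<theta>. P u = nct_quantize \<theta> \<rho> u}"

text \<open>Surface measure of the unit sphere: \<open>n\<close> times the volume of the cone over a set.\<close>

definition sphere_measure :: "'n::finite rvec measure" where
  "sphere_measure = scale_measure (of_nat CARD('n))
     (distr (restrict_space lborel (ball 0 1 - {0})) borel (\<lambda>x. x /\<^sub>R norm x))"

text \<open>The component of degree \<open>-n\<close> of a symbol of integer order \<open>m \<ge> -n\<close> has index \<open>m + n\<close>.
  The homogeneous symbols, hence the number \<open>r\<close>, are determined by \<open>P\<close>.\<close>

definition nct_residue ::
  "'n::{finite, linorder} rmat \<Rightarrow> ('n torus_op \<Rightarrow> 'n torus_op) \<Rightarrow> complex" where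
  "nct_residue \<theta> P = (THE r. \<exists>m \<rho> \<sigma>. nct_symbol_expansion \<theta> (of_int m) \<rho> \<sigma> \<and>
     (\<forall>u\<in>nct_smooth \<theta>. P u = nct_quantize \<theta> \<rho> u) \<and>
     r = (if m < - int CARD('n) then 0
          else LINT \<xi>|sphere_measure. nct_trace (\<sigma> (nat (m + int CARD('n))) \<xi>)))"

text \<open>The bounded operator on the completion \<open>'h\<close> that extends \<open>P\<close>; it is unique because the smooth
  elements are dense, and it exists for symbols of nonpositive order.\<close>

definition nct_extension ::
  "'n::{finite, linorder} rmat \<Rightarrow> ('n torus_op \<Rightarrow> 'h::complex_hilbert)
     \<Rightarrow> ('n torus_op \<Rightarrow> 'n torus_op) \<Rightarrow> 'h \<Rightarrow>\<^sub>L 'h" where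
  "nct_extension \<theta> \<iota> P = (THE T :: 'h \<Rightarrow>\<^sub>L 'h. \<forall>u\<in>nct_smooth \<theta>. T (\<iota> u) = \<iota> (P u))"

end

theory Submission
  imports Defs
begin

text \<open>In the orthonormal basis \<open>e k = \<iota> (U\<^sup>k)\<close> the operator \<open>P\<close> sends \<open>e k\<close> to the sum over \<open>l\<close> of
  \<open>a l k e (l + k)\<close>, where \<open>a l k\<close> is, up to a phase, the \<open>l\<close>-th coefficient of \<open>\<rho> k\<close>; it decays
  rapidly in \<open>l\<close> and like \<open>1 / |k|\<^sup>n\<close> in \<open>k\<close>. A diagonal \<open>l \<noteq> 0\<close> is a commutator with the diagonal
  unitary with entries \<open>exp (2 \<pi> i sqrt 2 k\<^sub>j)\<close>, up to the factor \<open>exp (2 \<pi> i sqrt 2 l\<^sub>j) - 1\<close>, which is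
  at least of order \<open>1 / |l|\<close> because \<open>sqrt 2\<close> is badly approximable. Hence every trace only sees the
  main diagonal, whose entries \<open>\<tau> (\<rho> k)\<close> are \<open>h k + O(1 / |k| ^ (n + 1))\<close> with \<open>h = \<tau> \<circ> \<rho>\<^bsub>-n\<^esub>\<close> homogeneous of
  degree \<open>-n\<close>. If \<open>h\<close> is positive, counting the lattice points in \<open>{h \<ge> \<lambda>}\<close> shows that the \<open>j\<close>-th largest
  entry is asymptotic to \<open>V / j\<close>, where \<open>V\<close> is the volume of \<open>{h \<ge> 1}\<close>, i.e. \<open>1 / n\<close> times the integral of
  \<open>h\<close> over the sphere; the general case follows by linearity. A normalized positive trace takes the value
  \<open>V\<close> on such an operator since it vanishes on operators of finite rank.\<close>

text \<open>No continuity of a trace is assumed, so the infinitely many off-diagonals cannot be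
  discarded one at a time. They are grouped into finitely many pieces, by the first nonzero
  coordinate of \<open>l\<close> in some order, and each piece as a whole is one commutator. The
  operator in that commutator must lie in the ideal itself: this is why small divisors may only be
  polynomially small, and why one spare power of decay in \<open>l\<close> is carried along.
  Membership in the ideal is always obtained by factoring an operator as a bounded one times a
  diagonal one with eigenvalues of order \<open>1 / j\<close>, and bounding singular values by a
  min-max argument. Adjoint, absolute value, singular values, extension and residue are definite
  descriptions, so each needs existence and uniqueness. Hence the Riesz theorem, the spectral
  theorem for compact positive operators, the uniqueness of positive roots, and a comparison of
  symbols, possibly of different orders, that agree on the lattice. Positivity of \<open>h\<close>
  is arranged by adding a large multiple of \<open>1 / |x|^n\<close> to its real and imaginary
  parts.\<close>

instance complex_hilbert \<subseteq> banach ..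

section \<open>Complex inner products\<close>

lemma cinner_add_right: "cinner x (y + z) = cinner x y + cinner x (z :: 'a::complex_inner)"
  by (metis cinner_add_left cinner_commute complex_cnj_add)

lemma cinner_scaleC_right: "cinner x (c *\<^sub>C y) = cnj c * cinner x (y :: 'a::complex_inner)"
  by (metis cinner_commute cinner_scaleC_left complex_cnj_mult)

text \<open>Multiplying \<open>x\<close> by the unimodular number that makes the inner product real
  and nonnegative reduces the claim to the real Cauchy-Schwarz inequality.\<close>

lemma cmod_cinner_le: "cmod (cinner x y) \<le> norm x * norm (y :: 'a::complex_inner)"
proof (cases "cinner x y = 0")
  case False
  define c where "c = cnj (sgn (cinner x y))"
  have c: "cmod c = 1" using False by (simp add: c_def norm_sgn)
  have "c * cinner x y = complex_of_real (cmod (cinner x y))"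
  proof -
    have "c * cinner x y = cinner x y * cnj (cinner x y) / complex_of_real (cmod (cinner x y))"
      by (simp add: c_def sgn_eq)
    also have "\<dots> = complex_of_real (cmod (cinner x y))"
      using False by (simp add: power2_eq_square flip: complex_norm_square)
    finally show ?thesis .
  qed
  then have "cmod (cinner x y) = inner (c *\<^sub>C x) y"
    by (simp add: inner_eq_Re_cinner cinner_scaleC_left)
  also have "\<dots> \<le> norm (c *\<^sub>C x) * norm y" by (rule norm_cauchy_schwarz)
  finally show ?thesis by (simp add: norm_scaleC c)
qed simp

interpretation cinner: bounded_bilinear "cinner :: 'a::complex_inner \<Rightarrow> 'a \<Rightarrow> complex"
proof
  show "\<exists>K. \<forall>a b. cmod (cinner a b) \<le> norm a * norm (b::'a) * K"
    using cmod_cinner_le by (intro exI[of _ 1]) auto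
qed (simp_all add: cinner_add_left cinner_add_right scaleR_eq_scaleC cinner_scaleC_left
    cinner_scaleC_right scaleR_conv_of_real)

declare cinner.zero_left [simp] cinner.zero_right [simp]

lemma cinner_self: "cinner x x = complex_of_real ((norm (x :: 'a::complex_inner))\<^sup>2)"
proof -
  have "Im (cinner x x) = 0"
    using arg_cong[OF cinner_commute[of x x], of Im] by simp
  moreover have "Re (cinner x x) = (norm x)\<^sup>2"
    by (metis inner_eq_Re_cinner power2_norm_eq_inner)
  ultimately show ?thesis by (simp add: complex_eq_iff)
qed

lemma cinner_all_eqD: "(\<And>z. cinner z x = cinner z y) \<Longrightarrow> x = (y :: 'a::complex_inner)"
proof -
  assume "\<And>z. cinner z x = cinner z y"
  then have "cinner (x - y) (x - y) = 0" by (simp add: cinner.diff_right)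
  then show "x = y" by (simp add: cinner_self)
qed

lemma norm_add_ortho:
  assumes "cinner x y = 0"
  shows "(norm (x + y))\<^sup>2 = (norm x)\<^sup>2 + (norm (y :: 'a::complex_inner))\<^sup>2"
proof -
  have "inner x y = 0" by (simp add: inner_eq_Re_cinner assms)
  then show ?thesis
    by (simp add: power2_norm_eq_inner inner_add_left inner_add_right inner_commute)
qed

text \<open>Polarization of the norm yields the real parts; the imaginary part is the real inner
  product with \<open>\<i> *\<^sub>C y\<close>.\<close>

lemma cinner_isometry:
  fixes T :: "'a::complex_inner \<Rightarrow> 'b::complex_inner"
  assumes add: "\<And>x y. T (x + y) = T x + T y" and sc: "\<And>c x. T (c *\<^sub>C x) = c *\<^sub>C T x"
    and iso: "\<And>x. norm (T x) = norm x"
  shows "cinner (T x) (T y) = cinner x y"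
proof -
  have i: "inner (T x) (T y) = inner x y" for x y
    using iso[of "x + y"] iso[of x] iso[of y]
    by (simp add: add norm_eq_sqrt_inner inner_add_left inner_add_right inner_commute)
  have im: "Im (cinner u v) = inner u (\<i> *\<^sub>C v)" for u v :: "'c::complex_inner"
    by (simp add: inner_eq_Re_cinner cinner_scaleC_right)
  show ?thesis
    using i[of x y] i[of x "\<i> *\<^sub>C y"]
    by (simp add: complex_eq_iff im sc) (simp add: inner_eq_Re_cinner)
qed

subsection \<open>Riesz representation and adjoints\<close>

lemma riesz_real:
  fixes g :: "'a::{real_inner, complete_space} \<Rightarrow> real"
  assumes "bounded_linear g"
  shows "\<exists>z. \<forall>x. g x = inner x z"
proof -
  interpret g: bounded_linear g by fact
  obtain K where K: "\<And>x. \<bar>g x\<bar> \<le> norm x * K" using g.bounded by auto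
  \<comment> \<open>The representing vector minimizes the functional \<open>J\<close>, which is uniformly convex.\<close>
  define J where "J x = (norm x)\<^sup>2 - 2 * g x" for x
  have J_low: "- K\<^sup>2 \<le> J x" for x
  proof -
    have "0 \<le> (norm x - K)\<^sup>2" by simp
    then show ?thesis using K[of x] by (simp add: J_def power2_diff)
  qed
  define m where "m = (INF x. J x)"
  have bdd: "bdd_below (range J)" using J_low by (intro bdd_belowI) auto
  have m_le: "m \<le> J x" for x unfolding m_def by (rule cINF_lower[OF bdd]) simp
  \<comment> \<open>Parallelogram law. As \<open>J\<close> is at least \<open>m\<close> at the
    midpoint, near-minimizers of \<open>J\<close> are close to each other, so a minimizing sequence
    is Cauchy.\<close>
  have par: "J x + J y - 2 * J ((1/2) *\<^sub>R (x + y)) = (norm (x - y))\<^sup>2 / 2" for x y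
    by (simp add: J_def g.add g.scaleR power2_norm_eq_inner inner_add_left inner_add_right
        inner_diff_left inner_diff_right inner_commute field_simps)
  have "\<exists>x. J x < m + inverse (real (Suc n))" for n
    using cINF_less_iff[OF _ bdd, of "m + inverse (real (Suc n))"] by (auto simp: m_def)
  then obtain X where X: "\<And>n. J (X n) < m + inverse (real (Suc n))" by metis
  have cau: "(norm (X i - X j))\<^sup>2 \<le> 2 * (inverse (real (Suc i)) + inverse (real (Suc j)))" for i j
  proof -
    have "d \<le> 2 * (u + v)" if "a + b - 2 * c = d / 2" "a < m + u" "b < m + v" "m \<le> c"
      for a b c d u v :: real
    proof -
      have "d = 2 * (a + b - 2 * c)" using that(1) by simp
      then show ?thesis using that(2-4) by argo
    qed
    from this[OF par X X m_le] show ?thesis .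
  qed
  have "Cauchy X"
  proof (rule metric_CauchyI)
    fix e :: real assume "0 < e"
    then obtain N where N: "inverse (real (Suc N)) < e\<^sup>2 / 4"
      using reals_Archimedean[of "e\<^sup>2 / 4"] by auto
    have "dist (X i) (X j) < e" if "i \<ge> N" "j \<ge> N" for i j
    proof -
      have "inverse (real (Suc i)) \<le> inverse (real (Suc N))"
        "inverse (real (Suc j)) \<le> inverse (real (Suc N))" using that by (auto simp: field_simps)
      then have "(norm (X i - X j))\<^sup>2 < e\<^sup>2" using cau[of i j] N by argo
      then show ?thesis using \<open>0 < e\<close> by (simp add: dist_norm power2_less_imp_less)
    qed
    then show "\<exists>M. \<forall>i\<ge>M. \<forall>j\<ge>M. dist (X i) (X j) < e" by blast
  qed
  then obtain z where z: "X \<longlonglongrightarrow> z" using Cauchy_convergent convergentD by blast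
  have "(\<lambda>n. J (X n)) \<longlonglongrightarrow> J z" unfolding J_def
    by (intro tendsto_intros z g.tendsto)
  moreover have "(\<lambda>n. m + inverse (real (Suc n))) \<longlonglongrightarrow> m + 0"
    by (intro tendsto_intros LIMSEQ_inverse_real_of_nat)
  ultimately have "J z \<le> m" using X
    by (intro LIMSEQ_le[of "\<lambda>n. J (X n)" "J z" "\<lambda>n. m + inverse (real (Suc n))"])
      (auto intro: less_imp_le)
  have "g x = inner x z" for x
  proof -
    have pos: "0 \<le> t\<^sup>2 * (norm x)\<^sup>2 + 2 * t * (inner x z - g x)" for t
    proof -
      have "J (z + t *\<^sub>R x) = J z + t\<^sup>2 * (norm x)\<^sup>2 + 2 * t * (inner x z - g x)"
      proof -
        have "(norm (z + t *\<^sub>R x))\<^sup>2 = (norm z)\<^sup>2 + t\<^sup>2 * (norm x)\<^sup>2 + 2 * t * inner x z"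
          by (simp add: power2_norm_eq_inner inner_add_left inner_add_right inner_commute
              algebra_simps power2_eq_square[of t])
        then show ?thesis by (simp add: J_def g.add g.scaleR algebra_simps)
      qed
      then show ?thesis using m_le[of "z + t *\<^sub>R x"] \<open>J z \<le> m\<close> by linarith
    qed
    show ?thesis
    proof (cases "x = 0")
      case True then show ?thesis by (simp add: g.zero)
    next
      case False
      define d where "d = inner x z - g x"
      \<comment> \<open>The inserted \<open>t\<close> is the minimizer of the quadratic polynomial
        in \<open>pos\<close>; nonnegativity there forces \<open>d = 0\<close>.\<close>
      have "0 \<le> (- d / (norm x)\<^sup>2)\<^sup>2 * (norm x)\<^sup>2 + 2 * (- d / (norm x)\<^sup>2) * d"
        using pos[of "- d / (norm x)\<^sup>2"] by (simp add: d_def)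
      also have "\<dots> = - d\<^sup>2 / (norm x)\<^sup>2" using False by (simp add: field_simps power2_eq_square)
      finally have "d\<^sup>2 \<le> 0" using False by (simp add: field_simps)
      then show ?thesis by (simp add: d_def)
    qed
  qed
  then show ?thesis by blast
qed

text \<open>The vector representing the real part of \<open>f\<close> also represents the imaginary
  part, because \<open>Im (f x) = - Re (f (\<i> *\<^sub>C x))\<close>.\<close>

lemma riesz_complex:
  fixes f :: "'a::complex_hilbert \<Rightarrow> complex"
  assumes bl: "bounded_linear f" and sc: "\<And>c x. f (c *\<^sub>C x) = c * f x"
  shows "\<exists>z. \<forall>x. f x = cinner x z"
proof -
  have "bounded_linear (\<lambda>x. Re (f x))"
    by (rule bounded_linear_compose[OF bounded_linear_Re bl])
  then obtain z where z: "\<And>x. Re (f x) = inner x z" using riesz_real by blast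
  have "f x = cinner x z" for x
    using z[of x] z[of "\<i> *\<^sub>C x"]
    by (simp add: complex_eq_iff inner_eq_Re_cinner sc cinner_scaleC_left)
  then show ?thesis by blast
qed

lemma adjoint_op_eqI:
  assumes "\<And>x y. cinner (blinfun_apply T x) y = cinner x (blinfun_apply S y)"
  shows "adjoint_op T = S"
  unfolding adjoint_op_def
proof (rule the_equality)
  show "\<forall>x y. cinner (T x) y = cinner x (S y)" using assms by simp
  fix R assume "\<forall>x y. cinner (blinfun_apply T x) y = cinner x (blinfun_apply R y)"
  then have "R y = S y" for y using assms by (intro cinner_all_eqD) metis
  then show "R = S" by (intro blinfun_eqI)
qed

text \<open>Being a definite description, \<open>adjoint_op T\<close> says nothing until an adjoint
  is exhibited; the Riesz vectors of the functionals \<open>\<lambda>x. cinner (T x) y\<close>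
  provide one.\<close>

lemma cinner_adjoint_op:
  fixes T :: "'a::complex_hilbert \<Rightarrow>\<^sub>L 'a"
  assumes "clinear_op T"
  shows "cinner (T x) y = cinner x (adjoint_op T y)"
proof -
  have "\<exists>z. \<forall>x. cinner (T x) y = cinner x z" for y
  proof (rule riesz_complex)
    show "bounded_linear (\<lambda>x. cinner (T x) y)"
      by (rule bounded_linear_compose[OF cinner.bounded_linear_left blinfun.bounded_linear_right])
    show "\<And>c x. cinner (T (c *\<^sub>C x)) y = c * cinner (T x) y"
      using assms by (simp add: clinear_op_def cinner_scaleC_left)
  qed
  then obtain S where S: "\<And>x y. cinner (T x) y = cinner x (S y)" by metis
  have "bounded_linear S"
  proof (rule bounded_linear_intro[where K = "norm T"])
    show "S (x + y) = S x + S y" for x y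
      by (rule cinner_all_eqD) (simp add: S[symmetric] cinner_add_right)
    show "S (r *\<^sub>R x) = r *\<^sub>R S x" for r x
      by (rule cinner_all_eqD) (simp add: S[symmetric] cinner.scaleR_right)
    show "norm (S y) \<le> norm y * norm T" for y
    proof -
      have "(norm (S y))\<^sup>2 = cmod (cinner (S y) (S y))"
        by (simp only: cinner_self norm_of_real) simp
      also have "\<dots> = cmod (cinner (T (S y)) y)" by (simp add: S)
      also have "\<dots> \<le> norm (T (S y)) * norm y" by (rule cmod_cinner_le)
      also have "\<dots> \<le> (norm T * norm (S y)) * norm y"
        by (intro mult_right_mono norm_blinfun) auto
      finally have "norm (S y) * norm (S y) \<le> (norm y * norm T) * norm (S y)"
        by (simp add: power2_eq_square algebra_simps)
      then show ?thesis
        by (cases "S y = 0") (auto simp: mult_le_cancel_right)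
    qed
  qed
  then have "cinner (T x) y = cinner x (Blinfun S y)" for x y
    by (simp add: S bounded_linear_Blinfun_apply)
  then show ?thesis using adjoint_op_eqI by metis
qed

lemma clinear_opD: "clinear_op T \<Longrightarrow> T (c *\<^sub>C x) = c *\<^sub>C T x"
  by (simp add: clinear_op_def)

lemma clinear_adjoint_op:
  fixes T :: "'a::complex_hilbert \<Rightarrow>\<^sub>L 'a"
  assumes "clinear_op T" shows "clinear_op (adjoint_op T)"
  unfolding clinear_op_def
proof (intro allI, rule cinner_all_eqD)
  fix c x z
  show "cinner z (adjoint_op T (c *\<^sub>C x)) = cinner z (c *\<^sub>C adjoint_op T x)"
    by (simp add: cinner_adjoint_op[OF assms, symmetric] cinner_scaleC_right)
qed

lemma norm_adjoint_op_le:
  fixes T :: "'a::complex_hilbert \<Rightarrow>\<^sub>L 'a"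
  assumes "clinear_op T" shows "norm (adjoint_op T) \<le> norm T"
proof (rule norm_blinfun_bound)
  fix y
  let ?S = "adjoint_op T"
  have "(norm (?S y))\<^sup>2 = cmod (cinner (?S y) (?S y))"
    by (simp only: cinner_self norm_of_real) simp
  also have "\<dots> = cmod (cinner (T (?S y)) y)" by (simp add: cinner_adjoint_op[OF assms])
  also have "\<dots> \<le> norm (T (?S y)) * norm y" by (rule cmod_cinner_le)
  also have "\<dots> \<le> (norm T * norm (?S y)) * norm y"
    by (intro mult_right_mono norm_blinfun) auto
  finally have "norm (?S y) * norm (?S y) \<le> (norm T * norm y) * norm (?S y)"
    by (simp add: power2_eq_square algebra_simps)
  then show "norm (?S y) \<le> norm T * norm y"
    by (cases "?S y = 0") (auto simp: mult_le_cancel_right)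
qed simp

section \<open>Complex-linear and positive operators\<close>

lemma clinear_op_compose: "clinear_op S \<Longrightarrow> clinear_op T \<Longrightarrow> clinear_op (S o\<^sub>L T)"
  by (simp add: clinear_op_def)

lemma clinear_op_add: "clinear_op S \<Longrightarrow> clinear_op T \<Longrightarrow> clinear_op (S + T)"
  by (simp add: clinear_op_def blinfun.add_left scaleC_add_right)

lemma scaleC_diff_right: "c *\<^sub>C (x - y) = c *\<^sub>C x - c *\<^sub>C (y :: 'a::complex_vector)"
  by (metis complex_vs.scale_right_diff_distrib)

lemma clinear_op_diff: "clinear_op S \<Longrightarrow> clinear_op T \<Longrightarrow> clinear_op (S - T)"
  by (simp add: clinear_op_def blinfun.diff_left scaleC_diff_right)

lemma scaleC_blinfun_apply [simp]: "blinfun_apply (c *\<^sub>C T) x = c *\<^sub>C (blinfun_apply T x)"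
  by transfer simp

lemma clinear_op_scaleC: "clinear_op T \<Longrightarrow> clinear_op (c *\<^sub>C T)"
  by (simp add: clinear_op_def scaleC_scaleC mult.commute)

lemma clinear_op_0: "clinear_op 0"
  by (simp add: clinear_op_def)

lemma norm_scaleC_blinfun: "norm (c *\<^sub>C T) = cmod c * norm (T :: 'a::real_normed_vector \<Rightarrow>\<^sub>L 'b::complex_inner)"
proof (cases "c = 0")
  case False
  have le: "norm (c *\<^sub>C T) \<le> cmod c * norm T" for c and T :: "'a \<Rightarrow>\<^sub>L 'b"
  proof (rule norm_blinfun_bound)
    show "norm ((c *\<^sub>C T) x) \<le> cmod c * norm T * norm x" for x
      using mult_left_mono[OF norm_blinfun[of T x], of "cmod c"]
      by (simp add: norm_scaleC mult.assoc)
  qed simp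
  have "norm T = norm (inverse c *\<^sub>C (c *\<^sub>C T))" using False by (simp add: scaleC_scaleC scaleC_one)
  also have "\<dots> \<le> cmod (inverse c) * norm (c *\<^sub>C T)" by (rule le)
  finally have "cmod c * norm T \<le> norm (c *\<^sub>C T)"
    using False by (simp add: norm_inverse norm_divide field_simps)
  then show ?thesis using le[of c T] by simp
qed simp

lemma closed_clinear_op: "closed {T :: 'a::complex_inner \<Rightarrow>\<^sub>L 'b::complex_inner. clinear_op T}"
proof -
  have "closed {T :: 'a \<Rightarrow>\<^sub>L 'b. T (c *\<^sub>C x) = c *\<^sub>C T x}" for c x
    by (intro closed_Collect_eq continuous_intros
        bounded_linear.continuous_on[OF bounded_linear_scaleC])
  then show ?thesis unfolding clinear_op_def Collect_all_eq by (intro closed_INT ballI)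
qed

lemma bounded_linear_scaleC_left: "bounded_linear (\<lambda>c. c *\<^sub>C (x :: 'a::complex_inner))"
  by (rule bounded_linear_intro[where K = "norm x"])
    (simp_all add: scaleC_add_left scaleR_eq_scaleC scaleC_scaleC norm_scaleC scaleR_conv_of_real)

text \<open>Polarization: the quadratic form is real at \<open>x + y\<close> and at
  \<open>x + \<i> *\<^sub>C y\<close>, which fixes the imaginary and the real part of the
  difference.\<close>

lemma positive_op_self_adjoint:
  assumes "positive_op A"
  shows "cinner (A x) y = cinner x (A y)"
proof -
  have cl: "clinear_op A" and r: "\<And>x. Im (cinner (A x) x) = 0"
    using assms by (auto simp: positive_op_def complex_is_Real_iff)
  have "Im (cinner (A x) y + cinner (A y) x) = 0"
    using r[of "x + y"] r[of x] r[of y] by (simp add: blinfun.add_right cinner_add_left cinner_add_right)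
  moreover have "Re (cinner (A y) x) - Re (cinner (A x) y) = 0"
    using r[of "x + \<i> *\<^sub>C y"] r[of x] r[of "\<i> *\<^sub>C y"]
    by (simp add: blinfun.add_right cinner_add_left cinner_add_right clinear_opD[OF cl]
        cinner_scaleC_left cinner_scaleC_right)
  ultimately have "cinner (A x) y = cnj (cinner (A y) x)" by (simp add: complex_eq_iff)
  then show ?thesis using cinner_commute by metis
qed

text \<open>Nonnegativity of the form at \<open>x - A x / M\<close>. The bound by \<open>M\<close>
  is asked only at the vector \<open>A x\<close>, so \<open>M\<close> may be the supremum of the
  form over an invariant subspace.\<close>

lemma positive_op_norm2_le:
  fixes A :: "'a::complex_inner \<Rightarrow>\<^sub>L 'a"
  assumes A: "positive_op A" and M: "0 < M" "Re (cinner (A (A x)) (A x)) \<le> M * (norm (A x))\<^sup>2"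
  shows "(norm (A x))\<^sup>2 \<le> M * Re (cinner (A x) x)"
proof -
  let ?t = "1 / M"
  have sa: "cinner (A (A x)) x = cinner (A x) (A x)" by (rule positive_op_self_adjoint[OF A])
  have "0 \<le> Re (cinner (A (x - ?t *\<^sub>R A x)) (x - ?t *\<^sub>R A x))"
    using A by (auto simp: positive_op_def)
  also have "\<dots> = Re (cinner (A x) x) - 2 * ?t * (norm (A x))\<^sup>2 + ?t\<^sup>2 * Re (cinner (A (A x)) (A x))"
    by (simp add: blinfun.diff_right blinfun.scaleR_right cinner.diff_left cinner.diff_right
        cinner.scaleR_left cinner.scaleR_right sa cinner_self power2_eq_square algebra_simps)
  also have "\<dots> \<le> Re (cinner (A x) x) - 2 * ?t * (norm (A x))\<^sup>2 + ?t\<^sup>2 * (M * (norm (A x))\<^sup>2)"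
    using M by (intro add_left_mono mult_left_mono) auto
  also have "\<dots> = Re (cinner (A x) x) - ?t * (norm (A x))\<^sup>2"
    using M by (simp add: power2_eq_square)
  finally show ?thesis using M by (simp add: field_simps)
qed

subsection \<open>Orthogonal families\<close>

text \<open>Cauchy criterion for unordered sums: the finite partial sums form a Cauchy filter, and
  completeness supplies its limit.\<close>

lemma summable_on_CauchyI:
  fixes f :: "'i \<Rightarrow> 'a::banach"
  assumes "\<And>\<epsilon>. \<epsilon> > 0 \<Longrightarrow> \<exists>F. finite F \<and> F \<subseteq> A \<and> (\<forall>G. finite G \<and> G \<subseteq> A - F \<longrightarrow> norm (sum f G) \<le> \<epsilon>)"
  shows "f summable_on A"
proof -
  have "\<exists>P. eventually P (finite_subsets_at_top A) \<and>
          (\<forall>F F'. P F \<and> P F' \<longrightarrow> dist (sum f F) (sum f F') < \<epsilon>)" if "\<epsilon> > 0" for \<epsilon>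
  proof -
    from that have "\<epsilon> / 3 > 0" by simp
    then have "\<exists>F. finite F \<and> F \<subseteq> A \<and> (\<forall>G. finite G \<and> G \<subseteq> A - F \<longrightarrow> norm (sum f G) \<le> \<epsilon> / 3)"
      by (rule assms)
    then obtain F where F: "finite F" "F \<subseteq> A"
      "\<forall>G. finite G \<and> G \<subseteq> A - F \<longrightarrow> norm (sum f G) \<le> \<epsilon> / 3" by blast
    define P where "P G \<longleftrightarrow> finite G \<and> F \<subseteq> G \<and> G \<subseteq> A" for G
    have "eventually P (finite_subsets_at_top A)"
      unfolding P_def eventually_finite_subsets_at_top using F by blast
    moreover have "dist (sum f G) (sum f G') < \<epsilon>" if "P G" "P G'" for G G'
    proof -
      have d: "sum f H - sum f F = sum f (H - F)" if "P H" for H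
        using that by (auto simp: P_def sum_diff)
      have "sum f G - sum f G' = sum f (G - F) - sum f (G' - F)" by (simp add: d[OF that(1), symmetric] d[OF that(2), symmetric])
      also have "norm \<dots> \<le> norm (sum f (G - F)) + norm (sum f (G' - F))" by (rule norm_triangle_ineq4)
      also have "\<dots> \<le> \<epsilon> / 3 + \<epsilon> / 3" using that by (intro add_mono F(3)[rule_format]) (auto simp: P_def)
      finally show ?thesis using \<open>\<epsilon> > 0\<close> by (simp add: dist_norm)
    qed
    ultimately show ?thesis by blast
  qed
  then have "cauchy_filter (filtermap (sum f) (finite_subsets_at_top A))"
    by (simp add: cauchy_filter_metric_filtermap)
  moreover have "complete (UNIV :: 'a set)"
    by (meson Cauchy_convergent UNIV_I complete_def convergent_def)
  ultimately obtain L where "(sum f \<longlongrightarrow> L) (finite_subsets_at_top A)"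
    using complete_uniform[where S=UNIV] by (force simp add: filterlim_def)
  then show ?thesis
    using summable_on_def has_sum_def by blast
qed

text \<open>Norms at most 1, rather than equal to 1, admit families padded with zero vectors, such
  as the eigenvectors of an operator with finitely many positive eigenvalues.\<close>

definition ortho_fam :: "('i \<Rightarrow> 'a::complex_inner) \<Rightarrow> bool" where
  "ortho_fam e \<longleftrightarrow> (\<forall>i j. i \<noteq> j \<longrightarrow> cinner (e i) (e j) = 0) \<and> (\<forall>i. norm (e i) \<le> 1)"

lemma cinner_sum_ortho:
  assumes "finite F" "\<And>i j. i \<in> F \<Longrightarrow> j \<in> F \<Longrightarrow> i \<noteq> j \<Longrightarrow> cinner (e i) (e j) = 0"
  shows "cinner (\<Sum>i\<in>F. a i *\<^sub>C e i) (\<Sum>j\<in>F. b j *\<^sub>C e j)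
    = (\<Sum>i\<in>F. a i * cnj (b i) * complex_of_real ((norm (e i))\<^sup>2))"
proof -
  have "cinner (a i *\<^sub>C e i) (\<Sum>j\<in>F. b j *\<^sub>C e j) = a i * cnj (b i) * complex_of_real ((norm (e i))\<^sup>2)"
    if i: "i \<in> F" for i
  proof -
    have "cinner (a i *\<^sub>C e i) (\<Sum>j\<in>F. b j *\<^sub>C e j) = (\<Sum>j\<in>F. cinner (a i *\<^sub>C e i) (b j *\<^sub>C e j))"
      by (rule cinner.sum_right)
    also have "\<dots> = (\<Sum>j\<in>F. if j = i then a i * cnj (b i) * complex_of_real ((norm (e i))\<^sup>2) else 0)"
      using assms(2)[OF i]
      by (intro sum.cong refl) (auto simp: cinner_scaleC_left cinner_scaleC_right cinner_self)
    finally show ?thesis using assms(1) i by simp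
  qed
  then show ?thesis by (simp add: cinner.sum_left)
qed

lemma norm2_sum_ortho:
  assumes "finite F" "\<And>i j. i \<in> F \<Longrightarrow> j \<in> F \<Longrightarrow> i \<noteq> j \<Longrightarrow> cinner (e i) (e j) = 0"
  shows "(norm (\<Sum>i\<in>F. a i *\<^sub>C e i))\<^sup>2 = (\<Sum>i\<in>F. (cmod (a i))\<^sup>2 * (norm (e i))\<^sup>2)"
proof -
  have "complex_of_real ((norm (\<Sum>i\<in>F. a i *\<^sub>C e i))\<^sup>2)
      = cinner (\<Sum>i\<in>F. a i *\<^sub>C e i) (\<Sum>i\<in>F. a i *\<^sub>C e i)"
    by (rule cinner_self[symmetric])
  also have "\<dots> = (\<Sum>i\<in>F. a i * cnj (a i) * complex_of_real ((norm (e i))\<^sup>2))"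
    by (rule cinner_sum_ortho[OF assms])
  also have "\<dots> = complex_of_real (\<Sum>i\<in>F. (cmod (a i))\<^sup>2 * (norm (e i))\<^sup>2)"
    by (simp only: of_real_sum of_real_mult complex_norm_square)
  finally show ?thesis by (simp only: of_real_eq_iff)
qed

lemma norm2_sum_ortho_fam_le:
  assumes "ortho_fam e" "finite F"
  shows "(norm (\<Sum>i\<in>F. a i *\<^sub>C e i))\<^sup>2 \<le> (\<Sum>i\<in>F. (cmod (a i))\<^sup>2)"
proof -
  have "(norm (\<Sum>i\<in>F. a i *\<^sub>C e i))\<^sup>2 = (\<Sum>i\<in>F. (cmod (a i))\<^sup>2 * (norm (e i))\<^sup>2)"
    using assms by (intro norm2_sum_ortho) (auto simp: ortho_fam_def)
  also have "\<dots> \<le> (\<Sum>i\<in>F. (cmod (a i))\<^sup>2)"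
    using assms by (intro sum_mono mult_left_le) (auto simp: ortho_fam_def power_le_one)
  finally show ?thesis .
qed

text \<open>Let \<open>s\<close> be the sum on the left. The combination \<open>y\<close> satisfies
  \<open>cinner x y = s\<close> and has squared norm at most \<open>s\<close>, so Cauchy-Schwarz
  gives \<open>s * s \<le> (norm x)^2 * s\<close>. This also covers vectors \<open>e i\<close> of
  norm below 1.\<close>

lemma bessel:
  assumes "ortho_fam e" "finite F"
  shows "(\<Sum>i\<in>F. (cmod (cinner x (e i)))\<^sup>2) \<le> (norm x)\<^sup>2"
proof -
  define y where "y = (\<Sum>i\<in>F. cinner x (e i) *\<^sub>C e i)"
  define s where "s = (\<Sum>i\<in>F. (cmod (cinner x (e i)))\<^sup>2)"
  have s0: "0 \<le> s" by (simp add: s_def sum_nonneg)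
  have "cinner x y = complex_of_real s"
    unfolding y_def s_def of_real_sum complex_norm_square cinner.sum_right cinner_scaleC_right
    by (simp add: mult.commute)
  then have "s = cmod (cinner x y)" using s0 by simp
  then have "s \<le> norm x * norm y" using cmod_cinner_le[of x y] by simp
  then have "s\<^sup>2 \<le> (norm x)\<^sup>2 * (norm y)\<^sup>2" using s0 by (metis power_mono power_mult_distrib)
  also have "\<dots> \<le> (norm x)\<^sup>2 * s"
    unfolding y_def s_def by (intro mult_left_mono norm2_sum_ortho_fam_le assms) simp
  finally have "s * s \<le> (norm x)\<^sup>2 * s" by (simp add: power2_eq_square)
  then have "s \<le> (norm x)\<^sup>2" using s0 by (cases "s = 0") (auto simp: mult_le_cancel_right)
  then show ?thesis by (simp add: s_def)
qed

lemma bessel_summable: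
  "ortho_fam e \<Longrightarrow> (\<lambda>i. (cmod (cinner x (e i)))\<^sup>2) summable_on UNIV"
  by (rule nonneg_bdd_above_summable_on) (auto intro!: bdd_aboveI2[where M = "(norm x)\<^sup>2"] bessel)

text \<open>By orthogonality the squared norm of a finite tail is at most the tail of the squared
  coefficients, so the Cauchy criterion applies although the series need not converge
  absolutely.\<close>

lemma ortho_summable:
  fixes e :: "'i \<Rightarrow> 'a::complex_hilbert"
  assumes e: "ortho_fam e" and c: "(\<lambda>i. (cmod (c i))\<^sup>2) summable_on UNIV"
  shows "(\<lambda>i. c i *\<^sub>C e i) summable_on UNIV"
proof (rule summable_on_CauchyI)
  fix \<epsilon> :: real assume "\<epsilon> > 0"
  let ?g = "\<lambda>i. (cmod (c i))\<^sup>2"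
  obtain F where F: "finite F" "dist (sum ?g F) (infsum ?g UNIV) \<le> \<epsilon>\<^sup>2"
    using has_sum_finite_approximation[OF has_sum_infsum[OF c], of "\<epsilon>\<^sup>2"] \<open>\<epsilon> > 0\<close> by auto
  have "norm (\<Sum>i\<in>G. c i *\<^sub>C e i) \<le> \<epsilon>" if G: "finite G" "G \<subseteq> UNIV - F" for G
  proof -
    have "(norm (\<Sum>i\<in>G. c i *\<^sub>C e i))\<^sup>2 \<le> sum ?g G"
      by (rule norm2_sum_ortho_fam_le[OF e G(1)])
    also have "\<dots> = sum ?g (F \<union> G) - sum ?g F"
      using F G by (subst sum.union_disjoint) auto
    also have "\<dots> \<le> infsum ?g UNIV - sum ?g F"
      using finite_sum_le_infsum[OF c, of "F \<union> G"] F G by auto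
    also have "\<dots> \<le> \<epsilon>\<^sup>2" using F(2) by (simp add: dist_real_def)
    finally show ?thesis by (rule power2_le_imp_le) (use \<open>\<epsilon> > 0\<close> in simp)
  qed
  then show "\<exists>F. finite F \<and> F \<subseteq> UNIV \<and> (\<forall>G. finite G \<and> G \<subseteq> UNIV - F \<longrightarrow> norm (\<Sum>i\<in>G. c i *\<^sub>C e i) \<le> \<epsilon>)"
    using F(1) by blast
qed

lemma has_sum_norm_le:
  fixes f :: "'i \<Rightarrow> 'a::real_normed_vector"
  assumes "(f has_sum s) A" "\<And>F. finite F \<Longrightarrow> F \<subseteq> A \<Longrightarrow> norm (sum f F) \<le> b"
  shows "norm s \<le> b"
proof (rule tendsto_upperbound)
  show "((\<lambda>F. norm (sum f F)) \<longlongrightarrow> norm s) (finite_subsets_at_top A)"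
    using assms(1) unfolding has_sum_def by (rule tendsto_norm)
  show "\<forall>\<^sub>F F in finite_subsets_at_top A. norm (sum f F) \<le> b"
    using assms(2) by (intro eventually_finite_subsets_at_top_weakI) auto
qed simp

text \<open>On an orthonormal family this sends \<open>e k\<close> to
  \<open>c k *\<^sub>C g k\<close>. With \<open>g = e\<close> it is a diagonal operator, with
  \<open>g k = e (l + k)\<close> a single diagonal of a matrix.\<close>

definition wop :: "('i \<Rightarrow> 'a::complex_hilbert) \<Rightarrow> ('i \<Rightarrow> 'a) \<Rightarrow> ('i \<Rightarrow> complex) \<Rightarrow> 'a \<Rightarrow>\<^sub>L 'a" where
  "wop e g c = Blinfun (\<lambda>x. \<Sum>\<^sub>\<infinity>k. (c k * cinner x (e k)) *\<^sub>C g k)"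

lemma
  assumes e: "ortho_fam e" and g: "ortho_fam g" and c: "\<And>k. cmod (c k) \<le> K"
  shows wop_has_sum: "((\<lambda>k. (c k * cinner x (e k)) *\<^sub>C g k) has_sum blinfun_apply (wop e g c) x) UNIV"
    and clinear_wop: "clinear_op (wop e g c)"
    and norm_wop_le: "norm (wop e g c) \<le> K"
proof -
  let ?S = "\<lambda>x. \<Sum>\<^sub>\<infinity>k. (c k * cinner x (e k)) *\<^sub>C g k"
  have K0: "0 \<le> K" using norm_ge_zero[of "c undefined"] c[of undefined] by linarith
  have le: "(cmod (c k * cinner x (e k)))\<^sup>2 \<le> K\<^sup>2 * (cmod (cinner x (e k)))\<^sup>2" for x k
    by (simp add: norm_mult power_mult_distrib mult_right_mono power_mono c)
  have hs: "((\<lambda>k. (c k * cinner x (e k)) *\<^sub>C g k) has_sum ?S x) UNIV" for x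
  proof (intro has_sum_infsum ortho_summable g)
    have "(\<lambda>k. K\<^sup>2 * (cmod (cinner x (e k)))\<^sup>2) summable_on UNIV"
      by (intro summable_on_cmult_right bessel_summable e)
    then show "(\<lambda>k. (cmod (c k * cinner x (e k)))\<^sup>2) summable_on UNIV"
      by (rule summable_on_comparison_test) (use le in auto)
  qed
  have add: "?S (x + y) = ?S x + ?S y" for x y
    using has_sum_add[OF hs[of x] hs[of y]]
    by (intro infsumI) (simp add: cinner_add_left scaleC_add_left ring_distribs)
  have sc: "?S (d *\<^sub>C x) = d *\<^sub>C ?S x" for d x
    using has_sum_bounded_linear[OF bounded_linear_scaleC hs[of x], of d]
    by (intro infsumI) (simp add: cinner_scaleC_left scaleC_scaleC mult_ac)
  have bd: "norm (?S x) \<le> norm x * K" for x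
  proof (rule has_sum_norm_le[OF hs])
    fix F :: "'a set" assume F: "finite F"
    have "(norm (\<Sum>k\<in>F. (c k * cinner x (e k)) *\<^sub>C g k))\<^sup>2 \<le> (\<Sum>k\<in>F. (cmod (c k * cinner x (e k)))\<^sup>2)"
      by (rule norm2_sum_ortho_fam_le[OF g F])
    also have "\<dots> \<le> (\<Sum>k\<in>F. K\<^sup>2 * (cmod (cinner x (e k)))\<^sup>2)" by (intro sum_mono le)
    also have "\<dots> \<le> K\<^sup>2 * (norm x)\<^sup>2"
      unfolding sum_distrib_left[symmetric] by (intro mult_left_mono bessel e F) simp
    also have "\<dots> = (norm x * K)\<^sup>2" by (simp add: power_mult_distrib)
    finally show "norm (\<Sum>k\<in>F. (c k * cinner x (e k)) *\<^sub>C g k) \<le> norm x * K"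
      by (rule power2_le_imp_le[of _ "norm x * K"]) (use K0 in simp)
  qed
  have bl: "bounded_linear ?S"
    by (rule bounded_linear_intro[where K = K]) (use add sc bd in \<open>simp_all add: scaleR_eq_scaleC\<close>)
  have ap: "blinfun_apply (wop e g c) = ?S" by (simp add: wop_def bounded_linear_Blinfun_apply bl)
  show "((\<lambda>k. (c k * cinner x (e k)) *\<^sub>C g k) has_sum blinfun_apply (wop e g c) x) UNIV"
    using hs ap by simp
  show "clinear_op (wop e g c)" using sc by (simp add: clinear_op_def ap)
  show "norm (wop e g c) \<le> K"
    using bd K0 by (intro norm_blinfun_bound) (auto simp: ap mult.commute)
qed

lemma wop_apply_fam:
  assumes e: "ortho_fam e" and g: "ortho_fam g" and c: "\<And>k. cmod (c k) \<le> K"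
  shows "wop e g c (e j) = (c j * complex_of_real ((norm (e j))\<^sup>2)) *\<^sub>C g j"
proof -
  have "((\<lambda>k. (c k * cinner (e j) (e k)) *\<^sub>C g k) has_sum wop e g c (e j)) UNIV"
    by (rule wop_has_sum[OF e g c])
  moreover have "((\<lambda>k. (c k * cinner (e j) (e k)) *\<^sub>C g k) has_sum
      (c j * complex_of_real ((norm (e j))\<^sup>2)) *\<^sub>C g j) UNIV"
  proof -
    have "((\<lambda>k. (c k * cinner (e j) (e k)) *\<^sub>C g k) has_sum
        (c j * complex_of_real ((norm (e j))\<^sup>2)) *\<^sub>C g j) {j}"
      by (intro has_sum_finiteI) (auto simp: cinner_self)
    then show ?thesis
      by (rule has_sum_cong_neutral[THEN iffD1, rotated -1]) (use e in \<open>auto simp: ortho_fam_def\<close>)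
  qed
  ultimately show ?thesis by (rule has_sum_unique)
qed

lemma wop_apply_0:
  assumes e: "ortho_fam e" and g: "ortho_fam g" and c: "\<And>k. cmod (c k) \<le> K"
    and x: "\<And>k. cinner x (e k) = 0"
  shows "wop e g c x = 0"
proof -
  have "((\<lambda>k. (c k * cinner x (e k)) *\<^sub>C g k) has_sum wop e g c x) UNIV"
    by (rule wop_has_sum[OF e g c])
  then have "((\<lambda>k. 0) has_sum wop e g c x) (UNIV :: 'a set)" by (simp add: x)
  then show ?thesis using has_sum_unique has_sum_0_simp by blast
qed

lemma positive_wop:
  assumes e: "ortho_fam e" and c: "\<And>k. 0 \<le> c k" "\<And>k. c k \<le> K"
  shows "positive_op (wop e e (\<lambda>k. complex_of_real (c k)))"
proof -
  have c': "cmod (complex_of_real (c k)) \<le> K" for k using c[of k] by simp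
  have "cinner (wop e e (\<lambda>k. complex_of_real (c k)) x) x \<in> \<real> \<and>
    0 \<le> Re (cinner (wop e e (\<lambda>k. complex_of_real (c k)) x) x)" for x
  proof -
    let ?s = "cinner (wop e e (\<lambda>k. complex_of_real (c k)) x) x"
    have "((\<lambda>k. cinner ((complex_of_real (c k) * cinner x (e k)) *\<^sub>C e k) x) has_sum ?s) UNIV"
      by (rule has_sum_bounded_linear[OF cinner.bounded_linear_left wop_has_sum[OF e e c']])
    moreover have "cinner ((complex_of_real (c k) * cinner x (e k)) *\<^sub>C e k) x
        = complex_of_real (c k * (cmod (cinner x (e k)))\<^sup>2)" for k
    proof -
      have "cinner (e k) x = cnj (cinner x (e k))" by (rule cinner_commute)
      then show ?thesis
        by (simp add: cinner_scaleC_left mult.assoc flip: complex_norm_square)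
    qed
    ultimately have hs: "((\<lambda>k. complex_of_real (c k * (cmod (cinner x (e k)))\<^sup>2)) has_sum ?s) UNIV"
      by simp
    have "Im ?s = 0" using has_sum_unique[OF has_sum_Im[OF hs], of 0] by simp
    moreover have "0 \<le> Re ?s" using has_sum_Re[OF hs] by (rule has_sum_nonneg) (use c in simp)
    ultimately show ?thesis by (simp add: complex_is_Real_iff)
  qed
  then show ?thesis using clinear_wop[OF e e c'] by (simp add: positive_op_def)
qed

subsection \<open>Compact positive operators\<close>

text \<open>Supremum of the numerical range on \<open>W\<close>, used as the largest eigenvalue of a
  compact positive operator on an invariant closed subspace.\<close>

definition quad_sup :: "('a::complex_inner \<Rightarrow>\<^sub>L 'a) \<Rightarrow> 'a set \<Rightarrow> real" where
  "quad_sup A W = (SUP x\<in>{x \<in> W. norm x \<le> 1}. Re (cinner (A x) x))"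

lemma quad_form_bdd: "bdd_above ((\<lambda>x. Re (cinner (blinfun_apply A x) x)) ` {x \<in> W. norm x \<le> 1})"
proof (rule bdd_aboveI2)
  fix x assume x: "x \<in> {x \<in> W. norm x \<le> 1}"
  have "Re (cinner (A x) x) \<le> cmod (cinner (A x) x)" by (rule complex_Re_le_cmod)
  also have "\<dots> \<le> norm (A x) * norm x" by (rule cmod_cinner_le)
  also have "\<dots> \<le> norm (A x) * 1" using x by (intro mult_left_mono) auto
  also have "\<dots> \<le> norm A * norm x" using norm_blinfun[of A x] by simp
  also have "\<dots> \<le> norm A * 1" using x by (intro mult_left_mono) auto
  finally show "Re (cinner (A x) x) \<le> norm A" by simp
qed

lemma quad_form_le:
  assumes "x \<in> W" "\<And>x r. x \<in> W \<Longrightarrow> r *\<^sub>R x \<in> W"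
  shows "Re (cinner (blinfun_apply A x) x) \<le> quad_sup A W * (norm x)\<^sup>2"
proof (cases "x = 0")
  case False
  let ?y = "(1 / norm x) *\<^sub>R x"
  have "Re (cinner (A ?y) ?y) \<le> quad_sup A W"
    unfolding quad_sup_def using assms False by (intro cSUP_upper quad_form_bdd) auto
  then show ?thesis
    using False by (simp add: blinfun.scaleR_right cinner.scaleR_left cinner.scaleR_right
        field_simps power2_eq_square)
qed simp

lemma norm2_diff_scaleR:
  "(norm (u - t *\<^sub>R v))\<^sup>2 = (norm u)\<^sup>2 - 2 * t * inner u v + t\<^sup>2 * (norm (v :: 'a::real_inner))\<^sup>2"
  by (simp add: power2_norm_eq_inner inner_diff_left inner_diff_right inner_commute[of v u]
      power2_eq_square[of t] algebra_simps)

text \<open>A maximizing sequence is asymptotically an eigenvector: the squared norm of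
  \<open>A (X n) - M *\<^sub>R X n\<close> is at most \<open>M\<close> times the defect of the form.
  Convergence of \<open>A (X n)\<close> along a subsequence therefore forces convergence of
  \<open>X n\<close>. If the supremum is not positive the zero vector is returned, so that the
  recursion below never stops.\<close>

lemma max_eigenvector:
  fixes A :: "'a::complex_inner \<Rightarrow>\<^sub>L 'a"
  assumes A: "positive_op A"
    and cpt: "\<And>X :: nat \<Rightarrow> 'a. (\<And>n. norm (X n) \<le> 1) \<Longrightarrow> \<exists>r l. strict_mono r \<and> (\<lambda>n. A (X (r n))) \<longlonglongrightarrow> l"
    and W: "closed W" "\<And>x y. x \<in> W \<Longrightarrow> y \<in> W \<Longrightarrow> x + y \<in> W" "\<And>x r. x \<in> W \<Longrightarrow> r *\<^sub>R x \<in> W" "0 \<in> W"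
    and inv: "\<And>x. x \<in> W \<Longrightarrow> A x \<in> W"
  shows "\<exists>e\<in>W. A e = quad_sup A W *\<^sub>R e \<and> norm e = (if quad_sup A W > 0 then 1 else 0)"
proof (cases "quad_sup A W > 0")
  case True
  define M where "M = quad_sup A W"
  have M: "M > 0" using True by (simp add: M_def)
  have "\<exists>x\<in>W. norm x \<le> 1 \<and> M - inverse (real (Suc n)) < Re (cinner (A x) x)" for n
  proof -
    have "M - inverse (real (Suc n)) < M" by simp
    then show ?thesis
      using less_cSUP_iff[of "{x \<in> W. norm x \<le> 1}" "\<lambda>x. Re (cinner (A x) x)" "M - inverse (real (Suc n))"]
        quad_form_bdd[of A W] W(4) unfolding M_def quad_sup_def by fastforce
  qed
  then obtain X where X: "\<And>n. X n \<in> W" "\<And>n. norm (X n) \<le> 1"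
      "\<And>n. M - inverse (real (Suc n)) < Re (cinner (A (X n)) (X n))"
    by metis
  obtain r l where r: "strict_mono r" and l: "(\<lambda>n. A (X (r n))) \<longlonglongrightarrow> l"
    using cpt[of X] X(2) by blast
  have q_le: "Re (cinner (A x) x) \<le> M * (norm x)\<^sup>2" if "x \<in> W" for x
    unfolding M_def using that W(3) by (intro quad_form_le) auto
  have close: "(norm (A (X n) - M *\<^sub>R X n))\<^sup>2 \<le> M * inverse (real (Suc n))" for n
  proof -
    have n1: "(norm (X n))\<^sup>2 \<le> 1" using X(2) by (simp add: power_le_one)
    have "(norm (A (X n)))\<^sup>2 \<le> M * Re (cinner (A (X n)) (X n))"
      by (rule positive_op_norm2_le[OF A M q_le]) (use inv X in auto)
    moreover have "(norm (A (X n) - M *\<^sub>R X n))\<^sup>2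
        = (norm (A (X n)))\<^sup>2 - 2 * M * Re (cinner (A (X n)) (X n)) + M\<^sup>2 * (norm (X n))\<^sup>2"
      by (simp add: norm2_diff_scaleR inner_eq_Re_cinner)
    moreover have "M\<^sup>2 * (norm (X n))\<^sup>2 \<le> M\<^sup>2 * 1" using n1 by (intro mult_left_mono) auto
    ultimately have "(norm (A (X n) - M *\<^sub>R X n))\<^sup>2 \<le> M * (M - Re (cinner (A (X n)) (X n)))"
      by (simp add: algebra_simps power2_eq_square[of M])
    also have "\<dots> \<le> M * inverse (real (Suc n))"
      using X(3)[of n] M by (intro mult_left_mono) argo+
    finally show ?thesis .
  qed
  have inv0: "(\<lambda>n. inverse (real (Suc (r n)))) \<longlonglongrightarrow> 0"
    using LIMSEQ_subseq_LIMSEQ[OF LIMSEQ_inverse_real_of_nat r] by (simp only: o_def)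
  have "(\<lambda>n. (norm (A (X (r n)) - M *\<^sub>R X (r n)))\<^sup>2) \<longlonglongrightarrow> 0"
  proof (rule tendsto_sandwich)
    show "\<forall>\<^sub>F n in sequentially. 0 \<le> (norm (A (X (r n)) - M *\<^sub>R X (r n)))\<^sup>2" by simp
    show "\<forall>\<^sub>F n in sequentially. (norm (A (X (r n)) - M *\<^sub>R X (r n)))\<^sup>2 \<le> M * inverse (real (Suc (r n)))"
      by (intro always_eventually allI close)
    show "(\<lambda>n. M * inverse (real (Suc (r n)))) \<longlonglongrightarrow> 0"
      using tendsto_mult[OF tendsto_const[of M] inv0] by simp
  qed (rule tendsto_const)
  then have "(\<lambda>n. sqrt ((norm (A (X (r n)) - M *\<^sub>R X (r n)))\<^sup>2)) \<longlonglongrightarrow> sqrt 0"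
    by (rule tendsto_real_sqrt)
  then have "(\<lambda>n. A (X (r n)) - M *\<^sub>R X (r n)) \<longlonglongrightarrow> 0"
    by (simp add: tendsto_norm_zero_iff)
  then have "(\<lambda>n. (1 / M) *\<^sub>R (A (X (r n)) - (A (X (r n)) - M *\<^sub>R X (r n)))) \<longlonglongrightarrow> (1 / M) *\<^sub>R (l - 0)"
    by (intro tendsto_intros l)
  then have lim: "(\<lambda>n. X (r n)) \<longlonglongrightarrow> (1 / M) *\<^sub>R l" using M by simp
  define e where "e = (1 / M) *\<^sub>R l"
  have e: "(\<lambda>n. X (r n)) \<longlonglongrightarrow> e" using lim by (simp add: e_def)
  have "e \<in> W" using closed_sequentially[OF W(1) _ e] X(1) by simp
  have "(\<lambda>n. A (X (r n))) \<longlonglongrightarrow> A e" by (intro blinfun.tendsto tendsto_const e)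
  then have "A e = l" using l LIMSEQ_unique by blast
  then have Ae: "A e = M *\<^sub>R e" using M by (simp add: e_def)
  have "norm e \<le> 1"
    by (rule LIMSEQ_le_const2[OF tendsto_norm[OF e]]) (use X in auto)
  have "M \<le> Re (cinner (A e) e)"
  proof (rule LIMSEQ_le)
    show "(\<lambda>n. M - inverse (real (Suc (r n)))) \<longlonglongrightarrow> M"
      using tendsto_diff[OF tendsto_const[of M] inv0] by simp
    show "(\<lambda>n. Re (cinner (A (X (r n))) (X (r n)))) \<longlonglongrightarrow> Re (cinner (A e) e)"
      by (intro tendsto_Re cinner.tendsto blinfun.tendsto tendsto_const e)
    show "\<exists>N. \<forall>n\<ge>N. M - inverse (real (Suc (r n))) \<le> Re (cinner (A (X (r n))) (X (r n)))"
      using X(3) less_imp_le by blast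
  qed
  also have "\<dots> = M * (norm e)\<^sup>2" by (simp add: Ae cinner.scaleR_left cinner_self)
  finally have "1 \<le> (norm e)\<^sup>2" using M by simp
  then have "norm e = 1"
    using \<open>norm e \<le> 1\<close> by (metis norm_ge_zero one_power2 order_antisym power2_le_imp_le)
  then show ?thesis using Ae \<open>e \<in> W\<close> True by (intro bexI[of _ e]) (auto simp: M_def)
next
  case False
  then show ?thesis using W(4) by (intro bexI[of _ 0]) auto
qed

text \<open>The spectral decomposition of a compact positive operator, indexed by all natural
  numbers: where \<open>\<mu>\<close> vanishes the eigenvector is the zero vector. The last clause
  says that nothing is left outside the span of the eigenvectors.\<close>

definition spectral_system :: "('a::complex_inner \<Rightarrow>\<^sub>L 'a) \<Rightarrow> (nat \<Rightarrow> 'a) \<Rightarrow> (nat \<Rightarrow> real) \<Rightarrow> bool" where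
  "spectral_system A e \<mu> \<longleftrightarrow> decseq \<mu> \<and> \<mu> \<longlonglongrightarrow> 0 \<and> (\<forall>i. 0 \<le> \<mu> i) \<and>
     (\<forall>i j. i \<noteq> j \<longrightarrow> cinner (e i) (e j) = 0) \<and> (\<forall>i. norm (e i) = (if \<mu> i > 0 then 1 else 0)) \<and>
     (\<forall>j. A (e j) = \<mu> j *\<^sub>R e j) \<and> (\<forall>x. (\<forall>j. cinner x (e j) = 0) \<longrightarrow> A x = 0)"

text \<open>Each eigenvector maximizes the quadratic form on the orthogonal complement of its predecessors.\<close>

lemma spectral_system_exists:
  fixes A :: "'a::complex_inner \<Rightarrow>\<^sub>L 'a"
  assumes A: "positive_op A"
    and cpt: "\<And>X :: nat \<Rightarrow> 'a. (\<And>n. norm (X n) \<le> 1) \<Longrightarrow> \<exists>r l. strict_mono r \<and> (\<lambda>n. A (X (r n))) \<longlonglongrightarrow> l"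
  shows "\<exists>e \<mu>. spectral_system A e \<mu>"
proof -
  define W where "W f j = {x. \<forall>i<j. cinner x (f i) = 0}" for f :: "nat \<Rightarrow> 'a" and j :: nat
  define P where "P f j r \<longleftrightarrow> r \<in> W f j \<and> A r = quad_sup A (W f j) *\<^sub>R r \<and>
      norm r = (if quad_sup A (W f j) > 0 then 1 else 0)" for f j r
  have closedW: "closed (W f j)" for f j
  proof -
    have "closed {x. cinner x (f i) = 0}" for i
      by (intro closed_Collect_eq continuous_intros cinner.continuous_on)
    moreover have "W f j = (\<Inter>i\<in>{..<j}. {x. cinner x (f i) = 0})" by (auto simp: W_def)
    ultimately show ?thesis by auto
  qed
  have addW: "x \<in> W f j \<Longrightarrow> y \<in> W f j \<Longrightarrow> x + y \<in> W f j" for x y f j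
    by (simp add: W_def cinner_add_left)
  have scW: "x \<in> W f j \<Longrightarrow> r *\<^sub>R x \<in> W f j" for x f j r
    by (simp add: W_def cinner.scaleR_left)
  have zW: "0 \<in> W f j" for f j by (simp add: W_def)
  have invW: "A x \<in> W f j" if x: "x \<in> W f j" and f: "\<And>i. i < j \<Longrightarrow> P f i (f i)" for x f j
    unfolding W_def
  proof (intro CollectI allI impI)
    fix i assume i: "i < j"
    have "cinner (A x) (f i) = cinner x (A (f i))" by (rule positive_op_self_adjoint[OF A])
    also have "\<dots> = cinner x (quad_sup A (W f i) *\<^sub>R f i)" using f[OF i] by (simp add: P_def)
    also have "\<dots> = 0" using x i by (simp add: W_def cinner.scaleR_right)
    finally show "cinner (A x) (f i) = 0" .
  qed
  have "\<exists>f. \<forall>j. P f j (f j)"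
  proof (rule dependent_wellorder_choice)
    fix r :: 'a and f g :: "nat \<Rightarrow> 'a" and x :: nat
    assume "\<And>y. y < x \<Longrightarrow> f y = g y"
    then have "W f x = W g x" by (simp add: W_def)
    then show "P f x r = P g x r" by (simp add: P_def)
  next
    fix j f assume f: "\<And>i. i < j \<Longrightarrow> P f i (f i)"
    have "\<exists>e\<in>W f j. A e = quad_sup A (W f j) *\<^sub>R e \<and> norm e = (if quad_sup A (W f j) > 0 then 1 else 0)"
      by (rule max_eigenvector[OF A cpt closedW addW scW zW invW[OF _ f]])
    then show "\<exists>r. P f j r" by (auto simp: P_def)
  qed
  then obtain e where e: "\<And>j. P e j (e j)" by blast
  define \<mu> where "\<mu> j = quad_sup A (W e j)" for j
  have mu0: "0 \<le> \<mu> j" for j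
    unfolding \<mu>_def quad_sup_def
    by (rule cSUP_upper2[OF quad_form_bdd, of 0]) (use zW in auto)
  have dec: "decseq \<mu>"
    unfolding decseq_Suc_iff \<mu>_def quad_sup_def
    by (intro allI cSUP_subset_mono quad_form_bdd) (use zW in \<open>auto simp: W_def intro!: exI[of _ 0]\<close>)
  have eig: "A (e j) = \<mu> j *\<^sub>R e j" and ne: "norm (e j) = (if \<mu> j > 0 then 1 else 0)" for j
    using e[of j] by (auto simp: P_def \<mu>_def)
  have o1: "cinner (e j) (e i) = 0" if "i < j" for i j
    using e[of j] that by (simp add: P_def W_def)
  have orth: "cinner (e i) (e j) = 0" if "i \<noteq> j" for i j
    using o1[of i j] o1[of j i] that cinner_commute[of "e i" "e j"] by (cases "i < j") auto
  obtain L where L: "\<mu> \<longlonglongrightarrow> L" using decseq_convergent[OF dec, of 0] mu0 by blast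
  have Lle: "L \<le> \<mu> j" for j using decseq_ge[OF dec L] .
  have "L \<ge> 0" using LIMSEQ_le_const[OF L] mu0 by blast
  have "L = 0"
  proof (rule ccontr)
    assume "L \<noteq> 0"
    then have Lp: "L > 0" using \<open>L \<ge> 0\<close> by simp
    then have n1: "norm (e j) = 1" for j using ne[of j] Lle[of j] by auto
    obtain r l where r: "strict_mono r" and l: "(\<lambda>n. A (e (r n))) \<longlonglongrightarrow> l"
      using cpt[of e] n1 by auto
    \<comment> \<open>If the eigenvalues stayed above \<open>L > 0\<close>, the images of the
      orthonormal eigenvectors would keep a distance of at least \<open>L\<close> and have no
      convergent subsequence.\<close>
    have d: "L \<le> dist (A (e (r i))) (A (e (r j)))" if "i \<noteq> j" for i j
    proof -
      have ne: "r i \<noteq> r j" using r that by (simp add: strict_mono_eq)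
      have "(norm (A (e (r i)) + (- A (e (r j)))))\<^sup>2 = (norm (A (e (r i))))\<^sup>2 + (norm (- A (e (r j))))\<^sup>2"
        using orth[OF ne] by (intro norm_add_ortho) (simp add: eig cinner.minus_right cinner.scaleR_left cinner.scaleR_right)
      also have "\<dots> \<ge> (\<mu> (r i))\<^sup>2" by (simp add: eig n1)
      also have "(\<mu> (r i))\<^sup>2 \<ge> L\<^sup>2" using Lle[of "r i"] Lp by (intro power_mono) auto
      finally have "L\<^sup>2 \<le> (dist (A (e (r i))) (A (e (r j))))\<^sup>2" by (simp add: dist_norm)
      then show ?thesis by (rule power2_le_imp_le) simp
    qed
    have "Cauchy (\<lambda>n. A (e (r n)))" using l LIMSEQ_imp_Cauchy by blast
    then obtain N where "\<And>i j. i \<ge> N \<Longrightarrow> j \<ge> N \<Longrightarrow> dist (A (e (r i))) (A (e (r j))) < L"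
      unfolding Cauchy_def using Lp by blast
    from this[of N "Suc N"] d[of N "Suc N"] show False by auto
  qed
  \<comment> \<open>Such an \<open>x\<close> lies in every \<open>W e j\<close>, so its quadratic
    form is bounded by each \<open>\<mu> j\<close>, hence is 0; for a positive operator this gives
    \<open>A x = 0\<close>.\<close>
  have "A x = 0" if x: "\<And>j. cinner x (e j) = 0" for x
  proof -
    have "x \<in> W e j" for j using x by (simp add: W_def)
    then have q: "Re (cinner (A x) x) \<le> \<mu> j * (norm x)\<^sup>2" for j
      unfolding \<mu>_def using scW by (intro quad_form_le) auto
    have "(\<lambda>j. \<mu> j * (norm x)\<^sup>2) \<longlonglongrightarrow> 0 * (norm x)\<^sup>2"
      using L \<open>L = 0\<close> by (intro tendsto_intros) auto
    then have "Re (cinner (A x) x) \<le> 0 * (norm x)\<^sup>2" by (rule LIMSEQ_le_const) (use q in auto)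
    then have q0: "Re (cinner (A x) x) \<le> 0" by simp
    have "(norm (A x))\<^sup>2 \<le> (norm A + 1) * Re (cinner (A x) x)"
    proof (rule positive_op_norm2_le[OF A])
      have "Re (cinner (A (A x)) (A x)) \<le> norm (A (A x)) * norm (A x)"
        using complex_Re_le_cmod cmod_cinner_le order_trans by blast
      also have "\<dots> \<le> (norm A * norm (A x)) * norm (A x)"
        by (intro mult_right_mono norm_blinfun) auto
      also have "\<dots> \<le> (norm A + 1) * (norm (A x))\<^sup>2"
        by (simp add: power2_eq_square algebra_simps)
      finally show "Re (cinner (A (A x)) (A x)) \<le> (norm A + 1) * (norm (A x))\<^sup>2" .
    qed (use norm_ge_zero[of A] in linarith)
    also have "\<dots> \<le> 0" using q0 norm_ge_zero[of A] by (intro mult_nonneg_nonpos) auto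
    finally show ?thesis by simp
  qed
  then have "spectral_system A e \<mu>"
    unfolding spectral_system_def using dec L \<open>L = 0\<close> mu0 orth ne eig by blast
  then show ?thesis by blast
qed

lemma spectral_system_ortho_fam: "spectral_system A e \<mu> \<Longrightarrow> ortho_fam e"
  by (simp add: spectral_system_def ortho_fam_def)

lemma spectral_system_bound: "spectral_system A e \<mu> \<Longrightarrow> cmod (complex_of_real (\<mu> k)) \<le> \<mu> 0"
  by (simp add: spectral_system_def decseqD)

lemma spectral_system_finite:
  assumes "spectral_system A e \<mu>" "l > 0"
  shows "finite {k. \<mu> k \<ge> l}"
proof -
  have "\<mu> \<longlonglongrightarrow> 0" using assms by (simp add: spectral_system_def)
  then have "eventually (\<lambda>k. \<mu> k < l) sequentially" using assms(2) by (rule order_tendstoD)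
  then obtain N where "\<And>k. k \<ge> N \<Longrightarrow> \<mu> k < l" by (auto simp: eventually_sequentially)
  then have "{k. \<mu> k \<ge> l} \<subseteq> {..<N}" by (auto simp: not_le) (meson not_le)
  then show ?thesis by (rule finite_subset) simp
qed

text \<open>\<open>?Q\<close> is the orthogonal projection onto the closed span of the
  \<open>e k\<close>. The remainder \<open>x - ?Q x\<close> is orthogonal to all of them and
  therefore killed by \<open>A\<close>. In particular a spectral system determines its
  operator.\<close>

lemma spectral_system_eq_wop:
  fixes A :: "'a::complex_hilbert \<Rightarrow>\<^sub>L 'a"
  assumes cl: "clinear_op A" and s: "spectral_system A e \<mu>"
  shows "A = wop e e (\<lambda>k. complex_of_real (\<mu> k))"
proof (rule blinfun_eqI)
  fix x
  note o = spectral_system_ortho_fam[OF s]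
  have one: "cmod ((\<lambda>_. 1) k) \<le> 1" for k :: nat by simp
  let ?B = "wop e e (\<lambda>k. complex_of_real (\<mu> k))" and ?Q = "wop e e (\<lambda>_. 1)"
  have hs: "((\<lambda>k. (1 * cinner x (e k)) *\<^sub>C e k) has_sum ?Q x) UNIV"
    by (rule wop_has_sum[OF o o one])
  have "cinner (x - ?Q x) (e j) = 0" for j
  proof -
    have "((\<lambda>k. cinner ((1 * cinner x (e k)) *\<^sub>C e k) (e j)) has_sum cinner (?Q x) (e j)) UNIV"
      by (rule has_sum_bounded_linear[OF cinner.bounded_linear_left hs])
    moreover have "((\<lambda>k. cinner ((1 * cinner x (e k)) *\<^sub>C e k) (e j)) has_sum cinner x (e j)) UNIV"
    proof -
      have "((\<lambda>k. cinner ((1 * cinner x (e k)) *\<^sub>C e k) (e j)) has_sum cinner x (e j)) {j}"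
      proof (intro has_sum_finiteI)
        show "cinner x (e j) = (\<Sum>k\<in>{j}. cinner ((1 * cinner x (e k)) *\<^sub>C e k) (e j))"
        proof (cases "\<mu> j > 0")
          case True
          then have "norm (e j) = 1" using s by (simp add: spectral_system_def)
          then show ?thesis by (simp add: cinner_scaleC_left cinner_self)
        next
          case False
          then have "norm (e j) = 0" using s by (simp add: spectral_system_def)
          then show ?thesis by simp
        qed
      qed simp
      then show ?thesis
        by (rule has_sum_cong_neutral[THEN iffD1, rotated -1])
          (use o in \<open>auto simp: ortho_fam_def cinner_scaleC_left\<close>)
    qed
    ultimately have "cinner (?Q x) (e j) = cinner x (e j)" by (rule has_sum_unique)
    then show ?thesis by (simp add: cinner.diff_left)
  qed
  then have "A (x - ?Q x) = 0" using s by (simp add: spectral_system_def)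
  then have "A x = A (?Q x)" by (simp add: blinfun.diff_right)
  moreover have "((\<lambda>k. A ((1 * cinner x (e k)) *\<^sub>C e k)) has_sum A (?Q x)) UNIV"
    by (rule has_sum_bounded_linear[OF blinfun.bounded_linear_right hs])
  moreover have "A (c *\<^sub>C e k) = (complex_of_real (\<mu> k) * c) *\<^sub>C e k" for c k
    using s by (simp add: spectral_system_def clinear_opD[OF cl] scaleR_eq_scaleC scaleC_scaleC mult.commute)
  ultimately have "((\<lambda>k. (complex_of_real (\<mu> k) * cinner x (e k)) *\<^sub>C e k) has_sum A x) UNIV"
    by simp
  moreover have "((\<lambda>k. (complex_of_real (\<mu> k) * cinner x (e k)) *\<^sub>C e k) has_sum ?B x) UNIV"
    by (rule wop_has_sum[OF o o spectral_system_bound[OF s]])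
  ultimately show "A x = ?B x" by (rule has_sum_unique)
qed

subsection \<open>Singular values\<close>

text \<open>An eigenvector for \<open>l\<close> is orthogonal to every \<open>e j\<close> with
  \<open>\<mu> j \<noteq> l\<close>. Subtracting its projection \<open>p\<close> leaves an
  eigenvector orthogonal to all \<open>e j\<close>; \<open>A\<close> kills it, and as
  \<open>l\<close> is nonzero it must vanish.\<close>

lemma eigenspace_spectral_system:
  fixes A :: "'a::complex_inner \<Rightarrow>\<^sub>L 'a"
  assumes A: "positive_op A" and s: "spectral_system A e \<mu>" and l: "l > 0"
  shows "{x. A x = l *\<^sub>R x} = complex_vs.span (e ` {k. \<mu> k = l})"
proof -
  have cl: "clinear_op A" using A by (simp add: positive_op_def)
  let ?K = "{k. \<mu> k = l}"
  have fin: "finite ?K" by (rule finite_subset[OF _ spectral_system_finite[OF s l]]) auto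
  have "complex_vs.subspace {x. A x = l *\<^sub>R x}"
    by (auto simp: complex_vs.subspace_def blinfun.add_right scaleR_add_right clinear_opD[OF cl]
        scaleR_eq_scaleC scaleC_scaleC mult.commute scaleC_add_right)
  moreover have "e ` ?K \<subseteq> {x. A x = l *\<^sub>R x}" using s by (auto simp: spectral_system_def)
  ultimately have sub: "complex_vs.span (e ` ?K) \<subseteq> {x. A x = l *\<^sub>R x}"
    by (intro complex_vs.span_minimal)
  moreover have "{x. A x = l *\<^sub>R x} \<subseteq> complex_vs.span (e ` ?K)"
  proof
    fix x assume "x \<in> {x. A x = l *\<^sub>R x}"
    then have Ax: "A x = l *\<^sub>R x" by simp
    define p where "p = (\<Sum>k\<in>?K. cinner x (e k) *\<^sub>C e k)"
    have pspan: "p \<in> complex_vs.span (e ` ?K)"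
      unfolding p_def by (intro complex_vs.span_sum complex_vs.span_scale complex_vs.span_base) auto
    then have "p \<in> {x. A x = l *\<^sub>R x}"
      using sub by blast
    then have Ap: "A (x - p) = l *\<^sub>R (x - p)" using Ax by (simp add: blinfun.diff_right scaleR_diff_right)
    have "cinner (x - p) (e j) = 0" for j
    proof (cases "\<mu> j = l")
      case True
      have "cinner p (e j) = (\<Sum>k\<in>?K. if k = j then cinner x (e j) else 0)"
        unfolding p_def cinner.sum_left using s True l
        by (intro sum.cong refl) (auto simp: cinner_scaleC_left spectral_system_def cinner_self)
      then show ?thesis using fin True by (simp add: cinner.diff_left)
    next
      case False
      have "complex_of_real l * cinner x (e j) = cinner (A x) (e j)"
        by (simp add: Ax cinner.scaleR_left scaleR_conv_of_real)
      also have "\<dots> = cinner x (A (e j))" by (rule positive_op_self_adjoint[OF A])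
      also have "\<dots> = complex_of_real (\<mu> j) * cinner x (e j)"
        using s by (simp add: spectral_system_def cinner.scaleR_right scaleR_conv_of_real)
      finally have "cinner x (e j) = 0" using False by simp
      moreover have "cinner (e k) (e j) = 0" if "k \<in> ?K" for k
      proof -
        have "k \<noteq> j" using that False by auto
        then show ?thesis using s by (simp add: spectral_system_def)
      qed
      then have "cinner p (e j) = 0"
        by (simp add: p_def cinner.sum_left cinner_scaleC_left)
      ultimately show ?thesis by (simp add: cinner.diff_left)
    qed
    then have "A (x - p) = 0" using s by (simp add: spectral_system_def)
    then have "x = p" using Ap l by simp
    then show "x \<in> complex_vs.span (e ` ?K)" using pspan by simp
  qed
  ultimately show ?thesis using sub by blast
qed

lemma eigenvalue_seq_spectral_system:
  fixes A :: "'a::complex_inner \<Rightarrow>\<^sub>L 'a"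
  assumes A: "positive_op A" and s: "spectral_system A e \<mu>"
  shows "eigenvalue_seq A \<mu>"
proof -
  have "finite {k. \<mu> k = l} \<and> card {k. \<mu> k = l} = complex_vs.dim {x. A x = l *\<^sub>R x}" if l: "l > 0" for l
  proof -
    let ?K = "{k. \<mu> k = l}"
    have fin: "finite ?K" by (rule finite_subset[OF _ spectral_system_finite[OF s l]]) auto
    have n1: "norm (e k) = 1" if "k \<in> ?K" for k using s l that by (simp add: spectral_system_def)
    have orth: "cinner (e i) (e k) = 0" if "i \<noteq> k" for i k using s that by (simp add: spectral_system_def)
    have inj: "inj_on e ?K"
    proof (rule inj_onI, rule ccontr)
      fix i j assume ij: "i \<in> ?K" "e i = e j" "i \<noteq> j"
      then have "cinner (e i) (e i) = 0" using orth[of i j] by simp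
      then show False using n1[OF ij(1)] by (simp add: cinner_self)
    qed
    have ind: "\<not> complex_vs.dependent (e ` ?K)"
    proof (rule complex_vs.independent_if_scalars_zero)
      fix f x assume z: "(\<Sum>x\<in>e ` ?K. f x *\<^sub>C x) = 0" and "x \<in> e ` ?K"
      then obtain j where j: "j \<in> ?K" "x = e j" by auto
      have "0 = cinner (\<Sum>k\<in>?K. f (e k) *\<^sub>C e k) (e j)"
        using z by (simp add: sum.reindex[OF inj])
      also have "\<dots> = (\<Sum>k\<in>?K. if k = j then f (e j) else 0)"
        unfolding cinner.sum_left using orth n1 j
        by (intro sum.cong refl) (auto simp: cinner_scaleC_left cinner_self)
      finally show "f x = 0" using j fin by simp
    qed (use fin in simp)
    have "complex_vs.dim {x. A x = l *\<^sub>R x} = card (e ` ?K)"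
      by (rule complex_vs.dim_eq_card[OF _ ind])
        (simp add: eigenspace_spectral_system[OF A s l] complex_vs.span_span)
    then show ?thesis using fin by (simp add: card_image[OF inj])
  qed
  then show ?thesis using s by (simp add: eigenvalue_seq_def spectral_system_def)
qed

lemma downset_eq_lessThan:
  fixes S :: "nat set"
  assumes "finite S" "\<And>i k. k \<in> S \<Longrightarrow> i \<le> k \<Longrightarrow> i \<in> S"
  shows "S = {..<card S}"
proof (cases "S = {}")
  case False
  have "S = {..Max S}" using assms(1) False by (auto intro: assms(2)[OF Max_in])
  then show ?thesis by (metis card_atMost lessThan_Suc_atMost)
qed simp

text \<open>Cardinalities of level sets add up to those of superlevel sets, and a finite superlevel
  set of a decreasing sequence is an initial segment, hence determined by its cardinality.\<close>

lemma decseq_eqI_level_card: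
  fixes \<mu> \<nu> :: "nat \<Rightarrow> real"
  assumes dec: "decseq \<mu>" "decseq \<nu>" and nn: "\<And>k. 0 \<le> \<mu> k" "\<And>k. 0 \<le> \<nu> k"
    and fin: "\<And>l. l > 0 \<Longrightarrow> finite {k. \<mu> k \<ge> l}"
    and eq: "\<And>l. l > 0 \<Longrightarrow> finite {k. \<nu> k = l} \<and> card {k. \<nu> k = l} = card {k. \<mu> k = l}"
  shows "\<nu> = \<mu>"
proof -
  have lev: "{k. \<nu> k \<ge> l} = {k. \<mu> k \<ge> l}" if l: "l > 0" for l
  proof -
    \<comment> \<open>These are the finitely many values of \<open>\<mu>\<close> that are at least
      \<open>l\<close>. A value of \<open>\<nu>\<close> above \<open>l\<close> is attained by
      \<open>\<mu>\<close> as well, since its level set has the same positive cardinality.\<close>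
    define R where "R = \<mu> ` {k. \<mu> k \<ge> l}"
    have finR: "finite R" using fin[OF l] by (simp add: R_def)
    have fm: "finite {k. \<mu> k = v}" if "v > 0" for v
      by (rule finite_subset[OF _ fin[OF that]]) auto
    have Rl: "v \<ge> l" if "v \<in> R" for v using that by (auto simp: R_def)
    have mu_eq: "{k. \<mu> k \<ge> l} = (\<Union>v\<in>R. {k. \<mu> k = v})" by (auto simp: R_def)
    have nu_eq: "{k. \<nu> k \<ge> l} = (\<Union>v\<in>R. {k. \<nu> k = v})"
    proof -
      have "\<nu> k \<in> R" if k: "\<nu> k \<ge> l" for k
      proof -
        have pos: "\<nu> k > 0" using k l by simp
        have "card {i. \<nu> i = \<nu> k} > 0" using conjunct1[OF eq[OF pos]] by (metis (mono_tags, lifting) card_gt_0_iff empty_iff mem_Collect_eq)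
        then have "{i. \<mu> i = \<nu> k} \<noteq> {}" using eq[OF pos] by (metis card.empty less_irrefl)
        then show ?thesis using k unfolding R_def by (metis (mono_tags, lifting) Collect_empty_eq image_eqI mem_Collect_eq)
      qed
      then show ?thesis using Rl by auto
    qed
    have "card {k. \<nu> k \<ge> l} = (\<Sum>v\<in>R. card {k. \<nu> k = v})"
      unfolding nu_eq using finR eq Rl l by (intro card_UN_disjoint) force+
    also have "\<dots> = (\<Sum>v\<in>R. card {k. \<mu> k = v})"
      using eq Rl l by (intro sum.cong refl) force
    also have "\<dots> = card {k. \<mu> k \<ge> l}"
      unfolding mu_eq using finR fm Rl l by (intro card_UN_disjoint[symmetric]) force+
    finally have c: "card {k. \<nu> k \<ge> l} = card {k. \<mu> k \<ge> l}" .
    have fnu: "finite {k. \<nu> k \<ge> l}" unfolding nu_eq using finR eq Rl l by force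
    have "{k. \<nu> k \<ge> l} = {..<card {k. \<nu> k \<ge> l}}"
      using dec(2) by (intro downset_eq_lessThan fnu) (auto dest: decseqD intro: order_trans)
    moreover have "{k. \<mu> k \<ge> l} = {..<card {k. \<mu> k \<ge> l}}"
      using dec(1) by (intro downset_eq_lessThan fin l) (auto dest: decseqD intro: order_trans)
    ultimately show ?thesis using c by simp
  qed
  show ?thesis
  proof
    fix k
    have "\<nu> k \<le> \<mu> k"
      using lev[of "\<nu> k"] nn[of k] by (cases "\<nu> k = 0") auto
    moreover have "\<mu> k \<le> \<nu> k"
      using lev[of "\<mu> k"] nn[of k] by (cases "\<mu> k = 0") auto
    ultimately show "\<nu> k = \<mu> k" by simp
  qed
qed

lemma eigenvalue_seq_unique:
  assumes A: "positive_op A" and s: "spectral_system A e \<mu>" and n: "eigenvalue_seq A \<nu>"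
  shows "\<nu> = \<mu>"
proof (rule decseq_eqI_level_card)
  show "decseq \<mu>" "\<And>k. 0 \<le> \<mu> k" using s by (auto simp: spectral_system_def)
  show "decseq \<nu>" "\<And>k. 0 \<le> \<nu> k" using n by (auto simp: eigenvalue_seq_def)
  show "\<And>l. l > 0 \<Longrightarrow> finite {k. \<mu> k \<ge> l}" by (rule spectral_system_finite[OF s])
  show "\<And>l. l > 0 \<Longrightarrow> finite {k. \<nu> k = l} \<and> card {k. \<nu> k = l} = card {k. \<mu> k = l}"
    using n eigenvalue_seq_spectral_system[OF A s] by (simp add: eigenvalue_seq_def)
qed

section \<open>Positive square roots and singular values of compact operators\<close>

lemma spectral_system_sqrt:
  fixes A :: "'a::complex_hilbert \<Rightarrow>\<^sub>L 'a"
  assumes A: "positive_op A" and s: "spectral_system A e \<mu>"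
  defines "S \<equiv> wop e e (\<lambda>k. complex_of_real (sqrt (\<mu> k)))"
  shows "positive_op S" "S o\<^sub>L S = A" "spectral_system S e (\<lambda>k. sqrt (\<mu> k))"
proof -
  note o = spectral_system_ortho_fam[OF s]
  have mu: "0 \<le> \<mu> k" "\<mu> k \<le> \<mu> 0" for k using s by (auto simp: spectral_system_def decseqD)
  have bd: "cmod (complex_of_real (sqrt (\<mu> k))) \<le> sqrt (\<mu> 0)" for k using mu by simp
  show pos: "positive_op S"
    unfolding S_def by (rule positive_wop[OF o, where K = "sqrt (\<mu> 0)"]) (use mu in \<open>auto simp: real_sqrt_le_mono\<close>)
  have Se: "S (e j) = sqrt (\<mu> j) *\<^sub>R e j" for j
    unfolding S_def wop_apply_fam[OF o o bd] using s
    using mu(1)[of j] by (cases "\<mu> j = 0") (auto simp: spectral_system_def scaleR_eq_scaleC less_le)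
  have S0: "S x = 0" if "\<And>j. cinner x (e j) = 0" for x
    unfolding S_def by (rule wop_apply_0[OF o o bd that])
  have "(\<lambda>k. sqrt (\<mu> k)) \<longlonglongrightarrow> sqrt 0"
    using s by (intro tendsto_real_sqrt) (simp add: spectral_system_def)
  then show "spectral_system S e (\<lambda>k. sqrt (\<mu> k))"
    using s Se S0 by (simp add: spectral_system_def decseq_def)
  have "spectral_system (S o\<^sub>L S) e \<mu>"
    using s Se S0 mu by (simp add: spectral_system_def blinfun.scaleR_right)
  moreover have "clinear_op A" "clinear_op (S o\<^sub>L S)"
    using A pos by (auto simp: positive_op_def intro: clinear_op_compose)
  ultimately show "S o\<^sub>L S = A" using spectral_system_eq_wop s by metis
qed

text \<open>The vector \<open>y = S x - m *\<^sub>R x\<close> satisfies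
  \<open>S y = - m *\<^sub>R y\<close>, and positivity excludes a negative eigenvalue unless
  \<open>y = 0\<close>.\<close>

lemma positive_sqrt_eigen:
  assumes S: "positive_op S" and e: "S (S x) = (m\<^sup>2) *\<^sub>R x" and m: "m > 0"
  shows "S x = m *\<^sub>R x"
proof -
  define y where "y = S x - m *\<^sub>R x"
  have "S y = - m *\<^sub>R y"
    by (simp add: y_def blinfun.diff_right blinfun.scaleR_right e power2_eq_square scaleR_diff_right)
  then have "Re (cinner (S y) y) = - m * (norm y)\<^sup>2"
    by (simp add: cinner.scaleR_left cinner.minus_left cinner_self)
  moreover have "0 \<le> Re (cinner (S y) y)" using S by (simp add: positive_op_def)
  ultimately have "(norm y)\<^sup>2 \<le> 0" using m by (simp add: mult_le_0_iff)
  then show ?thesis by (simp add: y_def)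
qed

text \<open>Every positive root has the same spectral system and so, by
  \<open>spectral_system_eq_wop\<close>, is the same operator. This settles the uniqueness in
  \<open>abs_op\<close>.\<close>

lemma positive_sqrt_unique:
  fixes A :: "'a::complex_hilbert \<Rightarrow>\<^sub>L 'a"
  assumes A: "positive_op A" and s: "spectral_system A e \<mu>"
    and S: "positive_op S" "S o\<^sub>L S = A"
  shows "spectral_system S e (\<lambda>k. sqrt (\<mu> k))"
proof -
  have mu: "0 \<le> \<mu> k" for k using s by (auto simp: spectral_system_def)
  have SS: "S (S x) = A x" for x using S(2) by (metis blinfun_apply_blinfun_compose)
  have S0: "S x = 0" if "A x = 0" for x
  proof -
    have "cinner (S x) (S x) = cinner (S (S x)) x"
      by (rule positive_op_self_adjoint[OF S(1), symmetric])
    then show ?thesis by (simp add: SS that cinner_self)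
  qed
  have "S (e j) = sqrt (\<mu> j) *\<^sub>R e j" for j
  proof (cases "\<mu> j > 0")
    case True
    show ?thesis
      by (rule positive_sqrt_eigen[OF S(1)]) (use s True in \<open>auto simp: SS spectral_system_def\<close>)
  next
    case False
    then have "norm (e j) = 0" using s by (simp add: spectral_system_def)
    then show ?thesis by simp
  qed
  moreover have "(\<lambda>k. sqrt (\<mu> k)) \<longlonglongrightarrow> sqrt 0"
    using s by (intro tendsto_real_sqrt) (simp add: spectral_system_def)
  ultimately show ?thesis using s S0 by (simp add: spectral_system_def decseq_def)
qed

lemma abs_op_spectral:
  fixes T :: "'a::complex_hilbert \<Rightarrow>\<^sub>L 'a"
  assumes A: "positive_op (adjoint_op T o\<^sub>L T)" and s: "spectral_system (adjoint_op T o\<^sub>L T) e \<mu>"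
  shows "abs_op T = wop e e (\<lambda>k. complex_of_real (sqrt (\<mu> k)))"
  unfolding abs_op_def
proof (rule the_equality)
  show "positive_op (wop e e (\<lambda>k. complex_of_real (sqrt (\<mu> k)))) \<and>
    wop e e (\<lambda>k. complex_of_real (sqrt (\<mu> k))) o\<^sub>L wop e e (\<lambda>k. complex_of_real (sqrt (\<mu> k))) = adjoint_op T o\<^sub>L T"
    using spectral_system_sqrt[OF A s] by simp
  fix S assume S: "positive_op S \<and> S o\<^sub>L S = adjoint_op T o\<^sub>L T"
  then show "S = wop e e (\<lambda>k. complex_of_real (sqrt (\<mu> k)))"
    using positive_sqrt_unique[OF A s] spectral_system_eq_wop by (metis positive_op_def)
qed

lemma singular_value_spectral:
  fixes T :: "'a::complex_hilbert \<Rightarrow>\<^sub>L 'a"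
  assumes A: "positive_op (adjoint_op T o\<^sub>L T)" and s: "spectral_system (adjoint_op T o\<^sub>L T) e \<mu>"
  shows "singular_value T = (\<lambda>k. sqrt (\<mu> k))"
  unfolding singular_value_def abs_op_spectral[OF A s]
  by (rule the_equality) (use eigenvalue_seq_unique eigenvalue_seq_spectral_system spectral_system_sqrt[OF A s] in blast)+

lemma singular_value_positive_eq:
  fixes T :: "'a::complex_hilbert \<Rightarrow>\<^sub>L 'a"
  assumes T: "positive_op T" and s: "spectral_system T e a"
  shows "singular_value T = a"
proof -
  have cl: "clinear_op T" using T by (simp add: positive_op_def)
  have adj: "adjoint_op T = T"
    by (rule adjoint_op_eqI) (rule positive_op_self_adjoint[OF T])
  have A: "positive_op (adjoint_op T o\<^sub>L T)"
    using positive_op_self_adjoint[OF T] cl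
    by (simp add: adj positive_op_def clinear_op_compose cinner_self)
  have a: "0 \<le> a k" for k using s by (simp add: spectral_system_def)
  have "(\<lambda>k. (a k)\<^sup>2) \<longlonglongrightarrow> 0\<^sup>2" using s by (intro tendsto_intros) (simp add: spectral_system_def)
  then have "spectral_system (adjoint_op T o\<^sub>L T) e (\<lambda>k. (a k)\<^sup>2)"
    using s by (auto simp: adj spectral_system_def decseq_def blinfun.scaleR_right power2_eq_square
        less_le intro!: mult_mono)
  from singular_value_spectral[OF A this] show ?thesis using a by simp
qed

lemma compact_op_subseq:
  fixes T :: "'a::complex_inner \<Rightarrow>\<^sub>L 'a" and X :: "nat \<Rightarrow> 'a"
  assumes T: "compact_op T" and X: "\<And>n. norm (X n) \<le> 1"
  shows "\<exists>r l. strict_mono r \<and> (\<lambda>n. T (X (r n))) \<longlonglongrightarrow> l"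
proof -
  have "seq_compact (closure (blinfun_apply T ` cball 0 1))"
    using T by (simp add: compact_op_def compact_eq_seq_compact_metric)
  moreover have "\<forall>n. T (X n) \<in> closure (blinfun_apply T ` cball 0 1)"
    using X by (intro allI closure_subset[THEN subsetD] imageI) simp
  ultimately obtain l r where "strict_mono r" "((\<lambda>n. T (X n)) \<circ> r) \<longlonglongrightarrow> l"
    unfolding seq_compact_def by metis
  then show ?thesis by (auto simp: o_def)
qed

lemma compact_op_spectral:
  fixes T :: "'a::complex_hilbert \<Rightarrow>\<^sub>L 'a"
  assumes T: "compact_op T"
  shows "positive_op (adjoint_op T o\<^sub>L T)" "\<exists>e \<mu>. spectral_system (adjoint_op T o\<^sub>L T) e \<mu>"
proof -
  have cl: "clinear_op T" using T by (simp add: compact_op_def)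
  have "cinner (adjoint_op T (T x)) x = cinner (T x) (T x)" for x
    using cinner_adjoint_op[OF cl, of x "T x"] cinner_commute by (metis complex_cnj_cnj)
  then show A: "positive_op (adjoint_op T o\<^sub>L T)"
    using cl by (simp add: positive_op_def clinear_op_compose clinear_adjoint_op cinner_self)
  show "\<exists>e \<mu>. spectral_system (adjoint_op T o\<^sub>L T) e \<mu>"
  proof (rule spectral_system_exists[OF A])
    fix X :: "nat \<Rightarrow> 'a" assume "\<And>n. norm (X n) \<le> 1"
    then obtain r l where "strict_mono r" "(\<lambda>n. T (X (r n))) \<longlonglongrightarrow> l"
      using compact_op_subseq[OF T] by blast
    then show "\<exists>r l. strict_mono r \<and> (\<lambda>n. (adjoint_op T o\<^sub>L T) (X (r n))) \<longlonglongrightarrow> l"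
      using blinfun.tendsto[OF tendsto_const] by fastforce
  qed
qed

text \<open>These are \<open>j\<close> homogeneous equations in \<open>j + 1\<close> unknowns. The
  orthonormal vectors \<open>e i\<close> span a space of dimension \<open>j\<close>, in which the
  \<open>j + 1\<close> vectors \<open>v m\<close>, with coordinates \<open>M m i\<close>, must be
  dependent.\<close>

lemma nontrivial_solution:
  fixes e :: "nat \<Rightarrow> 'a::complex_inner" and M :: "nat \<Rightarrow> nat \<Rightarrow> complex"
  assumes n1: "\<And>i. i < j \<Longrightarrow> norm (e i) = 1" and orth: "\<And>i k. i \<noteq> k \<Longrightarrow> cinner (e i) (e k) = 0"
  shows "\<exists>c. (\<exists>m\<le>j. c m \<noteq> 0) \<and> (\<forall>i<j. (\<Sum>m\<le>j. c m * M m i) = 0)"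
proof -
  define v where "v m = (\<Sum>i<j. M m i *\<^sub>C e i)" for m
  have "\<exists>c. (\<exists>m\<le>j. c m \<noteq> 0) \<and> (\<Sum>m\<le>j. c m *\<^sub>C v m) = 0"
  proof (cases "inj_on v {..j}")
    case inj: True
    have "v ` {..j} \<subseteq> complex_vs.span (e ` {..<j})"
      unfolding v_def
      by (intro image_subsetI complex_vs.span_sum complex_vs.span_scale complex_vs.span_base) auto
    moreover have "card (e ` {..<j}) < card (v ` {..j})"
      using card_image_le[of "{..<j}" e] by (simp add: card_image[OF inj])
    ultimately have "complex_vs.dependent (v ` {..j})"
      using complex_vs.independent_span_bound[of "e ` {..<j}" "v ` {..j}"] by auto
    then obtain u where u: "\<exists>x\<in>v ` {..j}. u x \<noteq> 0" "(\<Sum>x\<in>v ` {..j}. u x *\<^sub>C x) = 0"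
      using complex_vs.dependent_finite[of "v ` {..j}"] by auto
    then show ?thesis
      by (intro exI[of _ "\<lambda>m. u (v m)"]) (auto simp: sum.reindex[OF inj])
  next
    case False
    \<comment> \<open>A repeated vector disappears when the \<open>v m\<close> are collected into a
      set, which could then be independent; the difference of the two equal vectors is the relation
      in this case.\<close>
    then obtain a b where ab: "a \<le> j" "b \<le> j" "a \<noteq> b" "v a = v b" by (auto simp: inj_on_def)
    let ?c = "\<lambda>m. if m = a then 1 else if m = b then - 1 else (0 :: complex)"
    have "(\<Sum>m\<le>j. ?c m *\<^sub>C v m) = (\<Sum>m\<le>j. (if m = a then v a else 0) - (if m = b then v b else 0))"
      using ab by (intro sum.cong refl) (auto simp: scaleC_one)
    also have "\<dots> = 0" using ab by (simp add: sum_subtractf)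
    finally show ?thesis using ab by (intro exI[of _ ?c]) auto
  qed
  then obtain c where c: "\<exists>m\<le>j. c m \<noteq> 0" "(\<Sum>m\<le>j. c m *\<^sub>C v m) = 0" by blast
  have "(\<Sum>m\<le>j. c m * M m i) = 0" if i: "i < j" for i
  proof -
    have "cinner (v m) (e i) = (\<Sum>k<j. if k = i then M m i else 0)" for m
      unfolding v_def cinner.sum_left using n1 orth i
      by (intro sum.cong refl) (auto simp: cinner_scaleC_left cinner_self)
    then have vm: "cinner (v m) (e i) = M m i" for m using i by simp
    have "0 = cinner (\<Sum>m\<le>j. c m *\<^sub>C v m) (e i)" by (simp add: c)
    also have "\<dots> = (\<Sum>m\<le>j. c m * M m i)" by (simp add: cinner.sum_left cinner_scaleC_left vm)
    finally show ?thesis by simp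
  qed
  then show ?thesis using c(1) by blast
qed

text \<open>Half of the min-max principle: some nonzero \<open>x\<close> in the span of the first
  \<open>j + 1\<close> eigenvectors is orthogonal to the \<open>j\<close> vectors
  \<open>f i\<close>, and on that span \<open>(norm (T x))^2\<close> is at least
  \<open>\<mu> j * (norm x)^2\<close>.\<close>

lemma singular_value_le:
  fixes T :: "'a::complex_hilbert \<Rightarrow>\<^sub>L 'a"
  assumes T: "compact_op T" and K: "K \<ge> 0"
    and le: "\<And>x. (\<And>i. i < j \<Longrightarrow> cinner x (f i) = 0) \<Longrightarrow> norm (T x) \<le> K * norm x"
  shows "singular_value T j \<le> K"
proof -
  let ?A = "adjoint_op T o\<^sub>L T"
  note A = compact_op_spectral(1)[OF T]
  have cl: "clinear_op T" using T by (simp add: compact_op_def)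
  obtain e \<mu> where s: "spectral_system ?A e \<mu>" using compact_op_spectral(2)[OF T] by blast
  have sv: "singular_value T j = sqrt (\<mu> j)" by (simp add: singular_value_spectral[OF A s])
  show ?thesis
  proof (cases "\<mu> j > 0")
    case False
    then have "\<mu> j = 0" using s by (simp add: spectral_system_def less_le)
    then show ?thesis using K sv by simp
  next
    case True
    have mu: "\<mu> i > 0" "\<mu> j \<le> \<mu> i" if "i \<le> j" for i
    proof -
      show "\<mu> j \<le> \<mu> i" using s that by (simp add: spectral_system_def decseqD)
      then show "\<mu> i > 0" using True by simp
    qed
    have n1: "norm (e i) = 1" if "i \<le> j" for i using s mu that by (simp add: spectral_system_def)
    have orth: "cinner (e i) (e k) = 0" if "i \<noteq> k" for i k using s that by (simp add: spectral_system_def)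
    obtain c where c: "\<exists>m\<le>j. c m \<noteq> 0" "\<And>i. i < j \<Longrightarrow> (\<Sum>m\<le>j. c m * cinner (e m) (f i)) = 0"
      using nontrivial_solution[of j e "\<lambda>m i. cinner (e m) (f i)"] n1 orth by auto
    define x where "x = (\<Sum>m\<le>j. c m *\<^sub>C e m)"
    have "cinner x (f i) = 0" if "i < j" for i
      using c(2)[OF that] by (simp add: x_def cinner.sum_left cinner_scaleC_left)
    then have Tx: "norm (T x) \<le> K * norm x" by (rule le)
    have nx: "(norm x)\<^sup>2 = (\<Sum>m\<le>j. (cmod (c m))\<^sup>2)"
      unfolding x_def using n1 by (subst norm2_sum_ortho) (auto simp: orth)
    have x0: "(norm x)\<^sup>2 > 0" using c(1) unfolding nx by (auto intro!: sum_pos2)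
    have clA: "clinear_op ?A" using A by (simp add: positive_op_def)
    have Ax: "?A x = (\<Sum>m\<le>j. (complex_of_real (\<mu> m) * c m) *\<^sub>C e m)"
      unfolding x_def blinfun.sum_right clinear_opD[OF clA] using s
      by (intro sum.cong refl) (simp add: spectral_system_def scaleR_eq_scaleC scaleC_scaleC mult.commute)
    have "complex_of_real ((norm (T x))\<^sup>2) = cinner (T x) (T x)" by (rule cinner_self[symmetric])
    also have "\<dots> = cinner x (?A x)" by (simp add: cinner_adjoint_op[OF cl])
    also have "\<dots> = (\<Sum>m\<le>j. c m * cnj (complex_of_real (\<mu> m) * c m) * complex_of_real ((norm (e m))\<^sup>2))"
      unfolding Ax unfolding x_def by (rule cinner_sum_ortho) (auto simp: orth)
    also have "\<dots> = complex_of_real (\<Sum>m\<le>j. \<mu> m * (cmod (c m))\<^sup>2)"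
      unfolding of_real_sum of_real_mult complex_norm_square
      by (intro sum.cong refl) (simp add: n1 mult_ac)
    finally have "(norm (T x))\<^sup>2 = (\<Sum>m\<le>j. \<mu> m * (cmod (c m))\<^sup>2)" by (simp only: of_real_eq_iff)
    moreover have "\<mu> j * (norm x)\<^sup>2 \<le> (\<Sum>m\<le>j. \<mu> m * (cmod (c m))\<^sup>2)"
      unfolding nx sum_distrib_left using mu by (intro sum_mono mult_right_mono) auto
    moreover have "(norm (T x))\<^sup>2 \<le> (K * norm x)\<^sup>2" using Tx by (intro power_mono) auto
    ultimately have "\<mu> j * (norm x)\<^sup>2 \<le> K\<^sup>2 * (norm x)\<^sup>2" by (simp add: power_mult_distrib)
    then have "\<mu> j \<le> K\<^sup>2" using x0 by simp
    then show ?thesis using K sv real_le_lsqrt by simp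
  qed
qed

subsection \<open>Orthonormal bases and weighted shift operators\<close>

definition onb :: "('i \<Rightarrow> 'a::complex_inner) \<Rightarrow> bool" where
  "onb e \<longleftrightarrow> (\<forall>i j. cinner (e i) (e j) = (if i = j then 1 else 0)) \<and>
     (\<forall>x. (\<forall>k. cinner x (e k) = 0) \<longrightarrow> x = 0)"

lemma onb_norm: "onb e \<Longrightarrow> norm (e i) = 1"
proof -
  assume "onb e"
  then have "complex_of_real ((norm (e i))\<^sup>2) = 1" by (simp only: cinner_self[symmetric]) (simp add: onb_def)
  then have "(norm (e i))\<^sup>2 = 1" by (simp only: of_real_eq_1_iff)
  then show ?thesis by (simp add: power2_eq_1_iff) (metis norm_ge_zero not_one_le_zero neg_0_le_iff_le)
qed

lemma onb_ortho_fam: "onb e \<Longrightarrow> ortho_fam e"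
  by (simp add: ortho_fam_def onb_norm) (simp add: onb_def)

lemma ortho_fam_inj: "ortho_fam e \<Longrightarrow> inj \<pi> \<Longrightarrow> ortho_fam (\<lambda>k. e (\<pi> k))"
  by (simp add: ortho_fam_def inj_eq)

lemma onb_bij:
  assumes "onb e" "bij b" shows "onb (\<lambda>k. e (b k))"
  unfolding onb_def
proof (intro conjI allI impI)
  show "cinner (e (b i)) (e (b j)) = (if i = j then 1 else 0)" for i j
    using assms by (simp add: onb_def bij_is_inj inj_eq)
  fix x assume x: "\<forall>k. cinner x (e (b k)) = 0"
  have "cinner x (e k) = 0" for k using x[rule_format, of "inv b k"] bij_is_surj[OF assms(2)] by (simp add: surj_f_inv_f)
  then show "x = 0" using assms(1) by (simp add: onb_def)
qed

lemma wop_apply_onb: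
  assumes e: "onb e" and g: "ortho_fam g" and c: "\<And>k. cmod (c k) \<le> K"
  shows "wop e g c (e j) = c j *\<^sub>C g j"
  using wop_apply_fam[OF onb_ortho_fam[OF e] g c] by (simp add: onb_norm[OF e])

lemma onb_expand:
  fixes e :: "'i \<Rightarrow> 'a::complex_hilbert"
  assumes e: "onb e"
  shows "((\<lambda>k. cinner x (e k) *\<^sub>C e k) has_sum x) UNIV"
proof -
  note o = onb_ortho_fam[OF e]
  have one: "cmod ((\<lambda>_. 1) k) \<le> 1" for k :: 'i by simp
  let ?Q = "wop e e (\<lambda>_. 1)"
  have hs: "((\<lambda>k. (1 * cinner x (e k)) *\<^sub>C e k) has_sum ?Q x) UNIV"
    by (rule wop_has_sum[OF o o one])
  have "cinner (x - ?Q x) (e j) = 0" for j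
  proof -
    have "((\<lambda>k. cinner ((1 * cinner x (e k)) *\<^sub>C e k) (e j)) has_sum cinner (?Q x) (e j)) UNIV"
      by (rule has_sum_bounded_linear[OF cinner.bounded_linear_left hs])
    moreover have "((\<lambda>k. cinner ((1 * cinner x (e k)) *\<^sub>C e k) (e j)) has_sum cinner x (e j)) UNIV"
    proof -
      have "((\<lambda>k. cinner ((1 * cinner x (e k)) *\<^sub>C e k) (e j)) has_sum cinner x (e j)) {j}"
        using e by (intro has_sum_finiteI) (auto simp: cinner_scaleC_left onb_def)
      then show ?thesis
        by (rule has_sum_cong_neutral[THEN iffD1, rotated -1])
          (use e in \<open>auto simp: onb_def cinner_scaleC_left\<close>)
    qed
    ultimately have "cinner (?Q x) (e j) = cinner x (e j)" by (rule has_sum_unique)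
    then show ?thesis by (simp add: cinner.diff_left)
  qed
  then have "x - ?Q x = 0" using e unfolding onb_def by blast
  then show ?thesis using hs by simp
qed

lemma onb_blinfun_eqI:
  fixes S T :: "'a::complex_hilbert \<Rightarrow>\<^sub>L 'b::complex_inner"
  assumes e: "onb e" and cl: "clinear_op S" "clinear_op T" and eq: "\<And>k. S (e k) = T (e k)"
  shows "S = T"
proof (rule blinfun_eqI)
  fix x
  note hs = has_sum_bounded_linear[OF blinfun.bounded_linear_right onb_expand[OF e, of x]]
  show "S x = T x"
    using hs[of S] hs[of T]
    by (simp add: clinear_opD[OF cl(1)] clinear_opD[OF cl(2)] eq) (rule has_sum_unique)
qed

lemma
  fixes e :: "'i \<Rightarrow> 'a::complex_hilbert"
  assumes e: "ortho_fam e" and g: "ortho_fam g" and a: "\<And>k. cmod (a k) \<le> K"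
  shows wop_add: "(\<And>k. cmod (b k) \<le> L) \<Longrightarrow> wop e g (\<lambda>k. a k + b k) = wop e g a + wop e g b"
    and wop_scale: "wop e g (\<lambda>k. c * a k) = c *\<^sub>C wop e g a"
proof -
  assume b: "\<And>k. cmod (b k) \<le> L"
  have ab: "cmod (a k + b k) \<le> K + L" for k
    using norm_triangle_mono[OF a b] .
  show "wop e g (\<lambda>k. a k + b k) = wop e g a + wop e g b"
  proof (rule blinfun_eqI)
    fix x
    have "((\<lambda>k. ((a k + b k) * cinner x (e k)) *\<^sub>C g k) has_sum wop e g a x + wop e g b x) UNIV"
      using has_sum_add[OF wop_has_sum[where c = a and x = x, OF e g a] wop_has_sum[where c = b and x = x, OF e g b]]
      by (simp add: scaleC_add_left ring_distribs)
    then show "wop e g (\<lambda>k. a k + b k) x = (wop e g a + wop e g b) x"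
      using has_sum_unique[OF wop_has_sum[where c = "\<lambda>k. a k + b k" and x = x, OF e g ab]]
      by (simp add: blinfun.add_left)
  qed
next
  have ca: "cmod (c * a k) \<le> cmod c * K" for k
    by (simp add: norm_mult mult_left_mono a)
  show "wop e g (\<lambda>k. c * a k) = c *\<^sub>C wop e g a"
  proof (rule blinfun_eqI)
    fix x
    have "((\<lambda>k. ((c * a k) * cinner x (e k)) *\<^sub>C g k) has_sum c *\<^sub>C wop e g a x) UNIV"
      using has_sum_bounded_linear[OF bounded_linear_scaleC wop_has_sum[where c = a and x = x, OF e g a], of c]
      by (simp add: scaleC_scaleC mult_ac)
    then show "wop e g (\<lambda>k. c * a k) x = (c *\<^sub>C wop e g a) x"
      using has_sum_unique[OF wop_has_sum[where c = "\<lambda>k. c * a k" and x = x, OF e g ca]] by simp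
  qed
qed

lemma wop_cong_on:
  assumes e: "ortho_fam e" and g: "ortho_fam g" and a: "\<And>k. cmod (a k) \<le> K" and b: "\<And>k. cmod (b k) \<le> L"
    and eq: "\<And>k. cinner x (e k) = 0 \<or> a k = b k"
  shows "wop e g a x = wop e g b x"
proof -
  have "(\<lambda>k. (a k * cinner x (e k)) *\<^sub>C g k) = (\<lambda>k. (b k * cinner x (e k)) *\<^sub>C g k)"
    using eq by (intro ext) (metis mult_zero_right)
  then show ?thesis
    using wop_has_sum[where c = a and x = x, OF e g a] wop_has_sum[where c = b and x = x, OF e g b]
      has_sum_unique by metis
qed

subsection \<open>Operators dominated by the harmonic diagonal operator\<close>

text \<open>A finite net of a nearby compact set is a coarser net of \<open>S\<close>. Closed balls
  of half the radius keep the covering valid on the closure.\<close>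

lemma compact_closure_approx:
  fixes S :: "'a::banach set"
  assumes "\<And>\<epsilon>. \<epsilon> > 0 \<Longrightarrow> \<exists>C. compact C \<and> (\<forall>x\<in>S. \<exists>y\<in>C. dist x y \<le> \<epsilon>)"
  shows "compact (closure S)"
  unfolding compact_eq_totally_bounded
proof (intro conjI allI impI)
  show "complete (closure S)" by (simp add: complete_eq_closed)
  fix \<epsilon> :: real assume "\<epsilon> > 0"
  then have e4: "\<epsilon> / 4 > 0" by simp
  obtain C where C: "compact C" "\<forall>x\<in>S. \<exists>y\<in>C. dist x y \<le> \<epsilon> / 4" using assms[OF e4] by blast
  obtain k where k: "finite k" "C \<subseteq> (\<Union>x\<in>k. ball x (\<epsilon> / 4))"
    using C(1) e4 unfolding compact_eq_totally_bounded by blast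
  have "S \<subseteq> (\<Union>x\<in>k. cball x (\<epsilon> / 2))"
  proof
    fix x assume "x \<in> S"
    then obtain y where y: "y \<in> C" "dist x y \<le> \<epsilon> / 4" using C by blast
    then obtain z where "z \<in> k" "dist z y < \<epsilon> / 4" using k by auto
    then have "dist z x \<le> \<epsilon> / 2" using y dist_triangle2[of z x y] by linarith
    then show "x \<in> (\<Union>x\<in>k. cball x (\<epsilon> / 2))" using \<open>z \<in> k\<close> by auto
  qed
  then have "closure S \<subseteq> (\<Union>x\<in>k. cball x (\<epsilon> / 2))"
    using k(1) by (intro closure_minimal closed_UN) auto
  also have "\<dots> \<subseteq> (\<Union>x\<in>k. ball x \<epsilon>)" using \<open>\<epsilon> > 0\<close> by fastforce
  finally show "\<exists>k. finite k \<and> closure S \<subseteq> (\<Union>x\<in>k. ball x \<epsilon>)" using k(1) by blast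
qed

lemma compact_finite_combinations:
  fixes v :: "nat \<Rightarrow> 'a::complex_inner"
  shows "compact {\<Sum>i<N. c i *\<^sub>C v i |c. \<forall>i<N. cmod (c i) \<le> K}"
proof (induction N)
  case 0
  then show ?case by simp
next
  case (Suc N)
  let ?C = "\<lambda>N. {\<Sum>i<N. c i *\<^sub>C v i |c. \<forall>i<N. cmod (c i) \<le> K}"
  have "compact ((\<lambda>c. c *\<^sub>C v N) ` cball 0 K)"
    by (intro compact_continuous_image bounded_linear.continuous_on[OF bounded_linear_scaleC_left]
        continuous_on_id compact_cball)
  then have cp: "compact {x + y |x y. x \<in> ?C N \<and> y \<in> (\<lambda>c. c *\<^sub>C v N) ` cball 0 K}"
    using Suc by (intro compact_sums)
  have "?C (Suc N) = {x + y |x y. x \<in> ?C N \<and> y \<in> (\<lambda>c. c *\<^sub>C v N) ` cball 0 K}" (is "_ = ?R")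
  proof
    show "?C (Suc N) \<subseteq> ?R"
    proof
      fix z assume "z \<in> ?C (Suc N)"
      then obtain c where c: "z = (\<Sum>i<Suc N. c i *\<^sub>C v i)" "\<forall>i<Suc N. cmod (c i) \<le> K" by blast
      have "(\<Sum>i<N. c i *\<^sub>C v i) \<in> ?C N" "c N *\<^sub>C v N \<in> (\<lambda>c. c *\<^sub>C v N) ` cball 0 K"
        using c(2) by auto
      then show "z \<in> ?R" using c(1) by auto
    qed
    show "?R \<subseteq> ?C (Suc N)"
    proof
      fix z assume "z \<in> ?R"
      then obtain c d where c: "\<forall>i<N. cmod (c i) \<le> K" "cmod d \<le> K" "z = (\<Sum>i<N. c i *\<^sub>C v i) + d *\<^sub>C v N"
        by auto
      have "z = (\<Sum>i<Suc N. (c(N := d)) i *\<^sub>C v i)" using c(3) by simp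
      moreover have "\<forall>i<Suc N. cmod ((c(N := d)) i) \<le> K" using c by (auto simp: less_Suc_eq)
      ultimately show "z \<in> ?C (Suc N)" by blast
    qed
  qed
  then show ?case using cp by simp
qed

text \<open>The model operator of trace 1: its singular values are exactly those in the
  normalization of a trace. Membership in \<open>weak_trace_class\<close> is always shown by
  factoring through such an operator.\<close>

definition harm :: "(nat \<Rightarrow> 'a::complex_hilbert) \<Rightarrow> 'a \<Rightarrow>\<^sub>L 'a" where
  "harm f = wop f f (\<lambda>j. complex_of_real (1 / real (j + 1)))"

lemma harm_bound: "cmod (complex_of_real (1 / real (j + 1))) \<le> 1"
  unfolding norm_of_real by simp

lemma clinear_harm: "onb f \<Longrightarrow> clinear_op (harm f)"
  unfolding harm_def by (rule clinear_wop[OF onb_ortho_fam onb_ortho_fam harm_bound])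

lemma harm_apply: "onb f \<Longrightarrow> harm f (f j) = complex_of_real (1 / real (j + 1)) *\<^sub>C f j"
  unfolding harm_def by (rule wop_apply_onb[OF _ onb_ortho_fam harm_bound])

lemma norm_harm_apply_le:
  fixes f :: "nat \<Rightarrow> 'a::complex_hilbert"
  assumes f: "onb f" and x: "\<And>i. i < j \<Longrightarrow> cinner x (f i) = 0"
  shows "norm (harm f x) \<le> norm x / real (j + 1)"
proof -
  note o = onb_ortho_fam[OF f]
  let ?b = "\<lambda>i. if i < j then 0 else complex_of_real (1 / real (i + 1))"
  have b: "cmod (?b i) \<le> 1 / real (j + 1)" for i by (cases "i < j") (simp_all only: norm_of_real if_True if_False, simp_all add: frac_le)
  have "harm f x = wop f f ?b x"
    unfolding harm_def by (rule wop_cong_on[OF o o harm_bound b]) (use x in auto)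
  also have "norm \<dots> \<le> norm (wop f f ?b) * norm x" by (rule norm_blinfun)
  also have "\<dots> \<le> (1 / real (j + 1)) * norm x"
    by (intro mult_right_mono norm_wop_le[OF o o b]) simp
  finally show ?thesis by simp
qed

text \<open>Dropping all but the first \<open>N\<close> basis vectors moves the image of the unit
  ball by at most \<open>norm B / (N + 1)\<close>, and the truncated images lie in a compact set of
  finite combinations.\<close>

lemma compact_op_harm:
  fixes B :: "'a::complex_hilbert \<Rightarrow>\<^sub>L 'a"
  assumes B: "clinear_op B" and f: "onb f"
  shows "compact_op (B o\<^sub>L harm f)"
  unfolding compact_op_def
proof
  show "clinear_op (B o\<^sub>L harm f)" by (intro clinear_op_compose B clinear_harm f)
  note o = onb_ortho_fam[OF f]
  show "compact (closure (blinfun_apply (B o\<^sub>L harm f) ` cball 0 1))"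
  proof (rule compact_closure_approx)
    fix \<epsilon> :: real assume "\<epsilon> > 0"
    obtain N where N: "(norm B + 1) / \<epsilon> < real N" using reals_Archimedean2 by blast
    have NB: "norm B / real (N + 1) \<le> \<epsilon>"
      using N \<open>\<epsilon> > 0\<close> norm_ge_zero[of B] by (simp add: field_simps)
    let ?C = "{\<Sum>i<N. c i *\<^sub>C B (f i) |c. \<forall>i<N. cmod (c i) \<le> 1}"
    let ?h = "\<lambda>j. complex_of_real (1 / real (j + 1))"
    have "\<exists>y\<in>?C. dist ((B o\<^sub>L harm f) x) y \<le> \<epsilon>" if x: "norm x \<le> 1" for x
    proof -
      let ?y = "\<Sum>i<N. (?h i * cinner x (f i)) *\<^sub>C f i"
      let ?z = "x - (\<Sum>i<N. cinner x (f i) *\<^sub>C f i)"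
      have z: "cinner ?z (f i) = 0" if "i < N" for i
      proof -
        have "(\<Sum>k<N. cinner x (f k) * cinner (f k) (f i)) = (\<Sum>k<N. if k = i then cinner x (f i) else 0)"
          using f by (intro sum.cong refl) (simp add: onb_def)
        then show ?thesis using that by (simp add: cinner.diff_left cinner.sum_left cinner_scaleC_left)
      qed
      have "(norm ?z)\<^sup>2 \<le> (norm x)\<^sup>2"
      proof -
        have "cinner ?z (\<Sum>i<N. cinner x (f i) *\<^sub>C f i) = 0"
          using z by (simp add: cinner.sum_right cinner_scaleC_right)
        from norm_add_ortho[OF this] show ?thesis by simp
      qed
      then have nz: "norm ?z \<le> 1" using x by (meson order_trans power2_le_imp_le norm_ge_zero)
      have "harm f x - ?y = harm f ?z"
        by (simp add: blinfun.diff_right blinfun.sum_right clinear_opD[OF clinear_harm[OF f]] harm_apply[OF f]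
            scaleC_scaleC mult.commute)
      also have "norm \<dots> \<le> norm ?z / real (N + 1)" by (rule norm_harm_apply_le[OF f z])
      also have "\<dots> \<le> 1 / real (N + 1)" using nz by (simp add: divide_right_mono)
      finally have d: "norm (harm f x - ?y) \<le> 1 / real (N + 1)" .
      have "dist ((B o\<^sub>L harm f) x) (B ?y) \<le> norm B * norm (harm f x - ?y)"
        using norm_blinfun[of B "harm f x - ?y"] by (simp add: dist_norm blinfun.diff_right)
      also have "\<dots> \<le> norm B * (1 / real (N + 1))" by (intro mult_left_mono d) simp
      also have "\<dots> \<le> \<epsilon>" using NB by simp
      finally have "dist ((B o\<^sub>L harm f) x) (B ?y) \<le> \<epsilon>" .
      moreover have "B ?y = (\<Sum>i<N. (?h i * cinner x (f i)) *\<^sub>C B (f i))"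
        by (simp add: blinfun.sum_right clinear_opD[OF B])
      moreover have "cmod (?h i * cinner x (f i)) \<le> 1" for i
      proof -
        have "cmod (cinner x (f i)) \<le> norm x * norm (f i)" by (rule cmod_cinner_le)
        then have "cmod (cinner x (f i)) \<le> 1" using x by (simp add: onb_norm[OF f])
        then show ?thesis using harm_bound[of i] by (simp only: norm_mult mult_le_one norm_ge_zero)
      qed
      ultimately show ?thesis
        by (intro bexI[of _ "B ?y"]) auto
    qed
    then show "\<exists>C. compact C \<and> (\<forall>x\<in>blinfun_apply (B o\<^sub>L harm f) ` cball 0 1. \<exists>y\<in>C. dist x y \<le> \<epsilon>)"
      using compact_finite_combinations by (intro exI[of _ ?C]) auto
  qed
qed

lemma singular_value_nonneg: "compact_op (T :: 'a::complex_hilbert \<Rightarrow>\<^sub>L 'a) \<Longrightarrow> 0 \<le> singular_value T j"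
  using compact_op_spectral[of T] singular_value_spectral[of T]
  by (metis real_sqrt_ge_zero spectral_system_def)

text \<open>On the orthogonal complement of the first \<open>j\<close> basis vectors
  \<open>harm f\<close> has norm at most \<open>1 / (j + 1)\<close>, so min-max bounds the
  \<open>j\<close>-th singular value by \<open>norm B / (j + 1)\<close>.\<close>

lemma weak_trace_class_harm:
  fixes B :: "'a::complex_hilbert \<Rightarrow>\<^sub>L 'a"
  assumes B: "clinear_op B" and f: "onb f"
  shows "B o\<^sub>L harm f \<in> weak_trace_class"
proof -
  let ?T = "B o\<^sub>L harm f"
  have c: "compact_op ?T" by (rule compact_op_harm[OF B f])
  have le: "singular_value ?T j \<le> norm B / real (j + 1)" for j
  proof (rule singular_value_le[OF c])
    fix x assume x: "\<And>i. i < j \<Longrightarrow> cinner x (f i) = 0"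
    have "norm (?T x) \<le> norm B * norm (harm f x)" using norm_blinfun[of B "harm f x"] by simp
    also have "\<dots> \<le> norm B * (norm x / real (j + 1))"
      by (intro mult_left_mono norm_harm_apply_le[OF f x]) auto
    finally show "norm (?T x) \<le> norm B / real (j + 1) * norm x" by simp
  qed simp
  have "singular_value ?T \<in> O(\<lambda>k. 1 / real k)"
  proof (rule bigoI)
    show "\<forall>\<^sub>F j in sequentially. norm (singular_value ?T j) \<le> norm B * norm (1 / real j)"
    proof (rule eventually_sequentiallyI[of 1])
      fix j :: nat assume "1 \<le> j"
      then have "norm B / real (j + 1) \<le> norm B / real j" by (intro divide_left_mono) auto
      then show "norm (singular_value ?T j) \<le> norm B * norm (1 / real j)"
        using le[of j] singular_value_nonneg[OF c, of j] by simp
    qed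
  qed
  then show ?thesis using c by (simp add: weak_trace_class_def)
qed

definition harmonic_bdd :: "(nat \<Rightarrow> complex) \<Rightarrow> bool" where
  "harmonic_bdd a \<longleftrightarrow> (\<exists>C. \<forall>j. cmod (a j) * real (j + 1) \<le> C)"

lemma harmonic_bdd_bounded: "harmonic_bdd a \<Longrightarrow> \<exists>K. \<forall>j. cmod (a j) \<le> K"
proof -
  assume "harmonic_bdd a"
  then obtain C where C: "\<And>j. cmod (a j) * real (j + 1) \<le> C" by (auto simp: harmonic_bdd_def)
  have "cmod (a j) * 1 \<le> cmod (a j) * real (j + 1)" for j by (intro mult_left_mono) auto
  then show ?thesis using C by (intro exI[of _ C]) (metis mult.right_neutral order_trans)
qed

lemma harmonic_bdd_add: "harmonic_bdd a \<Longrightarrow> harmonic_bdd b \<Longrightarrow> harmonic_bdd (\<lambda>j. a j + b j)"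
proof -
  assume "harmonic_bdd a" "harmonic_bdd b"
  then obtain C D where C: "\<And>j. cmod (a j) * real (j + 1) \<le> C" "\<And>j. cmod (b j) * real (j + 1) \<le> D"
    by (auto simp: harmonic_bdd_def)
  have "cmod (a j + b j) * real (j + 1) \<le> C + D" for j
  proof -
    have "cmod (a j + b j) * real (j + 1) \<le> (cmod (a j) + cmod (b j)) * real (j + 1)"
      by (intro mult_right_mono norm_triangle_ineq) simp
    then show ?thesis using C[of j] unfolding distrib_right by linarith
  qed
  then show ?thesis by (auto simp: harmonic_bdd_def)
qed

lemma harmonic_bdd_mult: "harmonic_bdd a \<Longrightarrow> harmonic_bdd (\<lambda>j. c * a j)"
proof -
  assume "harmonic_bdd a"
  then obtain C where C: "\<And>j. cmod (a j) * real (j + 1) \<le> C" by (auto simp: harmonic_bdd_def)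
  have "cmod (c * a j) * real (j + 1) \<le> cmod c * C" for j
    using mult_left_mono[OF C[of j], of "cmod c"] by (simp only: norm_mult mult.assoc norm_ge_zero)
  then show ?thesis by (auto simp: harmonic_bdd_def)
qed

lemma harmonic_bdd_le: "harmonic_bdd a \<Longrightarrow> (\<And>j. cmod (b j) \<le> cmod (a j)) \<Longrightarrow> harmonic_bdd b"
  unfolding harmonic_bdd_def by (meson mult_right_mono of_nat_0_le_iff order_trans)

lemma harmonic_bdd_harm: "harmonic_bdd (\<lambda>j. complex_of_real (1 / real (j + 1)))"
  unfolding harmonic_bdd_def norm_of_real by (intro exI[of _ 1]) simp

lemma diag_eq_compose_harm:
  fixes f :: "nat \<Rightarrow> 'a::complex_hilbert"
  assumes f: "onb f" and a: "harmonic_bdd a"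
  shows "wop f f a = wop f f (\<lambda>j. a j * of_nat (j + 1)) o\<^sub>L harm f"
    and "clinear_op (wop f f (\<lambda>j. a j * of_nat (j + 1)))"
proof -
  note o = onb_ortho_fam[OF f]
  obtain C where "\<And>j. cmod (a j) * real (j + 1) \<le> C" using a by (auto simp: harmonic_bdd_def)
  then have C: "cmod (a j * of_nat (j + 1)) \<le> C" for j by (simp only: norm_mult norm_of_nat)
  obtain K where K: "\<And>j. cmod (a j) \<le> K" using harmonic_bdd_bounded[OF a] by blast
  show cl: "clinear_op (wop f f (\<lambda>j. a j * of_nat (j + 1)))" by (rule clinear_wop[OF o o C])
  show "wop f f a = wop f f (\<lambda>j. a j * of_nat (j + 1)) o\<^sub>L harm f"
  proof (rule onb_blinfun_eqI[OF f clinear_wop[OF o o K] clinear_op_compose[OF cl clinear_harm[OF f]]])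
    fix k
    have "complex_of_real (1 / real (k + 1)) * (a k * of_nat (k + 1)) = a k"
      by (simp add: field_simps flip: of_nat_Suc)
    then show "wop f f a (f k) = (wop f f (\<lambda>j. a j * of_nat (j + 1)) o\<^sub>L harm f) (f k)"
      by (simp only: blinfun_apply_blinfun_compose harm_apply[OF f] clinear_opD[OF cl]
        wop_apply_onb[OF f o C] wop_apply_onb[OF f o K] scaleC_scaleC)
  qed
qed

lemma weak_trace_class_diag:
  assumes "onb f" "harmonic_bdd a"
  shows "wop f f a \<in> weak_trace_class"
  using diag_eq_compose_harm[OF assms] weak_trace_class_harm[OF _ assms(1)] by metis

lemma harm_spectral:
  fixes f :: "nat \<Rightarrow> 'a::complex_hilbert"
  assumes f: "onb f"
  shows "positive_op (harm f)" "singular_value (harm f) k = 1 / real (k + 1)"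
    "harm f \<in> weak_trace_class"
proof -
  note o = onb_ortho_fam[OF f]
  show p: "positive_op (harm f)"
    unfolding harm_def by (rule positive_wop[OF o, where K = 1]) auto
  have "(\<lambda>j. 1 / real (j + 1)) \<longlonglongrightarrow> 0"
    using LIMSEQ_inverse_real_of_nat by (simp add: inverse_eq_divide)
  moreover have "decseq (\<lambda>j. 1 / real (j + 1))" by (auto simp: decseq_def frac_le)
  moreover have "x = 0" if "\<forall>j. cinner x (f j) = 0" for x using f that by (simp add: onb_def)
  ultimately have "spectral_system (harm f) f (\<lambda>j. 1 / real (j + 1))"
    using f harm_apply[OF f] unfolding spectral_system_def
    by (auto simp: onb_norm scaleR_eq_scaleC) (simp add: onb_def, metis blinfun.zero_right)
  then show "singular_value (harm f) k = 1 / real (k + 1)"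
    using singular_value_positive_eq[OF p] by metis
  show "harm f \<in> weak_trace_class"
    unfolding harm_def by (rule weak_trace_class_diag[OF f harmonic_bdd_harm])
qed

subsection \<open>Traces of diagonal operators\<close>

text \<open>The functional \<open>\<Phi>\<close> stands for the restriction of a normalized positive trace to the diagonal
  operators. It vanishes on finitely supported sequences because the harmonic series diverges.\<close>

locale harmonic_functional =
  fixes \<Phi> :: "(nat \<Rightarrow> complex) \<Rightarrow> complex"
  assumes add: "\<And>a b. harmonic_bdd a \<Longrightarrow> harmonic_bdd b \<Longrightarrow> \<Phi> (\<lambda>j. a j + b j) = \<Phi> a + \<Phi> b"
    and scale: "\<And>c a. harmonic_bdd a \<Longrightarrow> \<Phi> (\<lambda>j. c * a j) = c * \<Phi> a"
    and pos: "\<And>a. harmonic_bdd (\<lambda>j. complex_of_real (a j)) \<Longrightarrow> (\<And>j. 0 \<le> a j) \<Longrightarrow>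
        \<Phi> (\<lambda>j. complex_of_real (a j)) \<in> \<real> \<and> 0 \<le> Re (\<Phi> (\<lambda>j. complex_of_real (a j)))"
    and norm1: "\<Phi> (\<lambda>j. complex_of_real (1 / real (j + 1))) = 1"
    and swap: "\<And>i. \<Phi> (\<lambda>j. if j = i then 1 else 0) = \<Phi> (\<lambda>j. if j = 0 then 1 else 0)"
begin

lemma finite_bdd: "harmonic_bdd (\<lambda>j. if j < N then a j else 0)"
proof -
  have "cmod (if j < N then a j else 0) * real (j + 1) \<le> (\<Sum>i<N. cmod (a i) * real (i + 1))" for j
    by (cases "j < N") (auto intro!: member_le_sum[of j "{..<N}" "\<lambda>i. cmod (a i) * real (i + 1)", simplified] sum_nonneg)
  then show ?thesis unfolding harmonic_bdd_def by blast
qed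

lemma delta_bdd: "harmonic_bdd (\<lambda>j. if j = i then c else 0)"
  by (rule harmonic_bdd_le[OF finite_bdd[of "Suc i" "\<lambda>_. c"]]) auto

lemma finite_sum: "\<Phi> (\<lambda>j. if j < N then a j else 0) = (\<Sum>i<N. a i) * \<Phi> (\<lambda>j. if j = 0 then 1 else 0)"
proof (induction N)
  case 0
  show ?case using scale[OF harmonic_bdd_harm, of 0] by simp
next
  case (Suc N)
  have "(\<lambda>j. if j < Suc N then a j else 0) = (\<lambda>j. (if j < N then a j else 0) + a N * (if j = N then 1 else 0))"
    by (auto simp: fun_eq_iff less_Suc_eq)
  then have "\<Phi> (\<lambda>j. if j < Suc N then a j else 0)
      = \<Phi> (\<lambda>j. if j < N then a j else 0) + a N * \<Phi> (\<lambda>j. if j = N then 1 else 0)"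
    by (simp only: add[OF finite_bdd harmonic_bdd_mult[OF delta_bdd]] scale[OF delta_bdd])
  then show ?case by (simp add: Suc swap[of N] distrib_right)
qed

text \<open>Let \<open>c\<close> be the common value on unit vectors. Removing the first
  \<open>N\<close> terms of the harmonic sequence leaves a nonnegative tail, so \<open>c\<close>
  times the \<open>N\<close>-th harmonic number is at most 1 for every \<open>N\<close>.\<close>

lemma delta_zero: "\<Phi> (\<lambda>j. if j = 0 then 1 else 0) = 0"
proof -
  let ?d = "\<lambda>j::nat. complex_of_real (if j = 0 then 1 else 0)"
  define c where "c = Re (\<Phi> ?d)"
  have d: "?d = (\<lambda>j. if j = 0 then 1 else 0)" by auto
  have "\<Phi> ?d \<in> \<real> \<and> 0 \<le> Re (\<Phi> ?d)" by (rule pos) (simp_all only: d delta_bdd, auto)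
  then have c: "\<Phi> ?d = complex_of_real c" "0 \<le> c" by (auto simp: c_def)
  let ?h = "\<lambda>j::nat. complex_of_real (1 / real (j + 1))"
  have le: "(\<Sum>i<N. 1 / real (i + 1)) * c \<le> 1" for N
  proof -
    let ?r = "\<lambda>j. complex_of_real (if j < N then 0 else 1 / real (j + 1))"
    have rb: "harmonic_bdd ?r" by (rule harmonic_bdd_le[OF harmonic_bdd_harm]) (simp only: norm_of_real, auto)
    have "?h = (\<lambda>j. (if j < N then ?h j else 0) + ?r j)" by auto
    then have "\<Phi> ?h = \<Phi> (\<lambda>j. (if j < N then ?h j else 0) + ?r j)" by (rule arg_cong)
    also have "\<dots> = \<Phi> (\<lambda>j. if j < N then ?h j else 0) + \<Phi> ?r" by (rule add[OF finite_bdd rb])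
    finally have "1 = \<Phi> (\<lambda>j. if j < N then ?h j else 0) + \<Phi> ?r" unfolding norm1 .
    moreover have "0 \<le> Re (\<Phi> ?r)" by (rule pos[OF rb, THEN conjunct2]) simp
    moreover have "\<Phi> (\<lambda>j. if j < N then ?h j else 0) = complex_of_real ((\<Sum>i<N. 1 / real (i + 1)) * c)"
      unfolding finite_sum d[symmetric] c of_real_mult of_real_sum ..
    ultimately have "1 = Re (complex_of_real ((\<Sum>i<N. 1 / real (i + 1)) * c)) + Re (\<Phi> ?r)"
      by (metis one_complex.sel(1) plus_complex.sel(1))
    then show ?thesis using \<open>0 \<le> Re (\<Phi> ?r)\<close> unfolding Re_complex_of_real by linarith
  qed
  have "c = 0"
  proof (rule ccontr)
    assume "c \<noteq> 0"
    then have "c > 0" using c by simp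
    then have bnd: "(\<Sum>i<N. 1 / real (i + 1)) \<le> 1 / c" for N using le[of N] by (simp add: field_simps)
    have "summable (\<lambda>i. 1 / real (i + 1))"
      by (rule bounded_imp_summable[of _ "1 / c"]) (simp, simp only: lessThan_Suc_atMost[symmetric] bnd)
    then have "summable (\<lambda>i. inverse (real (Suc i)))" by (simp add: inverse_eq_divide)
    then have "summable (\<lambda>i. inverse (real i))" using summable_Suc_iff[of "\<lambda>i. inverse (real i)"] by simp
    then show False using not_summable_harmonic by blast
  qed
  then show ?thesis using c d by simp
qed

text \<open>The head of the sequence is finitely supported and contributes 0; the tail lies between
  plus and minus \<epsilon> times the harmonic sequence, and positivity squeezes its value.\<close>

lemma small_real:
  fixes a :: "nat \<Rightarrow> real"
  assumes lim: "(\<lambda>j. a j * real (j + 1)) \<longlonglongrightarrow> 0"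
  shows "harmonic_bdd (\<lambda>j. complex_of_real (a j))" "\<Phi> (\<lambda>j. complex_of_real (a j)) = 0"
proof -
  obtain K where "\<And>j. norm (a j * real (j + 1)) \<le> K"
    using convergent_imp_Bseq[OF convergentI[OF lim]] by (auto simp: Bseq_def)
  then have "\<And>j. \<bar>a j\<bar> * real (j + 1) \<le> K" by (simp add: abs_mult)
  then show ba: "harmonic_bdd (\<lambda>j. complex_of_real (a j))" by (auto simp: harmonic_bdd_def)
  let ?h = "\<lambda>j::nat. complex_of_real (1 / real (j + 1))"
  have "cmod (\<Phi> (\<lambda>j. complex_of_real (a j))) \<le> \<epsilon>" if eps: "\<epsilon> > 0" for \<epsilon>
  proof -
    obtain N where N: "\<And>j. j \<ge> N \<Longrightarrow> \<bar>a j * real (j + 1)\<bar> < \<epsilon>"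
      using LIMSEQ_D[OF lim eps] by auto
    let ?t = "\<lambda>j. if j < N then 0 else a j"
    have tb: "harmonic_bdd (\<lambda>j. complex_of_real (?t j))"
      by (rule harmonic_bdd_le[OF ba]) auto
    have "(\<lambda>j. complex_of_real (a j)) = (\<lambda>j. (if j < N then complex_of_real (a j) else 0) + complex_of_real (?t j))"
      by auto
    then have "\<Phi> (\<lambda>j. complex_of_real (a j))
        = \<Phi> (\<lambda>j. if j < N then complex_of_real (a j) else 0) + \<Phi> (\<lambda>j. complex_of_real (?t j))"
      using add[OF finite_bdd[of N "\<lambda>j. complex_of_real (a j)"] tb] by metis
    then have eq: "\<Phi> (\<lambda>j. complex_of_real (a j)) = \<Phi> (\<lambda>j. complex_of_real (?t j))"
      by (simp add: finite_sum delta_zero)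
    have t_le: "\<bar>?t j\<bar> \<le> \<epsilon> * (1 / real (j + 1))" for j
      using N[of j] eps by (auto simp: abs_mult field_simps)
    \<comment> \<open>The sign \<open>s\<close> is 1 or -1. Using both signs bounds the real part
      from both sides; that the values are real removes the imaginary part.\<close>
    have key: "complex_of_real \<epsilon> + s * \<Phi> (\<lambda>j. complex_of_real (?t j)) \<in> \<real> \<and>
        0 \<le> Re (complex_of_real \<epsilon> + s * \<Phi> (\<lambda>j. complex_of_real (?t j)))"
      if s: "s = complex_of_real r" "\<bar>r\<bar> = 1" for s r
    proof -
      let ?p = "\<lambda>j. \<epsilon> * (1 / real (j + 1)) + r * ?t j"
      have p: "(\<lambda>j. complex_of_real (?p j)) = (\<lambda>j. complex_of_real \<epsilon> * ?h j + s * complex_of_real (?t j))"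
        by (simp add: s fun_eq_iff)
      have "\<Phi> (\<lambda>j. complex_of_real (?p j)) \<in> \<real> \<and> 0 \<le> Re (\<Phi> (\<lambda>j. complex_of_real (?p j)))"
      proof (rule pos)
        show "harmonic_bdd (\<lambda>j. complex_of_real (?p j))"
          unfolding p by (intro harmonic_bdd_add harmonic_bdd_mult harmonic_bdd_harm tb)
        fix j
        have "\<bar>r * ?t j\<bar> \<le> \<epsilon> * (1 / real (j + 1))" using t_le[of j] s by (simp only: abs_mult mult_1)
        then show "0 \<le> ?p j" by linarith
      qed
      moreover have "\<Phi> (\<lambda>j. complex_of_real (?p j)) = complex_of_real \<epsilon> + s * \<Phi> (\<lambda>j. complex_of_real (?t j))"
        unfolding p
        by (simp only: add[OF harmonic_bdd_mult[OF harmonic_bdd_harm] harmonic_bdd_mult[OF tb]]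
            scale[OF harmonic_bdd_harm] scale[OF tb] norm1 mult_1_right)
      ultimately show ?thesis by metis
    qed
    let ?w = "\<Phi> (\<lambda>j. complex_of_real (?t j))"
    have "complex_of_real \<epsilon> + ?w \<in> \<real> \<and> 0 \<le> Re (complex_of_real \<epsilon> + ?w)" using key[of 1 1] by simp
    moreover have "complex_of_real \<epsilon> - ?w \<in> \<real> \<and> 0 \<le> Re (complex_of_real \<epsilon> - ?w)" using key[of "-1" "-1"] by simp
    ultimately have "Im ?w = 0" "\<bar>Re ?w\<bar> \<le> \<epsilon>" by (auto simp: complex_is_Real_iff)
    then have "cmod ?w \<le> \<epsilon>" by (simp add: cmod_eq_Re)
    then show ?thesis by (simp only: eq)
  qed
  then have "cmod (\<Phi> (\<lambda>j. complex_of_real (a j))) \<le> 0"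
    using field_le_epsilon[of "cmod (\<Phi> (\<lambda>j. complex_of_real (a j)))" 0] by simp
  then show "\<Phi> (\<lambda>j. complex_of_real (a j)) = 0" by simp
qed

lemma limit_value:
  assumes lim: "(\<lambda>j. a j * of_nat (j + 1)) \<longlonglongrightarrow> L"
  shows "harmonic_bdd a" "\<Phi> a = L"
proof -
  let ?h = "\<lambda>j::nat. complex_of_real (1 / real (j + 1))"
  define b where "b j = a j - L * ?h j" for j
  have "(\<lambda>j. a j * of_nat (j + 1) - L) \<longlonglongrightarrow> L - L" by (intro tendsto_intros lim)
  moreover have "b j * of_nat (j + 1) = a j * of_nat (j + 1) - L" for j
  proof -
    have "?h j * of_nat (j + 1) = 1" by (simp flip: of_nat_Suc)
    then show ?thesis unfolding b_def left_diff_distrib mult.assoc by (simp only: mult_1_right)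
  qed
  ultimately have lb: "(\<lambda>j. b j * of_nat (j + 1)) \<longlonglongrightarrow> 0" by simp
  have "(\<lambda>j. Re (b j) * real (j + 1)) \<longlonglongrightarrow> 0" "(\<lambda>j. Im (b j) * real (j + 1)) \<longlonglongrightarrow> 0"
    using tendsto_Re[OF lb] tendsto_Im[OF lb] by (simp_all add: distrib_left)
  note sm = small_real[OF this(1)] small_real[OF this(2)]
  have beq: "b = (\<lambda>j. complex_of_real (Re (b j)) + \<i> * complex_of_real (Im (b j)))"
    by (simp add: fun_eq_iff complex_eq_iff)
  have bb: "harmonic_bdd b" by (subst beq) (intro harmonic_bdd_add harmonic_bdd_mult sm)
  have "\<Phi> b = 0"
    by (subst beq) (simp add: add[OF sm(1) harmonic_bdd_mult[OF sm(3)]] scale[OF sm(3)] sm)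
  have aeq: "a = (\<lambda>j. L * ?h j + b j)" by (simp add: b_def)
  show "harmonic_bdd a" by (subst aeq) (intro harmonic_bdd_add harmonic_bdd_mult harmonic_bdd_harm bb)
  show "\<Phi> a = L"
    by (subst aeq) (simp only: add[OF harmonic_bdd_mult[OF harmonic_bdd_harm] bb] scale[OF harmonic_bdd_harm]
      norm1 \<open>\<Phi> b = 0\<close> mult_1_right add_0_right)
qed

end

section \<open>Evaluation of a normalized positive trace on diagonal operators\<close>

lemma trace_add:
  "positive_trace \<phi> \<Longrightarrow> S \<in> weak_trace_class \<Longrightarrow> T \<in> weak_trace_class \<Longrightarrow> \<phi> (S + T) = \<phi> S + \<phi> T"
  by (simp add: positive_trace_def is_trace_def)

lemma trace_scale: "positive_trace \<phi> \<Longrightarrow> T \<in> weak_trace_class \<Longrightarrow> \<phi> (c *\<^sub>C T) = c * \<phi> T"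
  by (simp add: positive_trace_def is_trace_def)

context
  fixes \<phi> :: "('a::complex_hilbert \<Rightarrow>\<^sub>L 'a) \<Rightarrow> complex" and f :: "nat \<Rightarrow> 'a"
  assumes pos: "positive_trace \<phi>" and nrm: "normalized_trace \<phi>" and f: "onb f"
begin

lemma trace_diag_add:
  assumes "harmonic_bdd a" "harmonic_bdd b"
  shows "\<phi> (wop f f (\<lambda>j. a j + b j)) = \<phi> (wop f f a) + \<phi> (wop f f b)"
proof -
  obtain K L where K: "\<And>j. cmod (a j) \<le> K" "\<And>j. cmod (b j) \<le> L"
    using harmonic_bdd_bounded assms by metis
  show ?thesis
    by (simp only: wop_add[OF onb_ortho_fam[OF f] onb_ortho_fam[OF f] K]
      trace_add[OF pos] weak_trace_class_diag[OF f] assms)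
qed

lemma trace_diag_scale:
  assumes "harmonic_bdd a"
  shows "\<phi> (wop f f (\<lambda>j. c * a j)) = c * \<phi> (wop f f a)"
proof -
  obtain K where K: "\<And>j. cmod (a j) \<le> K" using harmonic_bdd_bounded assms by metis
  show ?thesis
    by (simp only: wop_scale[OF onb_ortho_fam[OF f] onb_ortho_fam[OF f] K] trace_scale[OF pos]
      weak_trace_class_diag[OF f] assms)
qed

lemma trace_harm: "onb g \<Longrightarrow> \<phi> (harm g) = 1"
  using nrm harm_spectral[of g] by (simp add: normalized_trace_def)

text \<open>Exchanging two basis vectors changes the harmonic diagonal operator by a multiple of the
  difference of the two rank one projections, but not its trace.\<close>

lemma trace_rank_one: "\<phi> (wop f f (\<lambda>j. if j = i then 1 else 0)) = \<phi> (wop f f (\<lambda>j. if j = 0 then 1 else 0))"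
proof (cases "i = 0")
  case False
  define t :: "nat \<Rightarrow> nat" where "t j = (if j = 0 then i else if j = i then 0 else j)" for j
  have tt: "t (t j) = j" for j by (simp add: t_def)
  then have "bij t" using o_bij[of t t] by (auto simp: fun_eq_iff)
  note g = onb_bij[OF f this] and o = onb_ortho_fam[OF f]
  let ?h = "\<lambda>j::nat. complex_of_real (1 / real (j + 1))"
  let ?d = "\<lambda>i j::nat. (if j = i then 1 else 0) :: complex"
  \<comment> \<open>The difference of the two exchanged eigenvalues, 1 and
    \<open>1 / (i + 1)\<close>; it is nonzero because \<open>i\<close> is.\<close>
  let ?c = "1 - ?h i"
  have h0: "?h 0 = 1" by simp
  have db: "harmonic_bdd (?d k)" for k
    unfolding harmonic_bdd_def by (intro exI[of _ "real (k + 1)"]) auto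
  have db': "harmonic_bdd (\<lambda>j. ?c * ?d 0 j + (- ?c) * ?d i j)"
    by (intro harmonic_bdd_add harmonic_bdd_mult db)
  obtain K where K: "\<And>j. cmod (?c * ?d 0 j + (- ?c) * ?d i j) \<le> K" using harmonic_bdd_bounded[OF db'] by metis
  have "harm f = harm (\<lambda>j. f (t j)) + wop f f (\<lambda>j. ?c * ?d 0 j + (- ?c) * ?d i j)"
  proof (rule onb_blinfun_eqI[OF f])
    show "clinear_op (harm f)" by (rule clinear_harm[OF f])
    show "clinear_op (harm (\<lambda>j. f (t j)) + wop f f (\<lambda>j. ?c * ?d 0 j + (- ?c) * ?d i j))"
      by (intro clinear_op_add clinear_harm[OF g] clinear_wop[where K = K] o K)
    fix k
    have "harm (\<lambda>j. f (t j)) (f k) = ?h (t k) *\<^sub>C f k"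
      using harm_apply[OF g, of "t k"] by (simp only: tt)
    moreover have "?h k = ?h (t k) + (?c * ?d 0 k + (- ?c) * ?d i k)"
      using False h0 by (simp add: t_def)
    ultimately show "harm f (f k) = (harm (\<lambda>j. f (t j)) + wop f f (\<lambda>j. ?c * ?d 0 j + (- ?c) * ?d i j)) (f k)"
      by (simp only: blinfun.add_left harm_apply[OF f]
        wop_apply_onb[where c = "\<lambda>j. ?c * ?d 0 j + (- ?c) * ?d i j", OF f o K] scaleC_add_left[symmetric])
  qed
  then have "\<phi> (harm f) = \<phi> (harm (\<lambda>j. f (t j))) + \<phi> (wop f f (\<lambda>j. ?c * ?d 0 j + (- ?c) * ?d i j))"
    using trace_add[OF pos harm_spectral(3)[OF g] weak_trace_class_diag[OF f db']] by metis
  then have "\<phi> (wop f f (\<lambda>j. ?c * ?d 0 j + (- ?c) * ?d i j)) = 0"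
    by (simp add: trace_harm f g)
  then have "?c * \<phi> (wop f f (?d 0)) + (- ?c) * \<phi> (wop f f (?d i)) = 0"
    by (simp only: trace_diag_add[OF harmonic_bdd_mult[OF db] harmonic_bdd_mult[OF db]] trace_diag_scale[OF db])
  then have "?c * (\<phi> (wop f f (?d 0)) - \<phi> (wop f f (?d i))) = 0"
    by (simp only: right_diff_distrib minus_mult_left[symmetric] diff_conv_add_uminus[symmetric])
  moreover have "?c \<noteq> 0"
  proof -
    have "?h i \<noteq> 1" using False by (simp only: of_real_eq_1_iff) simp
    then show ?thesis by (metis right_minus_eq)
  qed
  ultimately show ?thesis by (metis mult_eq_0_iff right_minus_eq)
qed simp

lemma harmonic_functional_trace: "harmonic_functional (\<lambda>a. \<phi> (wop f f a))"
proof
  fix a assume a: "harmonic_bdd (\<lambda>j. complex_of_real (a j))" "\<And>j. 0 \<le> a j"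
  obtain K where K: "\<And>j. cmod (complex_of_real (a j)) \<le> K" using harmonic_bdd_bounded[OF a(1)] by metis
  have "a j \<le> K" for j using K[of j] abs_ge_self[of "a j"] by (simp only: norm_of_real)
  then have "positive_op (wop f f (\<lambda>j. complex_of_real (a j)))"
    using a(2) by (intro positive_wop onb_ortho_fam f)
  then show "\<phi> (wop f f (\<lambda>j. complex_of_real (a j))) \<in> \<real> \<and> 0 \<le> Re (\<phi> (wop f f (\<lambda>j. complex_of_real (a j))))"
    using pos weak_trace_class_diag[OF f a(1)] by (simp add: positive_trace_def)
qed (use trace_diag_add trace_diag_scale trace_harm[OF f] trace_rank_one in \<open>simp_all only: harm_def\<close>)

lemma trace_diag_limit:
  assumes "(\<lambda>j. a j * of_nat (j + 1)) \<longlonglongrightarrow> L"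
  shows "\<phi> (wop f f a) = L"
  by (rule harmonic_functional.limit_value(2)[OF harmonic_functional_trace assms])

end

subsection \<open>Enumeration in decreasing order\<close>

text \<open>Greedy choice: each step takes a maximizer of \<open>g\<close> among the points not yet
  listed, which exists since superlevel sets are finite. A point \<open>k\<close> never reached
  would leave infinitely many points with values at least \<open>g k\<close>.\<close>

lemma decreasing_enumeration:
  fixes g :: "'k \<Rightarrow> real"
  assumes inf: "infinite (UNIV :: 'k set)" and pos: "\<And>k. 0 < g k"
    and fin: "\<And>\<epsilon>. \<epsilon> > 0 \<Longrightarrow> finite {k. g k \<ge> \<epsilon>}"
  obtains b :: "nat \<Rightarrow> 'k" where "bij b" "decseq (\<lambda>j. g (b j))"
proof -
  define P where "P f j r \<longleftrightarrow> r \<notin> f ` {..<j} \<and> (\<forall>k. k \<notin> f ` {..<j} \<longrightarrow> g k \<le> g r)"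
    for f :: "nat \<Rightarrow> 'k" and j :: nat and r :: 'k
  have "\<exists>b. \<forall>j. P b j (b j)"
  proof (rule dependent_wellorder_choice)
    fix r :: 'k and f h :: "nat \<Rightarrow> 'k" and x :: nat
    assume "\<And>y. y < x \<Longrightarrow> f y = h y"
    then have "f ` {..<x} = h ` {..<x}" by (intro image_cong) auto
    then show "P f x r = P h x r" by (simp add: P_def)
  next
    fix j and f :: "nat \<Rightarrow> 'k"
    obtain k0 where k0: "k0 \<notin> f ` {..<j}"
      using inf ex_new_if_finite[of "f ` {..<j}"] by auto
    let ?S = "{k. g k \<ge> g k0} - f ` {..<j}"
    have S: "finite ?S" "?S \<noteq> {}" using fin[OF pos] k0 by auto
    define m where "m = Max (g ` ?S)"
    have "m \<in> g ` ?S" unfolding m_def using S by (intro Max_in) auto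
    then obtain r where r: "r \<in> ?S" "g r = m" by auto
    have "g k \<le> g r" if "k \<notin> f ` {..<j}" for k
    proof (cases "g k \<ge> g k0")
      case True
      then show ?thesis using r(2) S(1) that unfolding m_def by (auto intro: Max_ge)
    next
      case False
      then show ?thesis using r(1) by auto
    qed
    then show "\<exists>r. P f j r" using r(1) by (auto simp: P_def)
  qed
  then obtain b where b: "\<And>j. P b j (b j)" by blast
  have ne: "b i \<noteq> b j" if "i < j" for i j
    using b[of j] that unfolding P_def by (metis image_eqI lessThan_iff)
  have inj: "inj b"
  proof (rule injI, rule ccontr)
    fix x y assume "b x = b y" "x \<noteq> y"
    then show False using ne[of x y] ne[of y x] by (cases "x < y") auto
  qed
  have dec: "decseq (\<lambda>j. g (b j))"
    unfolding decseq_def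
  proof (intro allI impI)
    fix i j :: nat assume ij: "i \<le> j"
    have "b j \<notin> b ` {..<i}" using ij inj by (auto simp: inj_eq)
    then show "g (b j) \<le> g (b i)" using b[of i] by (auto simp: P_def)
  qed
  have "surj b"
  proof (rule ccontr)
    assume "\<not> surj b"
    then obtain k where "k \<notin> range b" by auto
    then have "k \<notin> b ` {..<j}" for j by blast
    then have "g k \<le> g (b j)" for j using b[of j] by (simp add: P_def)
    then have "range b \<subseteq> {i. g i \<ge> g k}" by auto
    then have "finite (range b)" using fin[OF pos] finite_subset by blast
    then show False using inj finite_imageD by blast
  qed
  then show ?thesis using that inj dec by (simp add: bij_def)
qed

subsection \<open>Lattice points and volumes\<close>

definition lattice_floor :: "'n::finite rvec \<Rightarrow> 'n ivec" where
  "lattice_floor x = (\<chi> i. \<lfloor>x $ i\<rfloor>)"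

lemma real_of_lattice_nth [simp]: "real_of_lattice k $ i = real_of_int (k $ i)"
  by (simp add: real_of_lattice_def)

lemma real_of_lattice_0 [simp]: "real_of_lattice 0 = 0"
  by (simp add: vec_eq_iff)

lemma real_of_lattice_eq_0_iff [simp]: "real_of_lattice k = 0 \<longleftrightarrow> k = 0"
  by (simp add: vec_eq_iff)

lemma lattice_floor_dist: "norm (x - real_of_lattice (lattice_floor x)) \<le> real CARD('n)"
  for x :: "'n::finite rvec"
proof -
  have "norm (x - real_of_lattice (lattice_floor x)) \<le> (\<Sum>i\<in>UNIV. \<bar>(x - real_of_lattice (lattice_floor x)) $ i\<bar>)"
    by (rule norm_le_l1_cart)
  also have "\<dots> \<le> (\<Sum>i\<in>(UNIV :: 'n set). 1)"
    by (intro sum_mono) (simp add: lattice_floor_def, linarith)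
  finally show ?thesis by simp
qed

lemma lattice_cell_eq:
  "{x. lattice_floor x = k} = {x. \<forall>i. real_of_int (k $ i) \<le> x $ i \<and> x $ i < real_of_int (k $ i) + 1}"
  by (auto simp: lattice_floor_def vec_eq_iff floor_eq_iff)

lemma lattice_cell_borel [measurable]: "{x. lattice_floor x = k} \<in> sets borel"
proof -
  have m: "(\<lambda>x :: 'a rvec. x $ i) \<in> borel_measurable borel" for i
    by (intro borel_measurable_continuous_onI continuous_intros)
  have "{x :: 'a rvec. real_of_int (k $ i) \<le> x $ i \<and> x $ i < real_of_int (k $ i) + 1} \<in> sets borel" for i
    using m[of i] by (simp add: borel_measurable_iff_ge Collect_conj_eq) measurable
  then have "(\<Inter>i. {x :: 'a rvec. real_of_int (k $ i) \<le> x $ i \<and> x $ i < real_of_int (k $ i) + 1}) \<in> sets borel"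
    by (intro sets.finite_INT) auto
  moreover have "(\<Inter>i. {x :: 'a rvec. real_of_int (k $ i) \<le> x $ i \<and> x $ i < real_of_int (k $ i) + 1})
      = {x. lattice_floor x = k}" unfolding lattice_cell_eq by auto
  ultimately show ?thesis by simp
qed

text \<open>The half-open cell lies between the open and the closed unit box, which have the same
  volume.\<close>

lemma emeasure_lattice_cell: "emeasure lborel {x. lattice_floor x = (k :: 'n::finite ivec)} = 1"
proof -
  let ?a = "real_of_lattice k" and ?b = "real_of_lattice k + 1"
  have eq: "(\<Prod>b\<in>Basis. (?b - ?a) \<bullet> b) = 1"
    by (rule prod.neutral) (auto simp: Basis_vec_def inner_axis)
  have le: "\<forall>b\<in>Basis. ?a \<bullet> b \<le> ?b \<bullet> b"
    by (auto simp: Basis_vec_def inner_axis)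
  have "box ?a ?b \<subseteq> {x. lattice_floor x = k}" "{x. lattice_floor x = k} \<subseteq> cbox ?a ?b"
    unfolding lattice_cell_eq by (force simp: mem_box_cart less_imp_le)+
  then have "emeasure lborel (box ?a ?b) \<le> emeasure lborel {x. lattice_floor x = k}"
     "emeasure lborel {x. lattice_floor x = k} \<le> emeasure lborel (cbox ?a ?b)"
    by (intro emeasure_mono; simp)+
  then show ?thesis
    unfolding emeasure_lborel_box_eq emeasure_lborel_cbox_eq using le eq by (simp add: antisym)
qed

lemma
  assumes "finite S"
  shows emeasure_lattice_cells: "emeasure lborel {x. lattice_floor x \<in> S} = of_nat (card S)"
    and lattice_cells_borel: "{x. lattice_floor x \<in> S} \<in> sets borel"
proof -
  have eq: "{x. lattice_floor x \<in> S} = (\<Union>k\<in>S. {x. lattice_floor x = k})" by auto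
  show "{x. lattice_floor x \<in> S} \<in> sets borel" unfolding eq using assms by (intro sets.finite_UN) auto
  have "emeasure lborel {x. lattice_floor x \<in> S} = (\<Sum>k\<in>S. emeasure lborel {x. lattice_floor x = k})"
    unfolding eq using assms by (intro sum_emeasure[symmetric]) (auto simp: disjoint_family_on_def)
  then show "emeasure lborel {x. lattice_floor x \<in> S} = of_nat (card S)"
    by (simp add: emeasure_lattice_cell)
qed

lemma finite_lattice_bounded: "finite {k :: 'n::finite ivec. norm (real_of_lattice k) \<le> R}"
proof -
  let ?m = "\<lceil>\<bar>R\<bar>\<rceil>"
  have "{k :: 'n ivec. norm (real_of_lattice k) \<le> R} \<subseteq> vec_lambda ` (PiE UNIV (\<lambda>_. {- ?m..?m}))"
  proof
    fix k :: "'n ivec" assume "k \<in> {k. norm (real_of_lattice k) \<le> R}"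
    then have "\<bar>real_of_int (k $ i)\<bar> \<le> \<bar>R\<bar>" for i
      using component_le_norm_cart[of "real_of_lattice k" i] by simp
    then have "k $ i \<in> {- ?m..?m}" for i
    proof -
      have "\<bar>real_of_int (k $ i)\<bar> \<le> real_of_int ?m"
        using \<open>\<And>i. \<bar>real_of_int (k $ i)\<bar> \<le> \<bar>R\<bar>\<close>[of i] le_of_int_ceiling[of "\<bar>R\<bar>"] by linarith
      then have "\<bar>k $ i\<bar> \<le> ?m" by (simp only: of_int_abs[symmetric] of_int_le_iff)
      then show ?thesis by (simp add: abs_le_iff)
    qed
    then have "(\<lambda>i. k $ i) \<in> PiE UNIV (\<lambda>_. {- ?m..?m})" by auto
    then show "k \<in> vec_lambda ` (PiE UNIV (\<lambda>_. {- ?m..?m}))"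
      by (metis (no_types, lifting) imageI vec_nth_inverse)
  qed
  then show ?thesis by (rule finite_subset) (intro finite_imageI finite_PiE, auto)
qed

lemma emeasure_lborel_scaleR:
  fixes S :: "'a::euclidean_space set"
  assumes S: "S \<in> sets borel" and c: "c > 0"
  shows "emeasure lborel {x. (1 / c) *\<^sub>R x \<in> S} = ennreal (c ^ DIM('a)) * emeasure lborel S"
proof -
  have m': "(\<lambda>x :: 'a. (1 / c) *\<^sub>R x) \<in> borel \<rightarrow>\<^sub>M borel" by measurable
  have S': "{x. (1 / c) *\<^sub>R x \<in> S} \<in> sets borel"
    using measurable_sets[OF m' S] by (simp add: vimage_def)
  have "emeasure lborel {x. (1 / c) *\<^sub>R x \<in> S}
      = emeasure (density (distr lborel borel (\<lambda>x. 0 + c *\<^sub>R x)) (\<lambda>_. ennreal (\<bar>c\<bar> ^ DIM('a)))) {x. (1 / c) *\<^sub>R x \<in> S}"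
    using lborel_affine[of c "0 :: 'a"] c by (metis less_irrefl)
  also have "\<dots> = ennreal (c ^ DIM('a)) * emeasure (distr lborel borel (\<lambda>x. 0 + c *\<^sub>R x)) {x. (1 / c) *\<^sub>R x \<in> S}"
    using S' c by (subst emeasure_density_const) auto
  also have "emeasure (distr lborel borel (\<lambda>x. 0 + c *\<^sub>R x)) {x. (1 / c) *\<^sub>R x \<in> S} = emeasure lborel S"
    using S' c by (subst emeasure_distr) (auto simp: vimage_def)
  finally show ?thesis .
qed

lemma ennreal_power_less_iff_scaled:
  assumes "c > 0" "n > 0" "0 \<le> (r :: real)"
  shows "ennreal (r ^ n) < ennreal c * u \<longleftrightarrow> ennreal ((r / root n c) ^ n) < u"
proof -
  have "ennreal (r ^ n) = ennreal c * ennreal ((r / root n c) ^ n)"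
    using assms by (simp add: power_divide real_root_pow_pos2 flip: ennreal_mult)
  then show ?thesis
    using assms(1) by (simp add: ennreal_mult_le_mult_iff flip: not_le)
qed

text \<open>Both sides are additive in \<open>u\<close> for disjoint supports, homogeneous, and continuous along
  increasing sequences.\<close>

lemma emeasure_star_shaped:
  fixes u :: "'n::finite rvec \<Rightarrow> ennreal"
  assumes "u \<in> borel_measurable borel"
  shows "emeasure lborel {x :: 'n rvec. x \<noteq> 0 \<and> ennreal (norm x ^ CARD('n)) < u (x /\<^sub>R norm x)}
    = (\<integral>\<^sup>+x\<in>ball 0 1 - {0}. u (x /\<^sub>R norm x) \<partial>lborel)"
proof -
  let ?n = "CARD('n)"
  let ?E = "\<lambda>u :: 'n rvec \<Rightarrow> ennreal. {x :: 'n rvec. x \<noteq> 0 \<and> ennreal (norm x ^ ?n) < u (x /\<^sub>R norm x)}"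
  let ?I = "\<lambda>u :: 'n rvec \<Rightarrow> ennreal. (\<integral>\<^sup>+x\<in>ball 0 1 - {0}. u (x /\<^sub>R norm x) \<partial>lborel)"
  have E[measurable]: "?E u \<in> sets borel" if [measurable]: "u \<in> borel_measurable borel" for u by measurable
  have I: "(\<lambda>x. u (x /\<^sub>R norm x) * indicator (ball 0 1 - {0}) x) \<in> borel_measurable (lborel :: 'n rvec measure)"
    if [measurable]: "u \<in> borel_measurable borel" for u :: "'n rvec \<Rightarrow> ennreal"
  proof -
    have "(\<lambda>x. u (x /\<^sub>R norm x)) \<in> borel_measurable (lborel :: 'n rvec measure)" by measurable
    then show ?thesis by (rule borel_measurable_times_ennreal) (intro borel_measurable_indicator, simp)
  qed
  from assms show "emeasure lborel (?E u) = ?I u"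
  proof (induction u rule: borel_measurable_induct)
    case (cong f g)
    then show ?case by simp
  next
    case (set A)
    have "?E (indicator A) = {x \<in> ball 0 1 - {0}. x /\<^sub>R norm x \<in> A}"
      by (auto simp: indicator_def power_less_one_iff ennreal_less_one_iff split: if_splits)
    moreover have "(\<integral>\<^sup>+x\<in>ball 0 1 - {0}. indicator A (x /\<^sub>R norm x) \<partial>lborel)
        = (\<integral>\<^sup>+x. indicator {x \<in> ball 0 1 - {0}. x /\<^sub>R norm x \<in> A} x \<partial>lborel)"
      by (intro nn_integral_cong) (auto simp: indicator_def)
    moreover have "{x \<in> ball 0 1 - {0}. x /\<^sub>R norm x \<in> A} \<in> sets (lborel :: 'n rvec measure)"
      using set by measurable
    ultimately show ?case by simp
  next
    case (mult u c)
    note [measurable] = mult(2)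
    show ?case
    proof (cases "c = 0")
      case True
      then show ?thesis by simp
    next
      case False
      obtain r where r: "c = ennreal r" "r > 0" using mult(1) False by (cases c) (auto simp: ennreal_eq_0_iff not_le)
      \<comment> \<open>Multiplying \<open>u\<close> by \<open>c\<close> dilates the star-shaped set
        by the \<open>n\<close>-th root of \<open>c\<close>, hence multiplies its volume by
        \<open>c\<close>.\<close>
      let ?s = "root ?n r"
      have s: "?s > 0" using r by simp
      have "x \<in> ?E (\<lambda>x. c * u x) \<longleftrightarrow> (1 / ?s) *\<^sub>R x \<in> ?E u" for x
      proof -
        have "inverse (norm ((1 / ?s) *\<^sub>R x)) * (1 / ?s) = inverse (norm x)" using s by (simp add: field_simps)
        then have dir: "((1 / ?s) *\<^sub>R x) /\<^sub>R norm ((1 / ?s) *\<^sub>R x) = x /\<^sub>R norm x" by (simp only: scaleR_scaleR)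
        have nm: "norm ((1 / ?s) *\<^sub>R x) = norm x / ?s" using s by simp
        have z: "(1 / ?s) *\<^sub>R x = 0 \<longleftrightarrow> x = 0" using s by simp
        have "ennreal (norm x ^ ?n) < ennreal r * u (x /\<^sub>R norm x) \<longleftrightarrow> ennreal ((norm x / ?s) ^ ?n) < u (x /\<^sub>R norm x)"
          by (rule ennreal_power_less_iff_scaled) (use r in auto)
        then show ?thesis unfolding mem_Collect_eq nm dir[unfolded nm] z r(1) by blast
      qed
      then have "?E (\<lambda>x. c * u x) = {x. (1 / ?s) *\<^sub>R x \<in> ?E u}" by blast
      then have "emeasure lborel (?E (\<lambda>x. c * u x)) = c * emeasure lborel (?E u)"
        using emeasure_lborel_scaleR[OF E[OF mult(2)] s] r by (simp add: real_root_pow_pos2)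
      then show ?thesis
      proof -
        from nn_integral_cmult[OF I[OF mult(2)], of c] \<open>emeasure lborel (?E (\<lambda>x. c * u x)) = c * emeasure lborel (?E u)\<close>
        show ?thesis by (simp add: mult.IH mult.assoc)
      qed
    qed
  next
    case (add u v)
    have d: "u y = 0 \<or> v y = 0" for y
      using \<open>\<And>x. x \<in> space borel \<Longrightarrow> u x = 0 \<or> v x = 0\<close> by simp
    have mem: "ennreal a < v y + u y \<longleftrightarrow> ennreal a < v y \<or> ennreal a < u y" for a y using d[of y] by auto
    have dis: "\<not> (ennreal a < v y \<and> ennreal a < u y)" for a y using d[of y] by auto
    have "?E (\<lambda>x. v x + u x) = ?E v \<union> ?E u" unfolding mem by blast
    moreover have "?E v \<inter> ?E u = {}" using dis by blast
    ultimately have "emeasure lborel (?E (\<lambda>x. v x + u x)) = emeasure lborel (?E v) + emeasure lborel (?E u)"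
      using E[OF \<open>u \<in> borel_measurable borel\<close>] E[OF \<open>v \<in> borel_measurable borel\<close>]
      by (simp add: plus_emeasure)
    also have "\<dots> = ?I (\<lambda>x. v x + u x)"
      using nn_integral_add[OF I[OF \<open>v \<in> borel_measurable borel\<close>] I[OF \<open>u \<in> borel_measurable borel\<close>]]
      by (simp only: add.IH distrib_right)
    finally show ?case .
  next
    case (seq U)
    note [measurable] = seq(1)
    have mono: "U i y \<le> U j y" if "i \<le> j" for i j y
      using \<open>incseq U\<close> that by (auto simp: incseq_def le_fun_def)
    have inc: "incseq (\<lambda>i. ?E (U i))"
      unfolding incseq_def
    proof (intro allI impI subsetI)
      fix i j x assume "i \<le> j" "x \<in> ?E (U i)"
      then show "x \<in> ?E (U j)" using less_le_trans[OF _ mono[OF \<open>i \<le> j\<close>]] by blast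
    qed
    have "ennreal a < (SUP i. U i y) \<longleftrightarrow> (\<exists>i. ennreal a < U i y)" for a y by (simp add: less_SUP_iff)
    then have "?E (\<lambda>x. SUP i. U i x) = (\<Union>i. ?E (U i))" by blast
    then have "emeasure lborel (?E (\<lambda>x. SUP i. U i x)) = (SUP i. emeasure lborel (?E (U i)))"
      using SUP_emeasure_incseq[of "\<lambda>i. ?E (U i)" lborel, OF _ inc] E[OF \<open>\<And>i. U i \<in> borel_measurable borel\<close>]
      by (simp add: image_subset_iff)
    also have "\<dots> = (SUP i. ?I (U i))" by (simp add: seq.IH)
    also have "\<dots> = (\<integral>\<^sup>+x. (SUP i. U i (x /\<^sub>R norm x) * indicator (ball 0 1 - {0}) x) \<partial>lborel)"
      using I[OF \<open>\<And>i. U i \<in> borel_measurable borel\<close>]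
      by (intro nn_integral_monotone_convergence_SUP[symmetric])
        (auto simp: incseq_def le_fun_def intro!: mult_right_mono mono)
    also have "\<dots> = ?I (\<lambda>x. SUP i. U i x)"
      by (intro nn_integral_cong) (simp add: SUP_mult_right_ennreal)
    finally show ?case by (simp add: image_comp SUP_apply)
  qed
qed

section \<open>Lattice point asymptotics for a positive density of degree \<open>-n\<close>\<close>

locale homogeneous_density =
  fixes F :: "'n::finite rvec \<Rightarrow> real"
  assumes cont: "continuous_on (- {0}) F"
    and pos: "\<And>x. x \<noteq> 0 \<Longrightarrow> 0 < F x"
    and hom: "\<And>t x. 0 < t \<Longrightarrow> x \<noteq> 0 \<Longrightarrow> F (t *\<^sub>R x) = F x / t ^ CARD('n)"
begin

lemma normalized: "x \<noteq> 0 \<Longrightarrow> F x = F (x /\<^sub>R norm x) / norm x ^ CARD('n)"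
  using hom[of "norm x" "x /\<^sub>R norm x"] by simp

lemma sphere_bound: obtains M where "0 < M" "\<And>x. x \<noteq> 0 \<Longrightarrow> F x \<le> M / norm x ^ CARD('n)"
proof -
  have "compact (F ` sphere 0 1)"
    by (intro compact_continuous_image continuous_on_subset[OF cont]) auto
  then obtain M where M: "\<And>y. y \<in> F ` sphere 0 1 \<Longrightarrow> norm y \<le> M"
    using compact_imp_bounded bounded_iff by metis
  have "F x \<le> (\<bar>M\<bar> + 1) / norm x ^ CARD('n)" if "x \<noteq> 0" for x
  proof -
    have "F (x /\<^sub>R norm x) \<le> \<bar>M\<bar> + 1" using M[of "F (x /\<^sub>R norm x)"] that by force
    then show ?thesis by (subst normalized[OF that]) (rule divide_right_mono, auto)
  qed
  then show ?thesis using that[of "\<bar>M\<bar> + 1"] by simp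
qed

lemma level_bounded: "l > 0 \<Longrightarrow> \<exists>R>0. \<forall>x. x \<noteq> 0 \<longrightarrow> F x \<ge> l \<longrightarrow> norm x \<le> R"
proof -
  assume l: "l > 0"
  obtain M where M: "0 < M" "\<And>x. x \<noteq> 0 \<Longrightarrow> F x \<le> M / norm x ^ CARD('n)" by (rule sphere_bound, rule that)
  \<comment> \<open>Outside the unit ball \<open>norm x\<close> is at most its \<open>n\<close>-th
    power, so \<open>M / norm x\<close> already bounds \<open>F x\<close>.\<close>
  have "norm x \<le> max 1 (M / l)" if x: "x \<noteq> 0" "F x \<ge> l" for x
  proof (rule ccontr)
    assume "\<not> norm x \<le> max 1 (M / l)"
    then have n: "norm x > 1" "norm x > M / l" by auto
    have "norm x ^ 1 \<le> norm x ^ CARD('n)" using n(1) by (intro power_increasing) auto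
    then have "M / norm x ^ CARD('n) \<le> M / norm x" using M(1) n(1) by (intro divide_left_mono mult_pos_pos) auto
    also have "\<dots> < l" using n l by (subst pos_divide_less_eq) (auto simp: field_simps)
    finally show False using M(2)[OF x(1)] x(2) by linarith
  qed
  then show ?thesis by (intro exI[of _ "max 1 (M / l)"]) auto
qed

text \<open>Dividing by \<open>norm x\<close> turns a displacement \<open>d\<close> into
  \<open>d / norm x\<close>. Uniform continuity of \<open>F\<close> on an annulus, together with its
  positive minimum on the sphere, converts this into a relative error. The one-sided bound serves
  both counts below, with lattice point and cell point exchanged.\<close>

lemma slowly_varying:
  assumes e: "0 < \<epsilon>" "\<epsilon> < 1"
  shows "\<exists>R>0. \<forall>x y. norm x \<ge> R \<longrightarrow> norm (x - y) \<le> d \<longrightarrow> y \<noteq> 0 \<and> F y \<ge> (1 - \<epsilon>) * F x"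
proof -
  let ?K = "{v :: 'n rvec. 1/2 \<le> norm v \<and> norm v \<le> 2}"
  have K: "compact ?K"
  proof -
    have "?K = cball 0 2 - ball 0 (1/2)" by auto
    then show ?thesis by (metis compact_cball compact_diff open_ball)
  qed
  have Kc: "continuous_on ?K F" by (rule continuous_on_subset[OF cont]) auto
  have uc: "uniformly_continuous_on ?K F" by (rule compact_uniformly_continuous[OF Kc K])
  have "sphere (0 :: 'n rvec) 1 \<noteq> {}" by simp
  then obtain u0 :: "'n rvec" where u0: "norm u0 = 1" "\<And>u. norm u = 1 \<Longrightarrow> F u0 \<le> F u"
    using continuous_attains_inf[OF compact_sphere, of 0 1 F] continuous_on_subset[OF cont, of "sphere 0 1"]
    by fastforce
  define m where "m = F u0"
  have m: "m > 0" unfolding m_def using u0(1) by (intro pos) auto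
  have "\<epsilon> * m > 0" using m e by simp
  from uc[unfolded uniformly_continuous_on_def, THEN spec, THEN mp, OF this]
  obtain \<delta> where \<delta>: "\<delta> > 0" "\<forall>u\<in>?K. \<forall>v\<in>?K. dist v u < \<delta> \<longrightarrow> dist (F v) (F u) < \<epsilon> * m"
    by blast
  \<comment> \<open>The second term keeps the rescaled \<open>y\<close> within distance 1/2 of the
    sphere, hence in the annulus \<open>?K\<close>; the third makes the rescaled displacement
    smaller than \<delta>.\<close>
  define R where "R = max 1 (max (2 * \<bar>d\<bar> + 1) (\<bar>d\<bar> / \<delta> + 1))"
  have "y \<noteq> 0 \<and> F y \<ge> (1 - \<epsilon>) * F x" if x: "norm x \<ge> R" and y: "norm (x - y) \<le> d" for x y
  proof -
    let ?r = "norm x"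
    have r: "?r \<ge> 1" "?r > 2 * \<bar>d\<bar>" "?r > \<bar>d\<bar> / \<delta>"
      using x unfolding R_def max.bounded_iff by linarith+
    let ?u = "x /\<^sub>R ?r" and ?v = "y /\<^sub>R ?r"
    have x0: "x \<noteq> 0" using r(1) by auto
    then have nu: "norm ?u = 1" by simp
    have duv: "norm (?v - ?u) \<le> \<bar>d\<bar> / ?r"
    proof -
      have "norm (?v - ?u) = norm (x - y) / ?r"
        by (simp add: scaleR_diff_right[symmetric] norm_minus_commute divide_inverse mult.commute)
      then show ?thesis using y r by (simp add: divide_right_mono)
    qed
    have rp: "?r > 0" using r(1) by linarith
    have "\<bar>d\<bar> / ?r \<le> 1/2" using pos_divide_le_eq[OF rp, of "\<bar>d\<bar>" "1/2"] r(2) by linarith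
    moreover have "\<bar>d\<bar> / ?r < \<delta>"
      using pos_divide_less_eq[OF rp, of "\<bar>d\<bar>" \<delta>] pos_divide_less_eq[OF \<delta>(1), of "\<bar>d\<bar>" ?r] r(3)
      by (simp only: mult.commute)
    ultimately have h: "norm (?v - ?u) \<le> 1/2" "norm (?v - ?u) < \<delta>" using duv by linarith+
    have "norm ?v \<ge> norm ?u - norm (?v - ?u)" using norm_triangle_ineq2[of ?u "?u - ?v"] by (simp add: norm_minus_commute)
    moreover have "norm ?v \<le> norm ?u + norm (?v - ?u)" by (metis add_diff_cancel_left' diff_add_cancel norm_triangle_ineq add.commute)
    ultimately have v: "?v \<in> ?K" "?u \<in> ?K" using h nu by auto
    have "dist (F ?v) (F ?u) < \<epsilon> * m" by (rule \<delta>(2)[THEN bspec, OF v(2), THEN bspec, OF v(1), THEN mp]) (use h in \<open>simp add: dist_norm\<close>)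
    moreover have "\<epsilon> * m \<le> \<epsilon> * F ?u" using u0(2)[OF nu] e by (auto simp: m_def)
    ultimately have uv: "F ?v \<ge> (1 - \<epsilon>) * F ?u" by (simp add: dist_real_def algebra_simps)
    have y0: "y \<noteq> 0" using v(1) by auto
    have Fx: "F x = F ?u / ?r ^ CARD('n)" using hom[of ?r ?u] x0 by simp
    have Fy: "F y = F ?v / ?r ^ CARD('n)" using hom[of ?r ?v] x0 y0 by simp
    have "(1 - \<epsilon>) * F x \<le> F y" unfolding Fx Fy using uv divide_right_mono[OF uv, of "?r ^ CARD('n)"] by simp
    then show ?thesis using y0 by simp
  qed
  then show ?thesis by (intro exI[of _ R]) (auto simp: R_def)
qed

definition vol :: real where "vol = measure lborel {x. x \<noteq> 0 \<and> F x \<ge> 1}"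

lemma level_borel: "{x. x \<noteq> 0 \<and> F x \<ge> l} \<in> sets borel"
proof -
  have "(\<lambda>x. if x \<in> - {0} then F x else 0) \<in> borel_measurable borel"
    by (intro borel_measurable_continuous_on_if cont) auto
  from borel_measurable_le[OF borel_measurable_const this, of l]
  have "{x. l \<le> (if x \<in> - {0} then F x else 0)} \<in> sets borel" by simp
  then have "{x. l \<le> (if x \<in> - {0} then F x else 0)} - {0} \<in> sets borel"
    using sets.Diff[of _ borel "{0}"] by simp
  also have "{x. l \<le> (if x \<in> - {0} then F x else 0)} - {0} = {x. x \<noteq> 0 \<and> F x \<ge> l}" by auto
  finally show ?thesis .
qed

lemma level_finite: "l > 0 \<Longrightarrow> emeasure lborel {x. x \<noteq> 0 \<and> F x \<ge> l} < \<infinity>"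
proof -
  assume "l > 0"
  then obtain R where "\<And>x. x \<noteq> 0 \<Longrightarrow> F x \<ge> l \<Longrightarrow> norm x \<le> R" using level_bounded by blast
  then have "{x. x \<noteq> 0 \<and> F x \<ge> l} \<subseteq> cball 0 R" by auto
  then show ?thesis by (meson bounded_cball bounded_subset emeasure_bounded_finite)
qed

text \<open>In degree \<open>-n\<close> the dilation by the \<open>n\<close>-th root of
  \<open>1 / l\<close> carries \<open>{F \<ge> 1}\<close> onto \<open>{F \<ge> l}\<close>. The
  resulting volume, of order \<open>1 / l\<close>, is what produces a multiple of the harmonic
  sequence.\<close>

lemma emeasure_level: 
  assumes l: "l > 0"
  shows "emeasure lborel {x. x \<noteq> 0 \<and> F x \<ge> l} = ennreal (vol / l)"
proof -
  let ?n = "CARD('n)" and ?c = "root CARD('n) (1 / l)"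
  have c: "?c > 0" "?c ^ ?n = 1 / l" using l by (auto simp: real_root_pow_pos2)
  have "x \<noteq> 0 \<and> F x \<ge> l \<longleftrightarrow> (1 / ?c) *\<^sub>R x \<in> {x. x \<noteq> 0 \<and> F x \<ge> 1}" for x
  proof (cases "x = 0")
    case False
    have "F ((1 / ?c) *\<^sub>R x) = F x * ?c ^ ?n" using hom[of "1 / ?c" x] c False by (simp add: power_divide)
    also have "\<dots> = F x / l" by (simp add: c(2))
    finally have FF: "F ((1 / ?c) *\<^sub>R x) = F x / l" .
    have z: "(1 / ?c) *\<^sub>R x = 0 \<longleftrightarrow> x = 0" using c(1) by simp
    show ?thesis unfolding mem_Collect_eq FF z using l False by simp
  qed simp
  then have "{x. x \<noteq> 0 \<and> F x \<ge> l} = {x. (1 / ?c) *\<^sub>R x \<in> {x. x \<noteq> 0 \<and> F x \<ge> 1}}" by blast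
  then have "emeasure lborel {x. x \<noteq> 0 \<and> F x \<ge> l} = ennreal (?c ^ ?n) * emeasure lborel {x. x \<noteq> 0 \<and> F x \<ge> 1}"
    using emeasure_lborel_scaleR[OF level_borel c(1), of 1] by simp
  also have "emeasure lborel {x. x \<noteq> 0 \<and> F x \<ge> 1} = ennreal vol"
    unfolding vol_def using level_finite[of 1] by (intro emeasure_eq_ennreal_measure) auto
  finally show ?thesis using c(2) l by (simp add: ennreal_mult[symmetric] vol_def)
qed

text \<open>The locale says nothing about \<open>F 0\<close>; the value 1 at the origin keeps all
  weights positive, and a single point does not change the asymptotics.\<close>

definition lattice_weight :: "'n ivec \<Rightarrow> real" where
  "lattice_weight k = (if k = 0 then 1 else F (real_of_lattice k))"

lemma lattice_weight_pos: "0 < lattice_weight k"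
  by (simp add: lattice_weight_def pos)

lemma lattice_weight_finite: "l > 0 \<Longrightarrow> finite {k. lattice_weight k \<ge> l}"
proof -
  assume "l > 0"
  then obtain R where R: "R > 0" "\<And>x. x \<noteq> 0 \<Longrightarrow> F x \<ge> l \<Longrightarrow> norm x \<le> R" using level_bounded by blast
  have "norm (real_of_lattice k) \<le> R" if "lattice_weight k \<ge> l" for k
    using that R by (cases "k = 0") (auto simp: lattice_weight_def)
  then have "{k. lattice_weight k \<ge> l} \<subseteq> {k. norm (real_of_lattice k) \<le> R}" by auto
  then show ?thesis using finite_lattice_bounded finite_subset by blast
qed

text \<open>Each lattice point is the corner of a cell of volume 1. Far from the origin the cells of
  the counted points lie in \<open>{F \<ge> (1 - \<epsilon>) * l}\<close>; \<open>C\<close> is the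
  number of points in the remaining ball.\<close>

lemma count_upper:
  assumes e: "0 < \<epsilon>" "\<epsilon> < 1"
  shows "\<exists>C. \<forall>l>0. real (card {k. lattice_weight k \<ge> l}) \<le> C + vol / ((1 - \<epsilon>) * l)"
proof -
  obtain R where R: "R > 0" "\<And>x y. norm x \<ge> R \<Longrightarrow> norm (x - y) \<le> real CARD('n) \<Longrightarrow> y \<noteq> 0 \<and> F y \<ge> (1 - \<epsilon>) * F x"
    using slowly_varying[OF e, of "real CARD('n)"] by blast
  let ?B = "{k :: 'n ivec. norm (real_of_lattice k) \<le> R}"
  have "real (card {k. lattice_weight k \<ge> l}) \<le> real (card ?B) + vol / ((1 - \<epsilon>) * l)" if l: "l > 0" for l
  proof -
    let ?N = "{k. lattice_weight k \<ge> l}" and ?S = "{k. lattice_weight k \<ge> l} - ?B"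
    have fS: "finite ?S" using lattice_weight_finite[OF l] by simp
    have "{x. lattice_floor x \<in> ?S} \<subseteq> {x. x \<noteq> 0 \<and> F x \<ge> (1 - \<epsilon>) * l}"
    proof
      fix x assume "x \<in> {x. lattice_floor x \<in> ?S}"
      then have k: "lattice_weight (lattice_floor x) \<ge> l" "norm (real_of_lattice (lattice_floor x)) > R" by auto
      then have "real_of_lattice (lattice_floor x) \<noteq> 0" using R(1) by auto
      then have Fk: "F (real_of_lattice (lattice_floor x)) \<ge> l"
        using k(1) by (auto simp: lattice_weight_def split: if_splits)
      have "x \<noteq> 0 \<and> F x \<ge> (1 - \<epsilon>) * F (real_of_lattice (lattice_floor x))"
        using k(2) lattice_floor_dist[of x] by (intro R(2)) (auto simp: norm_minus_commute)
      moreover have "(1 - \<epsilon>) * F (real_of_lattice (lattice_floor x)) \<ge> (1 - \<epsilon>) * l"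
        using Fk e by (intro mult_left_mono) auto
      ultimately show "x \<in> {x. x \<noteq> 0 \<and> F x \<ge> (1 - \<epsilon>) * l}" by auto
    qed
    then have "emeasure lborel {x. lattice_floor x \<in> ?S} \<le> emeasure lborel {x. x \<noteq> 0 \<and> F x \<ge> (1 - \<epsilon>) * l}"
      using level_borel by (intro emeasure_mono) auto
    then have "ennreal (real (card ?S)) \<le> ennreal (vol / ((1 - \<epsilon>) * l))"
      using emeasure_lattice_cells[OF fS] emeasure_level[of "(1 - \<epsilon>) * l"] e l
      by (simp add: ennreal_of_nat_eq_real_of_nat)
    then have S: "real (card ?S) \<le> vol / ((1 - \<epsilon>) * l)"
      using e l by (subst (asm) ennreal_le_iff) (auto simp: vol_def)
    have "card ?N \<le> card (?B \<union> ?S)"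
      using fS finite_lattice_bounded by (intro card_mono) auto
    also have "\<dots> \<le> card ?B + card ?S" by (rule card_Un_le)
    finally show ?thesis using S by linarith
  qed
  then show ?thesis by blast
qed

text \<open>Conversely, a fixed ball and the cells of the counted points cover
  \<open>{F \<ge> l / (1 - \<epsilon>)}\<close>.\<close>

lemma count_lower:
  assumes e: "0 < \<epsilon>" "\<epsilon> < 1"
  shows "\<exists>C. \<forall>l>0. vol * (1 - \<epsilon>) / l \<le> C + real (card {k. lattice_weight k \<ge> l})"
proof -
  obtain R where R: "R > 0" "\<And>x y. norm x \<ge> R \<Longrightarrow> norm (x - y) \<le> real CARD('n) \<Longrightarrow> y \<noteq> 0 \<and> F y \<ge> (1 - \<epsilon>) * F x"
    using slowly_varying[OF e, of "real CARD('n)"] by blast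
  have "vol * (1 - \<epsilon>) / l \<le> measure lborel (cball (0 :: 'n rvec) R) + real (card {k. lattice_weight k \<ge> l})" if l: "l > 0" for l
  proof -
    let ?N = "{k. lattice_weight k \<ge> l}"
    note fN = lattice_weight_finite[OF l]
    have l': "l / (1 - \<epsilon>) > 0" using l e by simp
    have "{x. x \<noteq> 0 \<and> F x \<ge> l / (1 - \<epsilon>)} \<subseteq> cball 0 R \<union> {x. lattice_floor x \<in> ?N}"
    proof
      fix x assume x: "x \<in> {x. x \<noteq> 0 \<and> F x \<ge> l / (1 - \<epsilon>)}"
      show "x \<in> cball 0 R \<union> {x. lattice_floor x \<in> ?N}"
      proof (cases "norm x \<le> R")
        case False
        then have "real_of_lattice (lattice_floor x) \<noteq> 0 \<and> F (real_of_lattice (lattice_floor x)) \<ge> (1 - \<epsilon>) * F x"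
          using lattice_floor_dist[of x] by (intro R(2)) auto
        moreover have "(1 - \<epsilon>) * F x \<ge> (1 - \<epsilon>) * (l / (1 - \<epsilon>))" using x e by (intro mult_left_mono) auto
        ultimately show ?thesis using e by (auto simp: lattice_weight_def)
      qed simp
    qed
    then have "emeasure lborel {x. x \<noteq> 0 \<and> F x \<ge> l / (1 - \<epsilon>)} \<le> emeasure lborel (cball 0 R \<union> {x. lattice_floor x \<in> ?N})"
      using lattice_cells_borel[OF fN] by (intro emeasure_mono) auto
    also have "\<dots> \<le> emeasure lborel (cball (0 :: 'n rvec) R) + emeasure lborel {x. lattice_floor x \<in> ?N}"
      using lattice_cells_borel[OF fN] by (intro emeasure_subadditive) auto
    also have "\<dots> = ennreal (measure lborel (cball (0 :: 'n rvec) R) + real (card ?N))"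
      using emeasure_lattice_cells[OF fN] emeasure_lborel_cball_finite[of "0 :: 'n rvec" R]
      by (simp add: ennreal_of_nat_eq_real_of_nat ennreal_plus emeasure_eq_ennreal_measure less_top)
    finally have "ennreal (vol / (l / (1 - \<epsilon>))) \<le> ennreal (measure lborel (cball (0 :: 'n rvec) R) + real (card ?N))"
      by (simp only: emeasure_level[OF l'])
    then have "vol / (l / (1 - \<epsilon>)) \<le> measure lborel (cball (0 :: 'n rvec) R) + real (card ?N)"
      by (subst (asm) ennreal_le_iff) auto
    then show ?thesis by (simp add: divide_divide_eq_right mult.commute)
  qed
  then show ?thesis by blast
qed

lemma vol_nonneg: "0 \<le> vol"
  by (simp add: vol_def)

lemma count_asymp: "((\<lambda>l. l * real (card {k. lattice_weight k \<ge> l})) \<longlongrightarrow> vol) (at_right 0)"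
proof (rule order_tendstoI)
  fix a assume a: "a < vol"
  \<comment> \<open>Small enough that \<open>vol * \<epsilon> < vol - a\<close>; the summand 1 in
    the denominator covers the case \<open>vol = 0\<close>.\<close>
  define \<epsilon> where "\<epsilon> = min (1/2) ((vol - a) / (2 * (vol + 1)))"
  have e: "0 < \<epsilon>" "\<epsilon> < 1" using a vol_nonneg by (auto simp: \<epsilon>_def min_def)
  have "vol * \<epsilon> \<le> vol * ((vol - a) / (2 * (vol + 1)))"
    by (intro mult_left_mono vol_nonneg) (simp add: \<epsilon>_def)
  also have "\<dots> = (vol - a) * (vol / (2 * (vol + 1)))" by simp
  also have "\<dots> < (vol - a) * 1"
    using a vol_nonneg by (intro mult_strict_left_mono) (auto simp: field_simps)
  finally have "vol * \<epsilon> < vol - a" by simp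
  then have ae: "a < vol * (1 - \<epsilon>)" by (simp add: algebra_simps)
  obtain C where C: "\<And>l. l > 0 \<Longrightarrow> vol * (1 - \<epsilon>) / l \<le> C + real (card {k. lattice_weight k \<ge> l})"
    using count_lower[OF e] by blast
  have "((\<lambda>l. vol * (1 - \<epsilon>) - C * l) \<longlongrightarrow> vol * (1 - \<epsilon>) - C * 0) (at_right 0)" by (intro tendsto_intros)
  then have "\<forall>\<^sub>F l in at_right 0. a < vol * (1 - \<epsilon>) - C * l" using ae by (intro order_tendstoD(1)) auto
  moreover have "\<forall>\<^sub>F l::real in at_right 0. l > 0" by (simp add: eventually_at_right_less)
  ultimately show "\<forall>\<^sub>F l in at_right 0. a < l * real (card {k. lattice_weight k \<ge> l})"
  proof eventually_elim
    case (elim l)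
    have "vol * (1 - \<epsilon>) = vol * (1 - \<epsilon>) / l * l" using elim by simp
    also have "\<dots> \<le> (C + real (card {k. lattice_weight k \<ge> l})) * l"
      using C[of l] elim by (intro mult_right_mono) auto
    also have "\<dots> = C * l + l * real (card {k. lattice_weight k \<ge> l})" by (simp add: algebra_simps)
    finally show ?case using elim(1) by linarith
  qed
next
  fix a assume a: "vol < a"
  \<comment> \<open>With this choice \<open>a * (1 - \<epsilon>)\<close> is the midpoint of
    \<open>vol\<close> and \<open>a\<close>.\<close>
  define \<epsilon> where "\<epsilon> = (a - vol) / (2 * a)"
  have a0: "a > 0" using a vol_nonneg by linarith
  have e: "0 < \<epsilon>" "\<epsilon> < 1" using a a0 vol_nonneg by (auto simp: \<epsilon>_def field_simps)
  have "a * (1 - \<epsilon>) = (a + vol) / 2" using a0 by (simp add: \<epsilon>_def field_simps)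
  then have "vol < a * (1 - \<epsilon>)" using a by simp
  then have ae: "vol / (1 - \<epsilon>) < a" using e by (simp add: field_simps)
  obtain C where C: "\<And>l. l > 0 \<Longrightarrow> real (card {k. lattice_weight k \<ge> l}) \<le> C + vol / ((1 - \<epsilon>) * l)"
    using count_upper[OF e] by blast
  have "((\<lambda>l. vol / (1 - \<epsilon>) + C * l) \<longlongrightarrow> vol / (1 - \<epsilon>) + C * 0) (at_right 0)" by (intro tendsto_intros)
  then have "\<forall>\<^sub>F l in at_right 0. vol / (1 - \<epsilon>) + C * l < a" using ae by (intro order_tendstoD(2)) auto
  moreover have "\<forall>\<^sub>F l::real in at_right 0. l > 0" by (simp add: eventually_at_right_less)
  ultimately show "\<forall>\<^sub>F l in at_right 0. l * real (card {k. lattice_weight k \<ge> l}) < a"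
  proof eventually_elim
    case (elim l)
    have "l * real (card {k. lattice_weight k \<ge> l}) \<le> l * (C + vol / ((1 - \<epsilon>) * l))"
      using C[of l] elim by (intro mult_left_mono) auto
    also have "\<dots> = vol / (1 - \<epsilon>) + C * l" using elim e by (simp add: field_simps)
    finally show ?case using elim by simp
  qed
qed

text \<open>Inversion of the counting function. At level \<open>\<mu> j\<close> at least the first
  \<open>j + 1\<close> points are counted; at level \<open>c * \<mu> j\<close> with
  \<open>c > 1\<close> at most \<open>j\<close> of them are. The factor \<open>c\<close> is needed
  because several points may share the value \<open>\<mu> j\<close>.\<close>

lemma sorted_lattice_weight:
  assumes b: "bij b" and dec: "decseq (\<lambda>j. lattice_weight (b j))"
  shows "(\<lambda>j. lattice_weight (b j) * real (j + 1)) \<longlonglongrightarrow> vol"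
proof -
  define \<mu> where "\<mu> j = lattice_weight (b j)" for j
  define N where "N l = {k. lattice_weight k \<ge> l}" for l
  have mupos: "0 < \<mu> j" for j by (simp add: \<mu>_def lattice_weight_pos)
  have mu_dec: "\<mu> j \<le> \<mu> i" if "i \<le> j" for i j using dec that by (simp add: \<mu>_def decseq_def)
  have inj: "inj b" using b by (simp add: bij_is_inj)
  have mu0: "\<mu> \<longlonglongrightarrow> 0"
  proof (rule decreasing_tendsto)
    show "\<forall>\<^sub>F n in sequentially. 0 \<le> \<mu> n" using mupos by (simp add: less_imp_le)
    fix x :: real assume "0 < x"
    have "finite (b -` N x)" unfolding N_def using lattice_weight_finite[OF \<open>0 < x\<close>] inj by (rule finite_vimageI)
    then have "finite {j. \<mu> j \<ge> x}" by (simp add: vimage_def N_def \<mu>_def)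
    then have "\<forall>\<^sub>F j in sequentially. j \<notin> {j. \<mu> j \<ge> x}"
      using eventually_cofinite[of "\<lambda>j. j \<notin> {j. \<mu> j \<ge> x}"] by (simp add: cofinite_eq_sequentially)
    then show "\<forall>\<^sub>F n in sequentially. \<mu> n < x" by (simp add: not_le)
  qed
  have lim: "(\<lambda>j. (c * \<mu> j) * real (card (N (c * \<mu> j)))) \<longlonglongrightarrow> vol" if c: "c > 0" for c
  proof -
    have "(\<lambda>j. c * \<mu> j) \<longlonglongrightarrow> c * 0" by (intro tendsto_intros mu0)
    then have "filterlim (\<lambda>j. c * \<mu> j) (at_right 0) sequentially"
      using mupos c by (intro tendsto_imp_filterlim_at_right) (auto intro!: always_eventually mult_pos_pos)
    from filterlim_compose[OF count_asymp this] show ?thesis by (simp add: N_def)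
  qed
  have up: "\<mu> j * real (j + 1) \<le> (1 * \<mu> j) * real (card (N (1 * \<mu> j)))" for j
  proof -
    have "b ` {..j} \<subseteq> N (\<mu> j)" using mu_dec by (auto simp: N_def \<mu>_def)
    then have "card (b ` {..j}) \<le> card (N (\<mu> j))"
      using lattice_weight_finite[OF mupos] by (intro card_mono) (auto simp: N_def)
    then have "j + 1 \<le> card (N (\<mu> j))" using inj by (simp add: card_image inj_on_subset)
    then have "real (j + 1) \<le> real (card (N (\<mu> j)))" by (rule of_nat_mono)
    then show ?thesis using mupos[of j] by (simp add: mult_left_mono)
  qed
  have low: "(c * \<mu> j) * real (card (N (c * \<mu> j))) \<le> c * (\<mu> j * real (j + 1))" if c: "c > 1" for c j
  proof -
    have "N (c * \<mu> j) \<subseteq> b ` {..<j}"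
    proof
      fix k assume k: "k \<in> N (c * \<mu> j)"
      obtain i where i: "k = b i" using b by (metis bij_pointE)
      have "\<mu> j < c * \<mu> j" using c mupos[of j] by simp
      then have "\<mu> j < \<mu> i" using k i by (simp add: N_def \<mu>_def)
      then have "i < j" using mu_dec[of j i] by (meson not_le)
      then show "k \<in> b ` {..<j}" using i by simp
    qed
    then have "card (N (c * \<mu> j)) \<le> card (b ` {..<j})" by (intro card_mono) auto
    also have "\<dots> \<le> j" using card_image_le[of "{..<j}" b] by simp
    finally have "real (card (N (c * \<mu> j))) \<le> real (j + 1)" by simp
    then show ?thesis using mupos[of j] c by (simp add: mult_left_mono mult.assoc del: of_nat_add of_nat_Suc)
  qed
  have "(\<lambda>j. \<mu> j * real (j + 1)) \<longlonglongrightarrow> vol"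
  proof (rule order_tendstoI)
    fix a assume a: "vol < a"
    have "\<forall>\<^sub>F j in sequentially. (1 * \<mu> j) * real (card (N (1 * \<mu> j))) < a"
      by (rule order_tendstoD(2)[OF lim a]) simp
    then show "\<forall>\<^sub>F j in sequentially. \<mu> j * real (j + 1) < a"
      by eventually_elim (use up order_le_less_trans in blast)
  next
    fix a assume a: "a < vol"
    show "\<forall>\<^sub>F j in sequentially. a < \<mu> j * real (j + 1)"
    proof (cases "a \<le> 0")
      case True
      have "0 < \<mu> j * real (j + 1)" for j using mupos[of j] by simp
      then show ?thesis using True order_le_less_trans by (intro always_eventually) blast
    next
      case False
      \<comment> \<open>Here \<open>c * a\<close> is the midpoint of \<open>a\<close> and
        \<open>vol\<close>.\<close>
      define c where "c = (a + vol) / (2 * a)"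
      have c: "c > 1" "c * a < vol" using a False by (auto simp: c_def field_simps)
      have "\<forall>\<^sub>F j in sequentially. c * a < (c * \<mu> j) * real (card (N (c * \<mu> j)))"
        by (rule order_tendstoD(1)[OF lim c(2)]) (use c in simp)
      then show ?thesis
      proof eventually_elim
        case (elim j)
        then have "c * a < c * (\<mu> j * real (j + 1))" using low[OF c(1), of j] by linarith
        then show ?case using c(1) by simp
      qed
    qed
  qed
  then show ?thesis by (simp add: \<mu>_def)
qed

end

lemma infinite_ivec: "infinite (UNIV :: 'n::finite ivec set)"
proof
  assume "finite (UNIV :: 'n ivec set)"
  then have "finite ((\<lambda>k :: 'n ivec. k $ undefined) ` UNIV)" by (rule finite_imageI)
  moreover have "(\<lambda>k :: 'n ivec. k $ undefined) ` UNIV = UNIV"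
    by (auto intro!: image_eqI[of _ _ "\<chi> i. _"])
  ultimately show False using infinite_UNIV_int by simp
qed

subsection \<open>Integrals over the unit sphere\<close>

lemma sphere_direction_measurable:
  "(\<lambda>x :: 'n::finite rvec. x /\<^sub>R norm x) \<in> restrict_space lborel (ball 0 1 - {0}) \<rightarrow>\<^sub>M borel"
  by (intro measurable_restrict_space1) measurable

lemma nn_integral_sphere_measure:
  fixes u :: "'n::finite rvec \<Rightarrow> ennreal"
  assumes "u \<in> borel_measurable borel"
  shows "(\<integral>\<^sup>+x. u x \<partial>sphere_measure) = of_nat CARD('n) * (\<integral>\<^sup>+x\<in>ball 0 1 - {0}. u (x /\<^sub>R norm x) \<partial>lborel)"
proof -
  have "(\<integral>\<^sup>+x. u x \<partial>sphere_measure)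
    = of_nat CARD('n) * (\<integral>\<^sup>+x. u x \<partial>distr (restrict_space lborel (ball 0 1 - {0})) borel (\<lambda>x. x /\<^sub>R norm x))"
    unfolding sphere_measure_def using assms by (intro nn_integral_scale_measure) simp
  also have "(\<integral>\<^sup>+x. u x \<partial>distr (restrict_space lborel (ball 0 1 - {0})) borel (\<lambda>x. x /\<^sub>R norm x))
    = (\<integral>\<^sup>+x. u (x /\<^sub>R norm x) \<partial>restrict_space lborel (ball 0 1 - {0}))"
    by (rule nn_integral_distr[OF sphere_direction_measurable]) (simp add: assms)
  also have "\<dots> = (\<integral>\<^sup>+x\<in>ball 0 1 - {0}. u (x /\<^sub>R norm x) \<partial>lborel)"
    by (rule nn_integral_restrict_space) simp
  finally show ?thesis .
qed

lemma sets_sphere_measure [simp, measurable_cong]: "sets sphere_measure = sets borel"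
  by (simp add: sphere_measure_def)

text \<open>The measure lives on the whole space and is the image of the punctured ball under
  \<open>\<lambda>x. x /\<^sub>R norm x\<close>, which never takes the value 0. Homogeneous
  functions are controlled only off the origin, so this excludes their value at 0.\<close>

lemma AE_sphere_measure: "AE x in (sphere_measure :: 'n::finite rvec measure). x \<noteq> 0"
proof (rule AE_I')
  have "emeasure (sphere_measure :: 'n rvec measure) {0} = (\<integral>\<^sup>+x. indicator {0} x \<partial>(sphere_measure :: 'n rvec measure))"
    by simp
  also have "\<dots> = of_nat CARD('n) * (\<integral>\<^sup>+x\<in>ball 0 1 - {0 :: 'n rvec}. indicator {0} (x /\<^sub>R norm x) \<partial>lborel)"
    by (rule nn_integral_sphere_measure) simp
  also have "(\<integral>\<^sup>+x\<in>ball 0 1 - {0 :: 'n rvec}. indicator {0} (x /\<^sub>R norm x) \<partial>lborel) = (\<integral>\<^sup>+x. 0 \<partial>(lborel :: 'n rvec measure))"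
    by (intro nn_integral_cong) (auto simp: indicator_def)
  finally show "{0} \<in> null_sets (sphere_measure :: 'n rvec measure)" by (simp add: null_sets_def)
qed auto

lemma borel_measurable_punctured:
  fixes h :: "'n::finite rvec \<Rightarrow> 'b::real_normed_vector"
  assumes "continuous_on (- {0}) h"
  shows "h \<in> borel_measurable borel"
proof -
  have "(\<lambda>x. if x \<in> - {0} then h x else h 0) \<in> borel_measurable borel"
    by (intro borel_measurable_continuous_on_if assms) auto
  moreover have "(\<lambda>x. if x \<in> - {0} then h x else h 0) = h" by auto
  ultimately show ?thesis by simp
qed

context homogeneous_density
begin

text \<open>For \<open>z < 1\<close> the strict superlevel set contains
  \<open>{F \<ge> 1 / z}\<close>, of volume \<open>z * vol\<close>; now let \<open>z\<close> tend to
  1. The strict inequality is the one in \<open>emeasure_star_shaped\<close>.\<close>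

lemma emeasure_open_level: "emeasure lborel {x. x \<noteq> 0 \<and> F x > 1} = ennreal vol"
proof (rule antisym)
  have m: "{x. x \<noteq> 0 \<and> F x > 1} \<in> sets lborel"
  proof -
    have "{x. 1 < F x} \<in> sets borel"
      using borel_measurable_less[OF borel_measurable_const borel_measurable_punctured[OF cont], of 1] by simp
    then have "{x. 1 < F x} - {0} \<in> sets borel" using sets.Diff[of _ borel "{0}"] by simp
    moreover have "{x. 1 < F x} - {0} = {x. x \<noteq> 0 \<and> F x > 1}" by auto
    ultimately show ?thesis by simp
  qed
  have "emeasure lborel {x. x \<noteq> 0 \<and> F x > 1} \<le> emeasure lborel {x. x \<noteq> 0 \<and> F x \<ge> 1}"
    using level_borel by (intro emeasure_mono) auto
  then show le: "emeasure lborel {x. x \<noteq> 0 \<and> F x > 1} \<le> ennreal vol"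
    using emeasure_level[of 1] by simp
  then obtain v where v: "emeasure lborel {x. x \<noteq> 0 \<and> F x > 1} = ennreal v" "0 \<le> v"
    by (cases "emeasure lborel {x. x \<noteq> 0 \<and> F x > 1}") (auto simp: top_unique)
  have "z * vol \<le> v" if z: "0 < z" "z < 1" for z
  proof -
    have "{x. x \<noteq> 0 \<and> F x \<ge> 1 / z} \<subseteq> {x. x \<noteq> 0 \<and> F x > 1}"
    proof
      fix x assume "x \<in> {x. x \<noteq> 0 \<and> F x \<ge> 1 / z}"
      moreover have "1 < 1 / z" using z by simp
      ultimately show "x \<in> {x. x \<noteq> 0 \<and> F x > 1}" by auto
    qed
    then have "emeasure lborel {x. x \<noteq> 0 \<and> F x \<ge> 1 / z} \<le> ennreal v"
      unfolding v(1)[symmetric] by (rule emeasure_mono[OF _ m])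
    then have "ennreal (vol / (1 / z)) \<le> ennreal v" using emeasure_level[of "1 / z"] z by simp
    then show ?thesis using v(2) by (subst (asm) ennreal_le_iff) (auto simp: mult.commute)
  qed
  then have "vol \<le> v" by (rule field_le_mult_one_interval)
  then show "ennreal vol \<le> emeasure lborel {x. x \<noteq> 0 \<and> F x > 1}" using v by (simp add: ennreal_leI)
qed

text \<open>By homogeneity \<open>F x > 1\<close> means that \<open>norm x ^ n\<close> is less than
  the value of \<open>F\<close> in the direction of \<open>x\<close>: the level set is star-shaped,
  and \<open>emeasure_star_shaped\<close> plays the role of polar coordinates.\<close>

lemma
  shows integrable_sphere: "integrable sphere_measure F"
    and integral_sphere: "(LINT x|sphere_measure. F x) = real CARD('n) * vol"
proof -
  have Fm[measurable]: "F \<in> borel_measurable borel" by (rule borel_measurable_punctured[OF cont])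
  have "(\<integral>\<^sup>+x. ennreal (F x) \<partial>sphere_measure)
      = of_nat CARD('n) * (\<integral>\<^sup>+x\<in>ball 0 1 - {0}. ennreal (F (x /\<^sub>R norm x)) \<partial>lborel)"
    by (rule nn_integral_sphere_measure) measurable
  also have "(\<integral>\<^sup>+x\<in>ball 0 1 - {0}. ennreal (F (x /\<^sub>R norm x)) \<partial>lborel)
      = emeasure lborel {x. x \<noteq> 0 \<and> ennreal (norm x ^ CARD('n)) < ennreal (F (x /\<^sub>R norm x))}"
    by (rule emeasure_star_shaped[symmetric]) measurable
  also have "{x. x \<noteq> 0 \<and> ennreal (norm x ^ CARD('n)) < ennreal (F (x /\<^sub>R norm x))} = {x. x \<noteq> 0 \<and> F x > 1}"
  proof -
    have "ennreal (norm x ^ CARD('n)) < ennreal (F (x /\<^sub>R norm x)) \<longleftrightarrow> F x > 1" if "x \<noteq> 0" for x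
      using that normalized[OF that] by (simp add: ennreal_less_iff less_divide_eq)
    then show ?thesis by blast
  qed
  also have "of_nat CARD('n) * emeasure lborel {x. x \<noteq> 0 \<and> F x > 1} = ennreal (real CARD('n) * vol)"
    by (simp add: emeasure_open_level ennreal_mult vol_nonneg ennreal_of_nat_eq_real_of_nat)
  finally have nn: "(\<integral>\<^sup>+x. ennreal (F x) \<partial>sphere_measure) = ennreal (real CARD('n) * vol)" .
  have AE: "AE x in sphere_measure. 0 \<le> F x"
    using AE_sphere_measure by eventually_elim (use pos less_imp_le in blast)
  have "has_bochner_integral sphere_measure F (real CARD('n) * vol)"
    by (rule has_bochner_integral_nn_integral[OF _ AE _ nn]) (simp_all add: vol_nonneg)
  then show "integrable sphere_measure F" "(LINT x|sphere_measure. F x) = real CARD('n) * vol"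
    by (auto simp: has_bochner_integral_iff)
qed

lemma enumeration:
  obtains b where "bij b" "(\<lambda>j. lattice_weight (b j) * real (j + 1)) \<longlonglongrightarrow> vol"
  using decreasing_enumeration[OF infinite_ivec lattice_weight_pos lattice_weight_finite]
    sorted_lattice_weight by metis

end

subsection \<open>Diagonal operators over the lattice\<close>

lemma wop_reindex:
  fixes e :: "'k \<Rightarrow> 'a::complex_hilbert"
  assumes e: "onb e" and b: "bij b" and a: "\<And>k. cmod (a k) \<le> K"
  shows "wop e e a = wop (\<lambda>j. e (b j)) (\<lambda>j. e (b j)) (\<lambda>j. a (b j))"
proof (rule onb_blinfun_eqI[OF e])
  note o = onb_ortho_fam[OF e] and eb = onb_bij[OF e b]
  note ob = onb_ortho_fam[OF eb]
  have ab: "cmod (a (b j)) \<le> K" for j by (rule a)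
  show "clinear_op (wop e e a)" by (rule clinear_wop[OF o o a])
  show "clinear_op (wop (\<lambda>j. e (b j)) (\<lambda>j. e (b j)) (\<lambda>j. a (b j)))"
    by (rule clinear_wop[where c = "\<lambda>j. a (b j)", OF ob ob ab])
  fix k
  obtain j where "k = b j" using b by (metis bij_pointE)
  then show "wop e e a (e k) = wop (\<lambda>j. e (b j)) (\<lambda>j. e (b j)) (\<lambda>j. a (b j)) (e k)"
    using wop_apply_onb[where c = "\<lambda>j. a (b j)" and j = j, OF eb ob ab] wop_apply_onb[where c = a, OF e o a] by simp
qed

context homogeneous_density
begin

text \<open>In decreasing order of the weights the coefficients become asymptotic to
  \<open>c * vol / (j + 1)\<close>. The order is dictated by the weights alone, so \<open>a\<close>
  may be complex and not monotone; \<open>c = 0\<close> treats terms of lower order.\<close>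

lemma diagonal_asymp:
  fixes e :: "'n ivec \<Rightarrow> 'a::complex_hilbert"
  assumes e: "onb e" and lim: "((\<lambda>k. a k / complex_of_real (lattice_weight k)) \<longlongrightarrow> c) cofinite"
  shows "wop e e a \<in> weak_trace_class"
    and "positive_trace \<phi> \<Longrightarrow> normalized_trace \<phi> \<Longrightarrow> \<phi> (wop e e a) = c * complex_of_real vol"
    and "\<exists>K. \<forall>k. cmod (a k) \<le> K"
proof -
  obtain b where b: "bij b" and bv: "(\<lambda>j. lattice_weight (b j) * real (j + 1)) \<longlonglongrightarrow> vol"
    by (rule enumeration)
  have "filterlim b cofinite sequentially"
    unfolding filterlim_iff eventually_cofinite
  proof (intro allI impI)
    fix P :: "'n ivec \<Rightarrow> bool" assume "finite {x. \<not> P x}"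
    then have "finite (b -` {x. \<not> P x})" using b by (intro finite_vimageI) (auto simp: bij_is_inj)
    then have "finite {j. \<not> P (b j)}" by (simp add: vimage_def)
    then show "\<forall>\<^sub>F j in sequentially. P (b j)"
      by (simp flip: cofinite_eq_sequentially add: eventually_cofinite)
  qed
  from filterlim_compose[OF lim this]
  have "(\<lambda>j. a (b j) / complex_of_real (lattice_weight (b j))
      * complex_of_real (lattice_weight (b j) * real (j + 1))) \<longlonglongrightarrow> c * complex_of_real vol"
    by (intro tendsto_mult tendsto_of_real bv)
  moreover have "a (b j) / complex_of_real (lattice_weight (b j))
      * complex_of_real (lattice_weight (b j) * real (j + 1)) = a (b j) * of_nat (j + 1)" for j
    using lattice_weight_pos[of "b j"] by simp
  ultimately have L: "(\<lambda>j. a (b j) * of_nat (j + 1)) \<longlonglongrightarrow> c * complex_of_real vol" by simp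
  have hb: "harmonic_bdd (\<lambda>j. a (b j))"
  proof -
    obtain K where "\<And>j. norm (a (b j) * of_nat (j + 1)) \<le> K"
      using convergent_imp_Bseq[OF convergentI[OF L]] by (auto simp: Bseq_def)
    then show ?thesis unfolding harmonic_bdd_def norm_mult norm_of_nat by blast
  qed
  then obtain K where K: "\<And>j. cmod (a (b j)) \<le> K" using harmonic_bdd_bounded by blast
  have aK: "cmod (a k) \<le> K" for k
    using K b by (metis bij_pointE)
  then show "\<exists>K. \<forall>k. cmod (a k) \<le> K" by blast
  note eq = wop_reindex[where a = a, OF e b aK]
  show "wop e e a \<in> weak_trace_class"
    unfolding eq by (rule weak_trace_class_diag[OF onb_bij[OF e b] hb])
  show "\<phi> (wop e e a) = c * complex_of_real vol" if "positive_trace \<phi>" "normalized_trace \<phi>"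
    unfolding eq by (rule trace_diag_limit[OF that onb_bij[OF e b] L])
qed

end

section \<open>Diagonals bounded by the inverse \<open>n\<close>-th power of the lattice
  norm\<close>

lemma homogeneous_density_power: "homogeneous_density (\<lambda>x :: 'n::finite rvec. 1 / norm x ^ CARD('n))"
  by standard (auto intro!: continuous_intros simp: power_mult_distrib)

definition lattice_decay :: "'n::finite ivec \<Rightarrow> real" where
  "lattice_decay k = (if k = 0 then 1 else 1 / norm (real_of_lattice k) ^ CARD('n))"

lemma lattice_decay_eq: "homogeneous_density.lattice_weight (\<lambda>x. 1 / norm x ^ CARD('n)) k = lattice_decay (k :: 'n::finite ivec)"
  by (simp add: homogeneous_density.lattice_weight_def[OF homogeneous_density_power] lattice_decay_def)

lemma lattice_decay_pos: "0 < lattice_decay k"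
  by (simp add: lattice_decay_def)

lemma blinfun_compose_assoc: "(A o\<^sub>L B) o\<^sub>L C = A o\<^sub>L (B o\<^sub>L C)"
  by (rule blinfun_eqI) simp

lemma lattice_decay_op:
  fixes e :: "'n::finite ivec \<Rightarrow> 'a::complex_hilbert"
  assumes e: "onb e" and B: "clinear_op B"
  shows "B o\<^sub>L wop e e (\<lambda>k. complex_of_real (lattice_decay k)) \<in> weak_trace_class"
proof -
  interpret homogeneous_density "\<lambda>x :: 'n rvec. 1 / norm x ^ CARD('n)" by (rule homogeneous_density_power)
  obtain b where b: "bij b" and bv: "(\<lambda>j. lattice_weight (b j) * real (j + 1)) \<longlonglongrightarrow> vol"
    by (rule enumeration)
  let ?g = "\<lambda>k :: 'n ivec. complex_of_real (lattice_decay k)"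
  obtain K where K: "\<And>j. norm (lattice_weight (b j) * real (j + 1)) \<le> K"
    using convergent_imp_Bseq[OF convergentI[OF bv]] by (auto simp: Bseq_def)
  have "cmod (?g (b j)) * real (j + 1) \<le> K" for j
    using K[of j] by (simp only: lattice_decay_eq norm_of_real real_norm_def abs_mult abs_of_nat)
  then have hb: "harmonic_bdd (\<lambda>j. ?g (b j))" unfolding harmonic_bdd_def by blast
  then obtain K where K: "\<And>j. cmod (?g (b j)) \<le> K" using harmonic_bdd_bounded by blast
  have gK: "cmod (?g k) \<le> K" for k using K b by (metis bij_pointE)
  note eq = wop_reindex[where a = ?g, OF e b gK]
  note f = onb_bij[OF e b]
  show ?thesis
    unfolding eq diag_eq_compose_harm(1)[OF f hb] blinfun_compose_assoc[symmetric]
    by (intro weak_trace_class_harm f clinear_op_compose B diag_eq_compose_harm(2)[OF f hb])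
qed

definition decay_bdd :: "('n::finite ivec \<Rightarrow> complex) \<Rightarrow> bool" where
  "decay_bdd a \<longleftrightarrow> (\<exists>C. \<forall>k. cmod (a k) \<le> C * lattice_decay k)"

lemma decay_bdd_add: "decay_bdd a \<Longrightarrow> decay_bdd b \<Longrightarrow> decay_bdd (\<lambda>k. a k + b k)"
  unfolding decay_bdd_def using norm_triangle_mono by (metis distrib_right)

lemma decay_bdd_mult: "decay_bdd a \<Longrightarrow> decay_bdd (\<lambda>k. c * a k)"
  unfolding decay_bdd_def norm_mult by (metis mult.assoc mult_left_mono norm_ge_zero)

lemma norm_real_of_lattice_ge_1: "k \<noteq> 0 \<Longrightarrow> 1 \<le> norm (real_of_lattice k)"
proof -
  assume "k \<noteq> 0"
  then obtain i where "k $ i \<noteq> 0" by (auto simp: vec_eq_iff)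
  then have "1 \<le> \<bar>real_of_lattice k $ i\<bar>" by simp
  then show ?thesis using component_le_norm_cart order_trans by blast
qed

lemma lattice_decay_le_1: "lattice_decay k \<le> 1"
  using norm_real_of_lattice_ge_1[of k] one_le_power[of "norm (real_of_lattice k)"]
  by (auto simp: lattice_decay_def divide_le_eq_1)

lemma decay_bdd_bounded: "decay_bdd a \<Longrightarrow> \<exists>K. \<forall>k. cmod (a k) \<le> K"
proof -
  assume "decay_bdd a"
  then obtain C where C: "\<And>k. cmod (a k) \<le> C * lattice_decay k" by (auto simp: decay_bdd_def)
  have "C * lattice_decay k \<le> \<bar>C\<bar> * 1" for k
    using lattice_decay_le_1[of k] lattice_decay_pos[of k] by (intro mult_mono) auto
  then show ?thesis using C order_trans by blast
qed

text \<open>Splitting the decay off on the right leaves a bounded operator with an explicit norm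
  bound. As \<open>g\<close> may be a shift of \<open>e\<close>, all diagonals of a matrix share the
  same right factor.\<close>

lemma lattice_diag_eq:
  fixes e :: "'n::finite ivec \<Rightarrow> 'a::complex_hilbert"
  assumes e: "onb e" and g: "ortho_fam g" and C: "\<And>k. cmod (a k) \<le> C * lattice_decay k"
  shows "wop e g a = wop e g (\<lambda>k. a k / complex_of_real (lattice_decay k)) o\<^sub>L wop e e (\<lambda>k. complex_of_real (lattice_decay k))"
    and "clinear_op (wop e g (\<lambda>k. a k / complex_of_real (lattice_decay k)))"
    and "norm (wop e g (\<lambda>k. a k / complex_of_real (lattice_decay k))) \<le> C"
proof -
  note o = onb_ortho_fam[OF e]
  let ?q = "\<lambda>k. a k / complex_of_real (lattice_decay k)" and ?g = "\<lambda>k. complex_of_real (lattice_decay k)"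
  have q: "cmod (?q k) \<le> C" for k
    using C[of k] lattice_decay_pos[of k] by (simp add: norm_divide divide_le_eq)
  have gb: "cmod (?g k) \<le> 1" for k using lattice_decay_le_1[of k] lattice_decay_pos[of k] by simp
  have ab: "cmod (a k) \<le> \<bar>C\<bar>" for k
  proof -
    have "C * lattice_decay k \<le> \<bar>C\<bar> * 1"
      using lattice_decay_le_1[of k] lattice_decay_pos[of k] by (intro mult_mono) auto
    then show ?thesis using C[of k] by simp
  qed
  show cq: "clinear_op (wop e g ?q)" by (rule clinear_wop[where c = ?q, OF o g q])
  show "norm (wop e g ?q) \<le> C" by (rule norm_wop_le[where c = ?q, OF o g q])
  show "wop e g a = wop e g ?q o\<^sub>L wop e e ?g"
  proof (rule onb_blinfun_eqI[OF e])
    show "clinear_op (wop e g a)" by (rule clinear_wop[where c = a, OF o g ab])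
    show "clinear_op (wop e g ?q o\<^sub>L wop e e ?g)"
      by (intro clinear_op_compose cq clinear_wop[where c = ?g, OF o o gb])
    show "wop e g a (e k) = (wop e g ?q o\<^sub>L wop e e ?g) (e k)" for k
      using lattice_decay_pos[of k]
      by (simp add: wop_apply_onb[where c = ?g, OF e o gb] wop_apply_onb[where c = ?q, OF e g q]
        wop_apply_onb[where c = a, OF e g ab] clinear_opD[OF cq] scaleC_scaleC)
  qed
qed

lemma weak_trace_class_lattice:
  assumes e: "onb e" and a: "decay_bdd a"
  shows "wop e e a \<in> weak_trace_class"
proof -
  obtain C where C: "\<And>k. cmod (a k) \<le> C * lattice_decay k" using a by (auto simp: decay_bdd_def)
  show ?thesis
    unfolding lattice_diag_eq(1)[OF e onb_ortho_fam[OF e] C]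
    by (rule lattice_decay_op[OF e lattice_diag_eq(2)[OF e onb_ortho_fam[OF e] C]])
qed

lemma trace_lattice_add:
  assumes e: "onb e" and tr: "positive_trace \<phi>" and ab: "decay_bdd a" "decay_bdd b"
  shows "\<phi> (wop e e (\<lambda>k. a k + b k)) = \<phi> (wop e e a) + \<phi> (wop e e b)"
proof -
  obtain K L where K: "\<And>k. cmod (a k) \<le> K" "\<And>k. cmod (b k) \<le> L"
    using decay_bdd_bounded ab by metis
  show ?thesis
    by (simp only: wop_add[where a = a and b = b, OF onb_ortho_fam[OF e] onb_ortho_fam[OF e] K]
      trace_add[OF tr] weak_trace_class_lattice[OF e] ab)
qed

lemma trace_lattice_scale:
  assumes e: "onb e" and tr: "positive_trace \<phi>" and a: "decay_bdd a"
  shows "\<phi> (wop e e (\<lambda>k. c * a k)) = c * \<phi> (wop e e a)"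
proof -
  obtain K where K: "\<And>k. cmod (a k) \<le> K" using decay_bdd_bounded a by metis
  show ?thesis
    by (simp only: wop_scale[where a = a, OF onb_ortho_fam[OF e] onb_ortho_fam[OF e] K]
      trace_scale[OF tr] weak_trace_class_lattice[OF e] a)
qed

lemma (in homogeneous_density) decay_bdd_weight: "decay_bdd (\<lambda>k. complex_of_real (lattice_weight k))"
proof -
  obtain M where M: "0 < M" "\<And>x. x \<noteq> 0 \<Longrightarrow> F x \<le> M / norm x ^ CARD('n)" by (rule sphere_bound, rule that)
  have "cmod (complex_of_real (lattice_weight k)) \<le> (M + 1) * lattice_decay k" for k
  proof (cases "k = 0")
    case False
    have "lattice_weight k \<le> M / norm (real_of_lattice k) ^ CARD('n)"
      using M(2)[of "real_of_lattice k"] False by (simp add: lattice_weight_def)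
    also have "\<dots> \<le> (M + 1) * lattice_decay k" using False by (simp add: lattice_decay_def divide_right_mono)
    finally show ?thesis using lattice_weight_pos[of k] by simp
  qed (use M in \<open>simp add: lattice_weight_def lattice_decay_def\<close>)
  then show ?thesis unfolding decay_bdd_def by blast
qed

text \<open>\<open>G p\<close> adds \<open>M / |x|^n\<close> to \<open>p\<close>. The densities for
  0, \<open>Re h\<close> and \<open>Im h\<close> are positive, and \<open>h\<close> is their
  combination with coefficients \<open>-1 - \<i>\<close>, 1 and \<open>\<i>\<close>. The remainder
  \<open>r\<close> is smaller by a power of \<open>|k|\<close> and has trace 0.\<close>

lemma diagonal_trace:
  fixes h :: "'n::finite rvec \<Rightarrow> complex" and e :: "'n ivec \<Rightarrow> 'a::complex_hilbert"
  assumes e: "onb e" and cont: "continuous_on (- {0}) h"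
    and hom: "\<And>t x. 0 < t \<Longrightarrow> x \<noteq> 0 \<Longrightarrow> h (t *\<^sub>R x) = h x / complex_of_real (t ^ CARD('n))"
    and d: "\<And>k. k \<noteq> 0 \<Longrightarrow> cmod (d k - h (real_of_lattice k)) \<le> C / norm (real_of_lattice k) ^ (CARD('n) + 1)"
    and tr: "positive_trace \<phi>" "normalized_trace \<phi>"
  shows "\<phi> (wop e e d) = 1 / of_nat CARD('n) * (LINT x|sphere_measure. h x)"
proof -
  let ?n = "CARD('n)"
  have "compact (h ` sphere 0 1)"
    by (intro compact_continuous_image continuous_on_subset[OF cont]) auto
  then obtain M' where M': "\<And>y. y \<in> h ` sphere 0 1 \<Longrightarrow> cmod y \<le> M'"
    using compact_imp_bounded bounded_iff by metis
  \<comment> \<open>Exceeding the bound on the sphere by 1 makes \<open>hM\<close> strict, hence the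
    three densities strictly positive.\<close>
  define M where "M = \<bar>M'\<bar> + 1"
  have M: "M > 0" by (simp add: M_def)
  have hM: "cmod (h x) < M / norm x ^ ?n" if x: "x \<noteq> 0" for x
  proof -
    have "h x = h (x /\<^sub>R norm x) / complex_of_real (norm x ^ ?n)"
      using hom[of "norm x" "x /\<^sub>R norm x"] x by simp
    then have "cmod (h x) = cmod (h (x /\<^sub>R norm x)) / norm x ^ ?n" by (simp add: norm_divide norm_power)
    moreover have "cmod (h (x /\<^sub>R norm x)) < M"
      using M'[of "h (x /\<^sub>R norm x)"] x by (force simp: M_def)
    ultimately show ?thesis using x by (simp add: divide_strict_right_mono)
  qed
  define G where "G p x = p x + M / norm x ^ ?n" for p :: "'n rvec \<Rightarrow> real" and x :: "'n rvec"
  have dens: "homogeneous_density (G p)"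
    if p: "continuous_on (- {0}) p" "\<And>t x. 0 < t \<Longrightarrow> x \<noteq> 0 \<Longrightarrow> p (t *\<^sub>R x) = p x / t ^ ?n"
      "\<And>x. x \<noteq> 0 \<Longrightarrow> - (M / norm x ^ ?n) < p x" for p
  proof
    show "continuous_on (- {0}) (G p)"
      unfolding G_def by (intro continuous_intros p(1)) auto
    show "0 < G p x" if "x \<noteq> 0" for x using p(3)[OF that] by (simp add: G_def)
    show "G p (t *\<^sub>R x) = G p x / t ^ ?n" if "0 < t" "x \<noteq> 0" for t x
      using that by (simp add: G_def p(2) power_mult_distrib add_divide_distrib mult.commute)
  qed
  let ?p1 = "\<lambda>x. Re (h x)" and ?p2 = "\<lambda>x. Im (h x)" and ?p0 = "\<lambda>x :: 'n rvec. 0 :: real"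
  interpret D0: homogeneous_density "G ?p0" by (rule dens) (use M in \<open>auto intro!: continuous_intros\<close>)
  have ReIm: "Re (z / complex_of_real r) = Re z / r" "Im (z / complex_of_real r) = Im z / r" for z r by simp_all
  interpret D1: homogeneous_density "G ?p1"
  proof (rule dens)
    show "continuous_on (- {0}) ?p1" by (intro continuous_intros cont)
    show "Re (h (t *\<^sub>R x)) = Re (h x) / t ^ ?n" if "0 < t" "x \<noteq> 0" for t x
      unfolding hom[OF that] ReIm ..
    show "- (M / norm x ^ ?n) < Re (h x)" if "x \<noteq> 0" for x
      using hM[OF that] abs_Re_le_cmod[of "h x"] by linarith
  qed
  interpret D2: homogeneous_density "G ?p2"
  proof (rule dens)
    show "continuous_on (- {0}) ?p2" by (intro continuous_intros cont)
    show "Im (h (t *\<^sub>R x)) = Im (h x) / t ^ ?n" if "0 < t" "x \<noteq> 0" for t x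
      unfolding hom[OF that] ReIm ..
    show "- (M / norm x ^ ?n) < Im (h x)" if "x \<noteq> 0" for x
      using hM[OF that] abs_Im_le_cmod[of "h x"] by linarith
  qed
  let ?w0 = "\<lambda>k. complex_of_real (D0.lattice_weight k)" and ?w1 = "\<lambda>k. complex_of_real (D1.lattice_weight k)"
    and ?w2 = "\<lambda>k. complex_of_real (D2.lattice_weight k)"
  define r where "r k = d k - (?w1 k + ((-1 - \<i>) * ?w0 k + \<i> * ?w2 k))" for k
  have r: "r k = d k - h (real_of_lattice k)" if "k \<noteq> 0" for k
    using that by (simp add: r_def D0.lattice_weight_def D1.lattice_weight_def D2.lattice_weight_def G_def complex_eq_iff)
  have rlim: "((\<lambda>k. r k / ?w0 k) \<longlongrightarrow> 0) cofinite"
  proof (rule tendstoI)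
    fix \<epsilon> :: real assume "\<epsilon> > 0"
    have "dist (r k / ?w0 k) 0 < \<epsilon>" if k: "norm (real_of_lattice k) > \<bar>C\<bar> / (M * \<epsilon>)" for k
    proof -
      have "0 \<le> \<bar>C\<bar> / (M * \<epsilon>)" using M \<open>\<epsilon> > 0\<close> by simp
      then have k0: "k \<noteq> 0" using k by auto
      let ?N = "norm (real_of_lattice k)"
      have N: "?N > 0" using k0 by simp
      have "cmod (r k / ?w0 k) = cmod (r k) * ?N ^ ?n / M"
        using k0 M by (simp add: norm_divide D0.lattice_weight_def G_def norm_mult norm_power)
      also have "\<dots> \<le> (C / ?N ^ (?n + 1)) * ?N ^ ?n / M"
        using d[OF k0] M by (intro divide_right_mono mult_right_mono) (auto simp: r[OF k0])
      also have "\<dots> = C / (M * ?N)" using N by simp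
      also have "\<dots> \<le> \<bar>C\<bar> / (M * ?N)" using N M by (intro divide_right_mono) auto
      also have "\<dots> < \<epsilon>"
      proof -
        have "\<bar>C\<bar> < ?N * (M * \<epsilon>)" using k M \<open>\<epsilon> > 0\<close> by (subst (asm) pos_divide_less_eq) auto
        then show ?thesis using M N by (subst pos_divide_less_eq) (auto simp: mult_ac)
      qed
      finally show ?thesis by simp
    qed
    then have "{k. \<not> dist (r k / ?w0 k) 0 < \<epsilon>} \<subseteq> {k. norm (real_of_lattice k) \<le> \<bar>C\<bar> / (M * \<epsilon>)}"
      by (auto simp: not_less) (meson not_le)
    then show "\<forall>\<^sub>F k in cofinite. dist (r k / ?w0 k) 0 < \<epsilon>"
      unfolding eventually_cofinite using finite_lattice_bounded finite_subset by blast
  qed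
  have one: "((\<lambda>k. ?w0 k / ?w0 k) \<longlongrightarrow> 1) cofinite" "((\<lambda>k. ?w1 k / ?w1 k) \<longlongrightarrow> 1) cofinite"
    "((\<lambda>k. ?w2 k / ?w2 k) \<longlongrightarrow> 1) cofinite"
    using D0.lattice_weight_pos D1.lattice_weight_pos D2.lattice_weight_pos
    by (simp_all add: less_imp_neq[symmetric])
  have v: "\<phi> (wop e e ?w0) = complex_of_real D0.vol" "\<phi> (wop e e ?w1) = complex_of_real D1.vol"
    "\<phi> (wop e e ?w2) = complex_of_real D2.vol" "\<phi> (wop e e r) = 0"
    using D0.diagonal_asymp(2)[OF e one(1) tr] D1.diagonal_asymp(2)[OF e one(2) tr]
      D2.diagonal_asymp(2)[OF e one(3) tr] D0.diagonal_asymp(2)[OF e rlim tr] by simp_all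
  have rb: "decay_bdd r"
    unfolding decay_bdd_def
  proof (intro exI allI)
    fix k
    show "cmod (r k) \<le> (\<bar>C\<bar> + cmod (r 0)) * lattice_decay k"
    proof (cases "k = 0")
      case False
      let ?N = "norm (real_of_lattice k)"
      have N: "1 \<le> ?N" by (rule norm_real_of_lattice_ge_1[OF False])
      have "cmod (r k) \<le> C / ?N ^ (?n + 1)" using d[OF False] by (simp only: r[OF False])
      also have "\<dots> \<le> \<bar>C\<bar> / ?N ^ (?n + 1)" by (intro divide_right_mono) auto
      also have "\<dots> \<le> \<bar>C\<bar> / ?N ^ ?n"
        using N power_increasing[of ?n "?n + 1" ?N] by (intro divide_left_mono mult_pos_pos zero_less_power) auto
      also have "\<dots> \<le> (\<bar>C\<bar> + cmod (r 0)) / ?N ^ ?n" by (intro divide_right_mono) auto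
      finally show ?thesis using False by (simp add: lattice_decay_def)
    qed (simp add: lattice_decay_def)
  qed
  have deq: "d = (\<lambda>k. ?w1 k + ((-1 - \<i>) * ?w0 k + (\<i> * ?w2 k + r k)))" by (simp add: r_def fun_eq_iff)
  note wb = D0.decay_bdd_weight D1.decay_bdd_weight D2.decay_bdd_weight
  have "\<phi> (wop e e d) = D1.vol + ((-1 - \<i>) * D0.vol + \<i> * D2.vol)"
    unfolding deq
    by (simp only: trace_lattice_add[OF e tr(1)] trace_lattice_scale[OF e tr(1)] decay_bdd_add decay_bdd_mult wb rb v add_0_right)
  moreover have "(LINT x|sphere_measure. h x) = of_nat ?n * (D1.vol + ((-1 - \<i>) * D0.vol + \<i> * D2.vol))"
  proof -
    have "h = (\<lambda>x. complex_of_real (G ?p1 x) + ((-1 - \<i>) * complex_of_real (G ?p0 x) + \<i> * complex_of_real (G ?p2 x)))"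
      by (simp add: G_def fun_eq_iff complex_eq_iff)
    then have "(LINT x|sphere_measure. h x)
      = (LINT x|sphere_measure. complex_of_real (G ?p1 x) + ((-1 - \<i>) * complex_of_real (G ?p0 x) + \<i> * complex_of_real (G ?p2 x)))"
      by (rule arg_cong)
    also have "\<dots> = complex_of_real (LINT x|sphere_measure. G ?p1 x)
       + ((-1 - \<i>) * complex_of_real (LINT x|sphere_measure. G ?p0 x) + \<i> * complex_of_real (LINT x|sphere_measure. G ?p2 x))"
      using D0.integrable_sphere D1.integrable_sphere D2.integrable_sphere by simp
    also have "\<dots> = of_nat ?n * (D1.vol + ((-1 - \<i>) * D0.vol + \<i> * D2.vol))"
      unfolding D0.integral_sphere D1.integral_sphere D2.integral_sphere by (simp add: algebra_simps)
    finally show ?thesis .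
  qed
  ultimately show ?thesis by simp
qed

subsection \<open>Translation invariance of the torus measure\<close>

text \<open>The half-open period cube: its lattice translates partition the space exactly, while it
  differs from the closed cube in \<open>torus_measure\<close> by a null set.\<close>

definition torus_cell :: "'n::finite rvec set" where
  "torus_cell = {x. lattice_floor ((1 / (2 * pi)) *\<^sub>R x) = 0}"

lemma torus_cell_eq: "torus_cell = {x. \<forall>i. 0 \<le> x $ i \<and> x $ i < 2 * pi}"
proof -
  have "lattice_floor y = 0 \<longleftrightarrow> (\<forall>i. 0 \<le> y $ i \<and> y $ i < 1)" for y :: "'a rvec"
    using lattice_cell_eq[of "0 :: 'a ivec"] by (simp add: set_eq_iff)
  moreover have "\<not> pi \<le> 0" using pi_gt_zero by linarith
  ultimately show ?thesis by (simp add: torus_cell_def zero_le_divide_iff)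
qed

lemma torus_cell_borel [measurable]: "torus_cell \<in> sets borel"
proof -
  have "(\<lambda>x :: 'a rvec. (1 / (2 * pi)) *\<^sub>R x) \<in> borel \<rightarrow>\<^sub>M borel" by measurable
  from measurable_sets[OF this lattice_cell_borel[of 0]] show ?thesis
    by (simp add: torus_cell_def vimage_def)
qed

lemma torus_cell_subset: "torus_cell \<subseteq> cbox 0 (\<chi> i. 2 * pi)"
  by (auto simp: torus_cell_eq mem_box_cart less_imp_le)

lemma AE_torus_cell: "AE x in lborel. x \<in> (cbox 0 (\<chi> i. 2 * pi) :: 'n::finite rvec set) \<longleftrightarrow> x \<in> torus_cell"
proof (rule AE_I')
  let ?c = "cbox 0 (\<chi> i. 2 * pi) :: 'n rvec set" and ?b = "box 0 (\<chi> i. 2 * pi) :: 'n rvec set"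
  have sub: "?b \<subseteq> torus_cell" by (force simp: torus_cell_eq mem_box_cart less_imp_le)
  have "emeasure lborel (?c - ?b) = emeasure lborel ?c - emeasure lborel ?b"
    by (rule emeasure_Diff) (use box_subset_cbox emeasure_lborel_box_finite[of 0 "(\<chi> i. 2 * pi) :: 'n rvec"] in auto)
  also have "\<dots> = 0" unfolding emeasure_lborel_cbox_eq emeasure_lborel_box_eq
    using emeasure_lborel_box_finite[of 0 "(\<chi> i. 2 * pi) :: 'n rvec"] by (simp add: emeasure_lborel_box_eq)
  finally show "?c - ?b \<in> null_sets lborel" by (simp add: null_sets_def)
  show "{x \<in> space lborel. \<not> (x \<in> ?c \<longleftrightarrow> x \<in> torus_cell)} \<subseteq> ?c - ?b"
    using sub torus_cell_subset by auto
qed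

lemma nn_integral_lborel_shift:
  fixes f :: "'a::euclidean_space \<Rightarrow> ennreal"
  assumes [measurable]: "f \<in> borel_measurable borel"
  shows "(\<integral>\<^sup>+x. f (x + c) \<partial>lborel) = (\<integral>\<^sup>+x. f x \<partial>lborel)"
proof -
  have "(\<integral>\<^sup>+x. f x \<partial>lborel) = (\<integral>\<^sup>+x. f x \<partial>distr lborel borel ((+) c))" by (simp only: lborel_distr_plus)
  also have "\<dots> = (\<integral>\<^sup>+x. f (c + x) \<partial>lborel)" by (rule nn_integral_distr) auto
  finally show ?thesis by (simp add: add.commute)
qed

lemma lattice_floor_shift: "lattice_floor (x + real_of_lattice k) = lattice_floor x + k"
  by (simp add: lattice_floor_def vec_eq_iff)

lemma torus_cell_shift: "x + (2 * pi) *\<^sub>R real_of_lattice k \<in> torus_cell \<longleftrightarrow> lattice_floor ((1 / (2 * pi)) *\<^sub>R x) = - k"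
proof -
  have "(1 / (2 * pi)) *\<^sub>R (x + (2 * pi) *\<^sub>R real_of_lattice k) = (1 / (2 * pi)) *\<^sub>R x + real_of_lattice k"
    by (simp add: scaleR_add_right)
  then show ?thesis by (simp add: torus_cell_def lattice_floor_shift eq_neg_iff_add_eq_0)
qed

lemma real_of_lattice_minus: "real_of_lattice (- k) = - real_of_lattice k"
  by (simp add: vec_eq_iff)

lemma real_of_lattice_add: "real_of_lattice (k + l) = real_of_lattice k + real_of_lattice l"
  by (simp add: vec_eq_iff)

lemma torus_cell_tiling:
  assumes b: "bij (b :: nat \<Rightarrow> 'n::finite ivec)"
  shows "(\<Sum>j. indicator torus_cell (x + (2 * pi) *\<^sub>R real_of_lattice (b j))) = (1 :: ennreal)"
    and "(\<Sum>j. indicator torus_cell (x - (2 * pi) *\<^sub>R real_of_lattice (b j))) = (1 :: ennreal)"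
proof -
  have one: "(\<Sum>j. indicator {l} (b j)) = (1 :: ennreal)" for l
  proof -
    obtain j0 where j0: "l = b j0" using b by (metis bij_pointE)
    have "(\<Sum>j. indicator {l} (b j)) = (\<Sum>j\<in>{j0}. indicator {l} (b j) :: ennreal)"
      using b by (intro suminf_finite) (auto simp: j0 indicator_def bij_is_inj inj_eq)
    then show ?thesis by (simp add: j0)
  qed
  let ?l = "lattice_floor ((1 / (2 * pi)) *\<^sub>R x)"
  have "indicator torus_cell (x + (2 * pi) *\<^sub>R real_of_lattice (b j)) = (indicator {- ?l} (b j) :: ennreal)" for j
    by (auto simp: indicator_def torus_cell_shift)
  then show "(\<Sum>j. indicator torus_cell (x + (2 * pi) *\<^sub>R real_of_lattice (b j))) = (1 :: ennreal)"
    by (simp only: one)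
  have "indicator torus_cell (x - (2 * pi) *\<^sub>R real_of_lattice (b j)) = (indicator {?l} (b j) :: ennreal)" for j
    using torus_cell_shift[of x "- b j"] by (auto simp: indicator_def real_of_lattice_minus)
  then show "(\<Sum>j. indicator torus_cell (x - (2 * pi) *\<^sub>R real_of_lattice (b j))) = (1 :: ennreal)"
    by (simp only: one)
qed

lemma periodic_lattice:
  fixes g :: "'n::finite rvec \<Rightarrow> 'b"
  assumes per: "\<And>x j. g (x + axis j (2 * pi)) = g x"
  shows "g (x + (2 * pi) *\<^sub>R real_of_lattice k) = g x"
proof -
  have nat: "g (x + real m *\<^sub>R axis j (2 * pi)) = g x" for x j m
  proof (induction m)
    case (Suc m)
    have "x + real (Suc m) *\<^sub>R axis j (2 * pi) = (x + real m *\<^sub>R axis j (2 * pi)) + axis j (2 * pi)"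
      by (simp add: algebra_simps)
    then show ?case using Suc per by metis
  qed simp
  have int: "g (x + of_int m *\<^sub>R axis j (2 * pi)) = g x" for x j m
  proof (cases "m \<ge> 0")
    case True
    then show ?thesis using nat[of x "nat m" j] by simp
  next
    case False
    then show ?thesis using nat[of "x + of_int m *\<^sub>R axis j (2 * pi)" "nat (- m)" j] by (simp add: algebra_simps)
  qed
  have "g (x + (\<Sum>j\<in>S. of_int (k $ j) *\<^sub>R axis j (2 * pi))) = g x" if "finite S" for S
    using that
  proof (induction S)
    case (insert j S)
    have "x + (\<Sum>i\<in>insert j S. of_int (k $ i) *\<^sub>R axis i (2 * pi))
      = (x + (\<Sum>i\<in>S. of_int (k $ i) *\<^sub>R axis i (2 * pi))) + of_int (k $ j) *\<^sub>R axis j (2 * pi)"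
      using insert by (simp add: algebra_simps)
    then show ?case using insert(3) int[of "x + (\<Sum>i\<in>S. of_int (k $ i) *\<^sub>R axis i (2 * pi))" "k $ j" j] by (simp add: add.assoc)
  qed simp
  moreover have "(\<Sum>j\<in>UNIV. of_int (k $ j) *\<^sub>R axis j (2 * pi)) = (2 * pi) *\<^sub>R real_of_lattice k"
    by (simp add: vec_eq_iff axis_def if_distrib[of "\<lambda>u. _ * u"] mult.commute cong: if_cong)
  ultimately show ?thesis using finite_class.finite_UNIV by fastforce
qed

lemma nn_integral_torus:
  fixes f :: "'n::finite rvec \<Rightarrow> ennreal"
  assumes [measurable]: "f \<in> borel_measurable borel"
  shows "(\<integral>\<^sup>+x. f x \<partial>torus_measure) = (\<integral>\<^sup>+x. f x * indicator torus_cell x \<partial>lborel) / emeasure lborel (cbox 0 (\<chi> i. 2 * pi) :: 'n rvec set)"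
proof -
  have "(\<integral>\<^sup>+x. f x \<partial>torus_measure) = (\<integral>\<^sup>+x. f x * indicator (cbox 0 (\<chi> i. 2 * pi)) x \<partial>lborel) / emeasure lborel (cbox 0 (\<chi> i. 2 * pi) :: 'n rvec set)"
    unfolding torus_measure_def by (rule nn_integral_uniform_measure) auto
  also have "(\<integral>\<^sup>+x. f x * indicator (cbox 0 (\<chi> i. 2 * pi)) x \<partial>lborel) = (\<integral>\<^sup>+x. f x * indicator torus_cell x \<partial>lborel)"
    by (intro nn_integral_cong_AE) (use AE_torus_cell in eventually_elim, auto simp: indicator_def)
  finally show ?thesis .
qed

text \<open>Unfolding: the shifted cube is cut along the translates of the cell, each piece is moved
  back by its lattice vector, which does not change \<open>g\<close>, and the pieces reassemble to
  the cell. Countable sums pass through the integral since everything is nonnegative.\<close>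

lemma nn_integral_torus_shift:
  fixes g :: "'n::finite rvec \<Rightarrow> ennreal"
  assumes [measurable]: "g \<in> borel_measurable borel" and per: "\<And>x j. g (x + axis j (2 * pi)) = g x"
  shows "(\<integral>\<^sup>+x. g (x + v) \<partial>torus_measure) = (\<integral>\<^sup>+x. g x \<partial>torus_measure)"
proof -
  \<comment> \<open>The density supplies an enumeration of the lattice, so that sums over lattice
    vectors become series.\<close>
  interpret homogeneous_density "\<lambda>x :: 'n rvec. 1 / norm x ^ CARD('n)" by (rule homogeneous_density_power)
  obtain b :: "nat \<Rightarrow> 'n ivec" where b: "bij b" by (rule enumeration)
  let ?D = "torus_cell :: 'n rvec set"
  let ?L = "\<lambda>j. (2 * pi) *\<^sub>R real_of_lattice (b j)"
  have [measurable]: "(\<lambda>x :: 'n rvec. indicator ?D (x + c) :: ennreal) \<in> borel_measurable borel" for c by measurable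
  have "(\<integral>\<^sup>+x. g (x + v) * indicator ?D x \<partial>lborel) = (\<integral>\<^sup>+x. g (x + v) * indicator ?D ((x + v) + (- v)) \<partial>lborel)"
    by simp
  also have "\<dots> = (\<integral>\<^sup>+y. g y * indicator ?D (y + (- v)) \<partial>lborel)"
    by (rule nn_integral_lborel_shift) measurable
  also have "\<dots> = (\<integral>\<^sup>+y. (\<Sum>j. g y * indicator ?D (y + (- v)) * indicator ?D (y + (- ?L j))) \<partial>lborel)"
    using torus_cell_tiling(2)[OF b] by (intro nn_integral_cong) (simp only: ennreal_suminf_cmult diff_conv_add_uminus mult_1_right)
  also have "\<dots> = (\<Sum>j. \<integral>\<^sup>+y. g y * indicator ?D (y + (- v)) * indicator ?D (y + (- ?L j)) \<partial>lborel)"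
    by (rule nn_integral_suminf) measurable
  also have "\<dots> = (\<Sum>j. \<integral>\<^sup>+z. g z * indicator ?D z * indicator ?D ((z - v) + ?L j) \<partial>lborel)"
  proof (intro suminf_cong)
    fix j
    have "(\<integral>\<^sup>+y. g y * indicator ?D (y + (- v)) * indicator ?D (y + (- ?L j)) \<partial>lborel)
      = (\<integral>\<^sup>+z. g (z + ?L j) * indicator ?D (z + ?L j + (- v)) * indicator ?D (z + ?L j + (- ?L j)) \<partial>lborel)"
      by (rule nn_integral_lborel_shift[symmetric]) measurable
    also have "\<dots> = (\<integral>\<^sup>+z. g z * indicator ?D z * indicator ?D ((z - v) + ?L j) \<partial>lborel)"
    proof (intro nn_integral_cong)
      fix z
      have "z + ?L j + (- v) = (z - v) + ?L j" "z + ?L j + (- ?L j) = z" by simp_all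
      then show "g (z + ?L j) * indicator ?D (z + ?L j + (- v)) * indicator ?D (z + ?L j + (- ?L j))
        = g z * indicator ?D z * indicator ?D ((z - v) + ?L j)"
        unfolding periodic_lattice[of g, OF per] by (simp only: mult_ac)
    qed
    finally show "(\<integral>\<^sup>+y. g y * indicator ?D (y + (- v)) * indicator ?D (y + (- ?L j)) \<partial>lborel)
      = (\<integral>\<^sup>+z. g z * indicator ?D z * indicator ?D ((z - v) + ?L j) \<partial>lborel)" .
  qed
  also have "\<dots> = (\<integral>\<^sup>+z. (\<Sum>j. g z * indicator ?D z * indicator ?D ((z - v) + ?L j)) \<partial>lborel)"
  proof (rule nn_integral_suminf[symmetric])
    fix j
    have "(\<lambda>z. g z * indicator ?D z * indicator ?D (z + (- v + ?L j))) \<in> borel_measurable lborel" by measurable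
    then show "(\<lambda>z. g z * indicator ?D z * indicator ?D ((z - v) + ?L j)) \<in> borel_measurable lborel"
      by (simp add: algebra_simps)
  qed
  also have "\<dots> = (\<integral>\<^sup>+z. g z * indicator ?D z \<partial>lborel)"
    using torus_cell_tiling(1)[OF b] by (intro nn_integral_cong) (simp only: ennreal_suminf_cmult mult_1_right)
  finally have eq: "(\<integral>\<^sup>+x. g (x + v) * indicator ?D x \<partial>lborel) = (\<integral>\<^sup>+z. g z * indicator ?D z \<partial>lborel)" .
  have [measurable]: "(\<lambda>x. g (x + v)) \<in> borel_measurable borel" by measurable
  show ?thesis by (simp add: nn_integral_torus eq)
qed

lemma emeasure_torus_space: "emeasure torus_measure (UNIV :: 'n::finite rvec set) = 1"
proof -
  let ?c = "cbox 0 (\<chi> i. 2 * pi) :: 'n rvec set"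
  have "0 < measure lborel ?c"
    by (auto simp: content_pos_lt_eq Basis_vec_def inner_axis)
  then have c: "emeasure lborel ?c \<noteq> 0" by (auto simp: measure_def)
  have "emeasure torus_measure (UNIV :: 'n rvec set) = emeasure lborel ?c / emeasure lborel ?c"
    unfolding torus_measure_def by (subst emeasure_uniform_measure) auto
  also have "\<dots> = 1" using c emeasure_lborel_cbox_finite[of 0 "(\<chi> i. 2 * pi) :: 'n rvec"]
    by (intro ennreal_divide_self) (auto simp: less_top)
  finally show ?thesis .
qed

subsection \<open>Completeness of the space of square-integrable functions\<close>

lemma torus_eq_refl: "torus_eq f f \<longleftrightarrow> torus_sqint f"
  by (auto simp: torus_eq_def)

lemma abs_rep_torus: "abs_torus_L2 (rep_torus_L2 \<xi>) = \<xi>"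
  by (rule Quotient_abs_rep[OF Quotient_torus_L2])

lemma rep_torus_sqint: "torus_sqint (rep_torus_L2 \<xi>)"
  using Quotient_rep_reflp[OF Quotient_torus_L2, of \<xi>] by (simp add: torus_eq_refl)

lemma norm_abs_torus:
  assumes f: "torus_sqint f"
  shows "ennreal ((norm (abs_torus_L2 f))\<^sup>2) = (\<integral>\<^sup>+x. ennreal ((cmod (f x))\<^sup>2) \<partial>torus_measure)"
proof -
  have "(norm (abs_torus_L2 f))\<^sup>2 = Re (cinner (abs_torus_L2 f) (abs_torus_L2 f))"
    by (simp add: power2_norm_eq_inner inner_eq_Re_cinner)
  also have "\<dots> = Re (LINT x|torus_measure. f x * cnj (f x))"
    using f by (simp add: cinner_torus_L2.abs_eq torus_eq_refl)
  also have "\<dots> = (LINT x|torus_measure. (cmod (f x))\<^sup>2)"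
    by (simp add: complex_norm_square[symmetric] flip: of_real_power)
  finally show ?thesis
    using f by (simp add: torus_sqint_def nn_integral_eq_integral)
qed

lemma torus_sqintI:
  assumes "f \<in> borel_measurable borel" "\<And>x j. f (x + axis j (2 * pi)) = f x"
    "(\<integral>\<^sup>+x. ennreal ((cmod (f x))\<^sup>2) \<partial>torus_measure) < \<infinity>"
  shows "torus_sqint f"
  unfolding torus_sqint_def using assms
  by (auto intro!: integrableI_bounded)

lemma abs_torus_diff:
  "torus_sqint f \<Longrightarrow> torus_sqint g \<Longrightarrow> abs_torus_L2 f - abs_torus_L2 g = abs_torus_L2 (\<lambda>x. f x - g x)"
  by (simp add: minus_torus_L2.abs_eq torus_eq_refl)

text \<open>Riesz-Fischer: along the indices \<open>s n\<close> the increments are summable almost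
  everywhere, which gives a pointwise limit \<open>f\<close>, and Fatou's lemma transfers the square
  norm estimates to \<open>f\<close>.\<close>

instance torus_L2 :: (finite) complete_space
proof
  fix X :: "nat \<Rightarrow> 'a torus_L2" assume X: "Cauchy X"
  have "\<exists>M. \<forall>i\<ge>M. \<forall>j\<ge>M. dist (X i) (X j) < 1 / 2 ^ n" for n
    using X unfolding Cauchy_def by (meson zero_less_divide_1_iff zero_less_numeral zero_less_power)
  then obtain M where M: "\<And>n i j. i \<ge> M n \<Longrightarrow> j \<ge> M n \<Longrightarrow> dist (X i) (X j) < 1 / 2 ^ n" by metis
  define s where "s n = Max (M ` {..n})" for n
  have s_ge: "M m \<le> s n" if "m \<le> n" for m n using that unfolding s_def by (intro Max_ge) auto
  define F where "F n = rep_torus_L2 (X (s n))" for n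
  have Fs: "torus_sqint (F n)" for n by (simp add: F_def rep_torus_sqint)
  have Fm[measurable]: "F n \<in> borel_measurable borel" for n using Fs by (simp add: torus_sqint_def)
  have N2: "(\<integral>\<^sup>+x. ennreal ((cmod (F n x - rep_torus_L2 (X i) x))\<^sup>2) \<partial>torus_measure) \<le> ennreal ((1 / 2 ^ m)\<^sup>2)"
    if "m \<le> n" "M m \<le> i" for n m i
  proof -
    have "norm (X (s n) - X i) \<le> 1 / 2 ^ m"
      using M[of m "s n" i] s_ge[OF that(1)] that(2) by (simp add: dist_norm)
    then have "ennreal ((norm (X (s n) - X i))\<^sup>2) \<le> ennreal ((1 / 2 ^ m)\<^sup>2)"
      by (intro ennreal_leI power_mono) auto
    moreover have "X (s n) - X i = abs_torus_L2 (\<lambda>x. F n x - rep_torus_L2 (X i) x)"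
      using abs_torus_diff[OF Fs rep_torus_sqint, of n "X i"] by (simp add: F_def abs_rep_torus)
    ultimately show ?thesis
      using norm_abs_torus[OF torus_sqint_diff[OF Fs rep_torus_sqint, of n "X i"]] by simp
  qed
  have L1: "(\<integral>\<^sup>+x. ennreal (cmod (F (Suc n) x - F n x)) \<partial>torus_measure) \<le> ennreal (1 / 2 ^ n)" for n
  proof -
    let ?u = "\<lambda>x. cmod (F (Suc n) x - F n x)"
    \<comment> \<open>Expanding the square of \<open>2 ^ n * u - 1\<close> bounds \<open>u\<close>
      by a multiple of \<open>u^2\<close> plus a constant. As the total mass is 1, this turns the
      square norm estimate into one for the integral of \<open>u\<close>.\<close>
    have pt: "ennreal (?u x) \<le> ennreal (2 ^ n / 2) * ennreal ((?u x)\<^sup>2) + ennreal (1 / 2 ^ n / 2)" for x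
    proof -
      have "0 \<le> (2 ^ n * ?u x - 1)\<^sup>2 / (2 * 2 ^ n)" by simp
      also have "\<dots> = 2 ^ n / 2 * (?u x)\<^sup>2 + 1 / 2 ^ n / 2 - ?u x"
        by (simp add: power2_eq_square field_simps)
      finally have "?u x \<le> 2 ^ n / 2 * (?u x)\<^sup>2 + 1 / 2 ^ n / 2" by simp
      then have "ennreal (?u x) \<le> ennreal (2 ^ n / 2 * (?u x)\<^sup>2 + 1 / 2 ^ n / 2)" by (rule ennreal_leI)
      also have "\<dots> = ennreal (2 ^ n / 2) * ennreal ((?u x)\<^sup>2) + ennreal (1 / 2 ^ n / 2)"
      proof -
        have "ennreal (2 ^ n / 2 * (?u x)\<^sup>2) = ennreal (2 ^ n / 2) * ennreal ((?u x)\<^sup>2)" by (rule ennreal_mult) auto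
        then show ?thesis by (subst ennreal_plus) auto
      qed
      finally show ?thesis .
    qed
    have um[measurable]: "(\<lambda>x. ennreal ((?u x)\<^sup>2)) \<in> borel_measurable torus_measure" by measurable
    have "(\<integral>\<^sup>+x. ennreal (?u x) \<partial>torus_measure)
      \<le> (\<integral>\<^sup>+x. ennreal (2 ^ n / 2) * ennreal ((?u x)\<^sup>2) + ennreal (1 / 2 ^ n / 2) \<partial>torus_measure)"
      by (intro nn_integral_mono pt)
    also have "\<dots> = ennreal (2 ^ n / 2) * (\<integral>\<^sup>+x. ennreal ((?u x)\<^sup>2) \<partial>torus_measure) + ennreal (1 / 2 ^ n / 2)"
    proof -
      have "space (torus_measure :: 'a rvec measure) = UNIV" using sets_eq_imp_space_eq[OF sets_torus_measure] by simp
      then show ?thesis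
        by (subst nn_integral_add) (auto simp: nn_integral_cmult emeasure_torus_space)
    qed
    also have "(\<integral>\<^sup>+x. ennreal ((?u x)\<^sup>2) \<partial>torus_measure) \<le> ennreal ((1 / 2 ^ n)\<^sup>2)"
      using N2[of n "Suc n" "s n"] s_ge[of n n] by (simp add: F_def)
    also have "ennreal (2 ^ n / 2) * ennreal ((1 / 2 ^ n)\<^sup>2) + ennreal (1 / 2 ^ n / 2) = ennreal (1 / 2 ^ n)"
      by (simp add: ennreal_mult[symmetric] ennreal_plus[symmetric] power2_eq_square del: ennreal_plus)
    finally show ?thesis by (simp add: add_right_mono mult_left_mono)
  qed
  have "(\<integral>\<^sup>+x. (\<Sum>n. ennreal (cmod (F (Suc n) x - F n x))) \<partial>torus_measure) < \<infinity>"
  proof -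
    have "(\<integral>\<^sup>+x. (\<Sum>n. ennreal (cmod (F (Suc n) x - F n x))) \<partial>torus_measure)
      = (\<Sum>n. \<integral>\<^sup>+x. ennreal (cmod (F (Suc n) x - F n x)) \<partial>torus_measure)"
      by (rule nn_integral_suminf) measurable
    also have "\<dots> \<le> (\<Sum>n. ennreal ((1 / 2) ^ n))"
      using L1 by (intro suminf_le) (auto simp: power_one_over)
    also have "\<dots> = ennreal 2"
      by (subst suminf_ennreal2) (auto simp: suminf_geometric)
    finally show ?thesis using order_le_less_trans[OF _ ennreal_less_top[of 2]] by simp
  qed
  then have AE1: "AE x in torus_measure. (\<Sum>n. ennreal (cmod (F (Suc n) x - F n x))) \<noteq> \<infinity>"
    by (intro nn_integral_PInf_AE) auto
  define f where "f x = lim (\<lambda>n. F n x)" for x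
  have AE2: "AE x in torus_measure. (\<lambda>n. F n x) \<longlonglongrightarrow> f x"
    using AE1
  proof eventually_elim
    case (elim x)
    then have "summable (\<lambda>n. cmod (F (Suc n) x - F n x))"
      by (intro summable_suminf_not_top) auto
    then have "summable (\<lambda>n. F (Suc n) x - F n x)" by (rule summable_norm_cancel)
    then have "(\<lambda>n. \<Sum>k<n. F (Suc k) x - F k x) \<longlonglongrightarrow> (\<Sum>n. F (Suc n) x - F n x)" by (rule summable_LIMSEQ)
    then have "(\<lambda>n. F n x - F 0 x) \<longlonglongrightarrow> (\<Sum>n. F (Suc n) x - F n x)" by (simp only: sum_lessThan_telescope[of "\<lambda>n. F n x"])
    then have "(\<lambda>n. (F n x - F 0 x) + F 0 x) \<longlonglongrightarrow> (\<Sum>n. F (Suc n) x - F n x) + F 0 x" by (intro tendsto_add tendsto_const)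
    then show ?case unfolding f_def using convergent_LIMSEQ_iff convergentI by fastforce
  qed
  have fm[measurable]: "f \<in> borel_measurable borel" unfolding f_def by measurable
  \<comment> \<open>Periodicity holds at every point, also where the sequence diverges, because both
    sides are \<open>lim\<close> of the same sequence.\<close>
  have fper: "f (x + axis j (2 * pi)) = f x" for x j
    unfolding f_def using Fs by (simp add: torus_sqint_def)
  have fin: "(\<integral>\<^sup>+x. ennreal ((cmod (f x - rep_torus_L2 (X i) x))\<^sup>2) \<partial>torus_measure) \<le> ennreal ((1 / 2 ^ m)\<^sup>2)"
    if "M m \<le> i" for i m
  proof -
    have [measurable]: "rep_torus_L2 (X i) \<in> borel_measurable borel" using rep_torus_sqint by (auto simp: torus_sqint_def)
    let ?v = "\<lambda>n x. ennreal ((cmod (F n x - rep_torus_L2 (X i) x))\<^sup>2)"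
    have "AE x in torus_measure. ennreal ((cmod (f x - rep_torus_L2 (X i) x))\<^sup>2) = liminf (\<lambda>n. ?v n x)"
      using AE2
    proof eventually_elim
      case (elim x)
      then have "(\<lambda>n. ?v n x) \<longlonglongrightarrow> ennreal ((cmod (f x - rep_torus_L2 (X i) x))\<^sup>2)"
        by (intro tendsto_intros)
      from lim_imp_Liminf[OF trivial_limit_sequentially this] show ?case by (rule sym)
    qed
    then have "(\<integral>\<^sup>+x. ennreal ((cmod (f x - rep_torus_L2 (X i) x))\<^sup>2) \<partial>torus_measure)
      = (\<integral>\<^sup>+x. liminf (\<lambda>n. ?v n x) \<partial>torus_measure)" by (rule nn_integral_cong_AE)
    also have "\<dots> \<le> liminf (\<lambda>n. \<integral>\<^sup>+x. ?v n x \<partial>torus_measure)"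
      by (rule nn_integral_liminf) measurable
    also have "\<dots> \<le> limsup (\<lambda>n. \<integral>\<^sup>+x. ?v n x \<partial>torus_measure)" by (rule Liminf_le_Limsup) simp
    also have "\<dots> \<le> ennreal ((1 / 2 ^ m)\<^sup>2)"
      using that by (intro Limsup_bounded eventually_sequentiallyI[of m] N2)
    finally show ?thesis .
  qed
  have ds: "torus_sqint (\<lambda>x. f x - rep_torus_L2 (X i) x)" if "M m \<le> i" for i m
  proof (rule torus_sqintI)
    have [measurable]: "rep_torus_L2 (X i) \<in> borel_measurable borel" using rep_torus_sqint by (auto simp: torus_sqint_def)
    show "(\<lambda>x. f x - rep_torus_L2 (X i) x) \<in> borel_measurable borel" by measurable
    show "f (x + axis j (2 * pi)) - rep_torus_L2 (X i) (x + axis j (2 * pi)) = f x - rep_torus_L2 (X i) x" for x j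
      using fper rep_torus_sqint[of "X i"] by (simp add: torus_sqint_def)
    show "(\<integral>\<^sup>+x. ennreal ((cmod (f x - rep_torus_L2 (X i) x))\<^sup>2) \<partial>torus_measure) < \<infinity>"
      using order_le_less_trans[OF fin[OF that] ennreal_less_top] by simp
  qed
  have fs: "torus_sqint f"
    using torus_sqint_add[OF ds[of 0 "M 0"] rep_torus_sqint[of "X (M 0)"]] by simp
  have close: "norm (X i - abs_torus_L2 f) \<le> 1 / 2 ^ m" if "M m \<le> i" for i m
  proof -
    have "abs_torus_L2 f - X i = abs_torus_L2 (\<lambda>x. f x - rep_torus_L2 (X i) x)"
      using abs_torus_diff[OF fs rep_torus_sqint, of "X i"] by (simp add: abs_rep_torus)
    then have "ennreal ((norm (abs_torus_L2 f - X i))\<^sup>2) \<le> ennreal ((1 / 2 ^ m)\<^sup>2)"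
      using norm_abs_torus[OF ds[OF that]] fin[OF that] by simp
    then have "(norm (abs_torus_L2 f - X i))\<^sup>2 \<le> (1 / 2 ^ m)\<^sup>2" by (subst (asm) ennreal_le_iff) auto
    then have "norm (abs_torus_L2 f - X i) \<le> 1 / 2 ^ m" by (rule power2_le_imp_le) simp
    then show ?thesis by (simp add: norm_minus_commute)
  qed
  have "X \<longlonglongrightarrow> abs_torus_L2 f"
  proof (rule LIMSEQ_I)
    fix r :: real assume "r > 0"
    then obtain m where "(1 / 2) ^ m < r" using real_arch_pow_inv[of r "1/2"] by auto
    then show "\<exists>no. \<forall>n\<ge>no. norm (X n - abs_torus_L2 f) < r"
      using close[of m] by (intro exI[of _ "M m"]) (metis order_le_less_trans power_one_over)
  qed
  then show "convergent X" by (rule convergentI)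
qed

instance torus_L2 :: (finite) complex_hilbert ..

subsection \<open>Weyl operators\<close>

lemma weyl_fun_sqint:
  fixes f :: "'n::finite rvec \<Rightarrow> complex"
  assumes f: "torus_sqint f"
  shows "torus_sqint (\<lambda>x. cis (real_of_lattice p \<bullet> x) * f (x + v))"
proof (rule torus_sqintI)
  have [measurable]: "f \<in> borel_measurable borel" using f by (simp add: torus_sqint_def)
  have per: "f (x + axis j (2 * pi)) = f x" for x j using f by (simp add: torus_sqint_def)
  have c: "(\<lambda>x :: 'n rvec. cis (real_of_lattice p \<bullet> x)) \<in> borel_measurable borel"
    by (intro borel_measurable_continuous_onI continuous_intros)
  show "(\<lambda>x. cis (real_of_lattice p \<bullet> x) * f (x + v)) \<in> borel_measurable borel"
    using c by measurable
  show "cis (real_of_lattice p \<bullet> (x + axis j (2 * pi))) * f (x + axis j (2 * pi) + v)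
    = cis (real_of_lattice p \<bullet> x) * f (x + v)" for x j
  proof -
    have "real_of_lattice p \<bullet> (x + axis j (2 * pi)) = real_of_lattice p \<bullet> x + 2 * pi * of_int (p $ j)"
      by (simp add: inner_add_right inner_axis mult.commute)
    then have "cis (real_of_lattice p \<bullet> (x + axis j (2 * pi))) = cis (real_of_lattice p \<bullet> x)"
      by (simp add: cis_mult[symmetric] cis_multiple_2pi)
    moreover have "x + axis j (2 * pi) + v = (x + v) + axis j (2 * pi)" by simp
    ultimately show ?thesis by (simp only: per)
  qed
  have "(\<integral>\<^sup>+x. ennreal ((cmod (cis (real_of_lattice p \<bullet> x) * f (x + v)))\<^sup>2) \<partial>torus_measure)
      = (\<integral>\<^sup>+x. ennreal ((cmod (f (x + v)))\<^sup>2) \<partial>torus_measure)" by (simp add: norm_mult)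
  also have "\<dots> = (\<integral>\<^sup>+x. ennreal ((cmod (f x))\<^sup>2) \<partial>torus_measure)"
    by (rule nn_integral_torus_shift[of "\<lambda>x. ennreal ((cmod (f x))\<^sup>2)"]) (simp_all add: per)
  also have "\<dots> < \<infinity>" using norm_abs_torus[OF f, symmetric] by simp
  finally show "(\<integral>\<^sup>+x. ennreal ((cmod (cis (real_of_lattice p \<bullet> x) * f (x + v)))\<^sup>2) \<partial>torus_measure) < \<infinity>" .
qed

text \<open>Equality almost everywhere is expressed by an integral, for which invariance under
  shifts is known; this makes translation well defined on classes.\<close>

lemma torus_eq_iff_integral:
  "torus_eq f g \<longleftrightarrow> torus_sqint f \<and> torus_sqint g \<and> (\<integral>\<^sup>+x. ennreal ((cmod (f x - g x))\<^sup>2) \<partial>torus_measure) = 0"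
proof (cases "torus_sqint f \<and> torus_sqint g")
  case True
  then have [measurable]: "f \<in> borel_measurable borel" "g \<in> borel_measurable borel" by (auto simp: torus_sqint_def)
  have "(\<integral>\<^sup>+x. ennreal ((cmod (f x - g x))\<^sup>2) \<partial>torus_measure) = 0 \<longleftrightarrow> (AE x in torus_measure. f x = g x)"
    by (subst nn_integral_0_iff_AE) auto
  then show ?thesis using True by (simp add: torus_eq_def)
qed (auto simp: torus_eq_def)

lemma nn_integral_weyl_fun:
  assumes "torus_sqint h"
  shows "(\<integral>\<^sup>+x. ennreal ((cmod (cis (real_of_lattice p \<bullet> x) * h (x + v)))\<^sup>2) \<partial>torus_measure)
    = (\<integral>\<^sup>+x. ennreal ((cmod (h x))\<^sup>2) \<partial>torus_measure)"
proof -
  have [measurable]: "h \<in> borel_measurable borel" using assms by (simp add: torus_sqint_def)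
  have "(\<integral>\<^sup>+x. ennreal ((cmod (h (x + v)))\<^sup>2) \<partial>torus_measure) = (\<integral>\<^sup>+x. ennreal ((cmod (h x))\<^sup>2) \<partial>torus_measure)"
    by (rule nn_integral_torus_shift[of "\<lambda>x. ennreal ((cmod (h x))\<^sup>2)"]) (use assms in \<open>auto simp: torus_sqint_def\<close>)
  then show ?thesis by (simp add: norm_mult)
qed

lift_definition weyl_apply :: "'n::finite ivec \<Rightarrow> 'n rvec \<Rightarrow> 'n torus_L2 \<Rightarrow> 'n torus_L2"
  is "\<lambda>p v f x. cis (real_of_lattice p \<bullet> x) * f (x + v)"
proof -
  fix p :: "'n ivec" and v :: "'n rvec" and f g :: "'n rvec \<Rightarrow> complex"
  assume fg: "torus_eq f g"
  then have s: "torus_sqint f" "torus_sqint g" by (auto simp: torus_eq_def)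
  have "(\<integral>\<^sup>+x. ennreal ((cmod (cis (real_of_lattice p \<bullet> x) * f (x + v) - cis (real_of_lattice p \<bullet> x) * g (x + v)))\<^sup>2) \<partial>torus_measure)
     = (\<integral>\<^sup>+x. ennreal ((cmod (f x - g x))\<^sup>2) \<partial>torus_measure)"
    using nn_integral_weyl_fun[OF torus_sqint_diff[OF s], of p v] by (simp add: right_diff_distrib)
  then show "torus_eq (\<lambda>x. cis (real_of_lattice p \<bullet> x) * f (x + v)) (\<lambda>x. cis (real_of_lattice p \<bullet> x) * g (x + v))"
    using fg s by (simp add: torus_eq_iff_integral weyl_fun_sqint)
qed

lemma weyl_apply_add: "weyl_apply p v (\<xi> + \<eta>) = weyl_apply p v \<xi> + weyl_apply p v \<eta>"
  by transfer (simp add: torus_eq_def torus_sqint_add weyl_fun_sqint distrib_left)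

lemma weyl_apply_scaleC: "weyl_apply p v (c *\<^sub>C \<xi>) = c *\<^sub>C weyl_apply p v \<xi>"
  by transfer (simp add: torus_eq_def torus_sqint_mult weyl_fun_sqint mult.left_commute)

text \<open>Translating the character with frequency \<open>q\<close> by \<open>v\<close> produces
  the phase \<open>exp (i q v)\<close>: the commutation relation in Weyl form.\<close>

lemma weyl_apply_weyl_apply:
  "weyl_apply p v (weyl_apply q w \<xi>) = cis (real_of_lattice q \<bullet> v) *\<^sub>C weyl_apply (p + q) (v + w) \<xi>"
proof transfer
  fix p q :: "'a ivec" and v w :: "'a rvec" and f :: "'a rvec \<Rightarrow> complex"
  assume "torus_eq f f"
  then have f: "torus_sqint f" by (simp add: torus_eq_refl)
  have "(\<lambda>x. cis (real_of_lattice p \<bullet> x) * (cis (real_of_lattice q \<bullet> (x + v)) * f (x + v + w)))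
    = (\<lambda>x. cis (real_of_lattice q \<bullet> v) * (cis (real_of_lattice (p + q) \<bullet> x) * f (x + (v + w))))"
    by (simp add: fun_eq_iff real_of_lattice_add inner_add_left inner_add_right cis_mult[symmetric] add.assoc mult_ac)
  then show "torus_eq (\<lambda>x. cis (real_of_lattice p \<bullet> x) * (cis (real_of_lattice q \<bullet> (x + v)) * f (x + v + w)))
    (\<lambda>x. cis (real_of_lattice q \<bullet> v) * (cis (real_of_lattice (p + q) \<bullet> x) * f (x + (v + w))))"
    using f by (simp add: torus_eq_refl torus_sqint_mult weyl_fun_sqint)
qed

lemma weyl_apply_0: "weyl_apply 0 0 \<xi> = \<xi>"
  by transfer simp

lemma norm_weyl_apply: "norm (weyl_apply p v \<xi>) = norm \<xi>"
proof -
  let ?f = "rep_torus_L2 \<xi>"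
  note f = rep_torus_sqint[of \<xi>]
  have "weyl_apply p v \<xi> = abs_torus_L2 (\<lambda>x. cis (real_of_lattice p \<bullet> x) * ?f (x + v))"
    using weyl_apply.abs_eq[of ?f p v] f by (simp add: abs_rep_torus torus_eq_refl)
  then have "ennreal ((norm (weyl_apply p v \<xi>))\<^sup>2) = ennreal ((norm \<xi>)\<^sup>2)"
    using norm_abs_torus[OF weyl_fun_sqint[OF f]] norm_abs_torus[OF f] nn_integral_weyl_fun[OF f]
    by (simp add: abs_rep_torus)
  then show ?thesis by simp
qed

definition weyl :: "'n::finite ivec \<Rightarrow> 'n rvec \<Rightarrow> 'n torus_op" where
  "weyl p v = Blinfun (weyl_apply p v)"

lemma weyl_blinfun: "blinfun_apply (weyl p v) = weyl_apply p v"
  unfolding weyl_def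
  by (intro bounded_linear_Blinfun_apply bounded_linear_intro[where K = 1])
    (simp_all add: weyl_apply_add weyl_apply_scaleC scaleR_eq_scaleC norm_weyl_apply)

lemma clinear_weyl: "clinear_op (weyl p v)"
  by (simp add: clinear_op_def weyl_blinfun weyl_apply_scaleC)

lemma cinner_weyl: "cinner (weyl p v \<xi>) (weyl p v \<eta>) = cinner \<xi> \<eta>"
  unfolding weyl_blinfun by (rule cinner_isometry) (simp_all add: weyl_apply_add weyl_apply_scaleC norm_weyl_apply)

lemma weyl_compose: "weyl p v o\<^sub>L weyl q w = cis (real_of_lattice q \<bullet> v) *\<^sub>C weyl (p + q) (v + w)"
  by (rule blinfun_eqI) (simp add: weyl_blinfun weyl_apply_weyl_apply)

lemma weyl_0: "weyl 0 0 = id_blinfun"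
  by (rule blinfun_eqI) (simp add: weyl_blinfun weyl_apply_0)

lemma norm_torus_one: "norm (torus_one :: 'n::finite torus_L2) = 1"
proof -
  have e: "torus_one = abs_torus_L2 (\<lambda>x :: 'n rvec. 1)" by (simp add: torus_one_def)
  have sp: "space (torus_measure :: 'n rvec measure) = UNIV" using sets_eq_imp_space_eq[OF sets_torus_measure] by simp
  have "ennreal ((norm (torus_one :: 'n torus_L2))\<^sup>2) = (\<integral>\<^sup>+x. ennreal ((cmod 1)\<^sup>2) \<partial>(torus_measure :: 'n rvec measure))"
    unfolding e by (rule norm_abs_torus[OF torus_sqint_const])
  also have "\<dots> = 1"
    using sp by (simp add: emeasure_torus_space)
  finally have "(norm (torus_one :: 'n torus_L2))\<^sup>2 = 1" by simp
  then show ?thesis by (simp add: power2_eq_1_iff) (metis norm_ge_zero not_one_le_zero neg_0_le_iff_le)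
qed

lemma weyl_torus_one: "weyl p v torus_one = weyl p 0 torus_one"
  unfolding weyl_blinfun by transfer (simp add: torus_eq_refl weyl_fun_sqint[OF torus_sqint_const[of 1], simplified])

text \<open>The functional is invariant under translations, which multiply \<open>exp (i p x)\<close> by a phase.\<close>

lemma nct_trace_weyl: "nct_trace (weyl p v) = (if p = 0 then 1 else 0)"
proof (cases "p = 0")
  case True
  have "weyl 0 v torus_one = (weyl 0 0 torus_one :: 'a torus_L2)" by (rule weyl_torus_one)
  then show ?thesis using True by (simp add: nct_trace_def weyl_0 cinner_self norm_torus_one)
next
  case False
  then obtain j where j: "p $ j \<noteq> 0" by (auto simp: vec_eq_iff)
  \<comment> \<open>The translation is chosen such that the phase is \<open>cis pi = -1\<close>; the
    trace then equals its own negative.\<close>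
  define u :: "'a rvec" where "u = axis j (pi / of_int (p $ j))"
  have pu: "real_of_lattice p \<bullet> u = pi" using j by (simp add: u_def inner_axis)
  have W: "weyl 0 u (weyl p v torus_one) = cis pi *\<^sub>C weyl p v torus_one"
  proof -
    have "weyl 0 u (weyl p v torus_one) = (weyl 0 u o\<^sub>L weyl p v) torus_one" by simp
    also have "\<dots> = cis pi *\<^sub>C weyl p (u + v) torus_one" by (simp only: weyl_compose pu scaleC_blinfun_apply add_0_left)
    also have "weyl p (u + v) torus_one = weyl p v torus_one" by (metis weyl_torus_one)
    finally show ?thesis .
  qed
  have "nct_trace (weyl p v) = cinner (weyl 0 u (weyl p v torus_one)) (weyl 0 u torus_one)"
    unfolding nct_trace_def by (rule cinner_weyl[symmetric])
  also have "weyl 0 u torus_one = (torus_one :: 'a torus_L2)"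
    using weyl_torus_one[of 0 u] by (simp add: weyl_0)
  also have "cinner (weyl 0 u (weyl p v torus_one)) torus_one = - nct_trace (weyl p v)"
    by (simp only: W cinner_scaleC_left nct_trace_def) simp
  finally show ?thesis using False by simp
qed

lemma blinfun_compose_id [simp]: "T o\<^sub>L id_blinfun = T" "id_blinfun o\<^sub>L T = T"
  by (rule blinfun_eqI, simp)+

text \<open>Up to a phase, every product of the generators and their inverses is a Weyl operator.\<close>

definition is_weyl :: "'n::finite ivec \<Rightarrow> 'n rvec \<Rightarrow> 'n torus_op \<Rightarrow> bool" where
  "is_weyl p v T \<longleftrightarrow> (\<exists>c. cmod c = 1 \<and> T = c *\<^sub>C weyl p v)"

lemma is_weyl_id: "is_weyl 0 0 id_blinfun"
  unfolding is_weyl_def by (intro exI[of _ 1]) (simp add: weyl_0 scaleC_one)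

lemma blinfun_compose_scaleC_left: "(c *\<^sub>C S) o\<^sub>L T = c *\<^sub>C (S o\<^sub>L T)"
  by (rule blinfun_eqI) simp

lemma blinfun_compose_scaleC_right: "clinear_op S \<Longrightarrow> S o\<^sub>L (c *\<^sub>C T) = c *\<^sub>C (S o\<^sub>L T)"
  by (rule blinfun_eqI) (simp add: clinear_opD)

lemma is_weyl_compose:
  assumes "is_weyl p v S" "is_weyl q w T"
  shows "is_weyl (p + q) (v + w) (S o\<^sub>L T)"
proof -
  obtain c d where c: "cmod c = 1" "S = c *\<^sub>C weyl p v" and d: "cmod d = 1" "T = d *\<^sub>C weyl q w"
    using assms by (auto simp: is_weyl_def)
  have "S o\<^sub>L T = (c * (d * cis (real_of_lattice q \<bullet> v))) *\<^sub>C weyl (p + q) (v + w)"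
    by (simp add: c d blinfun_compose_scaleC_left blinfun_compose_scaleC_right clinear_weyl weyl_compose scaleC_scaleC)
  moreover have "cmod (c * (d * cis (real_of_lattice q \<bullet> v))) = 1" using c d by (simp add: norm_mult)
  ultimately show ?thesis unfolding is_weyl_def by blast
qed

text \<open>The Weyl operator with opposite parameters and a corrected phase is inverse and adjoint
  at once. It gives the definite descriptions \<open>adjoint_op\<close> and
  \<open>inverse_op\<close> their values.\<close>

lemma is_weyl_unitary:
  assumes "is_weyl p v T"
  obtains S where "is_weyl (- p) (- v) S" "S o\<^sub>L T = id_blinfun" "T o\<^sub>L S = id_blinfun" "adjoint_op T = S" "inverse_op T = S"
proof -
  obtain c where c: "cmod c = 1" "T = c *\<^sub>C weyl p v" using assms by (auto simp: is_weyl_def)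
  have c0: "c \<noteq> 0" using c(1) by auto
  let ?d = "cis (real_of_lattice p \<bullet> v) / c"
  define S where "S = ?d *\<^sub>C weyl (- p) (- v)"
  have W: "is_weyl (- p) (- v) S"
    unfolding is_weyl_def S_def using c(1) by (intro exI[of _ ?d]) (simp add: norm_divide)
  have "S o\<^sub>L T = (?d * (c * cis (- (real_of_lattice p \<bullet> v)))) *\<^sub>C weyl 0 0"
    by (simp add: c S_def blinfun_compose_scaleC_left blinfun_compose_scaleC_right clinear_weyl weyl_compose scaleC_scaleC)
  also have "?d * (c * cis (- (real_of_lattice p \<bullet> v))) = 1" using c0 by (simp add: cis_mult)
  finally have ST: "S o\<^sub>L T = id_blinfun" by (simp add: weyl_0 scaleC_one)
  have "T o\<^sub>L S = (c * (?d * cis (- (real_of_lattice p \<bullet> v)))) *\<^sub>C weyl 0 0"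
    by (simp add: c S_def blinfun_compose_scaleC_left blinfun_compose_scaleC_right clinear_weyl weyl_compose
        scaleC_scaleC real_of_lattice_minus)
  also have "c * (?d * cis (- (real_of_lattice p \<bullet> v))) = 1" using c0 by (simp add: cis_mult)
  finally have TS: "T o\<^sub>L S = id_blinfun" by (simp add: weyl_0 scaleC_one)
  have iso: "cinner (T x) (T y) = cinner x y" for x y
  proof -
    have "cinner (T x) (T y) = (c * cnj c) * cinner x y"
      by (simp add: c(2) cinner_scaleC_left cinner_scaleC_right cinner_weyl)
    also have "c * cnj c = 1" using c(1) by (simp add: complex_norm_square[symmetric])
    finally show ?thesis by simp
  qed
  have "adjoint_op T = S"
  proof (rule adjoint_op_eqI)
    fix x y
    have "T (S y) = y" using TS by (metis blinfun_apply_blinfun_compose id_blinfun.rep_eq id_apply)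
    then show "cinner (T x) y = cinner x (S y)" using iso[of x "S y"] by simp
  qed
  moreover have "inverse_op T = S"
    unfolding inverse_op_def
  proof (rule the_equality)
    fix R assume "R o\<^sub>L T = id_blinfun \<and> T o\<^sub>L R = id_blinfun"
    then have "S o\<^sub>L (T o\<^sub>L R) = S o\<^sub>L id_blinfun" by simp
    then have "(S o\<^sub>L T) o\<^sub>L R = S" by (simp add: blinfun_compose_assoc)
    then show "R = S" by (simp add: ST)
  qed (use ST TS in simp)
  ultimately show ?thesis using that W ST TS by blast
qed

lemma clinear_is_weyl: "is_weyl p v T \<Longrightarrow> clinear_op T"
  by (auto simp: is_weyl_def intro: clinear_op_scaleC clinear_weyl)

lemma norm_is_weyl_le: "is_weyl p v T \<Longrightarrow> norm T \<le> 1"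
proof -
  assume "is_weyl p v T"
  then obtain c where c: "cmod c = 1" "T = c *\<^sub>C weyl p v" by (auto simp: is_weyl_def)
  show ?thesis
    by (rule norm_blinfun_bound) (simp_all add: c norm_scaleC weyl_blinfun norm_weyl_apply)
qed

lemma nct_trace_is_weyl: "is_weyl p v T \<Longrightarrow> p \<noteq> 0 \<Longrightarrow> nct_trace T = 0"
  using nct_trace_weyl[of p v] by (auto simp: is_weyl_def nct_trace_def cinner_scaleC_left)

lemma is_weyl_power:
  assumes "is_weyl p v T"
  shows "is_weyl (\<chi> i. int m * p $ i) (real m *\<^sub>R v) ((((o\<^sub>L) T) ^^ m) id_blinfun)"
proof (induction m)
  case 0
  have "(\<chi> i. int 0 * p $ i) = 0" by (simp add: vec_eq_iff)
  then show ?case using is_weyl_id by simp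
next
  case (Suc m)
  have "p + (\<chi> i. int m * p $ i) = (\<chi> i. int (Suc m) * p $ i)" "v + real m *\<^sub>R v = real (Suc m) *\<^sub>R v"
    by (simp_all add: vec_eq_iff algebra_simps)
  then show ?case using is_weyl_compose[OF assms Suc] by simp
qed

lemma is_weyl_powi:
  assumes T: "is_weyl p v T"
  shows "is_weyl (\<chi> i. m * p $ i) (of_int m *\<^sub>R v) (powi_op T m)"
proof (cases "0 \<le> m")
  case True
  then show ?thesis using is_weyl_power[OF T, of "nat m"] by (simp add: powi_op_def)
next
  case False
  obtain S where S: "is_weyl (- p) (- v) S" "inverse_op T = S" using is_weyl_unitary[OF T] by metis
  show ?thesis using is_weyl_power[OF S(1), of "nat (- m)"] False S(2) by (simp add: powi_op_def)
qed

lemma is_weyl_nct_U: "is_weyl (axis j 1) (pi *\<^sub>R column j \<theta>) (nct_U \<theta> j)"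
proof -
  have "real_of_lattice (axis j 1) \<bullet> x = x $ j" for x :: "'a rvec"
  proof -
    have "real_of_lattice (axis j 1) = (axis j 1 :: 'a rvec)" by (simp add: vec_eq_iff axis_def)
    then show ?thesis by (simp add: inner_axis' )
  qed
  then have "weyl_apply (axis j 1) (pi *\<^sub>R column j \<theta>) \<xi> = abs_torus_L2 (\<lambda>x. cis (x $ j) * rep_torus_L2 \<xi> (x + pi *\<^sub>R column j \<theta>))" for \<xi>
    using weyl_apply.abs_eq[of "rep_torus_L2 \<xi>" "axis j 1" "pi *\<^sub>R column j \<theta>"] rep_torus_sqint[of \<xi>]
    by (simp add: abs_rep_torus torus_eq_refl)
  then have "nct_U \<theta> j = weyl (axis j 1) (pi *\<^sub>R column j \<theta>)"
    unfolding nct_U_def weyl_def by metis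
  then show ?thesis unfolding is_weyl_def by (intro exI[of _ 1]) (simp add: scaleC_one)
qed

text \<open>The total translation performed by the monomial of exponent \<open>k\<close>. It is
  additive in \<open>k\<close>, which is why products of monomials are monomials up to a
  phase.\<close>

definition monomial_shift :: "'n::finite rmat \<Rightarrow> 'n ivec \<Rightarrow> 'n rvec" where
  "monomial_shift \<theta> k = (\<Sum>j\<in>UNIV. of_int (k $ j) *\<^sub>R (pi *\<^sub>R column j \<theta>))"

lemma monomial_shift_add: "monomial_shift \<theta> (k + l) = monomial_shift \<theta> k + monomial_shift \<theta> l"
  by (simp add: monomial_shift_def scaleR_add_left distrib_right sum.distrib)

lemma set_coords: "set coords = UNIV" "distinct coords"
  by (simp_all add: coords_def)

lemma is_weyl_monomial: "is_weyl k (monomial_shift \<theta> k) (nct_monomial \<theta> k)"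
proof -
  have *: "is_weyl (\<Sum>j\<in>set js. \<chi> i. k $ j * (axis j 1 :: 'a ivec) $ i) (\<Sum>j\<in>set js. of_int (k $ j) *\<^sub>R (pi *\<^sub>R column j \<theta>))
      (foldr (\<lambda>j T. powi_op (nct_U \<theta> j) (k $ j) o\<^sub>L T) js id_blinfun)" if "distinct js" for js
    using that
  proof (induction js)
    case (Cons j js)
    then show ?case
      using is_weyl_compose[OF is_weyl_powi[OF is_weyl_nct_U] Cons.IH] by simp
  qed (simp add: is_weyl_id)
  have "(\<Sum>j\<in>UNIV. \<chi> i. k $ j * (axis j 1 :: 'a ivec) $ i) = k"
    by (simp add: vec_eq_iff axis_def if_distrib[of "\<lambda>u. _ * u"] cong: if_cong)
  then show ?thesis
    using *[OF set_coords(2)] by (simp add: set_coords nct_monomial_def monomial_shift_def)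
qed

lemma nct_monomial_0: "nct_monomial \<theta> 0 = id_blinfun"
proof -
  have "foldr (\<lambda>j T. powi_op (nct_U \<theta> j) ((0 :: 'a ivec) $ j) o\<^sub>L T) js id_blinfun = id_blinfun" for js
    by (induction js) (simp_all add: powi_op_def)
  then show ?thesis by (simp add: nct_monomial_def)
qed

lemma nct_monomial_mult: "\<exists>c. cmod c = 1 \<and> nct_monomial \<theta> l o\<^sub>L nct_monomial \<theta> k = c *\<^sub>C nct_monomial \<theta> (l + k)"
proof -
  obtain a b where a: "cmod a = 1" "nct_monomial \<theta> l o\<^sub>L nct_monomial \<theta> k = a *\<^sub>C weyl (l + k) (monomial_shift \<theta> (l + k))"
    and b: "cmod b = 1" "nct_monomial \<theta> (l + k) = b *\<^sub>C weyl (l + k) (monomial_shift \<theta> (l + k))"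
    using is_weyl_compose[OF is_weyl_monomial[of l \<theta>] is_weyl_monomial[of k \<theta>]] is_weyl_monomial[of "l + k" \<theta>]
    unfolding monomial_shift_add[symmetric] is_weyl_def by metis
  have "b \<noteq> 0" using b(1) by auto
  then have "nct_monomial \<theta> l o\<^sub>L nct_monomial \<theta> k = (a / b) *\<^sub>C nct_monomial \<theta> (l + k)"
    by (simp add: a b scaleC_scaleC)
  then show ?thesis using a b by (intro exI[of _ "a / b"]) (simp add: norm_divide)
qed

text \<open>The cocycle of the monomials. It enters only through its modulus and its value 1 at
  \<open>l = 0\<close>, so it is chosen rather than computed.\<close>

definition nct_phase :: "'n::{finite, linorder} rmat \<Rightarrow> 'n ivec \<Rightarrow> 'n ivec \<Rightarrow> complex" where
  "nct_phase \<theta> l k = (SOME c. cmod c = 1 \<and> nct_monomial \<theta> l o\<^sub>L nct_monomial \<theta> k = c *\<^sub>C nct_monomial \<theta> (l + k))"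

lemma norm_nct_phase: "cmod (nct_phase \<theta> l k) = 1"
  and nct_monomial_compose: "nct_monomial \<theta> l o\<^sub>L nct_monomial \<theta> k = nct_phase \<theta> l k *\<^sub>C nct_monomial \<theta> (l + k)"
  using someI_ex[OF nct_monomial_mult[of \<theta> l k]] by (auto simp: nct_phase_def)

lemma nct_monomial_unitary:
  "nct_monomial \<theta> k o\<^sub>L adjoint_op (nct_monomial \<theta> k) = id_blinfun"
  using is_weyl_unitary[OF is_weyl_monomial[of k \<theta>]] by metis

lemma nct_trace_id: "nct_trace id_blinfun = 1"
  using nct_trace_weyl[of 0 0] by (simp add: weyl_0)

lemma nct_trace_monomials:
  "nct_trace (nct_monomial \<theta> l o\<^sub>L adjoint_op (nct_monomial \<theta> k)) = (if l = k then 1 else 0)"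
proof (cases "l = k")
  case False
  obtain S where S: "is_weyl (- k) (- monomial_shift \<theta> k) S" "adjoint_op (nct_monomial \<theta> k) = S"
    using is_weyl_unitary[OF is_weyl_monomial[of k \<theta>]] by metis
  show ?thesis
    using nct_trace_is_weyl[OF is_weyl_compose[OF is_weyl_monomial[of l \<theta>] S(1)]] False S(2) by simp
qed (simp add: nct_monomial_unitary nct_trace_id)

lemma clinear_monomial: "clinear_op (nct_monomial \<theta> k)"
  by (rule clinear_is_weyl[OF is_weyl_monomial])

lemma norm_monomial_le: "norm (nct_monomial \<theta> k) \<le> 1"
  by (rule norm_is_weyl_le[OF is_weyl_monomial])

subsection \<open>The algebra of the noncommutative torus\<close>

lemma bounded_linear_scaleC_blinfun:
  "bounded_linear (\<lambda>T :: 'a::real_normed_vector \<Rightarrow>\<^sub>L 'b::complex_inner. c *\<^sub>C T)"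
  by (rule bounded_linear_intro[where K = "cmod c"])
    (simp_all add: scaleC_add_right scaleR_eq_scaleC scaleC_scaleC mult.commute norm_scaleC_blinfun)

lemma adjoint_op_add:
  fixes S T :: "'a::complex_hilbert \<Rightarrow>\<^sub>L 'a"
  assumes "clinear_op S" "clinear_op T"
  shows "adjoint_op (S + T) = adjoint_op S + adjoint_op T"
  by (rule adjoint_op_eqI)
    (simp add: blinfun.add_left cinner_add_left cinner_add_right cinner_adjoint_op assms)

lemma adjoint_op_scaleC:
  fixes T :: "'a::complex_hilbert \<Rightarrow>\<^sub>L 'a"
  assumes "clinear_op T"
  shows "adjoint_op (c *\<^sub>C T) = cnj c *\<^sub>C adjoint_op T"
  by (rule adjoint_op_eqI) (simp add: cinner_scaleC_left cinner_scaleC_right cinner_adjoint_op assms)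

lemma adjoint_op_diff:
  fixes S T :: "'a::complex_hilbert \<Rightarrow>\<^sub>L 'a"
  assumes "clinear_op S" "clinear_op T"
  shows "adjoint_op (S - T) = adjoint_op S - adjoint_op T"
  by (rule adjoint_op_eqI)
    (simp add: blinfun.diff_left cinner.diff_left cinner.diff_right cinner_adjoint_op assms)

lemma
  assumes "S \<in> nct_algebra \<theta>" "T \<in> nct_algebra \<theta>"
  shows nct_algebra_add: "S + T \<in> nct_algebra \<theta>" and nct_algebra_compose: "S o\<^sub>L T \<in> nct_algebra \<theta>"
    and nct_algebra_scaleC: "c *\<^sub>C T \<in> nct_algebra \<theta>" and nct_algebra_adjoint: "adjoint_op T \<in> nct_algebra \<theta>"
  using assms by (auto simp: nct_algebra_def star_subalgebra_def)

lemma nct_algebra_0: "0 \<in> nct_algebra \<theta>" and nct_algebra_U: "nct_U \<theta> j \<in> nct_algebra \<theta>"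
  and closed_nct_algebra: "closed (nct_algebra \<theta>)"
  by (auto simp: nct_algebra_def star_subalgebra_def)

lemma nct_algebra_diff:
  assumes "S \<in> nct_algebra \<theta>" "T \<in> nct_algebra \<theta>" shows "S - T \<in> nct_algebra \<theta>"
proof -
  have "S - T = S + (-1) *\<^sub>C T" using scaleR_eq_scaleC[of "-1" T] by simp
  then show ?thesis using assms nct_algebra_add nct_algebra_scaleC by metis
qed

lemma nct_algebra_monomial: "nct_monomial \<theta> k \<in> nct_algebra \<theta>"
proof -
  have U: "nct_U \<theta> j \<in> nct_algebra \<theta>" "inverse_op (nct_U \<theta> j) \<in> nct_algebra \<theta>" "id_blinfun \<in> nct_algebra \<theta>" for j
  proof -
    obtain S where S: "nct_U \<theta> j o\<^sub>L S = id_blinfun" "adjoint_op (nct_U \<theta> j) = S" "inverse_op (nct_U \<theta> j) = S"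
      using is_weyl_unitary[OF is_weyl_nct_U] by metis
    show u: "nct_U \<theta> j \<in> nct_algebra \<theta>" by (rule nct_algebra_U)
    then show i: "inverse_op (nct_U \<theta> j) \<in> nct_algebra \<theta>" using nct_algebra_adjoint[OF u u] S by simp
    show "id_blinfun \<in> nct_algebra \<theta>" using nct_algebra_compose[OF u i] S by simp
  qed
  have pw: "(((o\<^sub>L) T) ^^ m) id_blinfun \<in> nct_algebra \<theta>" if "T \<in> nct_algebra \<theta>" for T m
    by (induction m) (use U(3) that nct_algebra_compose in auto)
  have pwi: "powi_op (nct_U \<theta> j) m \<in> nct_algebra \<theta>" for j m using pw U by (simp add: powi_op_def)
  have "foldr (\<lambda>j T. powi_op (nct_U \<theta> j) (k $ j) o\<^sub>L T) js id_blinfun \<in> nct_algebra \<theta>" for js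
    by (induction js) (simp_all add: U(3) nct_algebra_compose[OF pwi])
  then show ?thesis by (simp add: nct_monomial_def)
qed

lemma adjoint_monomial: "\<exists>c. cmod c = 1 \<and> adjoint_op (nct_monomial \<theta> k) = c *\<^sub>C nct_monomial \<theta> (- k)"
proof -
  obtain S where S: "is_weyl (- k) (- monomial_shift \<theta> k) S" "adjoint_op (nct_monomial \<theta> k) = S"
    using is_weyl_unitary[OF is_weyl_monomial[of k \<theta>]] by metis
  have "- monomial_shift \<theta> k = monomial_shift \<theta> (- k)" by (simp add: monomial_shift_def sum_negf)
  then obtain a b where "cmod a = 1" "S = a *\<^sub>C weyl (- k) (monomial_shift \<theta> (- k))"
    "cmod b = 1" "nct_monomial \<theta> (- k) = b *\<^sub>C weyl (- k) (monomial_shift \<theta> (- k))"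
    using S(1) is_weyl_monomial[of "- k" \<theta>] unfolding is_weyl_def by metis
  then show ?thesis using S(2)
    by (intro exI[of _ "a / b"]) (auto simp: norm_divide scaleC_scaleC)
qed

text \<open>Products and adjoints of monomials are multiples of monomials, so the span is closed
  under all operations, and continuity extends this to the norm closure. Complex linearity also
  survives in the closure, and the bound on adjoints depends on it.\<close>

lemma star_subalgebra_closure_span:
  "star_subalgebra (closure (complex_vs.span (range (nct_monomial \<theta>))))"
proof -
  let ?S = "complex_vs.span (range (nct_monomial \<theta>))"
  have cl: "clinear_op T" if "T \<in> closure ?S" for T
  proof -
    have sub: "complex_vs.subspace {T :: 'a torus_op. clinear_op T}"
      by (auto simp: complex_vs.subspace_def clinear_op_0 clinear_op_add clinear_op_scaleC)
    have "?S \<subseteq> {T. clinear_op T}"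
      by (rule complex_vs.span_minimal[OF _ sub]) (auto simp: clinear_monomial)
    then have "closure ?S \<subseteq> {T. clinear_op T}" by (rule closure_minimal[OF _ closed_clinear_op])
    then show ?thesis using that by blast
  qed
  have comp: "S o\<^sub>L T \<in> ?S" if S: "S \<in> ?S" and T: "T \<in> ?S" for S T
  proof -
    have 1: "nct_monomial \<theta> l o\<^sub>L T \<in> ?S" if "T \<in> ?S" for l T
      using that
    proof (induction rule: complex_vs.span_induct_alt)
      case base
      have "nct_monomial \<theta> l o\<^sub>L 0 = 0" by (rule blinfun_eqI) simp
      then show ?case by (simp add: complex_vs.span_zero)
    next
      case (step c x y)
      then obtain k where k: "x = nct_monomial \<theta> k" by auto
      have "nct_monomial \<theta> l o\<^sub>L (c *\<^sub>C x + y) = (c * nct_phase \<theta> l k) *\<^sub>C nct_monomial \<theta> (l + k) + (nct_monomial \<theta> l o\<^sub>L y)"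
        using nct_monomial_compose[of \<theta> l k, THEN arg_cong[of _ _ blinfun_apply]]
        by (intro blinfun_eqI) (simp add: k blinfun.add_right blinfun.add_left clinear_opD[OF clinear_monomial] fun_eq_iff scaleC_scaleC)
      then show ?case
        by (simp only:) (rule complex_vs.span_add[OF complex_vs.span_scale[OF complex_vs.span_base] step.IH], simp)
    qed
    show ?thesis using S
    proof (induction rule: complex_vs.span_induct_alt)
      case base
      have "0 o\<^sub>L T = 0" by (rule blinfun_eqI) simp
      then show ?case by (simp add: complex_vs.span_zero)
    next
      case (step c x y)
      then obtain k where k: "x = nct_monomial \<theta> k" by auto
      have "(c *\<^sub>C x + y) o\<^sub>L T = c *\<^sub>C (nct_monomial \<theta> k o\<^sub>L T) + (y o\<^sub>L T)"
        by (rule blinfun_eqI) (simp add: k blinfun.add_left)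
      then show ?case using step.IH 1[OF T]
        by (auto intro!: complex_vs.span_add complex_vs.span_scale)
    qed
  qed
  have adj: "adjoint_op T \<in> ?S" if "T \<in> ?S" for T
  proof -
    have sub: "complex_vs.subspace {T. clinear_op T \<and> adjoint_op T \<in> ?S}"
    proof -
      have "adjoint_op (0 :: 'a torus_op) = 0" by (rule adjoint_op_eqI) simp
      then show ?thesis
        by (auto simp: complex_vs.subspace_def clinear_op_0 clinear_op_add clinear_op_scaleC adjoint_op_add
            adjoint_op_scaleC complex_vs.span_zero complex_vs.span_add complex_vs.span_scale)
    qed
    have "nct_monomial \<theta> k \<in> {T. clinear_op T \<and> adjoint_op T \<in> ?S}" for k
    proof -
      obtain c where "adjoint_op (nct_monomial \<theta> k) = c *\<^sub>C nct_monomial \<theta> (- k)"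
        using adjoint_monomial by metis
      then show ?thesis
        by (simp add: clinear_monomial complex_vs.span_scale complex_vs.span_base)
    qed
    then have "?S \<subseteq> {T. clinear_op T \<and> adjoint_op T \<in> ?S}"
      by (intro complex_vs.span_minimal sub) auto
    then show ?thesis using that by blast
  qed
  have cs: "x \<in> closure ?S \<longleftrightarrow> (\<exists>f. (\<forall>n. f n \<in> ?S) \<and> f \<longlonglongrightarrow> x)" for x
    by (rule closure_sequential)
  show ?thesis
    unfolding star_subalgebra_def
  proof (intro conjI ballI allI)
    show "0 \<in> closure ?S" using complex_vs.span_zero closure_subset by blast
    fix S T assume "S \<in> closure ?S" "T \<in> closure ?S"
    then obtain f g where fg: "\<And>n. f n \<in> ?S" "f \<longlonglongrightarrow> S" "\<And>n. g n \<in> ?S" "g \<longlonglongrightarrow> T"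
      unfolding cs by blast
    show "S + T \<in> closure ?S" unfolding cs
      by (intro exI[of _ "\<lambda>n. f n + g n"] conjI allI tendsto_add fg complex_vs.span_add)
    show "S o\<^sub>L T \<in> closure ?S" unfolding cs
      by (intro exI[of _ "\<lambda>n. f n o\<^sub>L g n"] conjI allI comp fg
          bounded_bilinear.tendsto[OF bounded_bilinear_blinfun_compose])
  next
    fix T assume T: "T \<in> closure ?S"
    then obtain g where g: "\<And>n. g n \<in> ?S" "g \<longlonglongrightarrow> T" unfolding cs by blast
    show "c *\<^sub>C T \<in> closure ?S" for c unfolding cs
      by (intro exI[of _ "\<lambda>n. c *\<^sub>C g n"] conjI allI g complex_vs.span_scale
          bounded_linear.tendsto[OF bounded_linear_scaleC_blinfun])
    have clg: "clinear_op (g n)" for n using cl g(1) closure_subset by blast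
    have "(\<lambda>n. adjoint_op (g n)) \<longlonglongrightarrow> adjoint_op T"
    proof (rule LIM_zero_cancel, rule tendsto_norm_zero_cancel, rule tendsto_sandwich)
      show "\<forall>\<^sub>F n in sequentially. 0 \<le> norm (adjoint_op (g n) - adjoint_op T)" by simp
      show "\<forall>\<^sub>F n in sequentially. norm (adjoint_op (g n) - adjoint_op T) \<le> norm (g n - T)"
        using norm_adjoint_op_le[OF clinear_op_diff[OF clg cl[OF T]]]
        by (intro always_eventually allI) (simp add: adjoint_op_diff[OF clg cl[OF T]])
      show "(\<lambda>n. norm (g n - T)) \<longlonglongrightarrow> 0" using g(2) by (intro tendsto_norm_zero LIM_zero)
    qed (rule tendsto_const)
    then show "adjoint_op T \<in> closure ?S" unfolding cs
      by (intro exI[of _ "\<lambda>n. adjoint_op (g n)"] conjI allI adj g(1))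
  qed
qed

lemma nct_algebra_subset_closure_span: "nct_algebra \<theta> \<subseteq> closure (complex_vs.span (range (nct_monomial \<theta>)))"
proof -
  let ?S = "complex_vs.span (range (nct_monomial \<theta>))"
  have "nct_U \<theta> j \<in> ?S" for j
  proof -
    have "monomial_shift \<theta> (axis j 1) = (\<Sum>i\<in>UNIV. if i = j then pi *\<^sub>R column j \<theta> else 0)"
      unfolding monomial_shift_def by (intro sum.cong refl) (auto simp: axis_def)
    then have "monomial_shift \<theta> (axis j 1) = pi *\<^sub>R column j \<theta>" by simp
    then obtain a b where "cmod a = 1" "nct_U \<theta> j = a *\<^sub>C weyl (axis j 1) (pi *\<^sub>R column j \<theta>)"
      "cmod b = 1" "nct_monomial \<theta> (axis j 1) = b *\<^sub>C weyl (axis j 1) (pi *\<^sub>R column j \<theta>)"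
      using is_weyl_nct_U[of j \<theta>] is_weyl_monomial[of "axis j 1" \<theta>] unfolding is_weyl_def by metis
    then have "nct_U \<theta> j = (a / b) *\<^sub>C nct_monomial \<theta> (axis j 1)" by (auto simp: scaleC_scaleC)
    then show ?thesis by (simp add: complex_vs.span_scale complex_vs.span_base)
  qed
  then have "range (nct_U \<theta>) \<subseteq> closure ?S" using closure_subset by blast
  then show ?thesis unfolding nct_algebra_def using star_subalgebra_closure_span by blast
qed

lemma nct_algebra_clinear:
  fixes \<theta> :: "'a::{finite, linorder} rmat"
  shows "u \<in> nct_algebra \<theta> \<Longrightarrow> clinear_op u"
proof -
  have "complex_vs.subspace {T :: 'a torus_op. clinear_op T}"
    by (auto simp: complex_vs.subspace_def clinear_op_0 clinear_op_add clinear_op_scaleC)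
  then have "complex_vs.span (range (nct_monomial \<theta>)) \<subseteq> {T. clinear_op T}"
    by (rule complex_vs.span_minimal[rotated]) (auto simp: clinear_monomial)
  then have "closure (complex_vs.span (range (nct_monomial \<theta>))) \<subseteq> {T. clinear_op T}"
    by (rule closure_minimal[OF _ closed_clinear_op])
  then show "u \<in> nct_algebra \<theta> \<Longrightarrow> clinear_op u" using nct_algebra_subset_closure_span by blast
qed

lemma nct_algebra_sum: "finite F \<Longrightarrow> (\<And>i. i \<in> F \<Longrightarrow> f i \<in> nct_algebra \<theta>) \<Longrightarrow> sum f F \<in> nct_algebra \<theta>"
  by (induction F rule: finite_induct) (auto simp: nct_algebra_0 nct_algebra_add)

lemma nct_algebra_has_sum:
  fixes \<theta> :: "'a::{finite, linorder} rmat"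
  assumes "(f has_sum u) A" "\<And>i. i \<in> A \<Longrightarrow> f i \<in> nct_algebra \<theta>"
  shows "u \<in> nct_algebra \<theta>"
  by (rule Lim_in_closed_set[OF closed_nct_algebra _ _ assms(1)[unfolded has_sum_def]])
    (use assms(2) in \<open>auto intro!: eventually_finite_subsets_at_top_weakI nct_algebra_sum\<close>)

lemma norm_nct_trace_le: "cmod (nct_trace T) \<le> norm T"
proof -
  have "cmod (nct_trace T) \<le> norm (T torus_one) * norm (torus_one :: 'a torus_L2)"
    unfolding nct_trace_def by (rule cmod_cinner_le)
  also have "\<dots> \<le> norm T * norm (torus_one :: 'a torus_L2)"
    using norm_blinfun[of T torus_one] by (simp add: norm_torus_one)
  finally show ?thesis by (simp add: norm_torus_one)
qed

lemma bounded_linear_nct_trace: "bounded_linear nct_trace"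
  by (rule bounded_linear_intro[where K = 1])
    (simp_all add: nct_trace_def blinfun.add_left blinfun.scaleR_left cinner_add_left cinner.scaleR_left
      norm_nct_trace_le[unfolded nct_trace_def])

lemma norm_compose_adjoint_monomial_le: "norm (u o\<^sub>L adjoint_op (nct_monomial \<theta> k)) \<le> norm u"
proof -
  have "norm (u o\<^sub>L adjoint_op (nct_monomial \<theta> k)) \<le> norm u * norm (adjoint_op (nct_monomial \<theta> k))"
    by (rule norm_blinfun_compose)
  also have "\<dots> \<le> norm u * 1"
    by (rule mult_left_mono[OF order_trans[OF norm_adjoint_op_le[OF clinear_monomial] norm_monomial_le]]) simp
  finally show ?thesis by simp
qed

lemma norm_nct_coeff_le: "cmod (nct_coeff \<theta> u k) \<le> norm u"
  unfolding nct_coeff_def using norm_nct_trace_le norm_compose_adjoint_monomial_le order_trans by blast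

lemma nct_coeff_add: "nct_coeff \<theta> (u + v) k = nct_coeff \<theta> u k + nct_coeff \<theta> v k"
  by (simp add: nct_coeff_def nct_trace_def blinfun.add_left cinner_add_left)

lemma nct_coeff_scaleC: "nct_coeff \<theta> (c *\<^sub>C u) k = c * nct_coeff \<theta> u k"
  by (simp add: nct_coeff_def nct_trace_def cinner_scaleC_left)

lemma bounded_linear_nct_coeff: "bounded_linear (\<lambda>u. nct_coeff \<theta> u k)"
  by (rule bounded_linear_intro[where K = 1])
    (simp_all add: nct_coeff_add scaleR_eq_scaleC nct_coeff_scaleC norm_nct_coeff_le scaleR_conv_of_real)

lemma nct_coeff_monomial: "nct_coeff \<theta> (nct_monomial \<theta> l) k = (if l = k then 1 else 0)"
  by (simp add: nct_coeff_def nct_trace_monomials)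

lemma nct_coeff_has_sum:
  assumes "((\<lambda>l. c l *\<^sub>C nct_monomial \<theta> l) has_sum u) UNIV"
  shows "nct_coeff \<theta> u k = c k"
proof -
  have "((\<lambda>l. nct_coeff \<theta> (c l *\<^sub>C nct_monomial \<theta> l) k) has_sum nct_coeff \<theta> u k) UNIV"
    by (rule has_sum_bounded_linear[OF bounded_linear_nct_coeff assms])
  moreover have "((\<lambda>l. nct_coeff \<theta> (c l *\<^sub>C nct_monomial \<theta> l) k) has_sum c k) UNIV"
  proof -
    have "((\<lambda>l. nct_coeff \<theta> (c l *\<^sub>C nct_monomial \<theta> l) k) has_sum c k) {k}"
      by (intro has_sum_finiteI) (auto simp: nct_coeff_scaleC nct_coeff_monomial)
    then show ?thesis
      by (rule has_sum_cong_neutral[THEN iffD1, rotated -1]) (auto simp: nct_coeff_scaleC nct_coeff_monomial)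
  qed
  ultimately show ?thesis by (rule has_sum_unique)
qed

subsection \<open>The completion\<close>

lemma nct_trace_compose_adjoint:
  fixes \<theta> :: "'a::{finite, linorder} rmat"
  assumes "u \<in> nct_algebra \<theta>"
  shows "cmod (nct_trace (u o\<^sub>L adjoint_op u)) \<le> (norm u)\<^sup>2"
proof -
  have "norm (u o\<^sub>L adjoint_op u) \<le> norm u * norm (adjoint_op u)" by (rule norm_blinfun_compose)
  also have "\<dots> \<le> norm u * norm u"
    using norm_adjoint_op_le[OF nct_algebra_clinear[OF assms]] by (intro mult_left_mono) auto
  finally show ?thesis using norm_nct_trace_le[of "u o\<^sub>L adjoint_op u"] by (simp add: power2_eq_square)
qed

context
  fixes \<theta> :: "'n::{finite, linorder} rmat" and \<iota> :: "'n torus_op \<Rightarrow> 'h::complex_hilbert"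
  assumes compl: "nct_completion \<theta> \<iota>"
begin

lemma iota_add: "u \<in> nct_algebra \<theta> \<Longrightarrow> v \<in> nct_algebra \<theta> \<Longrightarrow> \<iota> (u + v) = \<iota> u + \<iota> v"
  and iota_scaleC: "u \<in> nct_algebra \<theta> \<Longrightarrow> \<iota> (c *\<^sub>C u) = c *\<^sub>C \<iota> u"
  and cinner_iota: "u \<in> nct_algebra \<theta> \<Longrightarrow> v \<in> nct_algebra \<theta> \<Longrightarrow> cinner (\<iota> u) (\<iota> v) = nct_trace (u o\<^sub>L adjoint_op v)"
  and closure_iota: "closure (\<iota> ` nct_algebra \<theta>) = UNIV"
  using compl unfolding nct_completion_def by blast+

lemma iota_0: "\<iota> 0 = 0"
  using iota_scaleC[OF nct_algebra_0, of 0] by simp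

lemma iota_diff:
  assumes "u \<in> nct_algebra \<theta>" "v \<in> nct_algebra \<theta>" shows "\<iota> (u - v) = \<iota> u - \<iota> v"
  using iota_add[OF nct_algebra_diff[OF assms] assms(2)] by (simp add: algebra_simps)

lemma norm_iota_le:
  assumes "u \<in> nct_algebra \<theta>" shows "norm (\<iota> u) \<le> norm u"
proof -
  have "(norm (\<iota> u))\<^sup>2 = cmod (cinner (\<iota> u) (\<iota> u))" by (simp only: cinner_self norm_of_real) simp
  also have "\<dots> \<le> (norm u)\<^sup>2"
    unfolding cinner_iota[OF assms assms] by (rule nct_trace_compose_adjoint[OF assms])
  finally show ?thesis by (rule power2_le_imp_le) simp
qed

lemma iota_sum: "finite F \<Longrightarrow> (\<And>i. i \<in> F \<Longrightarrow> f i \<in> nct_algebra \<theta>) \<Longrightarrow> \<iota> (sum f F) = (\<Sum>i\<in>F. \<iota> (f i))"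
  by (induction F rule: finite_induct) (auto simp: iota_0 iota_add nct_algebra_sum)

text \<open>\<open>\<iota>\<close> is additive and contractive on the algebra only and arbitrary
  outside of it, so convergence is transferred by the norm estimate for partial sums.\<close>

lemma iota_has_sum:
  assumes s: "(f has_sum u) A" and f: "\<And>i. i \<in> A \<Longrightarrow> f i \<in> nct_algebra \<theta>"
  shows "((\<lambda>i. \<iota> (f i)) has_sum \<iota> u) A"
proof -
  have u: "u \<in> nct_algebra \<theta>" by (rule nct_algebra_has_sum[OF s f])
  have "((\<lambda>F. norm (sum f F - u)) \<longlongrightarrow> 0) (finite_subsets_at_top A)"
    using s unfolding has_sum_def by (intro tendsto_norm_zero LIM_zero)
  note lim = this
  have "((\<lambda>F. norm ((\<Sum>i\<in>F. \<iota> (f i)) - \<iota> u)) \<longlongrightarrow> 0) (finite_subsets_at_top A)"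
  proof (rule tendsto_sandwich[where f = "\<lambda>_. 0" and h = "\<lambda>F. norm (sum f F - u)"])
    show "\<forall>\<^sub>F F in finite_subsets_at_top A. norm ((\<Sum>i\<in>F. \<iota> (f i)) - \<iota> u) \<le> norm (sum f F - u)"
    proof (rule eventually_finite_subsets_at_top_weakI)
      fix F assume F: "finite F" "F \<subseteq> A"
      then have m: "sum f F \<in> nct_algebra \<theta>" using f by (intro nct_algebra_sum) auto
      have "(\<Sum>i\<in>F. \<iota> (f i)) - \<iota> u = \<iota> (sum f F - u)"
        using F f by (subst iota_diff[OF m u], subst iota_sum) auto
      then show "norm ((\<Sum>i\<in>F. \<iota> (f i)) - \<iota> u) \<le> norm (sum f F - u)"
        using norm_iota_le[OF nct_algebra_diff[OF m u]] by simp
    qed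
    show "((\<lambda>F. norm (sum f F - u)) \<longlongrightarrow> 0) (finite_subsets_at_top A)" by (rule lim)
  qed (auto intro!: always_eventually)
  then have "((\<lambda>F. (\<Sum>i\<in>F. \<iota> (f i)) - \<iota> u) \<longlongrightarrow> 0) (finite_subsets_at_top A)"
    by (rule tendsto_norm_zero_cancel)
  then show ?thesis unfolding has_sum_def by (rule LIM_zero_cancel)
qed

text \<open>A vector orthogonal to all images of monomials is orthogonal to the image of their span,
  by contractivity of \<open>\<iota>\<close> to that of the algebra, and by density to
  itself.\<close>

lemma onb_iota: "onb (\<lambda>k. \<iota> (nct_monomial \<theta> k))"
  unfolding onb_def
proof (intro conjI allI impI)
  show "cinner (\<iota> (nct_monomial \<theta> i)) (\<iota> (nct_monomial \<theta> j)) = (if i = j then 1 else 0)" for i j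
    by (simp add: cinner_iota nct_algebra_monomial nct_trace_monomials)
  fix x assume x: "\<forall>k. cinner x (\<iota> (nct_monomial \<theta> k)) = 0"
  let ?S = "complex_vs.span (range (nct_monomial \<theta>))"
  have S: "u \<in> nct_algebra \<theta> \<and> cinner x (\<iota> u) = 0" if "u \<in> ?S" for u
    using that
  proof (induction rule: complex_vs.span_induct_alt)
    case base
    show ?case by (simp add: nct_algebra_0 iota_0)
  next
    case (step c m y)
    then obtain k where k: "m = nct_monomial \<theta> k" by auto
    note mk = nct_algebra_monomial[of \<theta> k]
    show ?case
      using step.IH x mk by (simp add: k iota_add iota_scaleC nct_algebra_add nct_algebra_scaleC
          cinner_add_right cinner_scaleC_right)
  qed
  have "cinner x (\<iota> u) = 0" if u: "u \<in> nct_algebra \<theta>" for u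
  proof -
    obtain g where g: "\<And>n. g n \<in> ?S" "g \<longlonglongrightarrow> u"
      using nct_algebra_subset_closure_span u closure_sequential by blast
    have "(\<lambda>n. \<iota> (g n)) \<longlonglongrightarrow> \<iota> u"
    proof (rule LIM_zero_cancel, rule tendsto_norm_zero_cancel, rule tendsto_sandwich)
      show "\<forall>\<^sub>F n in sequentially. 0 \<le> norm (\<iota> (g n) - \<iota> u)" by simp
      show "\<forall>\<^sub>F n in sequentially. norm (\<iota> (g n) - \<iota> u) \<le> norm (g n - u)"
        using norm_iota_le[OF nct_algebra_diff[OF _ u]] iota_diff[OF _ u] S[OF g(1)]
        by (intro always_eventually allI) metis
      show "(\<lambda>n. norm (g n - u)) \<longlonglongrightarrow> 0" using g(2) by (intro tendsto_norm_zero LIM_zero)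
    qed (rule tendsto_const)
    then have "(\<lambda>n. cinner x (\<iota> (g n))) \<longlonglongrightarrow> cinner x (\<iota> u)" by (intro cinner.tendsto tendsto_const)
    then show ?thesis using S[OF g(1)] by (simp add: LIMSEQ_const_iff)
  qed
  then have "\<iota> ` nct_algebra \<theta> \<subseteq> {y. cinner x y = 0}" by auto
  moreover have "closed {y. cinner x y = 0}"
    by (intro closed_Collect_eq continuous_intros cinner.continuous_on)
  ultimately have "closure (\<iota> ` nct_algebra \<theta>) \<subseteq> {y. cinner x y = 0}" by (rule closure_minimal)
  then have "cinner x x = 0" using closure_iota by auto
  then show "x = 0" by (simp add: cinner_self)
qed

end

subsection \<open>Rapidly decaying coefficients\<close>

text \<open>Sorted decreasingly, the weights \<open>lattice_decay\<close> are of order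
  \<open>1 / j\<close> by the lattice point asymptotics, so their squares are summable.\<close>

lemma lattice_decay_summable: "(\<lambda>k :: 'n::finite ivec. (lattice_decay k)\<^sup>2) summable_on UNIV"
proof -
  interpret homogeneous_density "\<lambda>x :: 'n rvec. 1 / norm x ^ CARD('n)" by (rule homogeneous_density_power)
  obtain b :: "nat \<Rightarrow> 'n ivec" where b: "bij b" and bv: "(\<lambda>j. lattice_weight (b j) * real (j + 1)) \<longlonglongrightarrow> vol"
    by (rule enumeration)
  obtain K where K: "\<And>j. norm (lattice_weight (b j) * real (j + 1)) \<le> K"
    using convergent_imp_Bseq[OF convergentI[OF bv]] by (auto simp: Bseq_def)
  have le: "norm ((lattice_decay (b j))\<^sup>2) \<le> K\<^sup>2 * (1 / (real (Suc j))\<^sup>2)" for j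
  proof -
    have "lattice_decay (b j) * real (Suc j) \<le> K"
      using K[of j] lattice_decay_pos[of "b j"] by (simp add: lattice_decay_eq abs_mult)
    then have "lattice_decay (b j) \<le> K / real (Suc j)" by (simp add: field_simps)
    then have "(lattice_decay (b j))\<^sup>2 \<le> (K / real (Suc j))\<^sup>2"
      using lattice_decay_pos[of "b j"] by (intro power_mono) auto
    then show ?thesis by (simp add: power_divide)
  qed
  have "summable (\<lambda>n. 1 / (real n)\<^sup>2)"
    using inverse_power_summable[of 2, where 'a = real] by (simp add: inverse_eq_divide)
  then have "summable (\<lambda>n. 1 / (real (Suc n))\<^sup>2)"
    using summable_Suc_iff[of "\<lambda>n. 1 / (real n)\<^sup>2"] by simp
  then have "summable (\<lambda>n. K\<^sup>2 * (1 / (real (Suc n))\<^sup>2))" by (rule summable_mult)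
  then have "summable (\<lambda>j. norm ((lattice_decay (b j))\<^sup>2))"
    by (rule summable_comparison_test'[of _ 0]) (use le in simp)
  then have "(\<lambda>j. (lattice_decay (b j))\<^sup>2) summable_on UNIV" by (rule norm_summable_imp_summable_on)
  then show ?thesis using summable_on_reindex_bij_betw[OF b, of "\<lambda>k. (lattice_decay k)\<^sup>2"] by simp
qed

lemma lattice_decay_ge: "1 / (1 + norm (real_of_lattice k)) ^ CARD('n) \<le> lattice_decay (k :: 'n::finite ivec)"
proof (cases "k = 0")
  case False
  then have "norm (real_of_lattice k) ^ CARD('n) \<le> (1 + norm (real_of_lattice k)) ^ CARD('n)"
    by (intro power_mono) auto
  then show ?thesis using False by (simp add: lattice_decay_def frac_le)
qed (simp add: lattice_decay_def)

text \<open>The bound is shaped for later use: the square of \<open>lattice_decay\<close> is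
  summable, and \<open>m\<close> further powers of the norm are kept in reserve.\<close>

lemma rapidly_decaying_bound:
  fixes c :: "'n::finite ivec \<Rightarrow> complex"
  assumes "rapidly_decaying c"
  shows "\<exists>C\<ge>0. \<forall>k. cmod (c k) \<le> C * (lattice_decay k)\<^sup>2 / (1 + norm (real_of_lattice k)) ^ m"
proof -
  let ?n = "CARD('n)"
  obtain C where C: "\<And>k. (1 + norm (real_of_lattice k)) ^ (2 * ?n + m) * cmod (c k) \<le> C"
    using assms unfolding rapidly_decaying_def by blast
  have "cmod (c k) \<le> \<bar>C\<bar> * (lattice_decay k)\<^sup>2 / (1 + norm (real_of_lattice k)) ^ m" for k
  proof -
    let ?r = "1 + norm (real_of_lattice k)"
    have r: "0 < ?r" using norm_ge_zero[of "real_of_lattice k"] by linarith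
    have "cmod (c k) \<le> \<bar>C\<bar> / ?r ^ (2 * ?n + m)"
      using C[of k] r by (simp add: pos_le_divide_eq mult.commute)
    also have "\<dots> = \<bar>C\<bar> * (1 / ?r ^ ?n)\<^sup>2 / ?r ^ m"
      by (simp add: power_add power_mult mult.commute power_divide flip: power_mult)
    also have "\<dots> \<le> \<bar>C\<bar> * (lattice_decay k)\<^sup>2 / ?r ^ m"
      using r lattice_decay_ge[of k] by (intro divide_right_mono mult_left_mono power_mono) auto
    finally show ?thesis .
  qed
  then show ?thesis by (intro exI[of _ "\<bar>C\<bar>"]) auto
qed

lemma rapidly_decaying_summable:
  fixes \<theta> :: "'n::{finite, linorder} rmat"
  assumes c: "rapidly_decaying c"
  shows "(\<lambda>k. c k *\<^sub>C nct_monomial \<theta> k) summable_on UNIV"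
proof -
  obtain C where C: "\<And>k. cmod (c k) \<le> C * (lattice_decay k)\<^sup>2"
    using rapidly_decaying_bound[OF c, of 0] by auto
  have "(\<lambda>k. norm (c k *\<^sub>C nct_monomial \<theta> k)) summable_on UNIV"
  proof (rule summable_on_comparison_test)
    show "(\<lambda>k. C * (lattice_decay k)\<^sup>2) summable_on (UNIV :: 'n ivec set)"
      by (intro summable_on_cmult_right lattice_decay_summable)
    show "norm (c k *\<^sub>C nct_monomial \<theta> k) \<le> C * (lattice_decay k)\<^sup>2" for k
      using mult_left_mono[OF norm_monomial_le[of \<theta> k], of "cmod (c k)"] C[of k]
      by (simp add: norm_scaleC_blinfun)
  qed auto
  then show ?thesis by (rule abs_summable_summable)
qed

lemma
  assumes "u \<in> nct_smooth \<theta>"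
  shows nct_smooth_coeff_decay: "rapidly_decaying (nct_coeff \<theta> u)"
    and nct_smooth_expand: "((\<lambda>k. nct_coeff \<theta> u k *\<^sub>C nct_monomial \<theta> k) has_sum u) UNIV"
proof -
  obtain c where c: "rapidly_decaying c" "((\<lambda>k. c k *\<^sub>C nct_monomial \<theta> k) has_sum u) UNIV"
    using assms by (auto simp: nct_smooth_def)
  have "nct_coeff \<theta> u = c" using nct_coeff_has_sum[OF c(2)] by auto
  then show "rapidly_decaying (nct_coeff \<theta> u)" "((\<lambda>k. nct_coeff \<theta> u k *\<^sub>C nct_monomial \<theta> k) has_sum u) UNIV"
    using c by simp_all
qed

lemma nct_smooth_algebra: "u \<in> nct_smooth \<theta> \<Longrightarrow> u \<in> nct_algebra \<theta>"
  by (rule nct_algebra_has_sum[OF nct_smooth_expand])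
    (auto intro: nct_algebra_scaleC nct_algebra_monomial)

lemma nct_smooth_monomial: "nct_monomial \<theta> l \<in> nct_smooth \<theta>"
proof -
  have "rapidly_decaying (\<lambda>k. if k = l then 1 else 0)"
    unfolding rapidly_decaying_def by (auto intro!: exI[of _ "(1 + norm (real_of_lattice l)) ^ _"])
  moreover have "((\<lambda>k. (if k = l then 1 else 0) *\<^sub>C nct_monomial \<theta> k) has_sum nct_monomial \<theta> l) UNIV"
  proof -
    have "((\<lambda>k. (if k = l then 1 else 0) *\<^sub>C nct_monomial \<theta> k) has_sum nct_monomial \<theta> l) {l}"
      by (intro has_sum_finiteI) (auto simp: scaleC_one)
    then show ?thesis by (rule has_sum_cong_neutral[THEN iffD1, rotated -1]) auto
  qed
  ultimately show ?thesis unfolding nct_smooth_def by blast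
qed

lemma rapidly_decaying_mult_coord:
  assumes c: "rapidly_decaying c"
  shows "rapidly_decaying (\<lambda>k. of_int (k $ j) * c k)"
  unfolding rapidly_decaying_def
proof
  fix N
  obtain C where C: "\<And>k. (1 + norm (real_of_lattice k)) ^ Suc N * cmod (c k) \<le> C"
    using c unfolding rapidly_decaying_def by blast
  have "(1 + norm (real_of_lattice k)) ^ N * cmod (of_int (k $ j) * c k) \<le> C" for k
  proof -
    have "\<bar>real_of_int (k $ j)\<bar> \<le> 1 + norm (real_of_lattice k)"
      using component_le_norm_cart[of "real_of_lattice k" j] by simp
    then have "(1 + norm (real_of_lattice k)) ^ N * (\<bar>real_of_int (k $ j)\<bar> * cmod (c k))
        \<le> (1 + norm (real_of_lattice k)) ^ N * ((1 + norm (real_of_lattice k)) * cmod (c k))"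
      by (intro mult_left_mono mult_right_mono) auto
    then show ?thesis using C[of k] by (simp add: norm_mult mult_ac)
  qed
  then show "\<exists>C. \<forall>k. (1 + norm (real_of_lattice k)) ^ N * cmod (of_int (k $ j) * c k) \<le> C" by blast
qed

lemma
  assumes u: "u \<in> nct_smooth \<theta>"
  shows nct_delta_smooth: "nct_delta \<theta> j u \<in> nct_smooth \<theta>"
    and nct_coeff_delta: "nct_coeff \<theta> (nct_delta \<theta> j u) k = of_int (k $ j) * nct_coeff \<theta> u k"
proof -
  have rd: "rapidly_decaying (\<lambda>k. of_int (k $ j) * nct_coeff \<theta> u k)"
    by (rule rapidly_decaying_mult_coord[OF nct_smooth_coeff_decay[OF u]])
  have hs: "((\<lambda>k. (of_int (k $ j) * nct_coeff \<theta> u k) *\<^sub>C nct_monomial \<theta> k) has_sum nct_delta \<theta> j u) UNIV"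
    unfolding nct_delta_def by (rule has_sum_infsum[OF rapidly_decaying_summable[OF rd]])
  show "nct_delta \<theta> j u \<in> nct_smooth \<theta>" using rd hs unfolding nct_smooth_def by blast
  show "nct_coeff \<theta> (nct_delta \<theta> j u) k = of_int (k $ j) * nct_coeff \<theta> u k"
    by (rule nct_coeff_has_sum[OF hs])
qed

lemma nct_coeff_deltas:
  assumes u: "u \<in> nct_smooth \<theta>"
  shows "nct_coeff \<theta> (nct_deltas \<theta> \<alpha> u) k = (\<Prod>j\<in>UNIV. of_int (k $ j) ^ \<alpha> j) * nct_coeff \<theta> u k"
proof -
  have pw: "(nct_delta \<theta> j ^^ m) v \<in> nct_smooth \<theta> \<and>
      nct_coeff \<theta> ((nct_delta \<theta> j ^^ m) v) k = of_int (k $ j) ^ m * nct_coeff \<theta> v k"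
    if "v \<in> nct_smooth \<theta>" for v j m
    by (induction m) (use that in \<open>auto simp: nct_delta_smooth nct_coeff_delta mult.assoc\<close>)
  have "foldr (\<lambda>j. nct_delta \<theta> j ^^ \<alpha> j) js u \<in> nct_smooth \<theta> \<and>
      nct_coeff \<theta> (foldr (\<lambda>j. nct_delta \<theta> j ^^ \<alpha> j) js u) k
        = (\<Prod>j\<in>set js. of_int (k $ j) ^ \<alpha> j) * nct_coeff \<theta> u k" if "distinct js" for js
    using that
  proof (induction js)
    case (Cons j js)
    then show ?case using pw[where v = "foldr (\<lambda>j. nct_delta \<theta> j ^^ \<alpha> j) js u" and j = j and m = "\<alpha> j"] by (simp add: mult.assoc)
  qed (simp add: u)
  from this[OF set_coords(2)] show ?thesis by (simp add: nct_deltas_def set_coords)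
qed

text \<open>The largest component carries at least the fraction \<open>1 / n\<close> of the norm.
  Hence pure powers of single derivations control all powers of the norm.\<close>

lemma norm_power_le_sum_components:
  "norm (real_of_lattice k) ^ N \<le> real CARD('n) ^ N * (\<Sum>j\<in>UNIV. \<bar>real_of_int (k $ j)\<bar> ^ N)" for k :: "'n::finite ivec"
proof -
  let ?m = "Max (range (\<lambda>j. \<bar>real_of_int (k $ j)\<bar>))"
  have "?m \<in> range (\<lambda>j. \<bar>real_of_int (k $ j)\<bar>)" by (intro Max_in) auto
  then obtain i where i: "?m = \<bar>real_of_int (k $ i)\<bar>" unfolding image_iff by blast
  have "norm (real_of_lattice k) \<le> (\<Sum>j\<in>UNIV. \<bar>real_of_int (k $ j)\<bar>)"
    using norm_le_l1_cart[of "real_of_lattice k"] by simp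
  also have "\<dots> \<le> (\<Sum>j\<in>(UNIV :: 'n set). ?m)" by (intro sum_mono Max_ge) auto
  also have "\<dots> = real CARD('n) * \<bar>real_of_int (k $ i)\<bar>" by (simp add: i)
  finally have "norm (real_of_lattice k) ^ N \<le> (real CARD('n) * \<bar>real_of_int (k $ i)\<bar>) ^ N"
    by (intro power_mono) auto
  also have "\<dots> = real CARD('n) ^ N * \<bar>real_of_int (k $ i)\<bar> ^ N" by (rule power_mult_distrib)
  also have "\<dots> \<le> real CARD('n) ^ N * (\<Sum>j\<in>UNIV. \<bar>real_of_int (k $ j)\<bar> ^ N)"
    by (intro mult_left_mono member_le_sum[of i UNIV "\<lambda>j. \<bar>real_of_int (k $ j)\<bar> ^ N"]) auto
  finally show ?thesis .
qed

lemma nct_coeff_le_deltas: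
  fixes \<theta> :: "'n::{finite, linorder} rmat"
  assumes u: "u \<in> nct_smooth \<theta>"
  shows "norm (real_of_lattice k) ^ N * cmod (nct_coeff \<theta> u k)
    \<le> real CARD('n) ^ N * (\<Sum>j\<in>UNIV. norm (nct_deltas \<theta> (\<lambda>i. if i = j then N else 0) u))"
proof -
  have "\<bar>real_of_int (k $ j)\<bar> ^ N * cmod (nct_coeff \<theta> u k) \<le> norm (nct_deltas \<theta> (\<lambda>i. if i = j then N else 0) u)" for j
  proof -
    have "(\<Prod>i\<in>UNIV. of_int (k $ i) ^ (if i = j then N else 0)) = (\<Prod>i\<in>UNIV. if i = j then of_int (k $ j) ^ N else (1 :: complex))"
      by (intro prod.cong refl) auto
    then have "nct_coeff \<theta> (nct_deltas \<theta> (\<lambda>i. if i = j then N else 0) u) k = of_int (k $ j) ^ N * nct_coeff \<theta> u k"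
      using nct_coeff_deltas[OF u, of "\<lambda>i. if i = j then N else 0" k] by simp
    then show ?thesis
      using norm_nct_coeff_le[of \<theta> "nct_deltas \<theta> (\<lambda>i. if i = j then N else 0) u" k]
      by (simp add: norm_mult norm_power)
  qed
  then have "(\<Sum>j\<in>UNIV. \<bar>real_of_int (k $ j)\<bar> ^ N) * cmod (nct_coeff \<theta> u k)
      \<le> (\<Sum>j\<in>UNIV. norm (nct_deltas \<theta> (\<lambda>i. if i = j then N else 0) u))"
    unfolding sum_distrib_right by (rule sum_mono)
  then have "real CARD('n) ^ N * ((\<Sum>j\<in>UNIV. \<bar>real_of_int (k $ j)\<bar> ^ N) * cmod (nct_coeff \<theta> u k))
      \<le> real CARD('n) ^ N * (\<Sum>j\<in>UNIV. norm (nct_deltas \<theta> (\<lambda>i. if i = j then N else 0) u))"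
    by (intro mult_left_mono) auto
  moreover have "norm (real_of_lattice k) ^ N * cmod (nct_coeff \<theta> u k)
      \<le> (real CARD('n) ^ N * (\<Sum>j\<in>UNIV. \<bar>real_of_int (k $ j)\<bar> ^ N)) * cmod (nct_coeff \<theta> u k)"
    by (intro mult_right_mono norm_power_le_sum_components) auto
  ultimately show ?thesis by (simp only: mult.assoc)
qed

subsection \<open>A small divisor estimate\<close>

text \<open>Infinite descent: \<open>p\<close> is even, and half of it takes the place of
  \<open>m\<close> in an equation of the same kind with a smaller solution.\<close>

lemma sqrt2_irrational_nat: "2 * m\<^sup>2 = (p :: nat)\<^sup>2 \<Longrightarrow> m = 0"
proof (induction m arbitrary: p rule: less_induct)
  case (less m)
  then have "even (p\<^sup>2)" by (metis dvd_triv_left)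
  then obtain q where q: "p = 2 * q" by (auto elim: evenE)
  then have mq: "2 * q\<^sup>2 = m\<^sup>2" using less.prems by (simp add: power2_eq_square)
  show ?case
  proof (rule ccontr)
    assume "m \<noteq> 0"
    moreover have "q < m"
    proof (rule ccontr)
      assume "\<not> q < m"
      then have "m\<^sup>2 \<le> q\<^sup>2" by (simp add: power_mono)
      then have "q\<^sup>2 = 0" using mq by linarith
      then show False using mq \<open>m \<noteq> 0\<close> by simp
    qed
    ultimately show False using less.IH[OF _ mq] mq by simp
  qed
qed

text \<open>Liouville's argument: the nonzero integer \<open>2 * m^2 - p^2\<close> factors into
  \<open>sqrt 2 * m - p\<close> and \<open>sqrt 2 * m + p\<close>, and the second factor is at most
  \<open>4 * |m|\<close>.\<close>

lemma sqrt2_diophantine: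
  fixes m p :: int
  assumes m: "m \<noteq> 0" and p: "\<bar>sqrt 2 * of_int m - of_int p\<bar> \<le> 1/2"
  shows "1 \<le> 4 * \<bar>real_of_int m\<bar> * \<bar>sqrt 2 * of_int m - of_int p\<bar>"
proof -
  let ?m = "\<bar>real_of_int m\<bar>" and ?x = "sqrt 2 * of_int m - of_int p"
  have m1: "1 \<le> ?m" using m by linarith
  have "2 * m\<^sup>2 \<noteq> p\<^sup>2"
  proof
    assume "2 * m\<^sup>2 = p\<^sup>2"
    then have "int (2 * (nat \<bar>m\<bar>)\<^sup>2) = int ((nat \<bar>p\<bar>)\<^sup>2)" by simp
    then have "nat \<bar>m\<bar> = 0" using sqrt2_irrational_nat by (metis of_nat_eq_iff)
    then show False using m by simp
  qed
  then have "1 \<le> \<bar>2 * m\<^sup>2 - p\<^sup>2\<bar>" by linarith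
  then have "1 \<le> \<bar>real_of_int (2 * m\<^sup>2 - p\<^sup>2)\<bar>" by linarith
  also have "real_of_int (2 * m\<^sup>2 - p\<^sup>2) = ?x * (sqrt 2 * of_int m + of_int p)"
    by (simp add: algebra_simps power2_eq_square flip: power2_eq_square[of "sqrt 2"])
  also have "\<bar>\<dots>\<bar> = \<bar>?x\<bar> * \<bar>sqrt 2 * of_int m + of_int p\<bar>" by (rule abs_mult)
  also have "\<dots> \<le> \<bar>?x\<bar> * (4 * ?m)"
  proof (rule mult_left_mono)
    have "sqrt 2 \<le> 3/2" by (rule real_le_lsqrt) (auto simp: power2_eq_square)
    then have "sqrt 2 * ?m \<le> 3/2 * ?m" by (rule mult_right_mono) simp
    then have "\<bar>sqrt 2 * of_int m\<bar> \<le> 3/2 * ?m" by (simp add: abs_mult)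
    then show "\<bar>sqrt 2 * of_int m + of_int p\<bar> \<le> 4 * ?m" using p m1 by linarith
  qed simp
  finally show ?thesis by (simp add: mult_ac)
qed

text \<open>The Taylor remainder is at most \<open>|y|^3 / 6\<close>, which is at most half of
  \<open>|y|\<close> because \<open>y^2 \<le> 3\<close> on this interval.\<close>

lemma half_le_abs_sin:
  assumes "\<bar>y\<bar> \<le> pi / 2" shows "\<bar>y\<bar> / 2 \<le> \<bar>sin y\<bar>"
proof -
  have "\<bar>sin y - (\<Sum>m<3. sin_coeff m * y ^ m)\<bar> \<le> inverse (fact 3) * \<bar>y\<bar> ^ 3" by (rule Maclaurin_sin_bound)
  moreover have "(\<Sum>m<3. sin_coeff m * y ^ m) = y" by (simp add: sin_coeff_def numeral_3_eq_3)
  ultimately have b: "\<bar>sin y - y\<bar> \<le> \<bar>y\<bar> ^ 3 / 6" by (simp add: fact_numeral)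
  have "pi \<le> 34/10" using pi_approx(2) by simp
  then have "\<bar>y\<bar> \<le> 17/10" using assms by linarith
  then have "\<bar>y\<bar>\<^sup>2 \<le> (17/10)\<^sup>2" by (intro power_mono) auto
  then have "\<bar>y\<bar>\<^sup>2 \<le> 3" by (simp add: power2_eq_square)
  then have "\<bar>y\<bar> * \<bar>y\<bar>\<^sup>2 \<le> \<bar>y\<bar> * 3" by (intro mult_left_mono) auto
  then have "\<bar>y\<bar> ^ 3 / 6 \<le> \<bar>y\<bar> / 2" by (simp add: power3_eq_cube power2_eq_square)
  then show ?thesis using b by linarith
qed

text \<open>With \<open>x\<close> the signed distance of \<open>sqrt 2 * m\<close> to the nearest
  integer, the divisor has modulus \<open>2 * |sin (pi * x)|\<close>, which is at least
  \<open>|x|\<close>.\<close>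

lemma small_divisor:
  assumes m: "m \<noteq> (0 :: int)"
  shows "1 \<le> 4 * \<bar>real_of_int m\<bar> * cmod (cis (2 * pi * sqrt 2 * of_int m) - 1)"
proof -
  define p where "p = round (sqrt 2 * of_int m)"
  let ?x = "sqrt 2 * of_int m - of_int p"
  have x: "\<bar>?x\<bar> \<le> 1/2" unfolding p_def using of_int_round_abs_le[of "sqrt 2 * of_int m"] by (simp add: abs_minus_commute)
  have d: "1 \<le> 4 * \<bar>real_of_int m\<bar> * \<bar>?x\<bar>" by (rule sqrt2_diophantine[OF m x])
  have "2 * pi * sqrt 2 * of_int m = 2 * pi * ?x + 2 * pi * of_int p" by (simp add: algebra_simps)
  then have "cis (2 * pi * sqrt 2 * of_int m) = cis (2 * pi * ?x) * cis (2 * pi * of_int p)"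
    by (simp only: cis_mult)
  also have "\<dots> = cis (2 * pi * ?x)" by (simp add: cis_multiple_2pi)
  also have "cis (2 * pi * ?x) - 1 = cis (pi * ?x) * (cis (pi * ?x) - cis (- (pi * ?x)))"
  proof -
    have "cis (2 * pi * x) - 1 = cis (pi * x) * (cis (pi * x) - cis (- (pi * x)))" for x :: real
      unfolding right_diff_distrib cis_mult by (simp add: mult.assoc)
    then show ?thesis .
  qed
  also have "cis (pi * ?x) - cis (- (pi * ?x)) = complex_of_real (2 * sin (pi * ?x)) * \<i>"
    by (simp add: complex_eq_iff)
  finally have c: "cmod (cis (2 * pi * sqrt 2 * of_int m) - 1) = 2 * \<bar>sin (pi * ?x)\<bar>"
    by (simp add: norm_mult)
  have "\<bar>pi * ?x\<bar> / 2 \<le> \<bar>sin (pi * ?x)\<bar>"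
    using x by (intro half_le_abs_sin) (simp add: abs_mult mult_left_mono[of _ "1/2" pi, simplified])
  then have "\<bar>?x\<bar> \<le> 2 * \<bar>sin (pi * ?x)\<bar>"
    using mult_right_mono[of 1 pi "\<bar>?x\<bar>"] pi_gt3 by (simp add: abs_mult)
  then have "4 * \<bar>real_of_int m\<bar> * \<bar>?x\<bar> \<le> 4 * \<bar>real_of_int m\<bar> * (2 * \<bar>sin (pi * ?x)\<bar>)"
    by (intro mult_left_mono) auto
  then show ?thesis unfolding c by (rule order_trans[OF d])
qed

subsection \<open>Operators with rapidly decaying off-diagonals\<close>

text \<open>The first index counts diagonals: \<open>a l k\<close> is the matrix entry in row \<open>l + k\<close> and column \<open>k\<close>.\<close>

definition diag_sum :: "('n::finite ivec \<Rightarrow> 'h::complex_hilbert) \<Rightarrow> ('n ivec \<Rightarrow> 'n ivec \<Rightarrow> complex) \<Rightarrow> 'h \<Rightarrow>\<^sub>L 'h" where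
  "diag_sum e a = (\<Sum>\<^sub>\<infinity>l. wop e (\<lambda>k. e (l + k)) (a l))"

text \<open>The squared factor makes the diagonals summable over \<open>l\<close>, the power
  \<open>m\<close> is the reserve spent on small divisors, and the last factor is the order
  \<open>-n\<close> in \<open>k\<close>.\<close>

definition matrix_decay :: "nat \<Rightarrow> ('n::finite ivec \<Rightarrow> 'n ivec \<Rightarrow> complex) \<Rightarrow> bool" where
  "matrix_decay m a \<longleftrightarrow> (\<exists>C\<ge>0. \<forall>l k. cmod (a l k) \<le> C * (lattice_decay l)\<^sup>2 / (1 + norm (real_of_lattice l)) ^ m * lattice_decay k)"

lemma matrix_decay_mono:
  assumes a: "matrix_decay m a" and le: "\<And>l k. cmod (b l k) \<le> cmod (a l k)"
  shows "matrix_decay m b"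
  using a unfolding matrix_decay_def by (meson le order_trans)

lemma matrix_decay_0: "matrix_decay m a \<Longrightarrow> matrix_decay 0 a"
proof -
  assume "matrix_decay m a"
  then obtain C where C: "C \<ge> 0" "\<And>l k. cmod (a l k) \<le> C * (lattice_decay l)\<^sup>2 / (1 + norm (real_of_lattice l)) ^ m * lattice_decay k"
    unfolding matrix_decay_def by blast
  have "cmod (a l k) \<le> C * (lattice_decay l)\<^sup>2 / (1 + norm (real_of_lattice l)) ^ 0 * lattice_decay k" for l k
  proof -
    have "1 \<le> (1 + norm (real_of_lattice l)) ^ m" by (rule one_le_power) simp
    then have "C * (lattice_decay l)\<^sup>2 / (1 + norm (real_of_lattice l)) ^ m \<le> C * (lattice_decay l)\<^sup>2 / 1"
    proof -
      have "0 < (1 + norm (real_of_lattice l)) ^ m" by (intro zero_less_power add_pos_nonneg) auto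
      then have "0 < (1 + norm (real_of_lattice l)) ^ m * 1" by simp
      moreover have "0 \<le> C * (lattice_decay l)\<^sup>2" using C(1) by simp
      ultimately show ?thesis using \<open>1 \<le> (1 + norm (real_of_lattice l)) ^ m\<close> by (intro divide_left_mono)
    qed
    then have "C * (lattice_decay l)\<^sup>2 / (1 + norm (real_of_lattice l)) ^ m * lattice_decay k \<le> C * (lattice_decay l)\<^sup>2 / 1 * lattice_decay k"
      using lattice_decay_pos[of k] by (intro mult_right_mono) auto
    then show ?thesis using C(2)[of l k] by simp
  qed
  then show ?thesis unfolding matrix_decay_def using C(1) by blast
qed

lemma matrix_decay_row: "matrix_decay 0 a \<Longrightarrow> decay_bdd (a l)"
  unfolding matrix_decay_def decay_bdd_def by (auto intro: exI[of _ "_ * (lattice_decay l)\<^sup>2"])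

lemma clinear_op_has_sum:
  fixes f :: "'i \<Rightarrow> 'a::complex_inner \<Rightarrow>\<^sub>L 'b::complex_inner"
  assumes s: "(f has_sum T) A" and cl: "\<And>i. i \<in> A \<Longrightarrow> clinear_op (f i)"
  shows "clinear_op T"
  unfolding clinear_op_def
proof (intro allI)
  fix c x
  have ap: "((\<lambda>i. f i y) has_sum T y) A" for y
    by (rule has_sum_bounded_linear[OF blinfun.bounded_linear_left s])
  have "((\<lambda>i. c *\<^sub>C f i x) has_sum c *\<^sub>C T x) A"
    by (rule has_sum_bounded_linear[OF bounded_linear_scaleC ap])
  moreover have "((\<lambda>i. c *\<^sub>C f i x) has_sum T (c *\<^sub>C x)) A"
    using ap[of "c *\<^sub>C x"] by (rule has_sum_cong[THEN iffD1, rotated]) (simp add: clinear_opD[OF cl])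
  ultimately show "T (c *\<^sub>C x) = c *\<^sub>C T x" using has_sum_unique by blast
qed

context
  fixes e :: "'n::finite ivec \<Rightarrow> 'h::complex_hilbert"
  assumes e: "onb e"
begin

lemma ortho_shift: "ortho_fam (\<lambda>k. e (l + k))"
  by (rule ortho_fam_inj[OF onb_ortho_fam[OF e]]) (simp add: inj_def)

text \<open>Norm convergence of the diagonals would not keep the sum in the ideal. After the common
  right factor \<open>?D\<close> is split off, the remaining shifts have norms bounded by a summable
  sequence and add up to a bounded \<open>B\<close>; the sum is \<open>B\<close> composed with
  \<open>?D\<close>.\<close>

lemma
  assumes a: "matrix_decay 0 a"
  shows diag_sum_has_sum: "((\<lambda>l. wop e (\<lambda>k. e (l + k)) (a l)) has_sum diag_sum e a) UNIV"
    and diag_sum_weak: "diag_sum e a \<in> weak_trace_class"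
    and clinear_diag_sum: "clinear_op (diag_sum e a)"
proof -
  obtain C where C0: "C \<ge> 0" and C: "\<And>l k. cmod (a l k) \<le> C * (lattice_decay l)\<^sup>2 * lattice_decay k"
    using a unfolding matrix_decay_def by auto
  let ?q = "\<lambda>l k. a l k / complex_of_real (lattice_decay k)"
  let ?D = "wop e e (\<lambda>k. complex_of_real (lattice_decay k))"
  note L = lattice_diag_eq[OF e ortho_shift C]
  have "(\<lambda>l. norm (wop e (\<lambda>k. e (l + k)) (?q l))) summable_on UNIV"
  proof (rule summable_on_comparison_test)
    show "(\<lambda>l. C * (lattice_decay l)\<^sup>2) summable_on (UNIV :: 'n ivec set)"
      by (intro summable_on_cmult_right lattice_decay_summable)
  qed (use L(3) in auto)
  then have "(\<lambda>l. wop e (\<lambda>k. e (l + k)) (?q l)) summable_on UNIV" by (rule abs_summable_summable)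
  then obtain B where B: "((\<lambda>l. wop e (\<lambda>k. e (l + k)) (?q l)) has_sum B) UNIV" by (auto simp: summable_on_def)
  have clB: "clinear_op B" by (rule clinear_op_has_sum[OF B L(2)])
  have "((\<lambda>l. wop e (\<lambda>k. e (l + k)) (?q l) o\<^sub>L ?D) has_sum B o\<^sub>L ?D) UNIV"
    by (rule has_sum_bounded_linear[OF bounded_bilinear.bounded_linear_left[OF bounded_bilinear_blinfun_compose] B])
  then have hs: "((\<lambda>l. wop e (\<lambda>k. e (l + k)) (a l)) has_sum B o\<^sub>L ?D) UNIV" by (simp only: L(1)[symmetric])
  then have eq: "diag_sum e a = B o\<^sub>L ?D" unfolding diag_sum_def by (rule infsumI)
  show "((\<lambda>l. wop e (\<lambda>k. e (l + k)) (a l)) has_sum diag_sum e a) UNIV" using hs eq by simp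
  show w: "diag_sum e a \<in> weak_trace_class" unfolding eq by (rule lattice_decay_op[OF e clB])
  then show "clinear_op (diag_sum e a)" by (simp add: weak_trace_class_def compact_op_def)
qed

lemma diag_sum_apply:
  assumes a: "matrix_decay 0 a"
  shows "((\<lambda>l. a l k *\<^sub>C e (l + k)) has_sum diag_sum e a (e k)) UNIV"
proof -
  have "((\<lambda>l. wop e (\<lambda>k. e (l + k)) (a l) (e k)) has_sum diag_sum e a (e k)) UNIV"
    by (rule has_sum_bounded_linear[OF blinfun.bounded_linear_left diag_sum_has_sum[OF a]])
  moreover have "wop e (\<lambda>k. e (l + k)) (a l) (e k) = a l k *\<^sub>C e (l + k)" for l
  proof -
    obtain K where "\<And>k. cmod (a l k) \<le> K" using decay_bdd_bounded[OF matrix_decay_row[OF a]] by blast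
    then show ?thesis by (rule wop_apply_onb[OF e ortho_shift])
  qed
  ultimately show ?thesis by simp
qed

lemma diag_sum_eqI:
  assumes a: "matrix_decay 0 a" and T: "clinear_op T"
    and eq: "\<And>k. ((\<lambda>l. a l k *\<^sub>C e (l + k)) has_sum T (e k)) UNIV"
  shows "T = diag_sum e a"
  by (rule onb_blinfun_eqI[OF e T clinear_diag_sum[OF a]]) (rule has_sum_unique[OF eq diag_sum_apply[OF a]])

lemma diag_sum_add:
  assumes a: "matrix_decay 0 a" and b: "matrix_decay 0 b" and ab: "matrix_decay 0 (\<lambda>l k. a l k + b l k)"
  shows "diag_sum e (\<lambda>l k. a l k + b l k) = diag_sum e a + diag_sum e b"
proof (rule diag_sum_eqI[OF ab, symmetric])
  show "clinear_op (diag_sum e a + diag_sum e b)" by (intro clinear_op_add clinear_diag_sum a b)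
  show "((\<lambda>l. (a l k + b l k) *\<^sub>C e (l + k)) has_sum (diag_sum e a + diag_sum e b) (e k)) UNIV" for k
    using has_sum_add[OF diag_sum_apply[OF a] diag_sum_apply[OF b]] by (simp add: scaleC_add_left blinfun.add_left)
qed

lemma diag_sum_diagonal:
  assumes a: "matrix_decay 0 a" and z: "\<And>l k. l \<noteq> 0 \<Longrightarrow> a l k = 0"
  shows "diag_sum e a = wop e e (a 0)"
proof (rule diag_sum_eqI[OF a, symmetric])
  obtain K where K: "\<And>k. cmod (a 0 k) \<le> K" using decay_bdd_bounded[OF matrix_decay_row[OF a]] by blast
  note o = onb_ortho_fam[OF e]
  show "clinear_op (wop e e (a 0))" by (rule clinear_wop[OF o o K])
  fix k
  have "((\<lambda>l. a l k *\<^sub>C e (l + k)) has_sum a 0 k *\<^sub>C e k) {0}"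
    by (intro has_sum_finiteI) auto
  then have "((\<lambda>l. a l k *\<^sub>C e (l + k)) has_sum a 0 k *\<^sub>C e k) UNIV"
    by (rule has_sum_cong_neutral[THEN iffD1, rotated -1]) (auto simp: z)
  then show "((\<lambda>l. a l k *\<^sub>C e (l + k)) has_sum wop e e (a 0) (e k)) UNIV"
    by (simp add: wop_apply_onb[OF e o K])
qed

text \<open>If all entries with \<open>l j = 0\<close> vanish, the operator is a commutator with the unitary that
  multiplies \<open>e k\<close> by \<open>exp (2 \<pi> i sqrt 2 k j)\<close>; dividing by the small denominators costs one power of
  the decay in \<open>l\<close>.\<close>

lemma trace_diag_sum_commutator:
  assumes tr: "is_trace \<phi>" and a: "matrix_decay 1 a" and z: "\<And>l k. l $ j = 0 \<Longrightarrow> a l k = 0"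
  shows "\<phi> (diag_sum e a) = 0"
proof -
  note o = onb_ortho_fam[OF e]
  define s where "s m = cis (2 * pi * sqrt 2 * of_int m)" for m :: int
  have s_add: "s (m + m') = s m * s m'" for m m' by (simp add: s_def cis_mult algebra_simps)
  have s1: "cmod (s m) = 1" for m by (simp add: s_def)
  \<comment> \<open>Commuting with \<open>V\<close> multiplies the entry on diagonal
    \<open>l\<close>, column \<open>k\<close>, by \<open>s (k $ j) * (s (l $ j) - 1)\<close>;
    \<open>b\<close> is \<open>a\<close> divided by this factor.\<close>
  define b where "b l k = (if l $ j = 0 then 0 else a l k / (s (l $ j) - 1) / s (k $ j))" for l k
  have sd: "1 \<le> 4 * \<bar>real_of_int m\<bar> * cmod (s m - 1)" if "m \<noteq> 0" for m
    unfolding s_def by (rule small_divisor[OF that])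
  obtain C where C0: "C \<ge> 0" and C: "\<And>l k. cmod (a l k) \<le> C * (lattice_decay l)\<^sup>2 / (1 + norm (real_of_lattice l)) ^ 1 * lattice_decay k"
    using a unfolding matrix_decay_def by auto
  have b_le: "cmod (b l k) \<le> 4 * C * (lattice_decay l)\<^sup>2 / (1 + norm (real_of_lattice l)) ^ 0 * lattice_decay k" for l k
  proof (cases "l $ j = 0")
    case False
    let ?r = "1 + norm (real_of_lattice l)" and ?d = "cmod (s (l $ j) - 1)"
    have r: "\<bar>real_of_int (l $ j)\<bar> \<le> ?r" "0 < ?r"
      using component_le_norm_cart[of "real_of_lattice l" j] norm_ge_zero[of "real_of_lattice l"] by (auto simp del: norm_ge_zero)
    have d: "1 \<le> 4 * \<bar>real_of_int (l $ j)\<bar> * ?d" by (rule sd[OF False])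
    then have d0: "0 < ?d" by (metis mult_zero_right not_one_le_zero zero_less_norm_iff norm_zero)
    have "4 * \<bar>real_of_int (l $ j)\<bar> * ?d \<le> 4 * ?r * ?d" using r by (intro mult_right_mono mult_left_mono) auto
    then have d4: "1 \<le> 4 * ?r * ?d" using d by linarith
    have "cmod (b l k) = cmod (a l k) / ?d" using False by (simp add: b_def norm_divide norm_mult s1)
    also have "\<dots> \<le> cmod (a l k) * (4 * ?r)"
      using mult_left_mono[OF d4, of "cmod (a l k)"] d0 by (simp add: pos_divide_le_eq mult_ac)
    also have "\<dots> \<le> (C * (lattice_decay l)\<^sup>2 / ?r ^ 1 * lattice_decay k) * (4 * ?r)"
      using C r by (intro mult_right_mono) auto
    also have "\<dots> = 4 * C * (lattice_decay l)\<^sup>2 / ?r ^ 0 * lattice_decay k"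
    proof -
      have "C * A / r ^ 1 * D * (4 * r) = 4 * C * A / r ^ 0 * D" if "0 < r" for A r D :: real
        using that by simp
      from this[OF r(2)] show ?thesis .
    qed
    finally show ?thesis .
  qed (use C0 lattice_decay_pos[of k] in \<open>simp add: b_def\<close>)
  have b: "matrix_decay 0 b" unfolding matrix_decay_def using b_le C0 by (intro exI[of _ "4 * C"]) auto
  define V where "V = wop e e (\<lambda>k. s (k $ j))"
  have sb: "cmod (s (k $ j)) \<le> 1" for k by (simp add: s1)
  have V: "V (e k) = s (k $ j) *\<^sub>C e k" for k unfolding V_def by (rule wop_apply_onb[OF e o sb])
  have clV: "clinear_op V" unfolding V_def by (rule clinear_wop[OF o o sb])
  note clb = clinear_diag_sum[OF b]
  have a0: "matrix_decay 0 a" by (rule matrix_decay_0[OF a])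
  have "(V o\<^sub>L diag_sum e b) - (diag_sum e b o\<^sub>L V) = diag_sum e a"
  proof (rule diag_sum_eqI[OF a0])
    show "clinear_op ((V o\<^sub>L diag_sum e b) - (diag_sum e b o\<^sub>L V))"
      by (intro clinear_op_diff clinear_op_compose clV clb)
    fix k
    note db = diag_sum_apply[OF b, of k]
    have h1: "((\<lambda>l. (b l k * s ((l + k) $ j)) *\<^sub>C e (l + k)) has_sum V (diag_sum e b (e k))) UNIV"
      using has_sum_bounded_linear[OF blinfun.bounded_linear_right[of V] db]
      by (simp add: clinear_opD[OF clV] V scaleC_scaleC)
    have h2: "((\<lambda>l. (s (k $ j) * b l k) *\<^sub>C e (l + k)) has_sum s (k $ j) *\<^sub>C diag_sum e b (e k)) UNIV"
      using has_sum_bounded_linear[OF bounded_linear_scaleC db] by (simp add: scaleC_scaleC)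
    have h3: "diag_sum e b (V (e k)) = s (k $ j) *\<^sub>C diag_sum e b (e k)" by (simp add: V clinear_opD[OF clb])
    have eq: "b l k * s ((l + k) $ j) - s (k $ j) * b l k = a l k" for l
    proof (cases "l $ j = 0")
      case False
      have "s (k $ j) \<noteq> 0" using s1[of "k $ j"] by auto
      moreover have "s (l $ j) - 1 \<noteq> 0" using sd[OF False] by auto
      moreover have "b l k * s ((l + k) $ j) - s (k $ j) * b l k = b l k * s (k $ j) * (s (l $ j) - 1)"
        by (simp add: s_add algebra_simps)
      ultimately show ?thesis using False by (simp add: b_def)
    qed (simp add: b_def z)
    have "((\<lambda>l. (b l k * s ((l + k) $ j)) *\<^sub>C e (l + k) - (s (k $ j) * b l k) *\<^sub>C e (l + k)) has_sum
      V (diag_sum e b (e k)) - diag_sum e b (V (e k))) UNIV"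
      using has_sum_add[OF h1 has_sum_bounded_linear[OF bounded_linear_minus[OF bounded_linear_ident] h2]] by (simp add: h3)
    then show "((\<lambda>l. a l k *\<^sub>C e (l + k)) has_sum ((V o\<^sub>L diag_sum e b) - (diag_sum e b o\<^sub>L V)) (e k)) UNIV"
      by (simp only: complex_vs.scale_left_diff_distrib[symmetric] eq blinfun.diff_left blinfun_apply_blinfun_compose)
  qed
  then show ?thesis using tr diag_sum_weak[OF b] clV unfolding is_trace_def by metis
qed

text \<open>Adding \<open>j\<close> to \<open>J\<close> adds the diagonals with
  \<open>l $ j \<noteq> 0\<close> that vanish on \<open>J\<close>, and all of these together form
  one commutator. Finite additivity of the trace therefore suffices for infinitely many
  diagonals.\<close>

lemma trace_diag_sum_off_diagonal:
  assumes tr: "positive_trace \<phi>" and a: "matrix_decay 1 a"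
  shows "finite J \<Longrightarrow> \<phi> (diag_sum e (\<lambda>l k. if \<exists>j\<in>J. l $ j \<noteq> 0 then a l k else 0)) = 0"
proof (induction J rule: finite_induct)
  have it: "is_trace \<phi>" using tr by (simp add: positive_trace_def)
  case empty
  show ?case
    by (rule trace_diag_sum_commutator[OF it matrix_decay_mono[OF a]]) auto
next
  have it: "is_trace \<phi>" using tr by (simp add: positive_trace_def)
  case (insert j J)
  let ?a1 = "\<lambda>l k. if \<exists>j\<in>J. l $ j \<noteq> 0 then a l k else 0"
  let ?a2 = "\<lambda>l k. if l $ j \<noteq> 0 \<and> (\<forall>i\<in>J. l $ i = 0) then a l k else 0"
  let ?a = "\<lambda>l k. if \<exists>i\<in>insert j J. l $ i \<noteq> 0 then a l k else 0"
  have d1: "matrix_decay 1 ?a1" and d2: "matrix_decay 1 ?a2" and d: "matrix_decay 1 ?a"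
    by (rule matrix_decay_mono[OF a], simp)+
  have sum: "?a = (\<lambda>l k. ?a1 l k + ?a2 l k)" by (auto simp: fun_eq_iff)
  have ds: "matrix_decay 0 (\<lambda>l k. ?a1 l k + ?a2 l k)"
    by (rule back_subst[of "matrix_decay 0", OF matrix_decay_0[OF d] sum])
  have "diag_sum e ?a = diag_sum e (\<lambda>l k. ?a1 l k + ?a2 l k)" by (rule arg_cong[OF sum])
  also have "\<dots> = diag_sum e ?a1 + diag_sum e ?a2"
    by (rule diag_sum_add[OF matrix_decay_0[OF d1] matrix_decay_0[OF d2] ds])
  finally have "diag_sum e ?a = diag_sum e ?a1 + diag_sum e ?a2" .
  then have "\<phi> (diag_sum e ?a) = \<phi> (diag_sum e ?a1) + \<phi> (diag_sum e ?a2)"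
    using trace_add[OF tr diag_sum_weak[OF matrix_decay_0[OF d1]] diag_sum_weak[OF matrix_decay_0[OF d2]]] by simp
  also have "\<phi> (diag_sum e ?a2) = 0"
    by (rule trace_diag_sum_commutator[OF it d2, of j]) auto
  finally show ?case using insert.IH by simp
qed

lemma trace_diag_sum:
  assumes tr: "positive_trace \<phi>" and a: "matrix_decay 1 a"
  shows "\<phi> (diag_sum e a) = \<phi> (wop e e (a 0))"
proof -
  let ?a1 = "\<lambda>l k. if \<exists>j\<in>UNIV. l $ j \<noteq> 0 then a l k else 0"
  let ?a2 = "\<lambda>l k. if l = 0 then a l k else 0"
  have d1: "matrix_decay 1 ?a1" and d2: "matrix_decay 1 ?a2"
    by (rule matrix_decay_mono[OF a], simp)+
  have sum: "a = (\<lambda>l k. ?a1 l k + ?a2 l k)" by (auto simp: fun_eq_iff vec_eq_iff)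
  have ds: "matrix_decay 0 (\<lambda>l k. ?a1 l k + ?a2 l k)"
    by (rule back_subst[of "matrix_decay 0", OF matrix_decay_0[OF a] sum])
  have "diag_sum e a = diag_sum e (\<lambda>l k. ?a1 l k + ?a2 l k)" by (rule arg_cong[OF sum])
  also have "\<dots> = diag_sum e ?a1 + diag_sum e ?a2"
    by (rule diag_sum_add[OF matrix_decay_0[OF d1] matrix_decay_0[OF d2] ds])
  finally have "diag_sum e a = diag_sum e ?a1 + diag_sum e ?a2" .
  then have "\<phi> (diag_sum e a) = \<phi> (diag_sum e ?a1) + \<phi> (diag_sum e ?a2)"
    using trace_add[OF tr diag_sum_weak[OF matrix_decay_0[OF d1]] diag_sum_weak[OF matrix_decay_0[OF d2]]] by simp
  also have "\<phi> (diag_sum e ?a1) = 0" by (rule trace_diag_sum_off_diagonal[OF tr a]) simp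
  also have "diag_sum e ?a2 = wop e e (?a2 0)" by (rule diag_sum_diagonal[OF matrix_decay_0[OF d2]]) simp
  finally show ?thesis by simp
qed

end

subsection \<open>Traces of symbols\<close>

lemma nct_deltas_0: "nct_deltas \<theta> (\<lambda>_. 0) u = u"
proof -
  have "foldr (\<lambda>j. nct_delta \<theta> j ^^ 0) js u = u" for js by (induction js) auto
  then show ?thesis by (simp add: nct_deltas_def)
qed

lemma nct_pderivs_0: "nct_pderivs \<theta> (\<lambda>_. 0) \<rho> = \<rho>"
proof -
  have "foldr (\<lambda>j. nct_pderiv \<theta> j ^^ 0) js \<rho> = \<rho>" for js by (induction js) auto
  then show ?thesis by (simp add: nct_pderivs_def)
qed

lemma nct_trace_diff: "nct_trace (u - v) = nct_trace u - nct_trace v"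
  by (simp add: nct_trace_def blinfun.diff_left cinner.diff_left)

lemma nct_trace_sum: "nct_trace (\<Sum>i\<in>I. f i) = (\<Sum>i\<in>I. nct_trace (f i))"
  by (simp add: nct_trace_def blinfun.sum_left cinner.sum_left)

lemma nct_trace_scaleC: "nct_trace (c *\<^sub>C u) = c * nct_trace u"
  by (simp add: nct_trace_def cinner_scaleC_left)

text \<open>The empty list of derivatives and the multi-order 0 reduce Frechet smoothness to
  continuity in operator norm, and the trace is bounded in that norm.\<close>

lemma continuous_on_nct_trace:
  assumes "\<rho> \<in> nct_homogeneous_symbols \<theta> q"
  shows "continuous_on (- {0}) (\<lambda>\<xi>. nct_trace (\<rho> \<xi>))"
proof -
  have "isCont (\<lambda>\<xi>. nct_trace (\<rho> \<xi>)) \<xi>" if "\<xi> \<noteq> 0" for \<xi>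
  proof -
    have "nct_tendsto \<theta> (foldr (nct_pderiv \<theta>) [] \<rho>) (foldr (nct_pderiv \<theta>) [] \<rho> \<xi>) (at \<xi>)"
      using assms that unfolding nct_homogeneous_symbols_def nct_smooth_on_def by blast
    then have "((\<lambda>x. norm (nct_deltas \<theta> (\<lambda>_. 0) (\<rho> x - \<rho> \<xi>))) \<longlongrightarrow> 0) (at \<xi>)"
      by (simp add: nct_tendsto_def)
    then have "((\<lambda>x. norm (\<rho> x - \<rho> \<xi>)) \<longlongrightarrow> 0) (at \<xi>)" by (simp only: nct_deltas_0)
    then have "((\<lambda>x. \<rho> x - \<rho> \<xi>) \<longlongrightarrow> 0) (at \<xi>)" by (rule tendsto_norm_zero_cancel)
    then have "(\<rho> \<longlongrightarrow> \<rho> \<xi>) (at \<xi>)" by (rule LIM_zero_cancel)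
    then show ?thesis unfolding isCont_def by (rule bounded_linear.tendsto[OF bounded_linear_nct_trace])
  qed
  then show ?thesis by (simp add: continuous_at_imp_continuous_on)
qed

lemma nct_trace_homogeneous:
  assumes "\<rho> \<in> nct_homogeneous_symbols \<theta> (of_int m)" "0 < t" "\<xi> \<noteq> 0"
  shows "nct_trace (\<rho> (t *\<^sub>R \<xi>)) = complex_of_real (t powi m) * nct_trace (\<rho> \<xi>)"
proof -
  have "\<rho> (t *\<^sub>R \<xi>) = (complex_of_real t powr of_int m) *\<^sub>C \<rho> \<xi>"
    using assms unfolding nct_homogeneous_symbols_def by blast
  also have "complex_of_real t powr of_int m = complex_of_real (t powi m)"
    using assms(2) complex_powr_of_int[of "complex_of_real t" m] by (simp add: of_real_power_int)
  finally show ?thesis by (simp add: nct_trace_scaleC)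
qed

lemma nct_symbol_trace_estimate:
  fixes \<rho> :: "'n::{finite, linorder} rvec \<Rightarrow> 'n torus_op"
  assumes "nct_symbol_expansion \<theta> q \<rho> \<sigma>"
  shows "\<exists>C. \<forall>\<xi>. 1 \<le> norm \<xi> \<longrightarrow>
    cmod (nct_trace (\<rho> \<xi>) - (\<Sum>j<N. nct_trace (\<sigma> j \<xi>))) \<le> C * norm \<xi> powr (Re q - real N)"
proof -
  have "\<exists>C. \<forall>\<xi>. 1 \<le> norm \<xi> \<longrightarrow>
      norm (nct_deltas \<theta> (\<lambda>_. 0) (nct_pderivs \<theta> (\<lambda>_. 0) (\<lambda>\<eta>. \<rho> \<eta> - (\<Sum>j<N. \<sigma> j \<eta>)) \<xi>))
      \<le> C * norm \<xi> powr (Re q - real N - real (\<Sum>i\<in>(UNIV :: 'n set). 0))"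
    using assms unfolding nct_symbol_expansion_def by blast
  then obtain C where C: "\<And>\<xi>. 1 \<le> norm \<xi> \<Longrightarrow> norm (\<rho> \<xi> - (\<Sum>j<N. \<sigma> j \<xi>)) \<le> C * norm \<xi> powr (Re q - real N)"
    by (auto simp: nct_deltas_0 nct_pderivs_0)
  have "cmod (nct_trace (\<rho> \<xi>) - (\<Sum>j<N. nct_trace (\<sigma> j \<xi>))) \<le> norm (\<rho> \<xi> - (\<Sum>j<N. \<sigma> j \<xi>))" for \<xi>
    unfolding nct_trace_sum[symmetric] nct_trace_diff[symmetric] by (rule norm_nct_trace_le)
  then show ?thesis using C order_trans by blast
qed

lemma nct_quantize_monomial:
  "nct_quantize \<theta> \<rho> (nct_monomial \<theta> k) = \<rho> (real_of_lattice k) o\<^sub>L nct_monomial \<theta> k"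
proof -
  have "((\<lambda>l. nct_coeff \<theta> (nct_monomial \<theta> k) l *\<^sub>C (\<rho> (real_of_lattice l) o\<^sub>L nct_monomial \<theta> l)) has_sum
      \<rho> (real_of_lattice k) o\<^sub>L nct_monomial \<theta> k) {k}"
    by (intro has_sum_finiteI) (auto simp: nct_coeff_monomial scaleC_one)
  then have "((\<lambda>l. nct_coeff \<theta> (nct_monomial \<theta> k) l *\<^sub>C (\<rho> (real_of_lattice l) o\<^sub>L nct_monomial \<theta> l)) has_sum
      \<rho> (real_of_lattice k) o\<^sub>L nct_monomial \<theta> k) UNIV"
    by (rule has_sum_cong_neutral[THEN iffD1, rotated -1]) (auto simp: nct_coeff_monomial)
  then show ?thesis unfolding nct_quantize_def by (rule infsumI)
qed

text \<open>Monomials are unitary and can be cancelled. An operator thus fixes its symbol at lattice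
  points, while its homogeneous components must be recovered from these values alone.\<close>

lemma nct_quantize_determines_symbol:
  assumes "nct_quantize \<theta> \<rho> (nct_monomial \<theta> k) = nct_quantize \<theta> \<rho>' (nct_monomial \<theta> k)"
  shows "\<rho> (real_of_lattice k) = \<rho>' (real_of_lattice k)"
proof -
  have "(\<rho> (real_of_lattice k) o\<^sub>L nct_monomial \<theta> k) o\<^sub>L adjoint_op (nct_monomial \<theta> k)
      = (\<rho>' (real_of_lattice k) o\<^sub>L nct_monomial \<theta> k) o\<^sub>L adjoint_op (nct_monomial \<theta> k)"
    using assms by (simp only: nct_quantize_monomial)
  then show ?thesis by (simp add: blinfun_compose_assoc nct_monomial_unitary)
qed

subsection \<open>Uniqueness of homogeneous components\<close>

text \<open>Dividing by the leading power shows that the top coefficient is 0; it is removed and the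
  degree drops until only the constant is left.\<close>

lemma polynomial_limit_const:
  fixes c :: "nat \<Rightarrow> complex"
  assumes "(\<lambda>t. \<Sum>j\<le>M. c j * of_nat (Suc t) ^ j) \<longlonglongrightarrow> L"
  shows "c 0 = L"
  using assms
proof (induction M)
  case 0
  then show ?case by (simp add: LIMSEQ_const_iff)
next
  case (Suc M)
  have inv: "(\<lambda>t. 1 / (of_nat (Suc t) :: complex)) \<longlonglongrightarrow> 0"
    using LIMSEQ_Suc[OF lim_1_over_n[where 'a = complex]] by simp
  have small: "(\<lambda>t. c j * of_nat (Suc t) ^ j / of_nat (Suc t) ^ Suc M) \<longlonglongrightarrow> 0" if "j \<le> M" for j
  proof -
    have "(\<lambda>t. c j * (1 / of_nat (Suc t)) ^ (Suc M - j)) \<longlonglongrightarrow> c j * 0 ^ (Suc M - j)"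
      by (intro tendsto_intros inv)
    moreover have "c j * (1 / of_nat (Suc t)) ^ (Suc M - j) = c j * of_nat (Suc t) ^ j / of_nat (Suc t) ^ Suc M" for t
    proof -
      have "(of_nat (Suc t) :: complex) ^ Suc M = of_nat (Suc t) ^ j * of_nat (Suc t) ^ (Suc M - j)"
        using that by (simp flip: power_add)
      moreover have "(of_nat (Suc t) :: complex) \<noteq> 0" by (simp del: of_nat_Suc)
      ultimately show ?thesis by (simp add: power_one_over field_simps del: of_nat_Suc power_Suc)
    qed
    ultimately show ?thesis using that by (simp add: power_0_left)
  qed
  have top: "(\<lambda>t. c (Suc M) * of_nat (Suc t) ^ Suc M / of_nat (Suc t) ^ Suc M) \<longlonglongrightarrow> c (Suc M)"
    by (simp del: of_nat_Suc power_Suc)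
  have lim: "(\<lambda>t. (\<Sum>j\<le>M. c j * of_nat (Suc t) ^ j / of_nat (Suc t) ^ Suc M) + c (Suc M) * of_nat (Suc t) ^ Suc M / of_nat (Suc t) ^ Suc M)
    \<longlonglongrightarrow> (\<Sum>j\<le>M. 0) + c (Suc M)"
    by (intro tendsto_add tendsto_sum small top) auto
  have lim': "(\<lambda>t. (\<Sum>j\<le>Suc M. c j * of_nat (Suc t) ^ j) * (1 / of_nat (Suc t)) ^ Suc M) \<longlonglongrightarrow> L * 0 ^ Suc M"
    by (intro tendsto_intros Suc.prems inv)
  have eq: "(\<Sum>j\<le>Suc M. c j * of_nat (Suc t) ^ j) * (1 / of_nat (Suc t)) ^ Suc M
      = (\<Sum>j\<le>M. c j * of_nat (Suc t) ^ j / of_nat (Suc t) ^ Suc M) + c (Suc M) * of_nat (Suc t) ^ Suc M / of_nat (Suc t) ^ Suc M" for t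
    by (simp add: power_one_over distrib_right sum_divide_distrib add_divide_distrib del: of_nat_Suc power_Suc)
  have "(\<Sum>j\<le>M. 0) + c (Suc M) = L * 0 ^ Suc M" by (rule LIMSEQ_unique[OF lim lim'[unfolded eq]])
  then have "c (Suc M) = 0" by simp
  then show ?case using Suc by simp
qed

text \<open>Rounding large multiples of \<open>x\<close> to the lattice and scaling back gives
  points \<open>y t\<close> that converge to \<open>x\<close>; homogeneity makes \<open>g\<close>
  vanish at them and continuity at \<open>x\<close>.\<close>

lemma homogeneous_zero_on_lattice:
  fixes g :: "'n::finite rvec \<Rightarrow> complex"
  assumes cont: "continuous_on (- {0}) g"
    and hom: "\<And>t x. 0 < t \<Longrightarrow> x \<noteq> 0 \<Longrightarrow> g (t *\<^sub>R x) = complex_of_real (t powi m) * g x"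
    and z: "\<And>k. k \<noteq> 0 \<Longrightarrow> g (real_of_lattice k) = 0" and x: "x \<noteq> 0"
  shows "g x = 0"
proof -
  define y where "y t = (1 / real (Suc t)) *\<^sub>R real_of_lattice (lattice_floor (real (Suc t) *\<^sub>R x))" for t
  have dist: "norm (y t - x) \<le> real CARD('n) * (1 / real (Suc t))" for t
  proof -
    have "y t - x = - ((1 / real (Suc t)) *\<^sub>R (real (Suc t) *\<^sub>R x - real_of_lattice (lattice_floor (real (Suc t) *\<^sub>R x))))"
      by (simp add: y_def scaleR_diff_right del: of_nat_Suc)
    then have "norm (y t - x) = norm (real (Suc t) *\<^sub>R x - real_of_lattice (lattice_floor (real (Suc t) *\<^sub>R x))) / real (Suc t)"
      by (simp del: of_nat_Suc)
    then show ?thesis using lattice_floor_dist[of "real (Suc t) *\<^sub>R x"] by (simp add: divide_right_mono)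
  qed
  have "(\<lambda>t. real CARD('n) * (1 / real (Suc t))) \<longlonglongrightarrow> real CARD('n) * 0"
    using LIMSEQ_Suc[OF lim_1_over_n[where 'a = real]] by (intro tendsto_mult tendsto_const)
  then have "(\<lambda>t. y t - x) \<longlonglongrightarrow> 0"
    using Lim_null_comparison[OF always_eventually[OF allI[OF dist]]] by (simp only: mult_zero_right)
  then have y: "y \<longlonglongrightarrow> x" by (rule LIM_zero_cancel)
  have "isCont g x" using continuous_on_eq_continuous_at[of "- {0}" g] cont x by (simp add: open_Compl)
  then have lim: "(\<lambda>t. g (y t)) \<longlonglongrightarrow> g x" using y by (rule isCont_tendsto_compose)
  have "\<forall>\<^sub>F t in sequentially. y t \<noteq> 0" using y x by (rule tendsto_imp_eventually_ne)
  then have "\<forall>\<^sub>F t in sequentially. g (y t) = 0"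
  proof eventually_elim
    case (elim t)
    then have k: "lattice_floor (real (Suc t) *\<^sub>R x) \<noteq> 0" by (auto simp: y_def)
    have "g (y t) = complex_of_real ((1 / real (Suc t)) powi m) * g (real_of_lattice (lattice_floor (real (Suc t) *\<^sub>R x)))"
      unfolding y_def using k by (intro hom) auto
    then show ?case using z[OF k] by simp
  qed
  then have "(\<lambda>t. g (y t)) \<longlonglongrightarrow> 0" by (rule tendsto_eventually)
  then show ?thesis by (rule LIMSEQ_unique[OF lim])
qed

lemma integral_sphere_cong:
  assumes "\<And>x. x \<noteq> 0 \<Longrightarrow> g x = (h x :: complex)" "continuous_on (- {0}) g" "continuous_on (- {0}) h"
  shows "(LINT x|sphere_measure. g x) = (LINT x|sphere_measure. h x)"
proof (rule integral_cong_AE)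
  show "g \<in> borel_measurable sphere_measure" "h \<in> borel_measurable sphere_measure"
    using borel_measurable_punctured[OF assms(2)] borel_measurable_punctured[OF assms(3)] by simp_all
  show "AE x in sphere_measure. g x = h x"
    using AE_sphere_measure by eventually_elim (rule assms(1))
qed

text \<open>Along the multiples of a lattice point an expansion becomes a polynomial in the multiplier, up to
  an error that tends to zero.\<close>

lemma expansion_multiples:
  fixes \<rho> :: "'n::{finite, linorder} rvec \<Rightarrow> 'n torus_op"
  assumes ex: "nct_symbol_expansion \<theta> (of_int m) \<rho> \<sigma>" and k: "k \<noteq> 0"
  shows "(\<lambda>t. of_nat (Suc t) ^ CARD('n) * nct_trace (\<rho> (real (Suc t) *\<^sub>R real_of_lattice k))
    - (\<Sum>j<nat (m + int CARD('n) + 1). complex_of_real (real (Suc t) powi (m + int CARD('n) - int j))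
        * nct_trace (\<sigma> j (real_of_lattice k)))) \<longlonglongrightarrow> 0"
proof -
  let ?n = "CARD('n)" and ?x = "real_of_lattice k"
  have x: "?x \<noteq> 0" "1 \<le> norm ?x" using k norm_real_of_lattice_ge_1 by auto
  \<comment> \<open>The remainder after \<open>N\<close> terms has order at most
    \<open>-n - 1\<close>, so it tends to 0 even after multiplication by the \<open>n\<close>-th
    power of the multiplier. For \<open>m < -n\<close> truncation by \<open>nat\<close> gives
    \<open>N = 0\<close>.\<close>
  define N where "N = nat (m + int ?n + 1)"
  obtain C where C: "\<And>\<xi>. 1 \<le> norm \<xi> \<Longrightarrow>
      cmod (nct_trace (\<rho> \<xi>) - (\<Sum>j<N. nct_trace (\<sigma> j \<xi>))) \<le> C * norm \<xi> powr (Re (of_int m) - real N)"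
    using nct_symbol_trace_estimate[OF ex] by blast
  have sig: "\<sigma> j \<in> nct_homogeneous_symbols \<theta> (of_int (m - int j))" for j
    using ex unfolding nct_symbol_expansion_def by simp
  define c where "c j = nct_trace (\<sigma> j ?x)" for j
  have sj: "nct_trace (\<sigma> j (real (Suc t) *\<^sub>R ?x)) = complex_of_real (real (Suc t) powi (m - int j)) * c j" for j t
    unfolding c_def by (rule nct_trace_homogeneous[OF sig _ x(1)]) simp
  have err: "cmod (of_nat (Suc t) ^ ?n * nct_trace (\<rho> (real (Suc t) *\<^sub>R ?x)) - (\<Sum>j<N. complex_of_real (real (Suc t) powi (m + int ?n - int j)) * c j))
      \<le> \<bar>C\<bar> * (1 / real (Suc t))" for t
  proof -
    let ?t = "real (Suc t)"
    have t: "?t \<ge> 1" by simp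
    have nx: "1 \<le> norm (?t *\<^sub>R ?x)" "?t \<le> norm (?t *\<^sub>R ?x)"
      using x(2) t mult_mono[of 1 ?t 1 "norm ?x"] mult_left_mono[of 1 "norm ?x" ?t] by (auto simp del: of_nat_Suc)
    have "of_nat (Suc t) ^ ?n * nct_trace (\<rho> (?t *\<^sub>R ?x)) - (\<Sum>j<N. complex_of_real (?t powi (m + int ?n - int j)) * c j)
        = of_nat (Suc t) ^ ?n * (nct_trace (\<rho> (?t *\<^sub>R ?x)) - (\<Sum>j<N. nct_trace (\<sigma> j (?t *\<^sub>R ?x))))"
    proof -
      have "complex_of_real (?t powi (m + int ?n - int j)) = of_nat (Suc t) ^ ?n * complex_of_real (?t powi (m - int j))" for j
      proof -
        have "?t powi (m + int ?n - int j) = ?t powi (int ?n + (m - int j))" by (simp add: algebra_simps)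
        also have "\<dots> = ?t ^ ?n * ?t powi (m - int j)" by (subst power_int_add) (auto simp del: of_nat_Suc)
        finally show ?thesis by (simp del: of_nat_Suc)
      qed
      then show ?thesis by (simp add: sj right_diff_distrib sum_distrib_left mult.assoc del: of_nat_Suc)
    qed
    also have "cmod \<dots> \<le> ?t ^ ?n * (C * norm (?t *\<^sub>R ?x) powr (Re (of_int m) - real N))"
      unfolding norm_mult using C[OF nx(1)] by (simp add: norm_power del: of_nat_Suc)
    also have "\<dots> \<le> ?t ^ ?n * (\<bar>C\<bar> * ?t powr (- real ?n - 1))"
    proof -
      have "norm (?t *\<^sub>R ?x) powr (Re (of_int m) - real N) \<le> norm (?t *\<^sub>R ?x) powr (- real ?n - 1)"
        using nx(1) by (intro powr_mono) (auto simp: N_def)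
      also have "\<dots> \<le> ?t powr (- real ?n - 1)"
        using nx(2) t by (intro powr_mono2') auto
      finally have "C * norm (?t *\<^sub>R ?x) powr (Re (of_int m) - real N) \<le> \<bar>C\<bar> * ?t powr (- real ?n - 1)"
        by (intro mult_mono) auto
      then show ?thesis using t by (intro mult_left_mono) auto
    qed
    also have "\<dots> = \<bar>C\<bar> * (1 / ?t)"
    proof -
      have "?t powr (- real ?n - 1) = 1 / (?t ^ ?n * ?t)"
        using t by (simp add: powr_diff powr_minus powr_realpow divide_inverse del: of_nat_Suc)
      then show ?thesis using t by (simp del: of_nat_Suc)
    qed
    finally show ?thesis .
  qed
  have "(\<lambda>t. \<bar>C\<bar> * (1 / real (Suc t))) \<longlonglongrightarrow> \<bar>C\<bar> * 0"
    using LIMSEQ_Suc[OF lim_1_over_n[where 'a = real]] by (intro tendsto_mult tendsto_const)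
  then show ?thesis
    using Lim_null_comparison[OF always_eventually[OF allI[OF err]]] unfolding c_def N_def by (simp only: mult_zero_right)
qed

text \<open>The polynomial along the multiples of \<open>k\<close> has a limit, so it is constant;
  its constant term is the component of degree \<open>-n\<close>. This recovers that component from
  values on the lattice, whatever order \<open>m\<close> is used.\<close>

lemma expansion_limit:
  fixes \<rho> :: "'n::{finite, linorder} rvec \<Rightarrow> 'n torus_op"
  assumes ex: "nct_symbol_expansion \<theta> (of_int m) \<rho> \<sigma>" and k: "k \<noteq> 0"
    and lim: "(\<lambda>t. of_nat (Suc t) ^ CARD('n) * nct_trace (\<rho> (real (Suc t) *\<^sub>R real_of_lattice k))) \<longlonglongrightarrow> L"
  shows "(if m < - int CARD('n) then 0 else nct_trace (\<sigma> (nat (m + int CARD('n))) (real_of_lattice k))) = L"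
proof -
  let ?n = "CARD('n)"
  define N where "N = nat (m + int ?n + 1)"
  define c where "c j = nct_trace (\<sigma> j (real_of_lattice k))" for j
  from tendsto_diff[OF lim expansion_multiples[OF ex k]]
  have pl: "(\<lambda>t. \<Sum>j<N. complex_of_real (real (Suc t) powi (m + int ?n - int j)) * c j) \<longlonglongrightarrow> L"
    by (simp add: c_def N_def)
  show ?thesis
  proof (cases "m < - int ?n")
    case True
    then have "N = 0" by (simp add: N_def)
    then show ?thesis using pl True by (simp add: LIMSEQ_const_iff)
  next
    case False
    define M where "M = nat (m + int ?n)"
    have M: "m + int ?n = int M" "N = Suc M" using False by (auto simp: M_def N_def)
    have "(\<Sum>j<N. complex_of_real (real (Suc t) powi (m + int ?n - int j)) * c j) = (\<Sum>j\<le>M. c (M - j) * of_nat (Suc t) ^ j)" for t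
    proof -
      have "(\<Sum>j<N. complex_of_real (real (Suc t) powi (m + int ?n - int j)) * c j) = (\<Sum>j\<le>M. of_nat (Suc t) ^ (M - j) * c j)"
        unfolding M(2) lessThan_Suc_atMost
      proof (intro sum.cong refl)
        fix j assume "j \<in> {..M}"
        then have "m + int ?n - int j = int (M - j)" using M(1) by (simp add: of_nat_diff)
        then show "complex_of_real (real (Suc t) powi (m + int ?n - int j)) * c j = of_nat (Suc t) ^ (M - j) * c j"
          by (simp del: of_nat_Suc)
      qed
      also have "\<dots> = (\<Sum>j\<le>M. of_nat (Suc t) ^ (M - (M - j)) * c (M - j))"
        using sum.nat_diff_reindex[of "\<lambda>j. of_nat (Suc t) ^ (M - j) * c j" "Suc M"]
        unfolding lessThan_Suc_atMost diff_Suc_Suc by (rule sym)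
      also have "\<dots> = (\<Sum>j\<le>M. c (M - j) * of_nat (Suc t) ^ j)"
        by (intro sum.cong refl) (simp add: mult.commute)
      finally show ?thesis .
    qed
    then have "(\<lambda>t. \<Sum>j\<le>M. c (M - j) * of_nat (Suc t) ^ j) \<longlonglongrightarrow> L" using pl by simp
    from polynomial_limit_const[OF this] show ?thesis using False by (simp add: c_def M_def)
  qed
qed

subsection \<open>Pseudodifferential operators of order \<open>-n\<close>\<close>

lemma nct_symbol_smooth: "nct_symbol_expansion \<theta> q \<rho> \<sigma> \<Longrightarrow> \<rho> \<xi> \<in> nct_smooth \<theta>"
  unfolding nct_symbol_expansion_def nct_smooth_on_def by blast

lemma nct_smooth_scaleC:
  assumes "u \<in> nct_smooth \<theta>" shows "c *\<^sub>C u \<in> nct_smooth \<theta>"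
proof -
  obtain d where d: "rapidly_decaying d" "((\<lambda>k. d k *\<^sub>C nct_monomial \<theta> k) has_sum u) UNIV"
    using assms by (auto simp: nct_smooth_def)
  have "rapidly_decaying (\<lambda>k. c * d k)"
    unfolding rapidly_decaying_def
  proof
    fix N
    obtain C where C: "\<And>k. (1 + norm (real_of_lattice k)) ^ N * cmod (d k) \<le> C"
      using d(1) unfolding rapidly_decaying_def by blast
    have "(1 + norm (real_of_lattice k)) ^ N * cmod (c * d k) \<le> cmod c * C" for k
      using mult_left_mono[OF C[of k], of "cmod c"] by (simp add: norm_mult mult_ac)
    then show "\<exists>C. \<forall>k. (1 + norm (real_of_lattice k)) ^ N * cmod (c * d k) \<le> C" by blast
  qed
  moreover have "((\<lambda>k. (c * d k) *\<^sub>C nct_monomial \<theta> k) has_sum c *\<^sub>C u) UNIV"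
    using has_sum_bounded_linear[OF bounded_linear_scaleC_blinfun d(2), of c] by (simp add: scaleC_scaleC)
  ultimately show ?thesis unfolding nct_smooth_def by blast
qed

text \<open>Derivations applied to the symbol give powers of \<open>l\<close> in its coefficients
  without affecting the order \<open>-n\<close> in \<open>k\<close>. Two cases escape this: at
  \<open>k = 0\<close> only the smoothness of the symbol's value is known, and at
  \<open>l = 0\<close> the norm bound alone is used.\<close>

lemma nct_symbol_matrix_decay:
  fixes \<rho> :: "'n::{finite, linorder} rvec \<Rightarrow> 'n torus_op"
  assumes ex: "nct_symbol_expansion \<theta> (- of_nat CARD('n)) \<rho> \<sigma>"
  shows "matrix_decay 1 (\<lambda>l k. nct_coeff \<theta> (\<rho> (real_of_lattice k)) l)"
proof -
  let ?n = "CARD('n)" and ?a = "\<lambda>l k. nct_coeff \<theta> (\<rho> (real_of_lattice k)) l"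
  have "\<exists>C. \<forall>\<xi>. 1 \<le> norm \<xi> \<longrightarrow> norm (nct_deltas \<theta> \<alpha> (\<rho> \<xi>)) \<le> C * norm \<xi> powr (- real ?n)" for \<alpha>
  proof -
    have "\<exists>C. \<forall>\<xi>. 1 \<le> norm \<xi> \<longrightarrow>
      norm (nct_deltas \<theta> \<alpha> (nct_pderivs \<theta> (\<lambda>_. 0) (\<lambda>\<eta>. \<rho> \<eta> - (\<Sum>j<0. \<sigma> j \<eta>)) \<xi>))
        \<le> C * norm \<xi> powr (Re (- of_nat ?n) - real 0 - real (\<Sum>i\<in>(UNIV :: 'n set). 0))"
      using ex unfolding nct_symbol_expansion_def by blast
    then show ?thesis by (simp add: nct_pderivs_0)
  qed
  then obtain D where D: "\<And>\<alpha> \<xi>. 1 \<le> norm \<xi> \<Longrightarrow> norm (nct_deltas \<theta> \<alpha> (\<rho> \<xi>)) \<le> D \<alpha> * norm \<xi> powr (- real ?n)"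
    by metis
  have D': "norm (nct_deltas \<theta> \<alpha> (\<rho> (real_of_lattice k))) \<le> D \<alpha> * lattice_decay k" if "k \<noteq> 0" for \<alpha> and k :: "'n ivec"
  proof -
    have "norm (real_of_lattice k) powr (- real ?n) = lattice_decay k"
      using that by (simp add: lattice_decay_def powr_minus_divide powr_realpow)
    then show ?thesis using D[OF norm_real_of_lattice_ge_1[OF that], of \<alpha>] by simp
  qed
  \<comment> \<open>\<open>2 * n\<close> powers yield the square of \<open>lattice_decay l\<close>;
    the last one is the reserve for the small divisors.\<close>
  let ?N = "2 * ?n + 1"
  define E where "E = real ?n ^ ?N * (\<Sum>j\<in>UNIV. D (\<lambda>i :: 'n. if i = j then ?N else 0))"
  obtain C0 where C0: "C0 \<ge> 0" "\<And>l. cmod (nct_coeff \<theta> (\<rho> 0) l) \<le> C0 * (lattice_decay l)\<^sup>2 / (1 + norm (real_of_lattice l)) ^ 1"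
    using rapidly_decaying_bound[OF nct_smooth_coeff_decay[OF nct_symbol_smooth[OF ex, of 0]], of 1] by blast
  define C where "C = C0 + 2 * \<bar>E\<bar> + \<bar>D (\<lambda>_. 0)\<bar>"
  have w: "0 \<le> (lattice_decay l)\<^sup>2 / (1 + norm (real_of_lattice l))" for l :: "'n ivec" by simp
  have "cmod (?a l k) \<le> C * (lattice_decay l)\<^sup>2 / (1 + norm (real_of_lattice l)) ^ 1 * lattice_decay k" for l k
  proof -
    have "\<exists>c. c \<le> C \<and> cmod (?a l k) \<le> c * ((lattice_decay l)\<^sup>2 / (1 + norm (real_of_lattice l))) * lattice_decay k"
    proof (cases "k = 0")
      case True
      then have "cmod (?a l k) \<le> C0 * ((lattice_decay l)\<^sup>2 / (1 + norm (real_of_lattice l))) * lattice_decay k"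
        using C0(2)[of l] by (simp add: lattice_decay_def)
      then show ?thesis by (intro exI[of _ C0]) (simp add: C_def)
    next
      case k: False
      show ?thesis
      proof (cases "l = 0")
        case True
        have "cmod (?a l k) \<le> norm (\<rho> (real_of_lattice k))" by (rule norm_nct_coeff_le)
        also have "\<dots> \<le> D (\<lambda>_. 0) * lattice_decay k" using D'[OF k, of "\<lambda>_. 0"] by (simp add: nct_deltas_0)
        finally have "cmod (?a l k) \<le> D (\<lambda>_. 0) * ((lattice_decay l)\<^sup>2 / (1 + norm (real_of_lattice l))) * lattice_decay k"
          using True by (simp add: lattice_decay_def)
        then show ?thesis using C0(1) by (intro exI[of _ "D (\<lambda>_. 0)"]) (simp add: C_def)
      next
        case False
        let ?x = "norm (real_of_lattice l)"
        have x: "1 \<le> ?x" by (rule norm_real_of_lattice_ge_1[OF False])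
        then have xp: "0 < ?x ^ ?N" by (intro zero_less_power) linarith
        have "?x ^ ?N * cmod (?a l k)
          \<le> real ?n ^ ?N * (\<Sum>j\<in>UNIV. norm (nct_deltas \<theta> (\<lambda>i. if i = j then ?N else 0) (\<rho> (real_of_lattice k))))"
          by (rule nct_coeff_le_deltas[OF nct_symbol_smooth[OF ex]])
        also have "\<dots> \<le> real ?n ^ ?N * (\<Sum>j\<in>UNIV. D (\<lambda>i. if i = j then ?N else 0) * lattice_decay k)"
          by (intro mult_left_mono sum_mono D' k) simp
        also have "\<dots> = E * lattice_decay k" by (simp add: E_def sum_distrib_right)
        also have "\<dots> \<le> \<bar>E\<bar> * lattice_decay k" using lattice_decay_pos[of k] by (intro mult_right_mono) auto
        finally have 1: "cmod (?a l k) \<le> \<bar>E\<bar> * lattice_decay k * (1 / ?x ^ ?N)"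
          using xp by (simp add: pos_le_divide_eq mult.commute del: zero_less_norm_iff)
        have "1 / ?x ^ ?N = (lattice_decay l)\<^sup>2 / ?x"
          using False by (simp add: lattice_decay_def power_divide power_add power_mult mult.commute flip: power_mult)
        also have "\<dots> \<le> (lattice_decay l)\<^sup>2 / ((1 + ?x) / 2)"
        proof -
          have "c / y \<le> c / ((1 + y) / 2)" if "1 \<le> y" "0 \<le> c" for c y :: real
            using that by (intro divide_left_mono) auto
          then show ?thesis using x by simp
        qed
        finally have 2: "1 / ?x ^ ?N \<le> 2 * ((lattice_decay l)\<^sup>2 / (1 + ?x))" by (simp add: mult.commute)
        have "cmod (?a l k) \<le> \<bar>E\<bar> * lattice_decay k * (2 * ((lattice_decay l)\<^sup>2 / (1 + ?x)))"
          by (rule order_trans[OF 1 mult_left_mono[OF 2]]) (use lattice_decay_pos[of k] in simp)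
        also have "\<dots> = (2 * \<bar>E\<bar>) * ((lattice_decay l)\<^sup>2 / (1 + ?x)) * lattice_decay k" by (simp add: mult_ac)
        finally show ?thesis using C0(1) by (intro exI[of _ "2 * \<bar>E\<bar>"]) (simp add: C_def)
      qed
    qed
    then obtain c where c: "c \<le> C" "cmod (?a l k) \<le> c * ((lattice_decay l)\<^sup>2 / (1 + norm (real_of_lattice l))) * lattice_decay k"
      by blast
    have "c * ((lattice_decay l)\<^sup>2 / (1 + norm (real_of_lattice l))) * lattice_decay k
      \<le> C * ((lattice_decay l)\<^sup>2 / (1 + norm (real_of_lattice l))) * lattice_decay k"
      using lattice_decay_pos[of k] by (intro mult_right_mono c w) auto
    then show ?thesis using c(2) by simp
  qed
  moreover have "C \<ge> 0" using C0(1) by (simp add: C_def)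
  ultimately show ?thesis unfolding matrix_decay_def by blast
qed

text \<open>\<open>infsum\<close> defaults to 0 on families that are not summable, so summability is
  what gives \<open>nct_quantize\<close> content. It follows from bounded symbol values and rapidly
  decaying coefficients.\<close>

lemma nct_quantize_has_sum:
  fixes \<rho> :: "'n::{finite, linorder} rvec \<Rightarrow> 'n torus_op"
  assumes bd: "\<And>k. norm (\<rho> (real_of_lattice k)) \<le> K" and u: "u \<in> nct_smooth \<theta>"
  shows "((\<lambda>k. nct_coeff \<theta> u k *\<^sub>C (\<rho> (real_of_lattice k) o\<^sub>L nct_monomial \<theta> k)) has_sum nct_quantize \<theta> \<rho> u) UNIV"
proof -
  obtain C where C: "C \<ge> 0" "\<And>k. cmod (nct_coeff \<theta> u k) \<le> C * (lattice_decay k)\<^sup>2"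
    using rapidly_decaying_bound[OF nct_smooth_coeff_decay[OF u], of 0] by auto
  have K: "0 \<le> K" using bd norm_ge_zero order_trans by blast
  have "(\<lambda>k. norm (nct_coeff \<theta> u k *\<^sub>C (\<rho> (real_of_lattice k) o\<^sub>L nct_monomial \<theta> k))) summable_on UNIV"
  proof (rule summable_on_comparison_test)
    show "(\<lambda>k. (C * K) * (lattice_decay k)\<^sup>2) summable_on (UNIV :: 'n ivec set)"
      by (intro summable_on_cmult_right lattice_decay_summable)
    fix k :: "'n ivec"
    have "norm (\<rho> (real_of_lattice k) o\<^sub>L nct_monomial \<theta> k) \<le> norm (\<rho> (real_of_lattice k)) * norm (nct_monomial \<theta> k)"
      by (rule norm_blinfun_compose)
    also have "\<dots> \<le> K * 1" by (intro mult_mono bd norm_monomial_le K) simp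
    finally have "cmod (nct_coeff \<theta> u k) * norm (\<rho> (real_of_lattice k) o\<^sub>L nct_monomial \<theta> k) \<le> (C * (lattice_decay k)\<^sup>2) * K"
      using C by (intro mult_mono) auto
    then show "norm (nct_coeff \<theta> u k *\<^sub>C (\<rho> (real_of_lattice k) o\<^sub>L nct_monomial \<theta> k)) \<le> (C * K) * (lattice_decay k)\<^sup>2"
      by (simp add: norm_scaleC_blinfun mult_ac)
  qed auto
  then show ?thesis unfolding nct_quantize_def by (rule has_sum_infsum[OF abs_summable_summable])
qed

text \<open>A competing extension \<open>S\<close> is only known to be real linear, so it is
  compared with \<open>T\<close> on all complex multiples of the basis vectors, which are images of
  smooth elements.\<close>

lemma nct_extension_eqI:
  fixes \<iota> :: "'n::{finite, linorder} torus_op \<Rightarrow> 'h::complex_hilbert" and T :: "'h \<Rightarrow>\<^sub>L 'h"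
  assumes i: "nct_completion \<theta> \<iota>" and T: "\<And>u. u \<in> nct_smooth \<theta> \<Longrightarrow> T (\<iota> u) = \<iota> (P u)"
  shows "nct_extension \<theta> \<iota> P = T"
  unfolding nct_extension_def
proof (rule the_equality)
  show "\<forall>u\<in>nct_smooth \<theta>. T (\<iota> u) = \<iota> (P u)" using T by blast
  fix S :: "'h \<Rightarrow>\<^sub>L 'h" assume S: "\<forall>u\<in>nct_smooth \<theta>. S (\<iota> u) = \<iota> (P u)"
  show "S = T"
  proof (rule blinfun_eqI)
    fix x
    let ?e = "\<lambda>k. \<iota> (nct_monomial \<theta> k)"
    have eq: "S (c *\<^sub>C ?e k) = T (c *\<^sub>C ?e k)" for c k
    proof -
      have "c *\<^sub>C ?e k = \<iota> (c *\<^sub>C nct_monomial \<theta> k)" by (simp add: iota_scaleC[OF i] nct_algebra_monomial)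
      moreover have "c *\<^sub>C nct_monomial \<theta> k \<in> nct_smooth \<theta>" by (rule nct_smooth_scaleC[OF nct_smooth_monomial])
      ultimately show ?thesis using S T by simp
    qed
    note ex = onb_expand[OF onb_iota[OF i], of x]
    show "S x = T x"
      using has_sum_bounded_linear[OF blinfun.bounded_linear_right[of S] ex]
        has_sum_bounded_linear[OF blinfun.bounded_linear_right[of T] ex]
      unfolding eq by (rule has_sum_unique)
  qed
qed

text \<open>\<open>P\<close> multiplies the monomial of exponent \<open>k\<close> by the value of
  \<rho> at \<open>k\<close>; expanding this value in monomials gives column \<open>k\<close> of the
  matrix. Both sides then agree on every smooth element, summed over its coefficients.\<close>

lemma nct_extension_eq_diag_sum:
  fixes \<rho> :: "'n::{finite, linorder} rvec \<Rightarrow> 'n torus_op" and \<iota> :: "'n torus_op \<Rightarrow> 'h::complex_hilbert"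
  assumes i: "nct_completion \<theta> \<iota>" and sm: "\<And>\<xi>. \<rho> \<xi> \<in> nct_smooth \<theta>" and bd: "\<And>k. norm (\<rho> (real_of_lattice k)) \<le> K"
    and a: "matrix_decay 0 (\<lambda>l k. nct_coeff \<theta> (\<rho> (real_of_lattice k)) l * nct_phase \<theta> l k)"
    and P: "\<And>u. u \<in> nct_smooth \<theta> \<Longrightarrow> P u = nct_quantize \<theta> \<rho> u"
  shows "nct_extension \<theta> \<iota> P
    = diag_sum (\<lambda>k. \<iota> (nct_monomial \<theta> k)) (\<lambda>l k. nct_coeff \<theta> (\<rho> (real_of_lattice k)) l * nct_phase \<theta> l k)"
    (is "_ = diag_sum ?e ?a")
proof (rule nct_extension_eqI[OF i])
  note e = onb_iota[OF i]
  have alg: "\<rho> (real_of_lattice k) o\<^sub>L nct_monomial \<theta> k \<in> nct_algebra \<theta>" for k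
    by (intro nct_algebra_compose nct_smooth_algebra sm nct_algebra_monomial)
  have Te: "diag_sum ?e ?a (?e k) = \<iota> (\<rho> (real_of_lattice k) o\<^sub>L nct_monomial \<theta> k)" for k
  proof -
    let ?r = "\<rho> (real_of_lattice k)"
    have "((\<lambda>l. (nct_coeff \<theta> ?r l *\<^sub>C nct_monomial \<theta> l) o\<^sub>L nct_monomial \<theta> k) has_sum ?r o\<^sub>L nct_monomial \<theta> k) UNIV"
      by (rule has_sum_bounded_linear[OF bounded_bilinear.bounded_linear_left[OF bounded_bilinear_blinfun_compose] nct_smooth_expand[OF sm]])
    then have "((\<lambda>l. ?a l k *\<^sub>C nct_monomial \<theta> (l + k)) has_sum ?r o\<^sub>L nct_monomial \<theta> k) UNIV"
      by (simp add: blinfun_compose_scaleC_left nct_monomial_compose scaleC_scaleC)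
    then have "((\<lambda>l. \<iota> (?a l k *\<^sub>C nct_monomial \<theta> (l + k))) has_sum \<iota> (?r o\<^sub>L nct_monomial \<theta> k)) UNIV"
      by (rule iota_has_sum[OF i]) (rule nct_algebra_scaleC[OF nct_algebra_monomial nct_algebra_monomial])
    then have "((\<lambda>l. ?a l k *\<^sub>C ?e (l + k)) has_sum \<iota> (?r o\<^sub>L nct_monomial \<theta> k)) UNIV"
      by (simp add: iota_scaleC[OF i] nct_algebra_monomial nct_algebra_scaleC)
    then show ?thesis by (rule has_sum_unique[OF diag_sum_apply[OF e a]])
  qed
  fix u assume u: "u \<in> nct_smooth \<theta>"
  let ?c = "nct_coeff \<theta> u"
  have "((\<lambda>k. \<iota> (?c k *\<^sub>C nct_monomial \<theta> k)) has_sum \<iota> u) UNIV"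
    by (rule iota_has_sum[OF i nct_smooth_expand[OF u]]) (rule nct_algebra_scaleC[OF nct_algebra_monomial nct_algebra_monomial])
  then have "((\<lambda>k. diag_sum ?e ?a (\<iota> (?c k *\<^sub>C nct_monomial \<theta> k))) has_sum diag_sum ?e ?a (\<iota> u)) UNIV"
    by (rule has_sum_bounded_linear[OF blinfun.bounded_linear_right])
  then have 1: "((\<lambda>k. ?c k *\<^sub>C \<iota> (\<rho> (real_of_lattice k) o\<^sub>L nct_monomial \<theta> k)) has_sum diag_sum ?e ?a (\<iota> u)) UNIV"
    by (simp add: iota_scaleC[OF i] nct_algebra_monomial clinear_opD[OF clinear_diag_sum[OF e a]] Te)
  have "((\<lambda>k. \<iota> (?c k *\<^sub>C (\<rho> (real_of_lattice k) o\<^sub>L nct_monomial \<theta> k))) has_sum \<iota> (nct_quantize \<theta> \<rho> u)) UNIV"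
    by (rule iota_has_sum[OF i nct_quantize_has_sum[where \<rho> = \<rho>, OF bd u]]) (rule nct_algebra_scaleC[OF alg alg])
  then have 2: "((\<lambda>k. ?c k *\<^sub>C \<iota> (\<rho> (real_of_lattice k) o\<^sub>L nct_monomial \<theta> k)) has_sum \<iota> (P u)) UNIV"
    by (simp add: iota_scaleC[OF i] alg P[OF u])
  show "diag_sum ?e ?a (\<iota> u) = \<iota> (P u)" by (rule has_sum_unique[OF 1 2])
qed

text \<open>The definite description ranges over every order and every symbol that represents
  \<open>P\<close>. Two such symbols agree on the lattice, so their components of degree
  \<open>-n\<close> have equal traces there, and by homogeneity and continuity everywhere off
  0.\<close>

lemma nct_residue_eq:
  fixes \<rho> :: "'n::{finite, linorder} rvec \<Rightarrow> 'n torus_op"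
  assumes ex: "nct_symbol_expansion \<theta> (- of_nat CARD('n)) \<rho> \<sigma>"
    and P: "\<And>u. u \<in> nct_smooth \<theta> \<Longrightarrow> P u = nct_quantize \<theta> \<rho> u"
  shows "nct_residue \<theta> P = (LINT \<xi>|sphere_measure. nct_trace (\<sigma> 0 \<xi>))"
proof -
  let ?n = "CARD('n)" and ?h = "\<lambda>\<xi>. nct_trace (\<sigma> 0 \<xi>)"
  have ex': "nct_symbol_expansion \<theta> (of_int (- int ?n)) \<rho> \<sigma>" using ex by simp
  have s0: "\<sigma> 0 \<in> nct_homogeneous_symbols \<theta> (of_int (- int ?n))"
    using ex' unfolding nct_symbol_expansion_def by (metis diff_zero of_nat_0)
  note ch = continuous_on_nct_trace[OF s0]
  show ?thesis
    unfolding nct_residue_def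
  proof (rule the_equality)
    show "\<exists>m \<rho> \<sigma>'. nct_symbol_expansion \<theta> (of_int m) \<rho> \<sigma>' \<and> (\<forall>u\<in>nct_smooth \<theta>. P u = nct_quantize \<theta> \<rho> u) \<and>
       (LINT \<xi>|sphere_measure. nct_trace (\<sigma> 0 \<xi>)) = (if m < - int ?n then 0
         else LINT \<xi>|sphere_measure. nct_trace (\<sigma>' (nat (m + int ?n)) \<xi>))"
      by (rule exI[of _ "- int ?n"], rule exI[of _ \<rho>], rule exI[of _ \<sigma>]) (use ex' P in simp)
    fix r assume "\<exists>m \<rho> \<sigma>. nct_symbol_expansion \<theta> (of_int m) \<rho> \<sigma> \<and> (\<forall>u\<in>nct_smooth \<theta>. P u = nct_quantize \<theta> \<rho> u) \<and>
       r = (if m < - int ?n then 0 else LINT \<xi>|sphere_measure. nct_trace (\<sigma> (nat (m + int ?n)) \<xi>))"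
    then obtain m \<rho>' \<sigma>' where ex2: "nct_symbol_expansion \<theta> (of_int m) \<rho>' \<sigma>'"
      and P2: "\<And>u. u \<in> nct_smooth \<theta> \<Longrightarrow> P u = nct_quantize \<theta> \<rho>' u"
      and r: "r = (if m < - int ?n then 0 else LINT \<xi>|sphere_measure. nct_trace (\<sigma>' (nat (m + int ?n)) \<xi>))"
      by blast
    have same: "\<rho> (real_of_lattice k) = \<rho>' (real_of_lattice k)" for k
      by (rule nct_quantize_determines_symbol[of \<theta>]) (use P[OF nct_smooth_monomial] P2[OF nct_smooth_monomial] in simp)
    \<comment> \<open>The trace of the degree \<open>-n\<close> component in the competing
      representation, which is absent if its order is below \<open>-n\<close>.\<close>
    define g where "g \<xi> = (if m < - int ?n then 0 else nct_trace (\<sigma>' (nat (m + int ?n)) \<xi>))" for \<xi>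
    have s': "\<sigma>' (nat (m + int ?n)) \<in> nct_homogeneous_symbols \<theta> (of_int (- int ?n))" if "\<not> m < - int ?n"
    proof -
      have "\<sigma>' (nat (m + int ?n)) \<in> nct_homogeneous_symbols \<theta> (of_int m - of_nat (nat (m + int ?n)))"
        using ex2 unfolding nct_symbol_expansion_def by blast
      moreover have "(of_int m - of_nat (nat (m + int ?n)) :: complex) = of_int (m - int (nat (m + int ?n)))" by simp
      moreover have "m - int (nat (m + int ?n)) = - int ?n" using that by simp
      ultimately show ?thesis by metis
    qed
    have cg: "continuous_on (- {0}) g"
      unfolding g_def using continuous_on_nct_trace[OF s'] by (cases "m < - int ?n") auto
    have gh: "g t = ?h t" if "t \<noteq> 0" for t
    proof -
      have "?h t - g t = 0"
      proof (rule homogeneous_zero_on_lattice[where g = "\<lambda>\<xi>. ?h \<xi> - g \<xi>" and m = "- int ?n"])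
        show "continuous_on (- {0}) (\<lambda>\<xi>. ?h \<xi> - g \<xi>)" by (intro continuous_on_diff ch cg)
        show "?h (t *\<^sub>R x) - g (t *\<^sub>R x) = complex_of_real (t powi - int ?n) * (?h x - g x)"
          if "0 < t" "x \<noteq> 0" for t x
          using nct_trace_homogeneous[OF s0 that] nct_trace_homogeneous[OF s' that]
          by (cases "m < - int ?n") (simp_all add: g_def right_diff_distrib)
        fix k :: "'n ivec" assume k: "k \<noteq> 0"
        let ?f = "\<lambda>\<rho> t. of_nat (Suc t) ^ ?n * nct_trace (\<rho> (real (Suc t) *\<^sub>R real_of_lattice k))"
        have mult: "real (Suc t) *\<^sub>R real_of_lattice k = real_of_lattice (\<chi> j. int (Suc t) * k $ j)" for t
          by (simp add: vec_eq_iff del: of_nat_Suc)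
        have "?f \<rho> \<longlonglongrightarrow> ?h (real_of_lattice k)"
        proof (rule LIM_zero_cancel)
          show "(\<lambda>t. ?f \<rho> t - ?h (real_of_lattice k)) \<longlonglongrightarrow> 0"
            using expansion_multiples[OF ex' k] by simp
        qed
        then have "?f \<rho>' \<longlonglongrightarrow> ?h (real_of_lattice k)" by (simp only: mult same)
        from expansion_limit[OF ex2 k this] show "?h (real_of_lattice k) - g (real_of_lattice k) = 0"
          by (simp add: g_def)
      qed (rule that)
      then show ?thesis by simp
    qed
    have "r = (LINT \<xi>|sphere_measure. g \<xi>)" unfolding r g_def by simp
    also have "\<dots> = (LINT \<xi>|sphere_measure. ?h \<xi>)" by (rule integral_sphere_cong[OF gh cg ch])
    finally show "r = (LINT \<xi>|sphere_measure. ?h \<xi>)" .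
  qed
qed

theorem theorem8p1:
  fixes \<theta> :: "'n::{finite, linorder} rmat"
    and \<iota> :: "'n torus_op \<Rightarrow> 'h::complex_hilbert"
    and P :: "'n torus_op \<Rightarrow> 'n torus_op"
  assumes "CARD('n) \<ge> 2"
    and "transpose \<theta> = - \<theta>"
    and "nct_completion \<theta> \<iota>"
    and "P \<in> nct_pdo \<theta> (- of_nat CARD('n))"
  shows "strongly_measurable_op (nct_extension \<theta> \<iota> P) \<and>
    has_nc_integral (nct_extension \<theta> \<iota> P) (1 / of_nat CARD('n) * nct_residue \<theta> P)"
proof -
  let ?n = "CARD('n)"
  note i = assms(3)
  obtain \<rho> \<sigma> where ex: "nct_symbol_expansion \<theta> (- of_nat ?n) \<rho> \<sigma>"
    and P: "\<And>u. u \<in> nct_smooth \<theta> \<Longrightarrow> P u = nct_quantize \<theta> \<rho> u"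
    using assms(4) unfolding nct_pdo_def nct_symbols_def by blast
  let ?h = "\<lambda>\<xi>. nct_trace (\<sigma> 0 \<xi>)"
  have s0: "\<sigma> 0 \<in> nct_homogeneous_symbols \<theta> (of_int (- int ?n))"
    using ex unfolding nct_symbol_expansion_def by (metis diff_zero of_nat_0 of_int_minus of_int_of_nat_eq)
  let ?e = "\<lambda>k. \<iota> (nct_monomial \<theta> k)"
  let ?a = "\<lambda>l k. nct_coeff \<theta> (\<rho> (real_of_lattice k)) l * nct_phase \<theta> l k"
  note e = onb_iota[OF i]
  have a: "matrix_decay 1 ?a"
    by (rule matrix_decay_mono[OF nct_symbol_matrix_decay[OF ex]]) (simp add: norm_mult norm_nct_phase)
  obtain K where K: "\<And>k. norm (\<rho> (real_of_lattice k)) \<le> K"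
  proof -
    have "\<exists>C. \<forall>\<xi>. 1 \<le> norm \<xi> \<longrightarrow>
      norm (nct_deltas \<theta> (\<lambda>_. 0) (nct_pderivs \<theta> (\<lambda>_. 0) (\<lambda>\<eta>. \<rho> \<eta> - (\<Sum>j<0. \<sigma> j \<eta>)) \<xi>))
        \<le> C * norm \<xi> powr (Re (- of_nat ?n) - real 0 - real (\<Sum>i\<in>(UNIV :: 'n set). 0))"
      using ex unfolding nct_symbol_expansion_def by blast
    then obtain C where C: "\<And>\<xi>. 1 \<le> norm \<xi> \<Longrightarrow> norm (\<rho> \<xi>) \<le> C * norm \<xi> powr (- real ?n)"
      by (auto simp: nct_pderivs_0 nct_deltas_0)
    have "norm (\<rho> (real_of_lattice k)) \<le> \<bar>C\<bar> + norm (\<rho> 0)" for k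
    proof (cases "k = 0")
      case False
      have x: "1 \<le> norm (real_of_lattice k)" by (rule norm_real_of_lattice_ge_1[OF False])
      have "norm (real_of_lattice k) powr (- real ?n) \<le> norm (real_of_lattice k) powr 0"
        using x by (intro powr_mono) auto
      then have "C * norm (real_of_lattice k) powr (- real ?n) \<le> \<bar>C\<bar> * 1"
        using False by (intro mult_mono) auto
      then show ?thesis using C[OF x] norm_ge_zero[of "\<rho> 0"] by linarith
    qed simp
    then show ?thesis by (rule that)
  qed
  have T: "nct_extension \<theta> \<iota> P = diag_sum ?e ?a"
    by (rule nct_extension_eq_diag_sum[where \<rho> = \<rho>, OF i nct_symbol_smooth[OF ex] K matrix_decay_0[OF a] P])
  \<comment> \<open>The monomial of exponent 0 is the identity, so the phase is 1 and the
    coefficient is the trace of the symbol.\<close>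
  have a0: "?a 0 = (\<lambda>k. nct_trace (\<rho> (real_of_lattice k)))"
  proof
    fix k
    have "nct_phase \<theta> 0 k = 1"
    proof -
      have "nct_phase \<theta> 0 k *\<^sub>C nct_monomial \<theta> k = nct_monomial \<theta> k"
        using nct_monomial_compose[of \<theta> 0 k] by (simp add: nct_monomial_0)
      then have "nct_coeff \<theta> (nct_phase \<theta> 0 k *\<^sub>C nct_monomial \<theta> k) k = nct_coeff \<theta> (nct_monomial \<theta> k) k" by simp
      then show ?thesis by (simp add: nct_coeff_scaleC nct_coeff_monomial)
    qed
    moreover have "adjoint_op (nct_monomial \<theta> 0) = id_blinfun"
      using nct_monomial_unitary[of \<theta> 0] by (simp add: nct_monomial_0)
    ultimately show "?a 0 k = nct_trace (\<rho> (real_of_lattice k))" by (simp add: nct_coeff_def)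
  qed
  \<comment> \<open>Subtracting just the leading term leaves order \<open>-n - 1\<close>, the spare
    power that \<open>diagonal_trace\<close> asks for.\<close>
  obtain C where C: "\<And>\<xi>. 1 \<le> norm \<xi> \<Longrightarrow> cmod (nct_trace (\<rho> \<xi>) - ?h \<xi>) \<le> C * norm \<xi> powr (- real ?n - 1)"
    using nct_symbol_trace_estimate[OF ex, of 1] by auto
  have "has_nc_integral (nct_extension \<theta> \<iota> P) (1 / of_nat ?n * nct_residue \<theta> P)"
    unfolding has_nc_integral_def
  proof (intro conjI allI impI)
    show "nct_extension \<theta> \<iota> P \<in> weak_trace_class"
      unfolding T by (rule diag_sum_weak[OF e matrix_decay_0[OF a]])
    fix \<phi> :: "('h \<Rightarrow>\<^sub>L 'h) \<Rightarrow> complex" assume "positive_trace \<phi> \<and> normalized_trace \<phi>"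
    then have tr: "positive_trace \<phi>" "normalized_trace \<phi>" by simp_all
    have "\<phi> (nct_extension \<theta> \<iota> P) = \<phi> (wop ?e ?e (?a 0))" unfolding T by (rule trace_diag_sum[OF e tr(1) a])
    also have "\<dots> = 1 / of_nat ?n * (LINT x|sphere_measure. ?h x)"
      unfolding a0
    proof (rule diagonal_trace[OF e continuous_on_nct_trace[OF s0] _ _ tr])
      show "?h (t *\<^sub>R x) = ?h x / complex_of_real (t ^ ?n)" if "0 < t" "x \<noteq> 0" for t x
        using nct_trace_homogeneous[OF s0 that] by (simp add: power_int_minus divide_inverse mult.commute)
      show "cmod (nct_trace (\<rho> (real_of_lattice k)) - ?h (real_of_lattice k)) \<le> C / norm (real_of_lattice k) ^ (?n + 1)"
        if "k \<noteq> 0" for k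
      proof -
        have "norm (real_of_lattice k) powr (- real ?n - 1) = 1 / norm (real_of_lattice k) ^ (?n + 1)"
          using that by (simp add: powr_diff powr_minus powr_realpow divide_inverse)
        then show ?thesis using C[OF norm_real_of_lattice_ge_1[OF that]] by simp
      qed
    qed
    also have "(LINT x|sphere_measure. ?h x) = nct_residue \<theta> P" by (rule nct_residue_eq[OF ex P, symmetric])
    finally show "\<phi> (nct_extension \<theta> \<iota> P) = 1 / of_nat ?n * nct_residue \<theta> P" .
  qed
  then show ?thesis unfolding strongly_measurable_op_def by blast
qed

end
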